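(* Let $K_{\mathfrak p}$ be the completion of a number field $K$ at a non-zero prime $\mathfrak p$ of $O_K$. Let $\mathscr{C}_{\mathfrak p}$ be the (semi-galois) category of finite etale $\Lambda_{O_{\mathfrak p}}$-rings over $K_{\mathfrak p}$ having integral models in the sense of Borger and de Smit, and let $\mathrm{F}_{\mathfrak p}:\mathscr{C}_{\mathfrak p}\to\mathbf{Sets}_f$ be its fiber functor. Then the fundamental monoid $\pi_1(\mathscr{C}_{\mathfrak p},\mathrm{F}_{\mathfrak p})$ is isomorphic to $Q_{\mathfrak p}\ltimes_{I_{\mathfrak p}}G_{\mathfrak p}$.
   Context: $O_{\mathfrak p}$ is the integer ring of $K_{\mathfrak p}$, $q$ the cardinality of its residue field, $\bar K_{\mathfrak p}$ an algebraic closure, $G_{\mathfrak p}=\mathrm{Gal}(\bar K_{\mathfrak p}/K_{\mathfrak p})$, $I_{\mathfrak p}$ its inertia subgroup, $\mathrm{Frob}_{\mathfrak p}\in G_{\mathfrak p}/I_{\mathfrak p}$ the Frobenius; $\mathbb{N}\ni0$. Objects of $\mathscr{C}_{\mathfrak p}$: pairs $(X,\psi)$ with $X$ a finite etale $K_{\mathfrak p}$-algebra and $\psi:X\to X$ a $K_{\mathfrak p}$-algebra endomorphism admitting an integral model, i.e. a finite $O_{\mathfrak p}$-subalgebra $A\subseteq X$ with $K_{\mathfrak p}\otimes_{O_{\mathfrak p}} A=X$, $\psi(A)\subseteq A$ and $\psi(a)\equiv a^q\bmod\mathfrak pA$ for all $a\in A$. Morphisms are $K_{\mathfrak p}$-algebra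 homomorphisms commuting with $\psi$. The fiber functor sends $(X,\psi)$ to the finite set $\mathrm{Hom}_{K_{\mathfrak p}\text{-alg}}(X,\bar K_{\mathfrak p})$ (contravariantly). The fundamental monoid $\pi_1(\mathscr{C}_{\mathfrak p},\mathrm{F}_{\mathfrak p})$ is the profinite monoid $\pi$ of endomorphisms of the fiber functor, characterised by the property that $\mathscr{C}_{\mathfrak p}$ is (oppositely) equivalent, via $\mathrm{F}_{\mathfrak p}$ and compatibly with underlying sets, to the category of finite sets with continuous right $\pi$-action. $W_{\mathfrak p}^+\subseteq G_{\mathfrak p}$ (Weil monoid) is the preimage of $\{\mathrm{Frob}_{\mathfrak p}^n:n\in\mathbb{N}\}$ under $G_{\mathfrak p}\to G_{\mathfrak p}/I_{\mathfrak p}$, with the Weil group topology ($I_{\mathfrak p}$ open with its profinite topology). $Q_{\mathfrak p}:=W_{\mathfrak p}^+\cup\{0_{\mathfrak p}\}$ is its one-point compactification, a profinite monoid with zero element $0_{\mathfrak p}$. $G_{\mathfrak p}$ acts on $Q_{\mathfrak p}$ by ${}^\sigma\rho=\sigma\rho\sigma^{-1}$ and ${}^\sigma0_{\mathfrak p}=0_{\mathfrak p}$. $Q_{\mathfrak p}\ltimes_{I_{\mathfrak p}}G_{\mathfrak p}$ is the quotient of the semidirect product $Q_{\mathfrak p}\ltimes G_{\mathfrak p}$, with $(\rho,\sigma)(\rho',\sigma')=(\rho\cdot{}^\sigma\rho',\sigma\sigma')$, by the relation $(\rho,\sigma)\sim(\rho u,u^{-1}\sigma)$ for $u\in I_{\mathfrak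 p}$. *)

theory Defs
  imports "HOL-Algebra.Algebra" "HOL-Algebra.Algebraic_Closure_Type" "HOL-Analysis.Urysohn"
    "HOL-Analysis.Function_Topology"
begin

section \<open>Number fields and their completions\<close>

definition number_field :: "'k::field_char_0 itself \<Rightarrow> bool" where
  "number_field _ \<longleftrightarrow>
     (\<exists>B :: 'k set. finite B \<and> (\<forall>x. \<exists>c :: 'k \<Rightarrow> rat. x = (\<Sum>b\<in>B. of_rat (c b) * b)))"

abbreviation ring_on :: "'a::ring_1 set \<Rightarrow> 'a ring" where
  "ring_on S \<equiv> ring_of_type_algebra\<lparr>carrier := S\<rparr>"

definition ring_of_integers :: "'k::field ring" where
  "ring_of_integers = ring_on {x. algebraic_int x}"

text \<open>For non-zero \<open>x\<close> in the ring of integers: the exponent of the non-zero prime \<open>P\<close> in the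
  factorisation of the ideal generated by \<open>x\<close>. The power of \<open>P\<close> is taken in the multiplicative
  monoid of ideals.\<close>

definition prime_order :: "'k::field set \<Rightarrow> 'k \<Rightarrow> nat" where
  "prime_order P x = (GREATEST n. x \<in> P [^]\<^bsub>ideals_set ring_of_integers\<^esub> n)"

text \<open>\<open>\<iota>\<close> exhibits the field \<open>'l\<close> with the absolute value \<open>v\<close> as the completion of \<open>'k\<close> at \<open>P\<close>: it
  is complete, \<open>'k\<close> is dense in it, and \<open>v\<close> restricts to a \<open>P\<close>-adic absolute value. The values on
  the ring of integers determine those on its field of fractions \<open>'k\<close>; the normalising constant
  \<open>c\<close> does not influence the topology.\<close>

definition completion_at :: "'k::field set \<Rightarrow> ('k \<Rightarrow> 'l::field) \<Rightarrow> ('l \<Rightarrow> real) \<Rightarrow> bool" where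
  "completion_at P \<iota> v \<longleftrightarrow>
     \<iota> \<in> ring_hom ring_of_type_algebra ring_of_type_algebra \<and>
     (\<forall>x. 0 \<le> v x) \<and> (\<forall>x. v x = 0 \<longleftrightarrow> x = 0) \<and>
     (\<forall>x y. v (x * y) = v x * v y) \<and>
     (\<forall>x y. v (x + y) \<le> max (v x) (v y)) \<and>
     (\<exists>c. 0 < c \<and> c < 1 \<and>
        (\<forall>x\<in>carrier ring_of_integers - {0}. v (\<iota> x) = c ^ prime_order P x)) \<and>
     Metric_space.mcomplete UNIV (\<lambda>x y. v (x - y)) \<and>
     (\<forall>x. \<forall>e>0. \<exists>a. v (x - \<iota> a) < e)"

definition local_integers :: "('l::field \<Rightarrow> real) \<Rightarrow> 'l set" where
  "local_integers v = {x. v x \<le> 1}"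

definition local_prime :: "('l::field \<Rightarrow> real) \<Rightarrow> 'l set" where
  "local_prime v = {x. v x < 1}"

definition residue_card :: "('l::field \<Rightarrow> real) \<Rightarrow> nat" where
  "residue_card v = card (carrier (ring_on (local_integers v) Quot local_prime v))"


section \<open>Finite etale algebras over a field\<close>

abbreviation base_field :: "'l::field ring" where
  "base_field \<equiv> ring_of_type_algebra"

definition alg_hom :: "('l::field, 'x) module \<Rightarrow> ('l, 'y) module \<Rightarrow> ('x \<Rightarrow> 'y) set" where
  "alg_hom E E' = {h \<in> ring_hom E E' \<inter> extensional (carrier E).
     \<forall>c. \<forall>x\<in>carrier E. h (c \<odot>\<^bsub>E\<^esub> x) = c \<odot>\<^bsub>E'\<^esub> h x}"

definition lin_span :: "('l, 'x) module \<Rightarrow> 'l set \<Rightarrow> 'x set \<Rightarrow> 'x set" where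
  "lin_span E C S = {(\<Oplus>\<^bsub>E\<^esub>s\<in>T. c s \<odot>\<^bsub>E\<^esub> s) | c T. finite T \<and> T \<subseteq> S \<and> c \<in> T \<rightarrow> C}"

definition alg_eval :: "('l::field, 'x) module \<Rightarrow> 'l poly \<Rightarrow> 'x \<Rightarrow> 'x" where
  "alg_eval E f x = (\<Oplus>\<^bsub>E\<^esub>i\<in>{..Polynomial.degree f}. poly.coeff f i \<odot>\<^bsub>E\<^esub> (x [^]\<^bsub>E\<^esub> i))"

text \<open>Each element is a root of a separable polynomial, i.e. one coprime to its derivative.\<close>

definition finite_separable_extension :: "('l::field, 'x) module \<Rightarrow> bool" where
  "finite_separable_extension L \<longleftrightarrow>
     Module.algebra base_field L \<and> Ring.field L \<and>
     (\<exists>S \<subseteq> carrier L. finite S \<and> carrier L = lin_span L UNIV S) \<and>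
     (\<forall>x\<in>carrier L. \<exists>f. coprime f (pderiv f) \<and> alg_eval L f x = \<zero>\<^bsub>L\<^esub>)"

text \<open>A finite etale algebra is one isomorphic (via \<open>h\<close>) to a product of finitely many finite
  separable field extensions. The factors can be sought in the same carrier type, since they are
  isomorphic to ideals of \<open>E\<close>.\<close>

definition finite_etale :: "('l::field, 'x) module \<Rightarrow> bool" where
  "finite_etale E \<longleftrightarrow> Module.algebra base_field E \<and>
     (\<exists>(n::nat) (L :: nat \<Rightarrow> ('l, 'x) module) h.
        (\<forall>i<n. finite_separable_extension (L i)) \<and>
        bij_betw h (carrier E) (\<Pi>\<^sub>E i\<in>{..<n}. carrier (L i)) \<and>
        (\<forall>i<n. (\<lambda>x\<in>carrier E. h x i) \<in> alg_hom E (L i)))"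


section \<open>The category of algebras with Frobenius lift having integral models\<close>

text \<open>\<open>A\<close> is a subalgebra over the integers of the local field, finite as a module. As \<open>A\<close> is
  torsion-free, the map \<open>K \<otimes> A \<rightarrow> E\<close> induced by \<open>A \<subseteq> E\<close> is always injective, so that
  \<open>K \<otimes> A = E\<close> says that \<open>A\<close> spans \<open>E\<close> over \<open>K\<close>. The last span is the ideal \<open>\<pp>A\<close>.\<close>

definition integral_model ::
    "('l::field \<Rightarrow> real) \<Rightarrow> ('l, 'x) module \<Rightarrow> ('x \<Rightarrow> 'x) \<Rightarrow> 'x set \<Rightarrow> bool" where
  "integral_model v E \<psi> A \<longleftrightarrow>
     subcring A E \<and>
     (\<exists>S \<subseteq> A. finite S \<and> A = lin_span E (local_integers v) S) \<and>
     lin_span E UNIV A = carrier E \<and>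
     \<psi> ` A \<subseteq> A \<and>
     (\<forall>a\<in>A. \<psi> a \<ominus>\<^bsub>E\<^esub> a [^]\<^bsub>E\<^esub> residue_card v \<in> lin_span E (local_prime v) A)"

text \<open>The objects have carriers in the type \<open>nat \<Rightarrow> 'l\<close>. This is a universe for the category: every
  finite-dimensional algebra over \<open>'l\<close> injects into it by coordinates, hence is isomorphic to one
  whose carrier lies in it.\<close>

type_synonym 'l lambda_alg = "('l, nat \<Rightarrow> 'l) module \<times> ((nat \<Rightarrow> 'l) \<Rightarrow> nat \<Rightarrow> 'l)"

definition lambda_objects :: "('l::field \<Rightarrow> real) \<Rightarrow> 'l lambda_alg set" where
  "lambda_objects v =
     {(E, \<psi>). finite_etale E \<and> \<psi> \<in> alg_hom E E \<and> (\<exists>A. integral_model v E \<psi> A)}"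

definition lambda_homs ::
    "'l::field lambda_alg \<Rightarrow> 'l lambda_alg \<Rightarrow> ((nat \<Rightarrow> 'l) \<Rightarrow> nat \<Rightarrow> 'l) set" where
  "lambda_homs = (\<lambda>(E, \<psi>) (E', \<phi>).
     {f \<in> alg_hom E E'. \<forall>x\<in>carrier E. f (\<psi> x) = \<phi> (f x)})"

definition closure_algebra :: "('l::field, 'l alg_closure) module" where
  "closure_algebra = \<lparr>carrier = UNIV, monoid.mult = (*), one = 1, ring.zero = 0, add = (+),
     module.smult = (\<lambda>c x. to_ac c * x)\<rparr>"

definition fiber :: "'l::field lambda_alg \<Rightarrow> ((nat \<Rightarrow> 'l) \<Rightarrow> 'l alg_closure) set" where
  "fiber = (\<lambda>(E, \<psi>). alg_hom E closure_algebra)"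

text \<open>For \<open>f : E \<rightarrow> E'\<close>, the induced map from the fiber of \<open>E'\<close> to the fiber of \<open>E\<close>.\<close>

definition fiber_map ::
    "'l::field lambda_alg \<Rightarrow> 'l lambda_alg \<Rightarrow> ((nat \<Rightarrow> 'l) \<Rightarrow> nat \<Rightarrow> 'l)
       \<Rightarrow> ((nat \<Rightarrow> 'l) \<Rightarrow> 'l alg_closure) \<Rightarrow> ((nat \<Rightarrow> 'l) \<Rightarrow> 'l alg_closure)" where
  "fiber_map = (\<lambda>(E, \<psi>) (E', \<phi>) f s. compose (carrier E) s f)"


section \<open>The fundamental monoid\<close>

text \<open>Endomorphisms (natural self-transformations) of a contravariant functor \<open>F\<close> to finite sets.
  The product \<open>\<alpha> \<otimes> \<beta>\<close> applies \<open>\<alpha>\<close> first: the monoid acts on the fibers from the right, by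
  \<open>s \<cdot> \<alpha> = \<alpha> A s\<close>. The topology is that of pointwise convergence, i.e. that of the inverse limit
  of the monoids of self-maps of the finite fibers.\<close>

definition functor_End ::
    "'o set \<Rightarrow> ('o \<Rightarrow> 'o \<Rightarrow> 'm set) \<Rightarrow> ('o \<Rightarrow> 's set) \<Rightarrow> ('o \<Rightarrow> 'o \<Rightarrow> 'm \<Rightarrow> 's \<Rightarrow> 's)
       \<Rightarrow> ('o \<Rightarrow> 's \<Rightarrow> 's) monoid" where
  "functor_End Ob Hom F Fmap = \<lparr>
     carrier = {\<alpha> \<in> (\<Pi>\<^sub>E A\<in>Ob. F A \<rightarrow>\<^sub>E F A).
       \<forall>A\<in>Ob. \<forall>B\<in>Ob. \<forall>f\<in>Hom A B. \<forall>s\<in>F B. \<alpha> A (Fmap A B f s) = Fmap A B f (\<alpha> B s)},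
     monoid.mult = (\<lambda>\<alpha> \<beta>. \<lambda>A\<in>Ob. compose (F A) (\<beta> A) (\<alpha> A)),
     one = (\<lambda>A\<in>Ob. \<lambda>s\<in>F A. s)\<rparr>"

definition functor_End_topology ::
    "'o set \<Rightarrow> ('o \<Rightarrow> 'o \<Rightarrow> 'm set) \<Rightarrow> ('o \<Rightarrow> 's set) \<Rightarrow> ('o \<Rightarrow> 'o \<Rightarrow> 'm \<Rightarrow> 's \<Rightarrow> 's)
       \<Rightarrow> ('o \<Rightarrow> 's \<Rightarrow> 's) topology" where
  "functor_End_topology Ob Hom F Fmap =
     subtopology (product_topology (\<lambda>A. discrete_topology (F A \<rightarrow>\<^sub>E F A)) Ob)
       (carrier (functor_End Ob Hom F Fmap))"

definition fundamental_monoid where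
  "fundamental_monoid v = functor_End (lambda_objects v) lambda_homs fiber fiber_map"

definition fundamental_monoid_topology where
  "fundamental_monoid_topology v =
     functor_End_topology (lambda_objects v) lambda_homs fiber fiber_map"


section \<open>Galois group, inertia and Frobenius\<close>

definition galois_group :: "('l::field alg_closure \<Rightarrow> 'l alg_closure) monoid" where
  "galois_group = \<lparr>
     carrier = {\<sigma> \<in> ring_iso ring_of_type_algebra ring_of_type_algebra. \<forall>c. \<sigma> (to_ac c) = to_ac c},
     monoid.mult = (\<circ>), one = id\<rparr>"

text \<open>The Krull topology is the topology of pointwise convergence.\<close>

definition krull_topology :: "('l::field alg_closure \<Rightarrow> 'l alg_closure) topology" where
  "krull_topology =
     subtopology (product_topology (\<lambda>_. discrete_topology UNIV) UNIV) (carrier galois_group)"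

definition closure_integers :: "('l::field \<Rightarrow> real) \<Rightarrow> 'l alg_closure set" where
  "closure_integers v = {x. \<exists>f :: 'l poly. Polynomial.lead_coeff f = 1 \<and>
     (\<forall>i. poly.coeff f i \<in> local_integers v) \<and> poly (map_poly to_ac f) x = 0}"

text \<open>The integral closure of the integers is a local ring; its maximal ideal consists of the
  non-units.\<close>

definition closure_prime :: "('l::field \<Rightarrow> real) \<Rightarrow> 'l alg_closure set" where
  "closure_prime v = closure_integers v - Units (ring_on (closure_integers v))"

definition inertia :: "('l::field \<Rightarrow> real) \<Rightarrow> ('l alg_closure \<Rightarrow> 'l alg_closure) set" where
  "inertia v = {\<sigma> \<in> carrier galois_group. \<forall>x\<in>closure_integers v. \<sigma> x - x \<in> closure_prime v}"

text \<open>The coset of inertia inducing the arithmetic Frobenius \<open>x \<mapsto> x\<^sup>q\<close> on the residue field, an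
  element of \<open>galois_group Mod inertia v\<close>.\<close>

definition frobenius :: "('l::field \<Rightarrow> real) \<Rightarrow> ('l alg_closure \<Rightarrow> 'l alg_closure) set" where
  "frobenius v = {\<sigma> \<in> carrier galois_group.
     \<forall>x\<in>closure_integers v. \<sigma> x - x ^ residue_card v \<in> closure_prime v}"

definition weil_group :: "('l::field \<Rightarrow> real) \<Rightarrow> ('l alg_closure \<Rightarrow> 'l alg_closure) set" where
  "weil_group v = {\<sigma> \<in> carrier galois_group.
     \<exists>n::int. inertia v #>\<^bsub>galois_group\<^esub> \<sigma> = frobenius v [^]\<^bsub>galois_group Mod inertia v\<^esub> n}"

definition weil_monoid :: "('l::field \<Rightarrow> real) \<Rightarrow> ('l alg_closure \<Rightarrow> 'l alg_closure) set" where
  "weil_monoid v = {\<sigma> \<in> carrier galois_group.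
     \<exists>n::nat. inertia v #>\<^bsub>galois_group\<^esub> \<sigma> = frobenius v [^]\<^bsub>galois_group Mod inertia v\<^esub> n}"

text \<open>The topology on the Weil group for which every translate of inertia, with its profinite
  topology, is open.\<close>

definition weil_topology :: "('l::field \<Rightarrow> real) \<Rightarrow> ('l alg_closure \<Rightarrow> 'l alg_closure) topology" where
  "weil_topology v = topology (\<lambda>U. U \<subseteq> weil_group v \<and>
     (\<forall>w\<in>weil_group v. openin (subtopology krull_topology (inertia v)) {u \<in> inertia v. w \<circ> u \<in> U}))"

lemma openin_weil_topology:
  "openin (weil_topology v) U \<longleftrightarrow> U \<subseteq> weil_group v \<and>
     (\<forall>w\<in>weil_group v. openin (subtopology krull_topology (inertia v)) {u \<in> inertia v. w \<circ> u \<in> U})"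
proof -
  let ?T = "subtopology krull_topology (inertia v)"
  have "istopology (\<lambda>U. U \<subseteq> weil_group v \<and>
     (\<forall>w\<in>weil_group v. openin ?T {u \<in> inertia v. w \<circ> u \<in> U}))"
    unfolding istopology_def
  proof (intro conjI allI impI ballI)
    fix S T w
    assume "S \<subseteq> weil_group v \<and> (\<forall>w\<in>weil_group v. openin ?T {u \<in> inertia v. w \<circ> u \<in> S})"
      and "T \<subseteq> weil_group v \<and> (\<forall>w\<in>weil_group v. openin ?T {u \<in> inertia v. w \<circ> u \<in> T})"
      and "w \<in> weil_group v"
    then have "openin ?T ({u \<in> inertia v. w \<circ> u \<in> S} \<inter> {u \<in> inertia v. w \<circ> u \<in> T})"
      by blast
    moreover have "{u \<in> inertia v. w \<circ> u \<in> S} \<inter> {u \<in> inertia v. w \<circ> u \<in> T} =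
        {u \<in> inertia v. w \<circ> u \<in> S \<inter> T}" by auto
    ultimately show "openin ?T {u \<in> inertia v. w \<circ> u \<in> S \<inter> T}" by simp
  next
    fix \<K> w
    assume "\<forall>S\<in>\<K>. S \<subseteq> weil_group v \<and> (\<forall>w\<in>weil_group v. openin ?T {u \<in> inertia v. w \<circ> u \<in> S})"
      and "w \<in> weil_group v"
    then have "openin ?T (\<Union>S\<in>\<K>. {u \<in> inertia v. w \<circ> u \<in> S})" by blast
    moreover have "(\<Union>S\<in>\<K>. {u \<in> inertia v. w \<circ> u \<in> S}) = {u \<in> inertia v. w \<circ> u \<in> \<Union>\<K>}"
      by auto
    ultimately show "openin ?T {u \<in> inertia v. w \<circ> u \<in> \<Union>\<K>}" by simp
  qed blast+
  then show ?thesis by (simp add: weil_topology_def topology_inverse')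
qed


section \<open>The monoid \<open>Q \<ltimes>\<^sub>I G\<close>\<close>

text \<open>The zero element is \<open>None\<close>.\<close>

definition adjoin_zero :: "('a, 'b) monoid_scheme \<Rightarrow> 'a option monoid" where
  "adjoin_zero M = \<lparr>carrier = insert None (Some ` carrier M),
     monoid.mult = (\<lambda>x y. Option.bind x (\<lambda>a. map_option (\<lambda>b. a \<otimes>\<^bsub>M\<^esub> b) y)),
     one = Some \<one>\<^bsub>M\<^esub>\<rparr>"

definition Q_monoid :: "('l::field \<Rightarrow> real) \<Rightarrow> ('l alg_closure \<Rightarrow> 'l alg_closure) option monoid" where
  "Q_monoid v = adjoin_zero (galois_group\<lparr>carrier := weil_monoid v\<rparr>)"

definition Q_topology :: "('l::field \<Rightarrow> real) \<Rightarrow> ('l alg_closure \<Rightarrow> 'l alg_closure) option topology" where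
  "Q_topology v = Alexandroff_compactification (subtopology (weil_topology v) (weil_monoid v))"

definition conj_action :: "('l::field alg_closure \<Rightarrow> 'l alg_closure)
    \<Rightarrow> ('l alg_closure \<Rightarrow> 'l alg_closure) option \<Rightarrow> ('l alg_closure \<Rightarrow> 'l alg_closure) option" where
  "conj_action \<sigma> = map_option (\<lambda>\<rho>. \<sigma> \<otimes>\<^bsub>galois_group\<^esub> \<rho> \<otimes>\<^bsub>galois_group\<^esub> inv\<^bsub>galois_group\<^esub> \<sigma>)"

definition semidirect ::
    "('a, 'c) monoid_scheme \<Rightarrow> ('b, 'd) monoid_scheme \<Rightarrow> ('b \<Rightarrow> 'a \<Rightarrow> 'a) \<Rightarrow> ('a \<times> 'b) monoid" where
  "semidirect Q G act = \<lparr>carrier = carrier Q \<times> carrier G,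
     monoid.mult = (\<lambda>(\<rho>, \<sigma>) (\<rho>', \<sigma>'). (\<rho> \<otimes>\<^bsub>Q\<^esub> act \<sigma> \<rho>', \<sigma> \<otimes>\<^bsub>G\<^esub> \<sigma>')),
     one = (\<one>\<^bsub>Q\<^esub>, \<one>\<^bsub>G\<^esub>)\<rparr>"

definition quotient_monoid :: "('a, 'b) monoid_scheme \<Rightarrow> 'a rel \<Rightarrow> 'a set monoid" where
  "quotient_monoid M r = \<lparr>carrier = carrier M // r,
     monoid.mult = (\<lambda>A B. \<Union>a\<in>A. \<Union>b\<in>B. r `` {a \<otimes>\<^bsub>M\<^esub> b}),
     one = r `` {\<one>\<^bsub>M\<^esub>}\<rparr>"

definition quotient_topology :: "'a topology \<Rightarrow> 'a rel \<Rightarrow> 'a set topology" where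
  "quotient_topology T r =
     topology (\<lambda>U. U \<subseteq> topspace T // r \<and> openin T {x \<in> topspace T. r `` {x} \<in> U})"

lemma openin_quotient_topology:
  "openin (quotient_topology T r) U \<longleftrightarrow>
     U \<subseteq> topspace T // r \<and> openin T {x \<in> topspace T. r `` {x} \<in> U}"
proof -
  have "istopology (\<lambda>U. U \<subseteq> topspace T // r \<and> openin T {x \<in> topspace T. r `` {x} \<in> U})"
    unfolding istopology_def
  proof (intro conjI allI impI)
    fix S V
    assume "S \<subseteq> topspace T // r \<and> openin T {x \<in> topspace T. r `` {x} \<in> S}"
      and "V \<subseteq> topspace T // r \<and> openin T {x \<in> topspace T. r `` {x} \<in> V}"
    then have "openin T ({x \<in> topspace T. r `` {x} \<in> S} \<inter> {x \<in> topspace T. r `` {x} \<in> V})"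
      by blast
    moreover have "{x \<in> topspace T. r `` {x} \<in> S} \<inter> {x \<in> topspace T. r `` {x} \<in> V} =
        {x \<in> topspace T. r `` {x} \<in> S \<inter> V}" by auto
    ultimately show "openin T {x \<in> topspace T. r `` {x} \<in> S \<inter> V}" by simp
  next
    fix \<K>
    assume "\<forall>S\<in>\<K>. S \<subseteq> topspace T // r \<and> openin T {x \<in> topspace T. r `` {x} \<in> S}"
    then have "openin T (\<Union>S\<in>\<K>. {x \<in> topspace T. r `` {x} \<in> S})" by blast
    moreover have "(\<Union>S\<in>\<K>. {x \<in> topspace T. r `` {x} \<in> S}) =
        {x \<in> topspace T. r `` {x} \<in> \<Union>\<K>}" by auto
    ultimately show "openin T {x \<in> topspace T. r `` {x} \<in> \<Union>\<K>}" by simp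
  qed blast+
  then show ?thesis by (simp add: quotient_topology_def topology_inverse')
qed

definition inertia_rel :: "('l::field \<Rightarrow> real)
    \<Rightarrow> (('l alg_closure \<Rightarrow> 'l alg_closure) option \<times> ('l alg_closure \<Rightarrow> 'l alg_closure)) rel" where
  "inertia_rel v =
     {((\<rho>, \<sigma>), (\<rho> \<otimes>\<^bsub>Q_monoid v\<^esub> Some u, inv\<^bsub>galois_group\<^esub> u \<otimes>\<^bsub>galois_group\<^esub> \<sigma>)) | \<rho> \<sigma> u.
        \<rho> \<in> carrier (Q_monoid v) \<and> \<sigma> \<in> carrier galois_group \<and> u \<in> inertia v}"

definition QG_monoid where
  "QG_monoid v = quotient_monoid (semidirect (Q_monoid v) galois_group conj_action) (inertia_rel v)"

definition QG_topology where
  "QG_topology v = quotient_topology (prod_topology (Q_topology v) krull_topology) (inertia_rel v)"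


section \<open>Isomorphism of topological monoids\<close>

definition topological_monoid_iso ::
    "('a, 'c) monoid_scheme \<Rightarrow> 'a topology \<Rightarrow> ('b, 'd) monoid_scheme \<Rightarrow> 'b topology \<Rightarrow> bool" where
  "topological_monoid_iso M T N U \<longleftrightarrow> (\<exists>\<Phi> \<in> iso M N. homeomorphic_map T U \<Phi>)"

end

theory Submission
  imports Defs "HOL-Library.Function_Algebras"
begin

text \<open>A pair \<open>(\<rho>, \<sigma>)\<close> with \<open>\<rho>\<close> of degree \<open>n\<close> (acting on residues as the \<open>n\<close>-th power of Frobenius) sends a
  point \<open>s\<close> of the fiber to \<open>\<sigma>\<^sup>-\<^sup>1 \<circ> \<rho>\<^sup>-\<^sup>1 \<circ> s \<circ> \<psi>\<^sup>n\<close>. Since \<open>\<psi>\<close> lifts Frobenius, points that are congruent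
  modulo the maximal ideal become equal after finitely many applications of \<open>\<psi>\<close>; so for large \<open>n\<close> the
  point \<open>\<rho>\<^sup>-\<^sup>1 \<circ> s \<circ> \<psi>\<^sup>n\<close> does not depend on \<open>n\<close> and \<open>\<rho>\<close>, and the zero element acts by this common
  value. This action is continuous and multiplicative.

  Objects are constructed as algebras of functions on a finite set \<open>T\<close> with values in the algebraic
  closure, where \<open>\<psi>\<close> is induced by a self-map of \<open>T\<close> and an automorphism of the values. They separate
  pairs up to inertia. They also show that the image of the action is dense: finitely many points of
  objects are the coordinates of one point of such an algebra, where \<open>T\<close> is the orbit of the tuple under
  Galois and \<open>\<psi>\<close>, and every homomorphism from an algebra of functions to the closure is an evaluation
  followed by a Galois automorphism. By compactness the action is then a quotient map onto the
  fundamental monoid.\<close>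

text \<open>Finite extensions and their valuations are never formed. Everything takes place in the
  closure, whose integers form a valuation ring by Hensel factorisation, the place where
  completeness enters; inertia and Frobenius become congruences modulo its maximal ideal, recorded
  by one degree.

  The obstacle lies in separating pairs. An object that is a field is unramified: its
  \<open>\<psi>\<close> is invertible, and inertia fixes sufficiently shifted points. Ramification
  is nevertheless visible, because a congruence modulo the prime holds trivially when both sides are
  divisible by the uniformizer. The objects that detect it consist of multiples of growing powers of
  the uniformizer, and their \<open>\<psi>\<close> pushes points along a chain into a sink. Each
  chain is finite and sees only degrees below its length, so the zero element is left with residues
  alone; this is why it determines the Galois component only up to inertia.

  From the number field, discreteness of \<open>v\<close> and finiteness of the residue field have
  to be extracted.\<close>

hide_const (open) Polynomials.degree Polynomials.lead_coeff
  Divisibility.prime Divisibility.irreducible Polynomial.order Ring_Divisibility.mult_of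

section \<open>Complete discretely valued fields with finite residue field\<close>

text \<open>If a product can only inherit \<open>Q\<close> from one of its factors, a proper
  factorisation of the least positive instance would produce a smaller one. It yields the residue
  characteristic as well as a rational prime in a prime ideal.\<close>

lemma prime_Least:
  assumes "n > (0::nat)" "Q n" "\<not> Q 1" "\<And>a b. Q (a * b) \<Longrightarrow> Q a \<or> Q b"
  shows "prime (LEAST n. n > 0 \<and> Q n)" "Q (LEAST n. n > 0 \<and> Q n)"
proof -
  define p where "p = (LEAST n. n > 0 \<and> Q n)"
  have p: "p > 0" "Q p" using LeastI[of "\<lambda>n. n > 0 \<and> Q n" n] assms by (auto simp: p_def)
  have least: "p \<le> m" if "m > 0" "Q m" for m unfolding p_def using that by (intro Least_le) simp
  have "prime p"
  proof (subst prime_nat_iff, intro conjI allI impI)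
    show "1 < p" using p assms(3) by (cases "p = 1") auto
    fix m assume "m dvd p"
    then obtain k where k: "p = m * k" by blast
    then have mk: "m > 0" "k > 0" using p(1) by auto
    from assms(4) p(2) k have "Q m \<or> Q k" by simp
    then show "m = 1 \<or> m = p"
    proof
      assume "Q m"
      then have "m * k \<le> m" using least mk(1) k by simp
      then show ?thesis using k mk by (cases k) auto
    next
      assume "Q k"
      then have "m * k \<le> k" using least mk(2) k by simp
      then show ?thesis using mk by (cases m) auto
    qed
  qed
  then show "prime (LEAST n. n > 0 \<and> Q n)" "Q (LEAST n. n > 0 \<and> Q n)" using p(2) by (simp_all add: p_def)
qed

section \<open>Ultrametric absolute values\<close>

locale valued_field =
  fixes v :: "'l::field \<Rightarrow> real"
  assumes v_nonneg [simp]: "0 \<le> v x"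
    and v_eq_0 [simp]: "v x = 0 \<longleftrightarrow> x = 0"
    and v_mult: "v (x * y) = v x * v y"
    and v_add_le_max: "v (x + y) \<le> max (v x) (v y)"
begin

lemma v_0 [simp]: "v 0 = 0" by simp

lemma v_1 [simp]: "v 1 = 1"
  using v_mult[of 1 1] v_eq_0[of 1] by (metis mult_cancel_left2 mult.right_neutral one_neq_zero)

lemma v_minus [simp]: "v (- x) = v x"
proof -
  have "v (-1) * v (-1) = 1" by (metis minus_mult_minus mult.right_neutral v_1 v_mult)
  then have "v (-1) = 1"
    by (metis abs_of_nonneg real_sqrt_abs2 real_sqrt_one v_nonneg)
  then show ?thesis using v_mult[of "-1" x] by simp
qed

lemma v_diff_le_max: "v (x - y) \<le> max (v x) (v y)"
  using v_add_le_max[of x "- y"] by simp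

lemma v_diff_commute: "v (x - y) = v (y - x)"
  by (metis minus_diff_eq v_minus)

lemma v_add_leI: "v x \<le> r \<Longrightarrow> v y \<le> r \<Longrightarrow> v (x + y) \<le> r"
  using v_add_le_max[of x y] by linarith

lemma v_diff_leI: "v x \<le> r \<Longrightarrow> v y \<le> r \<Longrightarrow> v (x - y) \<le> r"
  using v_diff_le_max[of x y] by linarith

lemma v_add_lessI: "v x < r \<Longrightarrow> v y < r \<Longrightarrow> v (x + y) < r"
  using v_add_le_max[of x y] by linarith

lemma v_diff_lessI: "v x < r \<Longrightarrow> v y < r \<Longrightarrow> v (x - y) < r"
  using v_diff_le_max[of x y] by linarith

lemma v_sum_leI: "(\<And>i. i \<in> A \<Longrightarrow> v (f i) \<le> r) \<Longrightarrow> 0 \<le> r \<Longrightarrow> v (\<Sum>i\<in>A. f i) \<le> r"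
  by (induction A rule: infinite_finite_induct) (auto intro: v_add_leI)

lemma v_power: "v (x ^ n) = v x ^ n"
  by (induction n) (auto simp: v_mult)

lemma v_inverse: "v (inverse x) = inverse (v x)"
proof (cases "x = 0")
  case False
  then have "v (inverse x) * v x = 1" by (metis left_inverse v_1 v_mult)
  then show ?thesis by (metis inverse_unique inverse_inverse_eq mult.commute)
qed simp

lemma v_divide: "v (x / y) = v x / v y"
  by (simp add: field_class.field_divide_inverse divide_real_def v_mult v_inverse)

lemma v_mult_le_1: "v x \<le> 1 \<Longrightarrow> v y \<le> 1 \<Longrightarrow> v (x * y) \<le> 1"
  by (simp add: v_mult mult_le_one)

lemma v_mult_less_1: "v x < 1 \<Longrightarrow> v y \<le> 1 \<Longrightarrow> v (x * y) < 1"
  unfolding v_mult using mult_left_le[of "v y" "v x"] by simp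

lemma v_mult_less_1': "v x \<le> 1 \<Longrightarrow> v y < 1 \<Longrightarrow> v (x * y) < 1"
  using v_mult_less_1[of y x] by (simp add: mult.commute)

lemma v_of_nat_le_1: "v (of_nat n) \<le> 1"
  by (induction n) (auto intro: v_add_leI)

lemma v_of_nat_prime: "v (of_nat (a * b)) < 1 \<Longrightarrow> v (of_nat a) < 1 \<or> v (of_nat b) < 1"
  using v_of_nat_le_1[of a] v_of_nat_le_1[of b] by (cases "v (of_nat a) = 1") (auto simp: v_mult)

lemma v_unit_add: "v x < 1 \<Longrightarrow> v y = 1 \<Longrightarrow> v (y + x) = 1"
  using v_add_le_max[of y x] v_diff_le_max[of "y + x" x] by (simp add: max_def split: if_splits)

end

text \<open>Discreteness is expressed by a largest value below 1. Characteristic zero is stated by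
  hand because the type has only the sort \<open>field\<close>; it serves to make minimal
  polynomials separable and to provide roots of unity of every order.\<close>

locale local_field = valued_field v for v :: "'l::field \<Rightarrow> real" +
  assumes v_complete: "Metric_space.mcomplete UNIV (\<lambda>x y. v (x - y))"
    and char_0: "of_nat n = (0 :: 'l) \<Longrightarrow> n = 0"
    and ex_uniformizer: "\<exists>p. 0 < v p \<and> v p < 1 \<and> (\<forall>x. v x < 1 \<longrightarrow> v x \<le> v p)"
    and finite_residue: "finite (carrier (ring_on (local_integers v) Quot local_prime v))"
begin

definition unif :: 'l where
  "unif = (SOME p. 0 < v p \<and> v p < 1 \<and> (\<forall>x. v x < 1 \<longrightarrow> v x \<le> v p))"

lemma unif: "0 < v unif" "v unif < 1" "v x < 1 \<Longrightarrow> v x \<le> v unif"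
  using someI_ex[OF ex_uniformizer, folded unif_def] by auto

lemma unif_nonzero [simp]: "unif \<noteq> 0"
  using unif(1) by auto

lemma local_prime_eq_unif_mult: "v x < 1 \<Longrightarrow> \<exists>y. v y \<le> 1 \<and> x = unif * y"
  using unif(1) unif(3)[of x] by (intro exI[of _ "x / unif"]) (auto simp: v_divide divide_le_eq)

lemma metric_space_v: "Metric_space UNIV (\<lambda>x y. v (x - y))"
proof
  fix x y z
  show "v (x - z) \<le> v (x - y) + v (y - z)"
    using v_add_le_max[of "x - y" "y - z"] v_nonneg[of "x - y"] v_nonneg[of "y - z"]
    by (simp add: max_def split: if_splits) (use v_nonneg in \<open>smt (verit)\<close>)+
qed (auto simp: v_diff_commute)

lemma v_diff_chain_le:
  fixes u :: "nat \<Rightarrow> 'l"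
  assumes "\<And>n. v (u (Suc n) - u n) \<le> r ^ n" and "0 < r" "r < 1" and "n \<le> k"
  shows "v (u k - u n) \<le> r ^ n"
  using \<open>n \<le> k\<close>
proof (induction k rule: dec_induct)
  case base
  then show ?case using assms by simp
next
  case (step k)
  have "v (u (Suc k) - u k) \<le> r ^ n"
    using assms(1)[of k] power_decreasing[OF step(1), of r] assms(2,3) by linarith
  from v_add_leI[OF this step.IH] show ?case by simp
qed

text \<open>By the ultrametric inequality a bound on consecutive differences bounds all later
  differences, so geometric decay of the steps gives a Cauchy sequence, and the same bound survives
  in the limit.\<close>

lemma convergent_if_diff_le_power:
  fixes u :: "nat \<Rightarrow> 'l"
  assumes u: "\<And>n. v (u (Suc n) - u n) \<le> r ^ n" and r: "0 < r" "r < 1"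
  shows "\<exists>L. \<forall>n. v (u n - L) \<le> r ^ n"
proof -
  interpret M: Metric_space UNIV "\<lambda>x y. v (x - y)" by (rule metric_space_v)
  have chain: "v (u k - u n) \<le> r ^ n" if "n \<le> k" for n k
    using v_diff_chain_le[OF u r that] .
  have "M.MCauchy u"
    unfolding M.MCauchy_def
  proof (intro conjI allI impI)
    fix e :: real assume "e > 0"
    then obtain N where N: "r ^ N < e" using real_arch_pow_inv r by blast
    show "\<exists>N. \<forall>n n'. N \<le> n \<longrightarrow> N \<le> n' \<longrightarrow> v (u n - u n') < e"
    proof (intro exI allI impI)
      fix n n' assume "N \<le> n" "N \<le> n'"
      then have "v ((u n - u N) - (u n' - u N)) \<le> r ^ N"
        by (intro v_diff_leI chain)
      then show "v (u n - u n') < e" using N by simp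
    qed
  qed simp
  then obtain L where L: "limitin M.mtopology u L sequentially"
    using v_complete unfolding M.mcomplete_def by blast
  have "v (u n - L) \<le> r ^ n" for n
  proof -
    have "\<forall>\<^sub>F k in sequentially. v (u k - L) < r ^ n"
      using L r unfolding M.limitin_metric by simp
    then obtain k where "k \<ge> n" "v (u k - L) < r ^ n"
      unfolding eventually_sequentially by (metis nle_le)
    then have "v ((u k - L) - (u k - u n)) \<le> r ^ n"
      using v_diff_leI[of "u k - L" "r ^ n" "u k - u n"] chain by simp
    then show ?thesis by simp
  qed
  then show ?thesis by blast
qed

subsection \<open>The residue field\<close>

lemma ring_on_sel [simp]:
  "carrier (ring_on S) = S" "monoid.mult (ring_on S) = (*)" "ring.add (ring_on S) = (+)"
  "monoid.one (ring_on S) = 1" "ring.zero (ring_on S) = 0"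
  by (auto simp: ring_of_type_algebra_def)

lemma cring_integers: "cring (ring_on (local_integers v))"
proof -
  have "\<exists>y. v y \<le> 1 \<and> y + x = 0" if "v x \<le> 1" for x
    using that by (intro exI[of _ "- x"]) simp
  then show ?thesis
    by unfold_locales
      (auto simp: local_integers_def algebra_simps v_mult Units_def mult_le_one
            intro: v_add_leI)
qed

lemma a_inv_integers: "x \<in> local_integers v \<Longrightarrow> \<ominus>\<^bsub>ring_on (local_integers v)\<^esub> x = - x"
  using cring_integers
  by (intro abelian_group.minus_equality)
     (auto simp: cring_def local_integers_def dest: ring.is_abelian_group)

lemma ideal_prime: "ideal (local_prime v) (ring_on (local_integers v))"
proof (intro idealI)
  show "ring (ring_on (local_integers v))" using cring_integers cring_def by blast
  then interpret ring "ring_on (local_integers v)" .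
  show "subgroup (local_prime v) (add_monoid (ring_on (local_integers v)))"
  proof (intro add.subgroupI)
    show "local_prime v \<subseteq> carrier (ring_on (local_integers v))"
      by (auto simp: local_prime_def local_integers_def)
    show "local_prime v \<noteq> {}" by (auto simp: local_prime_def intro: exI[of _ 0])
  next
    fix a assume a: "a \<in> local_prime v"
    then have "a \<in> local_integers v" by (simp add: local_prime_def local_integers_def)
    from a_inv_integers[OF this] a
    show "\<ominus>\<^bsub>ring_on (local_integers v)\<^esub> a \<in> local_prime v"
      by (simp add: local_prime_def)
  qed (auto simp: local_prime_def intro: v_add_lessI)
next
  fix a x assume "a \<in> local_prime v" "x \<in> carrier (ring_on (local_integers v))"
  then show "x \<otimes>\<^bsub>ring_on (local_integers v)\<^esub> a \<in> local_prime v"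
    and "a \<otimes>\<^bsub>ring_on (local_integers v)\<^esub> x \<in> local_prime v"
    by (auto simp: local_prime_def local_integers_def v_mult_less_1 v_mult_less_1')
qed

abbreviation "residue_ring \<equiv> ring_on (local_integers v) Quot local_prime v"
abbreviation "residue_class x \<equiv> local_prime v +>\<^bsub>ring_on (local_integers v)\<^esub> x"

lemma residue_class_eq_iff:
  assumes "v x \<le> 1" "v y \<le> 1"
  shows "residue_class x = residue_class y \<longleftrightarrow> v (x - y) < 1"
proof -
  have *: "residue_class z = {w. v (w - z) < 1}" for z
  proof -
    have "\<exists>h. v h < 1 \<and> w = h + z" if "v (w - z) < 1" for w
      using that by (intro exI[of _ "w - z"]) simp
    then show ?thesis
      by (auto simp: a_r_coset_def r_coset_def local_prime_def)
  qed
  show ?thesis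
  proof
    assume "residue_class x = residue_class y"
    moreover have "x \<in> residue_class x" by (simp add: *)
    ultimately show "v (x - y) < 1" by (simp add: *)
  next
    assume xy: "v (x - y) < 1"
    have "v (w - x) < 1 \<longleftrightarrow> v (w - y) < 1" for w
      using v_add_lessI[of "w - x" 1 "x - y"] v_diff_lessI[of "w - y" 1 "x - y"] xy by auto
    then show "residue_class x = residue_class y" by (simp add: *)
  qed
qed

lemma carrier_residue_ring: "carrier residue_ring = residue_class ` local_integers v"
  by (auto simp: FactRing_def A_RCOSETS_def' )

text \<open>An integer outside the open unit ball has value 1, so its inverse is integral and every
  ideal containing it is the whole ring.\<close>

lemma field_residue: "field residue_ring"
proof -
  interpret R: cring "ring_on (local_integers v)" by (rule cring_integers)
  interpret I: ideal "local_prime v" "ring_on (local_integers v)" by (rule ideal_prime)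
  have "maximalideal (local_prime v) (ring_on (local_integers v))"
  proof (intro maximalidealI ideal_prime)
    show "carrier (ring_on (local_integers v)) \<noteq> local_prime v"
      by (auto simp: local_integers_def local_prime_def dest!: equalityD1 subsetD[of _ _ 1])
  next
    fix J assume J: "ideal J (ring_on (local_integers v))" "local_prime v \<subseteq> J"
      "J \<subseteq> carrier (ring_on (local_integers v))"
    interpret J: ideal J "ring_on (local_integers v)" by fact
    show "J = local_prime v \<or> J = carrier (ring_on (local_integers v))"
    proof (cases "J \<subseteq> local_prime v")
      case False
      then obtain x where x: "x \<in> J" "v x = 1"
        using J(3) by (force simp: local_integers_def local_prime_def)
      have "inverse x \<in> local_integers v" using x by (simp add: local_integers_def v_inverse)
      from J.I_l_closed[OF x(1), of "inverse x"] this x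
      have "1 \<in> J" by (metis v_eq_0 left_inverse ring_on_sel(1,2) zero_neq_one)
      then show ?thesis using J.one_imp_carrier by simp
    qed (use J in auto)
  qed
  then show ?thesis by (rule maximalideal.quotient_is_field) (rule cring_integers)
qed

lemma residue_class_hom: "residue_class \<in> ring_hom (ring_on (local_integers v)) residue_ring"
  by (rule ideal.rcos_ring_hom[OF ideal_prime])

lemma residue_class_power:
  assumes "v x \<le> 1"
  shows "residue_class x [^]\<^bsub>residue_ring\<^esub> (n::nat) = residue_class (x ^ n)"
proof -
  interpret F: field residue_ring by (rule field_residue)
  have [simp]: "v (x ^ k) \<le> 1" for k using assms by (simp add: v_power power_le_one)
  show ?thesis
  proof (induction n)
    case 0
    show ?case using ring_hom_one[OF residue_class_hom] by simp
  next
    case (Suc n)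
    then show ?case
      using ring_hom_mult[OF residue_class_hom, of "x ^ n" x] assms
      by (simp add: mult.commute local_integers_def)
  qed
qed

lemma residue_class_zero: "v x < 1 \<Longrightarrow> residue_class x = \<zero>\<^bsub>residue_ring\<^esub>"
  using ring_hom_zero[OF residue_class_hom] residue_class_eq_iff[of x 0] cring_integers field_residue
  by (simp add: cring_def field_def domain_def)

lemma residue_card_ge_2: "residue_card v \<ge> 2"
proof -
  have "residue_class 0 \<noteq> residue_class 1" by (subst residue_class_eq_iff) auto
  moreover have "{residue_class 0, residue_class 1} \<subseteq> carrier residue_ring"
    by (simp add: carrier_residue_ring) (simp add: local_integers_def)
  ultimately show ?thesis
    using card_mono[OF finite_residue, of "{residue_class 0, residue_class 1}"]
    by (simp add: residue_card_def)
qed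

text \<open>For units this is Lagrange's theorem in the multiplicative group of the residue field,
  of order q - 1; for non-units both terms are small.\<close>

lemma power_residue_card: assumes "v x \<le> 1" shows "v (x ^ residue_card v - x) < 1"
proof (cases "v x < 1")
  case True
  then have "v (x ^ residue_card v) < 1"
    using residue_card_ge_2 by (simp add: v_power power_less_one_iff)
  with True show ?thesis by (intro v_diff_lessI)
next
  case False
  interpret F: field residue_ring by (rule field_residue)
  interpret G: group "mult_of residue_ring" by (rule F.field_mult_group)
  let ?c = "residue_class x"
  have "residue_class x \<noteq> residue_class 0" using False assms by (subst residue_class_eq_iff) auto
  then have c: "?c \<in> carrier (mult_of residue_ring)"
    using assms residue_class_zero[of 0]
    by (simp add: Multiplicative_Group.carrier_mult_of carrier_residue_ring)
      (simp add: local_integers_def)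
  then have "?c [^]\<^bsub>mult_of residue_ring\<^esub> order (mult_of residue_ring) = \<one>\<^bsub>mult_of residue_ring\<^esub>"
    by (intro G.pow_order_eq_1)
  moreover have "order (mult_of residue_ring) = residue_card v - 1"
    using finite_residue by (simp add: Coset.order_def Multiplicative_Group.carrier_mult_of residue_card_def)
  ultimately have "?c [^]\<^bsub>residue_ring\<^esub> (residue_card v - 1) = \<one>\<^bsub>residue_ring\<^esub>"
    by (simp add: Multiplicative_Group.nat_pow_mult_of Multiplicative_Group.one_mult_of)
  then have "residue_class (x ^ (residue_card v - 1)) = residue_class 1"
    using assms ring_hom_one[OF residue_class_hom] by (simp add: residue_class_power)
  then have "v (x ^ (residue_card v - 1) - 1) < 1"
    using assms by (subst (asm) residue_class_eq_iff) (auto simp: v_power power_le_one)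
  moreover have "x ^ residue_card v - x = x * (x ^ (residue_card v - 1) - 1)"
    using residue_card_ge_2 by (cases "residue_card v") (auto simp: algebra_simps)
  ultimately show ?thesis using assms False by (simp add: v_mult)
qed

definition res_char :: nat where "res_char = (LEAST n. n > 0 \<and> v (of_nat n) < 1)"

text \<open>Pigeonhole: two natural numbers share one of the finitely many residue classes, and
  their difference is the witness.\<close>

lemma ex_nat_v_less_1: "\<exists>n>0. v (of_nat n) < 1"
proof -
  have "\<not> inj (\<lambda>n::nat. residue_class (of_nat n))"
  proof
    assume "inj (\<lambda>n::nat. residue_class (of_nat n))"
    moreover have "range (\<lambda>n::nat. residue_class (of_nat n)) \<subseteq> carrier residue_ring"
      by (simp add: carrier_residue_ring) (auto simp: local_integers_def v_of_nat_le_1)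
    ultimately show False using finite_residue finite_subset
      by (metis finite_imageD infinite_UNIV_nat)
  qed
  then obtain a b :: nat where ab: "a < b" "residue_class (of_nat a) = residue_class (of_nat b)"
    unfolding inj_def by (metis linorder_neqE_nat)
  then have "v (of_nat b - of_nat a) < 1"
    by (metis residue_class_eq_iff v_of_nat_le_1)
  then show ?thesis using ab by (intro exI[of _ "b - a"]) (auto simp: of_nat_diff)
qed

lemma res_char: "res_char > 0" "v (of_nat res_char) < 1"
  using LeastI_ex[OF ex_nat_v_less_1] by (auto simp: res_char_def)

lemma prime_res_char: "prime res_char"
  unfolding res_char_def
  by (rule prime_Least(1)[of res_char "\<lambda>n. v (of_nat n) < 1", OF res_char _ v_of_nat_prime]) simp

lemma nat_v_less_1_iff: "v (of_nat n) < 1 \<longleftrightarrow> res_char dvd n"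
proof
  assume "res_char dvd n"
  then obtain k where "n = res_char * k" by blast
  then show "v (of_nat n) < 1"
    using v_mult_less_1[OF res_char(2) v_of_nat_le_1[of k]] by simp
next
  assume n: "v (of_nat n) < 1"
  show "res_char dvd n"
  proof (rule ccontr)
    assume nd: "\<not> res_char dvd n"
    have eq: "of_nat n = (of_nat (n div res_char) * of_nat res_char + of_nat (n mod res_char) :: 'l)"
      by (metis div_mult_mod_eq of_nat_add of_nat_mult)
    have "v (of_nat (n div res_char) * of_nat res_char) < 1"
      using v_mult_less_1'[OF v_of_nat_le_1 res_char(2)] .
    from v_diff_lessI[OF n this] eq have "v (of_nat (n mod res_char)) < 1" by simp
    moreover have "n mod res_char > 0" using nd by (simp add: dvd_eq_mod_eq_0)
    ultimately have "n mod res_char \<ge> res_char"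
      unfolding res_char_def by (intro Least_le) auto
    then show False using res_char(1) mod_less_divisor leD by blast
  qed
qed

text \<open>For a prime \<open>r\<close> dividing the order of the additive group, Sylow provides a
  subgroup of order \<open>r\<close>. A non-zero element of it is the class of a unit
  \<open>y\<close> with \<open>of_nat r * y\<close> small, so \<open>r\<close> itself is small and
  equals \<open>res_char\<close>.\<close>

lemma residue_card_power_of_char: "\<exists>k. residue_card v = res_char ^ k"
proof -
  interpret F: field residue_ring by (rule field_residue)
  have only: "r = res_char" if r: "prime r" "r dvd residue_card v" for r
  proof (rule ccontr)
    assume ne: "r \<noteq> res_char"
    obtain k where k: "residue_card v = r * k" using r by blast
    have "order (add_monoid residue_ring) = r ^ 1 * k"
      using k by (simp add: residue_card_def Coset.order_def)
    from sylow_thm[OF r(1) F.add.is_group this]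
    have "\<exists>H. subgroup H (add_monoid residue_ring) \<and> card H = r ^ 1"
      using finite_residue by simp
    then obtain H where H: "subgroup H (add_monoid residue_ring)" "card H = r" by auto
    have "card H > 1" using H prime_gt_1_nat[OF r(1)] by simp
    have "\<not> H \<subseteq> {\<zero>\<^bsub>residue_ring\<^esub>}"
    proof
      assume "H \<subseteq> {\<zero>\<^bsub>residue_ring\<^esub>}"
      then have "card H \<le> card {\<zero>\<^bsub>residue_ring\<^esub>}" by (intro card_mono) auto
      then show False using \<open>card H > 1\<close> by simp
    qed
    then obtain x where x: "x \<in> H" "x \<noteq> \<zero>\<^bsub>residue_ring\<^esub>" by blast
    let ?G = "(add_monoid residue_ring)\<lparr>carrier := H\<rparr>"
    interpret H: group ?G using F.add.subgroup_imp_group[OF H(1)] .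
    have "x [^]\<^bsub>?G\<^esub> order ?G = \<one>\<^bsub>?G\<^esub>" using x by (intro H.pow_order_eq_1) auto
    then have 1: "[r] \<cdot>\<^bsub>residue_ring\<^esub> x = \<zero>\<^bsub>residue_ring\<^esub>"
      using H by (simp add: Coset.order_def add_pow_def nat_pow_def)
    obtain y where y: "v y \<le> 1" "x = residue_class y"
    proof -
      have "x \<in> carrier residue_ring" using x(1) subgroup.subset[OF H(1)] by auto
      then show ?thesis using that by (auto simp only: carrier_residue_ring) (auto simp: local_integers_def)
    qed
    have "[n] \<cdot>\<^bsub>residue_ring\<^esub> x = residue_class (of_nat n * y)" for n :: nat
    proof (induction n)
      case 0
      show ?case using residue_class_zero[of 0] by simp
    next
      case (Suc n)
      have "v (of_nat n * y) \<le> 1" by (rule v_mult_le_1[OF v_of_nat_le_1 y(1)])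
      then have "residue_class (of_nat n * y + y) = residue_class (of_nat n * y) \<oplus>\<^bsub>residue_ring\<^esub> x"
        using ring_hom_add[OF residue_class_hom, of "of_nat n * y" y] y
        by (simp add: local_integers_def)
      moreover have "[Suc n] \<cdot>\<^bsub>residue_ring\<^esub> x = [n] \<cdot>\<^bsub>residue_ring\<^esub> x \<oplus>\<^bsub>residue_ring\<^esub> x"
        by (simp add: add_pow_def nat_pow_def)
      ultimately show ?case using Suc by (simp add: distrib_right add.commute)
    qed
    with 1 have "residue_class (of_nat r * y) = residue_class 0"
      using residue_class_zero[of 0] by simp
    then have "v (of_nat r * y) < 1"
      using residue_class_eq_iff[of "of_nat r * y" 0] v_mult_le_1[OF v_of_nat_le_1 y(1)] by simp
    moreover have "\<not> v y < 1" using x(2) y(2) residue_class_zero[of y] by blast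
    then have "v y = 1" using y(1) by linarith
    ultimately have "res_char dvd r" by (simp add: v_mult nat_v_less_1_iff[symmetric])
    with ne primes_dvd_imp_eq[OF prime_res_char r(1)] show False by simp
  qed
  have "\<exists>k. n = res_char ^ k" if "n > 0" "\<And>r. prime r \<Longrightarrow> r dvd n \<Longrightarrow> r = res_char" for n
    using that
  proof (induction n rule: less_induct)
    case (less n)
    show ?case
    proof (cases "n = 1")
      case False
      then obtain r where r: "prime r" "r dvd n" using prime_factor_nat by blast
      then have "res_char dvd n" using less.prems by auto
      then obtain l where l: "n = res_char * l" by blast
      have "l > 0" "l < n" using l less.prems(1) prime_gt_1_nat[OF prime_res_char] by (auto intro: Nat.gr0I)
      then obtain k where "l = res_char ^ k" using less.IH[of l] less.prems(2) l by auto
      then show ?thesis using l by (intro exI[of _ "Suc k"]) simp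
    qed (auto intro: exI[of _ 0])
  qed
  from this[OF _ only] residue_card_ge_2 show ?thesis by simp
qed

end

section \<open>Spans, Nakayama's lemma and Hensel factorisation\<close>

text \<open>The sum runs over all of \<open>B\<close>, so only finite \<open>B\<close> are
  meaningful. The coefficients need not form a ring: for an ideal \<open>J\<close> of a ring this is
  the product of \<open>J\<close> with the module generated by \<open>B\<close>, the form in which
  Nakayama's lemma is applied.\<close>

definition rspan :: "'a::comm_ring_1 set \<Rightarrow> 'a set \<Rightarrow> 'a set" where
  "rspan R B = {\<Sum>b\<in>B. c b * b | c. \<forall>b\<in>B. c b \<in> R}"

locale subring_set =
  fixes R :: "'a::comm_ring_1 set"
  assumes zero_mem: "0 \<in> R" and one_mem: "1 \<in> R"
    and add_mem: "x \<in> R \<Longrightarrow> y \<in> R \<Longrightarrow> x + y \<in> R"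
    and minus_mem: "x \<in> R \<Longrightarrow> - x \<in> R"
    and mult_mem: "x \<in> R \<Longrightarrow> y \<in> R \<Longrightarrow> x * y \<in> R"
begin

lemma diff_mem: "x \<in> R \<Longrightarrow> y \<in> R \<Longrightarrow> x - y \<in> R"
  using add_mem minus_mem by fastforce

lemma sum_mem: "(\<And>i. i \<in> I \<Longrightarrow> f i \<in> R) \<Longrightarrow> (\<Sum>i\<in>I. f i) \<in> R"
  by (induction I rule: infinite_finite_induct) (auto intro: zero_mem add_mem)

lemma power_mem: "x \<in> R \<Longrightarrow> x ^ n \<in> R"
  by (induction n) (auto intro: one_mem mult_mem)

lemma of_nat_mem: "of_nat n \<in> R"
  by (induction n) (auto intro: zero_mem one_mem add_mem)

lemma rspan_zero: "0 \<in> rspan R B"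
  by (auto simp: rspan_def zero_mem intro!: exI[of _ "\<lambda>_. 0"])

lemma rspan_add: "x \<in> rspan R B \<Longrightarrow> y \<in> rspan R B \<Longrightarrow> x + y \<in> rspan R B"
  unfolding rspan_def by (force simp: sum.distrib distrib_right add_mem intro: exI[of _ "\<lambda>b. _ b + _ b"])

lemma rspan_scale: "r \<in> R \<Longrightarrow> x \<in> rspan R B \<Longrightarrow> r * x \<in> rspan R B"
  unfolding rspan_def
  by (force simp: sum_distrib_left mult.assoc mult_mem intro: exI[of _ "\<lambda>b. r * _ b"])

lemma rspan_minus: "x \<in> rspan R B \<Longrightarrow> - x \<in> rspan R B"
  using rspan_scale[of "-1" x B] minus_mem[OF one_mem] by simp

lemma rspan_diff: "x \<in> rspan R B \<Longrightarrow> y \<in> rspan R B \<Longrightarrow> x - y \<in> rspan R B"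
  using rspan_add rspan_minus by fastforce

lemma rspan_base: "finite B \<Longrightarrow> b \<in> B \<Longrightarrow> b \<in> rspan R B"
  unfolding rspan_def
  by (intro CollectI exI[of _ "\<lambda>x. if x = b then 1 else 0"])
     (auto simp: zero_mem one_mem if_distrib[of "\<lambda>x. x * _"] sum.delta cong: if_cong)

lemma rspan_sum: "(\<And>i. i \<in> I \<Longrightarrow> f i \<in> rspan R B) \<Longrightarrow> (\<Sum>i\<in>I. f i) \<in> rspan R B"
  by (induction I rule: infinite_finite_induct) (auto intro: rspan_zero rspan_add)

lemma rspan_mult:
  assumes "x \<in> rspan R B" "y \<in> rspan R C"
    and "\<And>b c. b \<in> B \<Longrightarrow> c \<in> C \<Longrightarrow> b * c \<in> rspan R D"
  shows "x * y \<in> rspan R D"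
proof -
  obtain f where f: "x = (\<Sum>b\<in>B. f b * b)" "\<And>b. b \<in> B \<Longrightarrow> f b \<in> R"
    using assms(1) by (auto simp: rspan_def)
  obtain g where g: "y = (\<Sum>c\<in>C. g c * c)" "\<And>c. c \<in> C \<Longrightarrow> g c \<in> R"
    using assms(2) by (auto simp: rspan_def)
  have "x * y = (\<Sum>b\<in>B. \<Sum>c\<in>C. (f b * g c) * (b * c))"
    unfolding f g by (simp add: sum_product algebra_simps)
  also have "\<dots> \<in> rspan R D"
    by (rule rspan_sum)+ (rule rspan_scale[OF mult_mem[OF f(2) g(2)] assms(3)])
  finally show ?thesis .
qed

end

text \<open>Elimination of one generator at a time. By \<open>inv\<close> the ideal lies in the
  Jacobson radical, so the relation expressing \<open>s0\<close> can be solved for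
  \<open>s0\<close>; substituting it leaves relations of the same kind between the remaining
  generators.\<close>

lemma nakayama:
  fixes R J S :: "'a::field set"
  assumes R: "subring_set R"
    and J: "J \<subseteq> R" "\<And>x y. x \<in> J \<Longrightarrow> y \<in> J \<Longrightarrow> x + y \<in> J" "\<And>r x. r \<in> R \<Longrightarrow> x \<in> J \<Longrightarrow> r * x \<in> J"
    and inv: "\<And>j. j \<in> J \<Longrightarrow> j \<noteq> 1 \<and> inverse (1 - j) \<in> R"
    and S: "finite S" "S \<subseteq> rspan J S"
  shows "S \<subseteq> {0}"
  using S
proof (induction S)
  case (insert s0 S)
  interpret subring_set R by fact
  have comb: "\<exists>a c. x = a * s0 + (\<Sum>t\<in>S. c t * t) \<and> a \<in> J \<and> (\<forall>t\<in>S. c t \<in> J)" if x: "x \<in> insert s0 S" for x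
  proof -
    obtain c where "x = (\<Sum>t\<in>insert s0 S. c t * t)" "\<forall>t\<in>insert s0 S. c t \<in> J"
      using insert.prems x by (auto simp: rspan_def)
    then show ?thesis using insert.hyps by auto
  qed
  obtain a0 c0 where 0: "s0 = a0 * s0 + (\<Sum>t\<in>S. c0 t * t)" "a0 \<in> J" "\<forall>t\<in>S. c0 t \<in> J"
    using comb[of s0] by auto
  define r where "r = inverse (1 - a0)"
  have r: "r \<in> R" "1 - a0 \<noteq> 0" using inv[OF 0(2)] by (auto simp: r_def)
  have "(1 - a0) * s0 = (\<Sum>t\<in>S. c0 t * t)" using 0(1) by (simp add: algebra_simps)
  then have "r * ((1 - a0) * s0) = r * (\<Sum>t\<in>S. c0 t * t)" by simp
  then have s0: "s0 = (\<Sum>t\<in>S. (r * c0 t) * t)"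
    using r by (simp add: r_def sum_distrib_left mult.assoc[symmetric])
  have "S \<subseteq> rspan J S"
  proof
    fix s assume "s \<in> S"
    with comb[of s] obtain a c where s: "s = a * s0 + (\<Sum>t\<in>S. c t * t)" "a \<in> J" "\<forall>t\<in>S. c t \<in> J"
      by auto
    have "s = (\<Sum>t\<in>S. (a * (r * c0 t) + c t) * t)"
      by (subst s(1), subst s0) (simp add: sum_distrib_left sum.distrib algebra_simps)
    moreover have "a * (r * c0 t) + c t \<in> J" if "t \<in> S" for t
      using that s 0(3) r J by (meson subsetD)
    ultimately show "s \<in> rspan J S" by (auto simp: rspan_def)
  qed
  then have "S \<subseteq> {0}" by (rule insert.IH)
  moreover from this have "s0 = 0" by (subst s0, intro sum.neutral) auto
  ultimately show ?case by simp
qed simp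

section \<open>Hensel factorisation\<close>

context local_field
begin

text \<open>The Gauss norm of the polynomial is at most \<open>c\<close>; \<open>cbound 1\<close>
  means integral coefficients.\<close>

definition cbound :: "real \<Rightarrow> 'l poly \<Rightarrow> bool" where
  "cbound c p \<longleftrightarrow> (\<forall>i. v (poly.coeff p i) \<le> c)"

lemma cbound_add: "cbound c p \<Longrightarrow> cbound c q \<Longrightarrow> cbound c (p + q)"
  by (auto simp: cbound_def intro: v_add_leI)

lemma cbound_diff: "cbound c p \<Longrightarrow> cbound c q \<Longrightarrow> cbound c (p - q)"
  by (auto simp: cbound_def intro: v_diff_leI)

lemma cbound_mono: "cbound c p \<Longrightarrow> c \<le> d \<Longrightarrow> cbound d p"
  unfolding cbound_def using order_trans by blast

lemma cbound_mult:
  assumes "cbound c p" "cbound d q" "0 \<le> c" "0 \<le> d"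
  shows "cbound (c * d) (p * q)"
  using assms unfolding cbound_def coeff_mult
  by (auto intro!: v_sum_leI simp: v_mult mult_mono)

lemma cbound_smult: "cbound c p \<Longrightarrow> cbound (v a * c) (smult a p)"
  by (auto simp: cbound_def v_mult intro: mult_left_mono)

lemma cbound_monom: "v a \<le> c \<Longrightarrow> cbound c (Polynomial.monom a n)"
  using order_trans[OF v_nonneg[of a]] by (auto simp: cbound_def)

lemma cbound_all_imp_zero:
  assumes "\<And>k. cbound (r ^ k) p" "0 < r" "r < 1"
  shows "p = 0"
proof (rule poly_eqI)
  fix i
  have "\<not> 0 < v (poly.coeff p i)"
    using assms real_arch_pow_inv[of "v (poly.coeff p i)" r] by (auto simp: cbound_def simp flip: not_less)
  then have "v (poly.coeff p i) = 0" using v_nonneg[of "poly.coeff p i"] by linarith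
  then show "poly.coeff p i = poly.coeff 0 i" by simp
qed

text \<open>Coefficients converge one by one; the common degree bound makes the limit a
  polynomial.\<close>

lemma poly_convergent:
  fixes p :: "nat \<Rightarrow> 'l poly"
  assumes "\<And>k. cbound (r ^ k) (p (Suc k) - p k)" and "0 < r" "r < 1" and deg: "\<And>k i. i > d \<Longrightarrow> poly.coeff (p k) i = 0"
  shows "\<exists>q. degree q \<le> d \<and> (\<forall>k. cbound (r ^ k) (p k - q))"
proof -
  have "\<forall>i. \<exists>L. \<forall>k. v (poly.coeff (p k) i - L) \<le> r ^ k"
    using assms(1,2,3) by (intro allI convergent_if_diff_le_power) (auto simp: cbound_def)
  then obtain L where L: "\<And>i k. v (poly.coeff (p k) i - L i) \<le> r ^ k" by metis
  define q where "q = (\<Sum>i\<le>d. Polynomial.monom (L i) i)"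
  have q: "poly.coeff q i = (if i \<le> d then L i else 0)" for i
    by (auto simp: q_def coeff_sum)
  have "cbound (r ^ k) (p k - q)" for k
    unfolding cbound_def using L[of k] deg[of _ k] assms(2) by (auto simp: q)
  moreover have "degree q \<le> d" by (intro degree_le) (auto simp: q)
  ultimately show ?thesis by blast
qed

text \<open>A polynomial with unit constant term is invertible as a power series over the integers,
  and \<open>a\<close> is the quotient of \<open>D\<close> by \<open>u\<close> cut off at degree
  \<open>r\<close>. Adding \<open>monom c r\<close> changes the coefficient of the product at
  \<open>r\<close> by \<open>c\<close> times that unit.\<close>

lemma solve_mod_X_power:
  assumes u: "cbound 1 u" "v (poly.coeff u 0) = 1" and D: "cbound 1 D"
  shows "\<exists>a. cbound 1 a \<and> (\<forall>i\<ge>r. poly.coeff a i = 0) \<and> (\<forall>i<r. poly.coeff (a * u) i = poly.coeff D i)"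
proof (induction r)
  case 0
  then show ?case by (intro exI[of _ 0]) (auto simp: cbound_def)
next
  case (Suc r)
  then obtain a where a: "cbound 1 a" "\<forall>i\<ge>r. poly.coeff a i = 0" "\<forall>i<r. poly.coeff (a * u) i = poly.coeff D i"
    by blast
  define c where "c = (poly.coeff D r - poly.coeff (a * u) r) / poly.coeff u 0"
  have "cbound 1 (D - a * u)" using cbound_diff[OF D, of "a * u"] cbound_mult[OF a(1) u(1)] by simp
  then have c: "v c \<le> 1" using u by (auto simp: c_def v_divide cbound_def)
  have u0: "poly.coeff u 0 \<noteq> 0" using u by auto
  show ?case
  proof (intro exI[of _ "a + Polynomial.monom c r"] conjI allI impI)
    fix i assume "i < Suc r"
    then show "poly.coeff ((a + Polynomial.monom c r) * u) i = poly.coeff D i"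
      using a(3) u0 by (cases "i = r") (auto simp: distrib_right coeff_monom_mult c_def)
  qed (use a c cbound_add[OF a(1) cbound_monom[OF c]] in auto)
qed

text \<open>Modulo the uniformizer \<open>f\<close> is X^r times \<open>u\<close>, and the factors
  are coprime because \<open>u\<close> has a unit constant term. The error \<open>smult c D\<close>
  is absorbed by writing \<open>D = a * u + monom 1 r * b\<close> and adding
  \<open>smult c a\<close> and \<open>smult c b\<close> to the factors; the degree bounds keep the
  first factor monic of degree \<open>r\<close>.\<close>

lemma hensel_step:
  assumes f: "cbound 1 f" "degree f \<le> n" and r: "r < n" and u: "u = poly_shift r f" "v (poly.coeff f r) = 1"
    and e: "e = v unif" "k > 0"
    and g: "cbound e (g - Polynomial.monom 1 r)" "cbound e (h - u)" "cbound (e ^ k) (f - g * h)"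
      "degree (g - Polynomial.monom 1 r) < r" "degree h \<le> n - r" and r0: "r > 0"
  shows "\<exists>g' h'. cbound e (g' - Polynomial.monom 1 r) \<and> cbound e (h' - u) \<and> cbound (e ^ Suc k) (f - g' * h')
     \<and> degree (g' - Polynomial.monom 1 r) < r \<and> degree h' \<le> n - r \<and> cbound (e ^ k) (g' - g) \<and> cbound (e ^ k) (h' - h)"
proof -
  have e01: "0 < e" "e < 1" using unif e by auto
  define c where "c = unif ^ k"
  have c: "v c = e ^ k" "c \<noteq> 0" by (auto simp: c_def v_power e)
  define D where "D = smult (inverse c) (f - g * h)"
  have D: "cbound 1 D" "smult c D = f - g * h"
    using cbound_smult[OF g(3), of "inverse c"] c e01 by (auto simp: D_def v_inverse)
  have uc: "poly.coeff u i = poly.coeff f (i + r)" for i by (simp add: u coeff_poly_shift add.commute)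
  have u1: "cbound 1 u" "v (poly.coeff u 0) = 1" using f u(2) by (auto simp: cbound_def uc)
  obtain a where a: "cbound 1 a" "\<forall>i\<ge>r. poly.coeff a i = 0" "\<forall>i<r. poly.coeff (a * u) i = poly.coeff D i"
    using solve_mod_X_power[OF u1 D(1)] by blast
  define b where "b = poly_shift r (D - a * u)"
  have b: "D = a * u + Polynomial.monom 1 r * b"
    by (rule poly_eqI) (use a(3) in \<open>auto simp: b_def coeff_monom_mult coeff_poly_shift not_less\<close>)
  have Dau: "cbound 1 (D - a * u)" using cbound_diff[OF D(1), of "a * u"] cbound_mult[OF a(1) u1(1)] by simp
  then have b1: "cbound 1 b" by (auto simp: b_def cbound_def coeff_poly_shift)
  have dega: "degree a < r" using a(2) r0 by (metis degree_0 leI leading_coeff_0_iff)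
  have degg: "degree g \<le> r"
    using degree_add_le[of "g - Polynomial.monom 1 r" r "Polynomial.monom 1 r"] g(4) degree_monom_le[of 1 r]
    by simp
  have degu: "degree u \<le> n - r" using f(2) by (intro degree_le) (auto simp: uc intro: coeff_eq_0)
  have "degree (g * h) \<le> n" using degree_mult_le[of g h] degg g(5) r by linarith
  then have "degree D \<le> n" unfolding D_def using f(2) degree_diff_le degree_smult_le order_trans by blast
  moreover have "degree (a * u) \<le> n" using degree_mult_le[of a u] dega degu r by linarith
  ultimately have "degree (D - a * u) \<le> n" by (rule degree_diff_le)
  then have degb: "degree b \<le> n - r"
    using coeff_eq_0[of "D - a * u"] by (intro degree_le) (simp add: b_def coeff_poly_shift)
  define g' h' where "g' = g + smult c a" and "h' = h + smult c b"
  have ek: "e ^ k \<le> e" using e01 e(2) power_decreasing[of 1 k e] by simp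
  have ca: "cbound (e ^ k) (smult c a)" "cbound (e ^ k) (smult c b)"
    using cbound_smult[OF a(1), of c] cbound_smult[OF b1, of c] c by simp_all
  \<comment> \<open>The main part of the error cancels. What remains carries the factor
    \<open>c\<close> and a second factor of size at most \<open>e\<close>, because \<open>g\<close>
    and \<open>h\<close> are close to X^r and \<open>u\<close>.\<close>
  have eq: "f - g' * h' = smult c (a * (u - h) + b * (Polynomial.monom 1 r - g) - smult c (a * b))"
  proof -
    have "f - g' * h' = (f - g * h) - smult c (a * h + g * b) - smult c (smult c (a * b))"
      by (simp add: g'_def h'_def algebra_simps smult_add_right)
    also have "f - g * h = smult c (a * u + Polynomial.monom 1 r * b)" using D(2) b by simp
    finally show ?thesis by (simp add: algebra_simps smult_add_right smult_diff_right)
  qed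
  have "cbound e (a * (u - h))" "cbound e (b * (Polynomial.monom 1 r - g))"
    using cbound_mult[OF a(1), of e "u - h"] cbound_mult[OF b1, of e "Polynomial.monom 1 r - g"] g(1,2) e01
    by (auto simp: cbound_def v_diff_commute)
  moreover have "cbound e (smult c (a * b))"
    using cbound_smult[OF cbound_mult[OF a(1) b1], of c] c ek cbound_mono by force
  ultimately have "cbound e (a * (u - h) + b * (Polynomial.monom 1 r - g) - smult c (a * b))"
    by (intro cbound_add cbound_diff)
  from cbound_smult[OF this, of c] have 1: "cbound (e ^ Suc k) (f - g' * h')"
    unfolding eq by (simp add: c mult.commute)
  have 2: "cbound e (g' - Polynomial.monom 1 r)" "cbound e (h' - u)"
    using cbound_add[OF g(1) cbound_mono[OF ca(1) ek]] cbound_add[OF g(2) cbound_mono[OF ca(2) ek]]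
    by (simp_all add: g'_def h'_def algebra_simps)
  have "degree (smult c a) < r" using dega degree_smult_le[of c a] by linarith
  then have 3: "degree (g' - Polynomial.monom 1 r) < r"
    using degree_add_less[OF g(4), of "smult c a"] by (simp add: g'_def algebra_simps)
  have 4: "degree h' \<le> n - r"
    unfolding h'_def by (intro degree_add_le g(5) order_trans[OF degree_smult_le degb])
  show ?thesis using 1 2 3 4 ca by (intro exI[of _ g'] exI[of _ h']) (simp add: g'_def h'_def)
qed

text \<open>Here \<open>r\<close> is the first index of a unit coefficient. The exact degree
  \<open>r\<close> of the factor is what matters: the first unit coefficient of an irreducible
  polynomial cannot lie strictly between its two ends.\<close>

lemma hensel_factorisation:
  assumes f: "cbound 1 f" and r: "0 < r" "r < degree f"
    and fr: "v (poly.coeff f r) = 1" "\<And>i. i < r \<Longrightarrow> v (poly.coeff f i) < 1"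
  shows "\<exists>g h. f = g * h \<and> degree g = r"
proof -
  define n u e Y where "n = degree f" and "u = poly_shift r f" and "e = v unif" and "Y = Polynomial.monom (1::'l) r"
  have e01: "0 < e" "e < 1" using unif by (auto simp: e_def)
  define Q where "Q = (\<lambda>k (g, h). cbound e (g - Y) \<and> cbound e (h - u) \<and> cbound (e ^ Suc k) (f - g * h)
     \<and> degree (g - Y) < r \<and> degree h \<le> n - r)"
  define S where "S = (\<lambda>k (g, h) (g', h'). cbound (e ^ Suc k) (g' - g) \<and> cbound (e ^ Suc k) (h' - h))"
  have "\<exists>s. \<forall>k. Q k (s k) \<and> S k (s k) (s (Suc k))"
  proof (rule dependent_nat_choice)
    \<comment> \<open>Only the coefficients of \<open>f\<close> below \<open>r\<close> survive in
      this difference, and these are non-units.\<close>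
    have "cbound e (f - Y * u)"
      unfolding cbound_def
    proof
      fix i
      show "v (poly.coeff (f - Y * u) i) \<le> e"
        using fr(2)[of i] unif(3)[of "poly.coeff f i"] e01
        by (auto simp: Y_def coeff_monom_mult u_def coeff_poly_shift e_def not_less)
    qed
    moreover have "degree u \<le> n - r"
      by (intro degree_le) (auto simp: u_def n_def coeff_poly_shift intro: coeff_eq_0)
    ultimately have "Q 0 (Y, u)" using e01 r by (auto simp: Q_def cbound_def)
    then show "\<exists>x. Q 0 x" by blast
  next
    fix x k assume "Q k x"
    then obtain g h where x: "x = (g, h)" and Q: "Q k (g, h)" by (cases x) auto
    have "\<exists>g' h'. cbound e (g' - Polynomial.monom 1 r) \<and> cbound e (h' - u) \<and> cbound (e ^ Suc (Suc k)) (f - g' * h')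
     \<and> degree (g' - Polynomial.monom 1 r) < r \<and> degree h' \<le> n - r \<and> cbound (e ^ Suc k) (g' - g) \<and> cbound (e ^ Suc k) (h' - h)"
      by (rule hensel_step) (use f r fr Q in \<open>auto simp: Q_def n_def u_def e_def Y_def\<close>)
    then show "\<exists>y. Q (Suc k) y \<and> S k x y" by (auto simp: Q_def S_def x Y_def)
  qed
  then obtain s where s: "\<And>k. Q k (s k)" "\<And>k. S k (s k) (s (Suc k))" by blast
  define G H where "G = (\<lambda>k. fst (s k))" and "H = (\<lambda>k. snd (s k))"
  have GH: "cbound (e ^ Suc k) (f - G k * H k)" "degree (G k - Y) < r" "degree (H k) \<le> n - r"
      "cbound (e ^ Suc k) (G (Suc k) - G k)" "cbound (e ^ Suc k) (H (Suc k) - H k)"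
      "cbound e (G k - Y)" "cbound e (H k - u)" for k
    using s(1)[of k] s(2)[of k] by (auto simp: Q_def S_def G_def H_def case_prod_beta)
  have le: "e ^ Suc k \<le> e ^ k" for k using e01 by (simp add: mult_left_le_one_le)
  have Xr: "poly.coeff (G k) i = 0" if "i > r" for k i
    using coeff_eq_0[of "G k - Y" i] GH(2)[of k] that by (simp add: Y_def)
  have "\<exists>q. degree q \<le> r \<and> (\<forall>k. cbound (e ^ k) (G k - q))"
    using GH(4) cbound_mono[OF _ le] e01 Xr by (intro poly_convergent) auto
  then obtain g where g: "degree g \<le> r" "\<And>k. cbound (e ^ k) (G k - g)" by blast
  have Hn: "poly.coeff (H k) i = 0" if "i > n - r" for k i
    using GH(3)[of k] that by (intro coeff_eq_0) simp
  have "\<exists>q. degree q \<le> n - r \<and> (\<forall>k. cbound (e ^ k) (H k - q))"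
    using GH(5) cbound_mono[OF _ le] e01 Hn by (intro poly_convergent) auto
  then obtain h where h: "\<And>k. cbound (e ^ k) (H k - h)" by blast
  have G1: "cbound 1 (G k)" for k
  proof -
    have "cbound 1 Y" by (auto simp: Y_def cbound_def)
    then show ?thesis using cbound_add[OF cbound_mono[OF GH(6)[of k]], of 1 Y] e01 by simp
  qed
  have "cbound 1 h"
  proof -
    have "cbound 1 u" using f by (auto simp: u_def cbound_def coeff_poly_shift)
    then have "cbound 1 (H 0)" using cbound_add[OF cbound_mono[OF GH(7)[of 0]], of 1 u] e01 by simp
    from cbound_diff[OF this h[of 0, simplified]] show ?thesis by simp
  qed
  have "cbound (e ^ k) (f - g * h)" for k
  proof -
    have "f - g * h = (f - G k * H k) + G k * (H k - h) + (G k - g) * h" by (simp add: algebra_simps)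
    moreover have "cbound (e ^ k) (G k * (H k - h))"
      using cbound_mult[OF G1[of k] h[of k]] e01 by simp
    moreover have "cbound (e ^ k) ((G k - g) * h)"
      using cbound_mult[OF g(2)[of k] \<open>cbound 1 h\<close>] e01 by simp
    ultimately show ?thesis using cbound_mono[OF GH(1) le] by (metis cbound_add)
  qed
  then have "f - g * h = 0" using e01 by (rule cbound_all_imp_zero)
  moreover have "poly.coeff g r = 1"
  proof -
    have 0: "poly.coeff (G k) r = 1" for k
      using coeff_eq_0[of "G k - Y" r] GH(2)[of k] by (simp add: Y_def)
    have "v (1 - poly.coeff g r) \<le> e ^ k" for k
      using g(2)[of k] 0 by (metis cbound_def coeff_diff)
    then have "\<not> 0 < v (1 - poly.coeff g r)"
      using real_arch_pow_inv[of "v (1 - poly.coeff g r)" e] e01 by (auto simp flip: not_less)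
    then have "v (1 - poly.coeff g r) = 0" using v_nonneg[of "1 - poly.coeff g r"] by linarith
    then show ?thesis by simp
  qed
  then have "degree g = r" using g(1) by (simp add: le_antisym le_degree)
  ultimately show ?thesis by auto
qed

end

section \<open>The algebraic closure and its automorphisms\<close>

definition aeval :: "'l::field poly \<Rightarrow> 'l alg_closure \<Rightarrow> 'l alg_closure" where
  "aeval f x = poly (map_poly to_ac f) x"

lemma aeval_add [simp]: "aeval (f + g) x = aeval f x + aeval g x"
proof -
  have "map_poly to_ac (f + g) = map_poly to_ac f + map_poly to_ac g"
    by (rule poly_eqI) (simp add: coeff_map_poly)
  then show ?thesis by (simp add: aeval_def)
qed

lemma aeval_mult [simp]: "aeval (f * g) x = aeval f x * aeval g x"
proof -
  have "map_poly to_ac (f * g) = map_poly to_ac f * map_poly to_ac g"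
    by (rule poly_eqI) (simp add: coeff_map_poly coeff_mult to_ac_sum)
  then show ?thesis by (simp add: aeval_def)
qed

lemma aeval_pCons [simp]: "aeval (pCons c f) x = to_ac c + x * aeval f x"
  by (simp add: aeval_def map_poly_pCons)

lemma aeval_0 [simp]: "aeval 0 x = 0" and aeval_1 [simp]: "aeval 1 x = 1"
  by (simp_all add: aeval_def)

lemma aeval_smult [simp]: "aeval (smult c f) x = to_ac c * aeval f x"
  using aeval_mult[of "[:c:]" f x] by simp

lemma aeval_minus [simp]: "aeval (- f) x = - aeval f x"
  using aeval_smult[of "-1" f x] by simp

lemma aeval_diff [simp]: "aeval (f - g) x = aeval f x - aeval g x"
  using aeval_add[of f "- g" x] by simp

lemma aeval_monom [simp]: "aeval (Polynomial.monom c n) x = to_ac c * x ^ n"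
  by (simp add: aeval_def map_poly_monom poly_monom)

lemma aeval_altdef: "aeval f x = (\<Sum>i\<le>degree f. to_ac (poly.coeff f i) * x ^ i)"
  by (simp add: aeval_def poly_altdef degree_map_poly coeff_map_poly)

definition min_poly :: "'l::field alg_closure \<Rightarrow> 'l poly" where
  "min_poly x = (SOME f. Polynomial.lead_coeff f = 1 \<and> aeval f x = 0 \<and>
     (\<forall>g. g \<noteq> 0 \<longrightarrow> aeval g x = 0 \<longrightarrow> degree f \<le> degree g))"

lemma min_poly:
  shows lead_coeff_min_poly: "Polynomial.lead_coeff (min_poly x) = 1"
    and aeval_min_poly [simp]: "aeval (min_poly x) x = 0"
    and min_poly_minimal: "g \<noteq> 0 \<Longrightarrow> aeval g x = 0 \<Longrightarrow> degree (min_poly x) \<le> degree g"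
proof -
  obtain p where "p \<noteq> 0" "aeval p x = 0"
    using alg_closure_algebraic unfolding aeval_def by blast
  then obtain f where f: "f \<noteq> 0" "aeval f x = 0" and min: "\<And>g. g \<noteq> 0 \<Longrightarrow> aeval g x = 0 \<Longrightarrow> degree f \<le> degree g"
    using ex_has_least_nat[of "\<lambda>f. f \<noteq> 0 \<and> aeval f x = 0" p degree] by blast
  have "\<exists>f. Polynomial.lead_coeff f = 1 \<and> aeval f x = 0 \<and>
     (\<forall>g. g \<noteq> 0 \<longrightarrow> aeval g x = 0 \<longrightarrow> degree f \<le> degree g)"
    using f min by (intro exI[of _ "smult (inverse (Polynomial.lead_coeff f)) f"]) auto
  from someI_ex[OF this, folded min_poly_def]
  show "Polynomial.lead_coeff (min_poly x) = 1" "aeval (min_poly x) x = 0"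
    "g \<noteq> 0 \<Longrightarrow> aeval g x = 0 \<Longrightarrow> degree (min_poly x) \<le> degree g" by auto
qed

lemma min_poly_nonzero [simp]: "min_poly x \<noteq> 0"
  using lead_coeff_min_poly[of x] by auto

lemma min_poly_degree_less: "aeval g x = 0 \<Longrightarrow> degree g < degree (min_poly x) \<Longrightarrow> g = 0"
  using min_poly_minimal[of g x] by linarith

lemma degree_min_poly_pos: "degree (min_poly x) > 0"
proof (rule ccontr)
  assume "\<not> degree (min_poly x) > 0"
  then obtain c where "min_poly x = [:c:]" by (metis degree_eq_zeroE gr0I)
  then show False using lead_coeff_min_poly[of x] aeval_min_poly[of x] by simp
qed

text \<open>The constant term of the minimal polynomial is non-zero by minimality, so the equation
  can be solved for it. Hence every subalgebra of the closure over the base field is a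
  field.\<close>

lemma inverse_eq_aeval: assumes "a \<noteq> 0" shows "\<exists>g. aeval g a = inverse a"
proof -
  obtain c f where cf: "min_poly a = pCons c f" by (cases "min_poly a")
  have eq: "to_ac c + a * aeval f a = 0" using aeval_min_poly[of a] by (simp add: cf)
  have "c \<noteq> 0"
  proof
    assume "c = 0"
    then have "aeval f a = 0" using eq assms by simp
    moreover have "f \<noteq> 0" using cf \<open>c = 0\<close> min_poly_nonzero[of a] by auto
    ultimately show False using min_poly_minimal[of f a] cf by simp
  qed
  have "a * aeval f a = - to_ac c" using eq by (simp add: eq_neg_iff_add_eq_0 add.commute)
  then have "(a * aeval f a) * (- inverse (to_ac c)) = 1" using \<open>c \<noteq> 0\<close> by simp
  then have "a * aeval (smult (- inverse c) f) a = 1" by (simp add: mult_ac)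
  then show ?thesis using assms by (intro exI[of _ "smult (- inverse c) f"]) (metis inverse_unique)
qed

subsection \<open>Extending embeddings\<close>

text \<open>The graph of an embedding, over the base field, of a subalgebra of the closure; trivial
  kernel of the inverse relation is not demanded, only single-valuedness at \<open>0\<close>. As a
  set of pairs it is ordered by inclusion, as Zorn's lemma wants it.\<close>

definition alg_graph :: "('l::field alg_closure \<times> 'l alg_closure) set \<Rightarrow> bool" where
  "alg_graph \<Gamma> \<longleftrightarrow> (\<forall>c. (to_ac c, to_ac c) \<in> \<Gamma>) \<and>
     (\<forall>a b c d. (a, b) \<in> \<Gamma> \<longrightarrow> (c, d) \<in> \<Gamma> \<longrightarrow> (a + c, b + d) \<in> \<Gamma> \<and> (a * c, b * d) \<in> \<Gamma>) \<and>
     (\<forall>b. (0, b) \<in> \<Gamma> \<longrightarrow> b = 0)"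

context
  fixes \<Gamma> :: "('l::field alg_closure \<times> 'l alg_closure) set"
  assumes G: "alg_graph \<Gamma>"
begin

lemma graph_const: "(to_ac k, to_ac k) \<in> \<Gamma>"
  and graph_add: "(a, b) \<in> \<Gamma> \<Longrightarrow> (c, d) \<in> \<Gamma> \<Longrightarrow> (a + c, b + d) \<in> \<Gamma>"
  and graph_mult: "(a, b) \<in> \<Gamma> \<Longrightarrow> (c, d) \<in> \<Gamma> \<Longrightarrow> (a * c, b * d) \<in> \<Gamma>"
  and graph_zero: "(0, b) \<in> \<Gamma> \<Longrightarrow> b = 0"
proof -
  note * = G[unfolded alg_graph_def]
  show "(to_ac k, to_ac k) \<in> \<Gamma>" using *[THEN conjunct1] by (rule spec)
  show "(a, b) \<in> \<Gamma> \<Longrightarrow> (c, d) \<in> \<Gamma> \<Longrightarrow> (a + c, b + d) \<in> \<Gamma>"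
    "(a, b) \<in> \<Gamma> \<Longrightarrow> (c, d) \<in> \<Gamma> \<Longrightarrow> (a * c, b * d) \<in> \<Gamma>"
    using *[THEN conjunct2, THEN conjunct1] by simp_all
  show "(0, b) \<in> \<Gamma> \<Longrightarrow> b = 0" using *[THEN conjunct2, THEN conjunct2] by (simp only:)
qed

lemma graph_minus: "(a, b) \<in> \<Gamma> \<Longrightarrow> (- a, - b) \<in> \<Gamma>"
  using graph_mult[OF graph_const[of "-1"], of a b] by simp

lemma graph_diff: "(a, b) \<in> \<Gamma> \<Longrightarrow> (c, d) \<in> \<Gamma> \<Longrightarrow> (a - c, b - d) \<in> \<Gamma>"
  using graph_add[OF _ graph_minus, of a b c d] by simp

lemma graph_unique: "(a, b) \<in> \<Gamma> \<Longrightarrow> (a, c) \<in> \<Gamma> \<Longrightarrow> b = c"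
  using graph_zero[of "b - c"] graph_diff[of a b a c] by simp

lemma graph_sum: "(\<And>i. i \<in> I \<Longrightarrow> (f i, g i) \<in> \<Gamma>) \<Longrightarrow> (\<Sum>i\<in>I. f i, \<Sum>i\<in>I. g i) \<in> \<Gamma>"
  using graph_const[of 0] by (induction I rule: infinite_finite_induct) (auto intro: graph_add)

lemma graph_aeval: "(a, b) \<in> \<Gamma> \<Longrightarrow> (aeval f a, aeval f b) \<in> \<Gamma>"
  using graph_const[of 0] by (induction f) (auto intro: graph_add graph_mult graph_const)

lemma graph_inverse: assumes "(a, b) \<in> \<Gamma>" "a \<noteq> 0" shows "(inverse a, inverse b) \<in> \<Gamma>"
proof -
  obtain g where g: "aeval g a = inverse a" using inverse_eq_aeval assms(2) by blast
  have ab: "(aeval g a, aeval g b) \<in> \<Gamma>" using assms graph_aeval by blast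
  from graph_mult[OF assms(1) this] have "(1, b * aeval g b) \<in> \<Gamma>" using g assms by simp
  with graph_const[of 1] have "b * aeval g b = 1" using graph_unique[of 1 "b * aeval g b" 1] by simp
  then have "aeval g b = inverse b" by (metis inverse_unique)
  with ab g show ?thesis by simp
qed

definition graph_poly :: "'l alg_closure poly \<Rightarrow> 'l alg_closure poly \<Rightarrow> bool" where
  "graph_poly g h \<longleftrightarrow> (\<forall>i. (poly.coeff g i, poly.coeff h i) \<in> \<Gamma>)"

lemma graph_poly_intros:
  "graph_poly f g \<Longrightarrow> graph_poly f' g' \<Longrightarrow> graph_poly (f + f') (g + g')"
  "graph_poly f g \<Longrightarrow> graph_poly f' g' \<Longrightarrow> graph_poly (f - f') (g - g')"
  "graph_poly f g \<Longrightarrow> graph_poly f' g' \<Longrightarrow> graph_poly (f * f') (g * g')"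
  "(a, b) \<in> \<Gamma> \<Longrightarrow> graph_poly (Polynomial.monom a n) (Polynomial.monom b n)"
  "(a, b) \<in> \<Gamma> \<Longrightarrow> graph_poly [:a:] [:b:]"
  "(a, b) \<in> \<Gamma> \<Longrightarrow> graph_poly f g \<Longrightarrow> graph_poly (smult a f) (smult b g)"
  using graph_const[of 0]
  by (auto simp: graph_poly_def coeff_mult coeff_pCons split: nat.split
      intro: graph_add graph_diff graph_mult graph_sum)

text \<open>Adjunction of one element: \<open>p\<close> is the minimal polynomial of
  \<open>x\<close> over the domain, \<open>q\<close> its image under the partial embedding and
  \<open>y\<close> a root of \<open>q\<close>. Polynomials in \<open>x\<close> are sent to the
  corresponding polynomials in \<open>y\<close>.\<close>

lemma extend_graph: "\<exists>\<Gamma>' y. alg_graph \<Gamma>' \<and> \<Gamma> \<subseteq> \<Gamma>' \<and> (x, y) \<in> \<Gamma>'"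
proof -
  define Q where "Q = (\<lambda>n. \<exists>p q. graph_poly p q \<and> p \<noteq> 0 \<and> poly p x = 0 \<and> degree p = n)"
  have "Q (degree (map_poly to_ac (min_poly x)))"
    unfolding Q_def graph_poly_def using graph_const aeval_min_poly[of x] min_poly_nonzero[of x]
    by (intro exI[of _ "map_poly to_ac (min_poly x)"])
      (auto simp: aeval_def coeff_map_poly poly_eq_iff)
  then have QL: "Q (LEAST n. Q n)" by (rule LeastI)
  define n where "n = (LEAST n. Q n)"
  obtain p0 q0 where p0: "graph_poly p0 q0" "p0 \<noteq> 0" "poly p0 x = 0" "degree p0 = n"
    using QL unfolding Q_def n_def by auto
  have min: "p = 0" if "graph_poly p q" "poly p x = 0" "degree p < n" for p q
    using that not_less_Least[of "degree p" Q] unfolding n_def Q_def by blast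
  define a b where "a = poly.coeff p0 n" and "b = poly.coeff q0 n"
  have ab: "(a, b) \<in> \<Gamma>" "a \<noteq> 0" using p0 by (auto simp: graph_poly_def a_def b_def)
  define p q where "p = smult (inverse a) p0" and "q = smult (inverse b) q0"
  have "b \<noteq> 0"
    using graph_mult[OF ab(1) graph_inverse[OF ab]] graph_unique[of 1 0 1] graph_const[of 1] ab(2) by auto
  then have q1: "poly.coeff q n = 1" by (simp add: q_def b_def)
  have p1: "degree p = n" "poly.coeff p n = 1" "poly p x = 0"
    using ab p0 by (auto simp: p_def a_def)
  have pq: "graph_poly p q" unfolding p_def q_def
    by (rule graph_poly_intros(6)[OF graph_inverse[OF ab] p0(1)])
  have degq: "degree q = n"
  proof (rule antisym)
    show "degree q \<le> n"
    proof (rule degree_le, intro allI impI)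
      fix i assume "n < i"
      then have "(0, poly.coeff q i) \<in> \<Gamma>" using pq p1(1) by (metis graph_poly_def coeff_eq_0)
      then show "poly.coeff q i = 0" by (rule graph_zero)
    qed
    show "n \<le> degree q" using q1 by (intro le_degree) simp
  qed
  have "n > 0"
  proof (rule ccontr)
    assume "\<not> n > 0"
    then have "p = [:1:]" using p1 by (metis degree_eq_zeroE gr0I coeff_pCons_0)
    then show False using p1 by simp
  qed
  then obtain y where y: "poly q y = 0" using alg_closed_imp_poly_has_root[of q] degq by auto
  \<comment> \<open>Well-definedness by long division: a multiple of \<open>p\<close> subtracted
    from \<open>g\<close> is mirrored by the corresponding multiple of \<open>q\<close> subtracted
    from \<open>h\<close>, and the degree of \<open>g\<close> drops until minimality of
    \<open>p\<close> applies.\<close>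
  have key: "poly h y = 0" if "graph_poly g h" "poly g x = 0" for g h
    using that
  proof (induction "degree g" arbitrary: g h rule: less_induct)
    case less
    show ?case
    proof (cases "degree g < n")
      case True
      then have "g = 0" using min less.prems by blast
      then have "poly.coeff h i = 0" for i
        using less.prems(1) graph_zero[of "poly.coeff h i"] by (metis graph_poly_def coeff_0)
      then have "h = 0" by (intro poly_eqI) simp
      then show ?thesis by simp
    next
      case False
      define k where "k = degree g - n"
      define c d where "c = poly.coeff g (degree g)" and "d = poly.coeff h (degree g)"
      have cd: "(c, d) \<in> \<Gamma>" using less.prems by (auto simp: c_def d_def graph_poly_def)
      define g' h' where "g' = g - Polynomial.monom c k * p" and "h' = h - Polynomial.monom d k * q"
      have g'h': "graph_poly g' h'"
        unfolding g'_def h'_def by (intro graph_poly_intros less.prems(1) cd pq)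
      have kn: "degree g = k + n" using False by (simp add: k_def)
      have lt: "poly.coeff g' i = 0" if "i \<ge> degree g" for i
      proof (cases "i = degree g")
        case True
        then show ?thesis using kn p1(2) by (simp add: g'_def coeff_monom_mult c_def)
      next
        case F: False
        then show ?thesis using that kn p1(1)
          by (auto simp: g'_def coeff_monom_mult coeff_eq_0)
      qed
      have r: "poly g' x = 0" using less.prems p1 by (simp add: g'_def)
      have "poly h' y = 0"
      proof (cases "g' = 0")
        case True
        then have "poly.coeff h' i = 0" for i
          using g'h' graph_zero[of "poly.coeff h' i"] by (metis graph_poly_def coeff_0)
        then have "h' = 0" by (intro poly_eqI) simp
        then show ?thesis by simp
      next
        case F: False
        then have "degree g' < degree g" using lt by (metis leading_coeff_0_iff not_less)
        then show ?thesis using less.hyps[OF _ g'h' r] by simp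
      qed
      then show ?thesis using y by (simp add: h'_def)
    qed
  qed
  define \<Gamma>' where "\<Gamma>' = {(poly g x, poly h y) | g h. graph_poly g h}"
  have "alg_graph \<Gamma>'"
    unfolding alg_graph_def
  proof (intro conjI allI impI)
    fix c
    show "(to_ac c, to_ac c) \<in> \<Gamma>'"
      unfolding \<Gamma>'_def using graph_poly_intros(5)[OF graph_const[of c]]
      by (intro CollectI exI[of _ "[:to_ac c:]"]) auto
  next
    fix a b c d assume "(a, b) \<in> \<Gamma>'" "(c, d) \<in> \<Gamma>'"
    then obtain g h g' h' where *: "a = poly g x" "b = poly h y" "c = poly g' x" "d = poly h' y"
      "graph_poly g h" "graph_poly g' h'" by (auto simp: \<Gamma>'_def)
    show "(a + c, b + d) \<in> \<Gamma>'"
      unfolding \<Gamma>'_def by (intro CollectI exI[of _ "g + g'"] exI[of _ "h + h'"])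
        (auto simp: * intro: graph_poly_intros *)
    show "(a * c, b * d) \<in> \<Gamma>'"
      unfolding \<Gamma>'_def by (intro CollectI exI[of _ "g * g'"] exI[of _ "h * h'"])
        (auto simp: * intro: graph_poly_intros *)
  next
    fix b assume "(0, b) \<in> \<Gamma>'"
    then show "b = 0" using key unfolding \<Gamma>'_def by force
  qed
  moreover have "\<Gamma> \<subseteq> \<Gamma>'"
  proof clarify
    fix a b assume "(a, b) \<in> \<Gamma>"
    then show "(a, b) \<in> \<Gamma>'"
      unfolding \<Gamma>'_def by (intro CollectI exI[of _ "[:a:]"] exI[of _ "[:b:]"]) (auto intro: graph_poly_intros)
  qed
  moreover have "(x, y) \<in> \<Gamma>'"
    unfolding \<Gamma>'_def using graph_poly_intros(4)[OF graph_const[of 1], of 1]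
    by (intro CollectI exI[of _ "Polynomial.monom 1 1"]) (auto simp: poly_monom)
  ultimately show ?thesis by blast
qed

end

text \<open>Unions of chains are again graphs, since two pairs always lie in a common member; a
  maximal graph is total because otherwise one more element could be adjoined.\<close>

lemma alg_graph_total_extension:
  assumes "alg_graph \<Gamma>0"
  shows "\<exists>\<Gamma>. alg_graph \<Gamma> \<and> \<Gamma>0 \<subseteq> \<Gamma> \<and> (\<forall>x. \<exists>y. (x, y) \<in> \<Gamma>)"
proof -
  let ?A = "{\<Gamma>. alg_graph \<Gamma> \<and> \<Gamma>0 \<subseteq> \<Gamma>}"
  have "\<exists>M\<in>?A. \<forall>\<Gamma>\<in>?A. M \<subseteq> \<Gamma> \<longrightarrow> \<Gamma> = M"
  proof (rule subset_Zorn_nonempty)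
    show "?A \<noteq> {}" using assms by blast
  next
    fix \<C> assume C: "\<C> \<noteq> {}" "subset.chain ?A \<C>"
    have sub: "\<C> \<subseteq> ?A" using C by (simp add: subset.chain_def)
    have two: "\<exists>\<Gamma>\<in>\<C>. p \<in> \<Gamma> \<and> q \<in> \<Gamma>" if pq: "p \<in> \<Union>\<C>" "q \<in> \<Union>\<C>" for p q
    proof -
      obtain A B where AB: "A \<in> \<C>" "B \<in> \<C>" "p \<in> A" "q \<in> B" using pq by blast
      then have "A \<subseteq> B \<or> B \<subseteq> A" using C(2) unfolding subset_chain_def by blast
      then show ?thesis using AB by blast
    qed
    have alg: "alg_graph \<Gamma>" if "\<Gamma> \<in> \<C>" for \<Gamma> using sub that by blast
    obtain \<Gamma>1 where \<Gamma>1: "\<Gamma>1 \<in> \<C>" using C(1) by blast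
    have "alg_graph (\<Union>\<C>)"
      unfolding alg_graph_def
    proof (intro conjI allI impI)
      fix c show "(to_ac c, to_ac c) \<in> \<Union>\<C>" using graph_const[OF alg[OF \<Gamma>1]] \<Gamma>1 by blast
    next
      fix a b c d assume "(a, b) \<in> \<Union>\<C>" "(c, d) \<in> \<Union>\<C>"
      from two[OF this] obtain \<Gamma> where \<Gamma>: "\<Gamma> \<in> \<C>" "(a, b) \<in> \<Gamma>" "(c, d) \<in> \<Gamma>" by blast
      show "(a + c, b + d) \<in> \<Union>\<C>" "(a * c, b * d) \<in> \<Union>\<C>"
        using graph_add[OF alg[OF \<Gamma>(1)] \<Gamma>(2,3)] graph_mult[OF alg[OF \<Gamma>(1)] \<Gamma>(2,3)] \<Gamma>(1) by blast+
    next
      fix b assume "(0, b) \<in> \<Union>\<C>"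
      then show "b = 0" using alg graph_zero by (metis Union_iff)
    qed
    then show "\<Union>\<C> \<in> ?A" using C(1) sub by blast
  qed
  then obtain M where M: "alg_graph M" "\<Gamma>0 \<subseteq> M" "\<And>\<Gamma>. alg_graph \<Gamma> \<Longrightarrow> \<Gamma>0 \<subseteq> \<Gamma> \<Longrightarrow> M \<subseteq> \<Gamma> \<Longrightarrow> \<Gamma> = M"
    by auto
  have "\<exists>y. (x, y) \<in> M" for x
  proof -
    obtain \<Gamma>' y where *: "alg_graph \<Gamma>'" "M \<subseteq> \<Gamma>'" "(x, y) \<in> \<Gamma>'"
      using extend_graph[OF M(1), of x] by (elim exE conjE)
    then show ?thesis using M(2) M(3)[of \<Gamma>'] by auto
  qed
  with M show ?thesis by (intro exI[of _ M]) simp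
qed

subsection \<open>The Galois group\<close>

abbreviation "Gal \<equiv> carrier galois_group"

lemma galois_iff: "\<sigma> \<in> Gal \<longleftrightarrow> bij \<sigma> \<and> (\<forall>x y. \<sigma> (x + y) = \<sigma> x + \<sigma> y) \<and> (\<forall>x y. \<sigma> (x * y) = \<sigma> x * \<sigma> y) \<and>
   (\<forall>c. \<sigma> (to_ac c) = to_ac c)"
proof -
  have "\<sigma> 1 = 1" if "\<forall>c. \<sigma> (to_ac c) = to_ac c" using that[rule_format, of 1] by simp
  then show ?thesis
    by (auto simp: galois_group_def ring_iso_def ring_hom_def ring_of_type_algebra_def)
qed

context
  fixes \<sigma> :: "'l::field alg_closure \<Rightarrow> 'l alg_closure"
  assumes s: "\<sigma> \<in> Gal"
begin

lemma gal_bij: "bij \<sigma>" and gal_add: "\<sigma> (x + y) = \<sigma> x + \<sigma> y" and gal_mult: "\<sigma> (x * y) = \<sigma> x * \<sigma> y"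
  and gal_to_ac: "\<sigma> (to_ac c) = to_ac c"
  using s unfolding galois_iff by auto

lemma gal_0: "\<sigma> 0 = 0" and gal_1: "\<sigma> 1 = 1"
  using gal_to_ac[of 0] gal_to_ac[of 1] by auto

lemma gal_minus: "\<sigma> (- x) = - \<sigma> x"
  using gal_add[of x "- x"] gal_0 by (simp add: eq_neg_iff_add_eq_0 add.commute)

lemma gal_diff: "\<sigma> (x - y) = \<sigma> x - \<sigma> y"
  using gal_add[of x "- y"] gal_minus by simp

lemma gal_power: "\<sigma> (x ^ n) = \<sigma> x ^ n"
  by (induction n) (auto simp: gal_1 gal_mult)

lemma gal_aeval: "\<sigma> (aeval f x) = aeval f (\<sigma> x)"
  by (induction f) (auto simp: gal_0 gal_add gal_mult gal_to_ac)

lemma gal_eq_iff: "\<sigma> x = \<sigma> y \<longleftrightarrow> x = y"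
  using gal_bij by (meson bij_is_inj injD)

lemma gal_eq_0_iff: "\<sigma> x = 0 \<longleftrightarrow> x = 0"
  using gal_eq_iff[of x 0] gal_0 by simp

lemma gal_inverse: "\<sigma> (inverse x) = inverse (\<sigma> x)"
  by (cases "x = 0") (auto simp: gal_0 gal_1 gal_mult[symmetric] intro: inverse_unique[symmetric])

end

lemma finite_aeval_roots: "f \<noteq> 0 \<Longrightarrow> finite {x. aeval f x = 0}"
  unfolding aeval_def by (rule poly_roots_finite) (auto simp: poly_eq_iff coeff_map_poly)

text \<open>Surjectivity is automatic: an injective endomorphism maps the finite root set of each
  minimal polynomial into itself, hence onto itself.\<close>

lemma hom_imp_gal:
  fixes \<sigma> :: "'l::field alg_closure \<Rightarrow> 'l alg_closure"
  assumes add: "\<And>x y. \<sigma> (x + y) = \<sigma> x + \<sigma> y" and mult: "\<And>x y. \<sigma> (x * y) = \<sigma> x * \<sigma> y"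
    and const: "\<And>c. \<sigma> (to_ac c) = to_ac c"
  shows "\<sigma> \<in> Gal"
proof -
  have 0: "\<sigma> 0 = 0" "\<sigma> 1 = 1" using const[of 0] const[of 1] by auto
  have inj: "inj \<sigma>"
  proof (rule injI, rule ccontr)
    fix x y assume xy: "\<sigma> x = \<sigma> y" "x \<noteq> y"
    have "\<sigma> (x - y) + \<sigma> y = \<sigma> x" by (simp flip: add)
    then have "\<sigma> (x - y) = 0" using xy by simp
    moreover have "\<sigma> (x - y) * \<sigma> (inverse (x - y)) = 1" using xy 0 by (simp flip: mult)
    ultimately show False by simp
  qed
  have ae: "\<sigma> (aeval f x) = aeval f (\<sigma> x)" for f x
    by (induction f) (auto simp: 0 add mult const)
  have "y \<in> range \<sigma>" for y
  proof -
    let ?R = "{x. aeval (min_poly y) x = 0}"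
    have "finite ?R" by (intro finite_aeval_roots) simp
    moreover have "\<sigma> ` ?R \<subseteq> ?R"
      using ae[of "min_poly y", symmetric] 0 by auto
    ultimately have "\<sigma> ` ?R = ?R"
      using inj by (intro endo_inj_surj) (auto intro: inj_on_subset)
    then show ?thesis using aeval_min_poly[of y] by blast
  qed
  then have "bij \<sigma>" using inj by (auto simp: bij_def)
  then show ?thesis using add mult const by (simp add: galois_iff)
qed

theorem extend_to_galois:
  assumes "alg_graph \<Gamma>"
  shows "\<exists>\<sigma>\<in>Gal. \<forall>(x, y)\<in>\<Gamma>. \<sigma> x = y"
proof -
  obtain M where M: "alg_graph M" "\<Gamma> \<subseteq> M" "\<forall>x. \<exists>y. (x, y) \<in> M"
    using alg_graph_total_extension[OF assms] by blast
  then obtain \<sigma> where \<sigma>: "\<And>x. (x, \<sigma> x) \<in> M" by metis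
  have *: "\<sigma> x = y" if "(x, y) \<in> M" for x y
    using graph_unique[OF M(1) \<sigma> that] .
  have "\<sigma> \<in> Gal"
    by (rule hom_imp_gal) (auto intro!: * graph_add[OF M(1)] graph_mult[OF M(1)] graph_const[OF M(1)] \<sigma>)
  then show ?thesis using * M(2) by blast
qed

text \<open>A polynomial vanishing at \<open>x\<close> is a multiple of the minimal polynomial and
  so vanishes at \<open>y\<close>; evaluation at \<open>x\<close> and \<open>y\<close> therefore
  defines a partial embedding, which extends.\<close>

lemma conjugate_if_root:
  assumes "aeval (min_poly x) y = 0"
  shows "\<exists>\<sigma>\<in>Gal. \<sigma> x = y"
proof -
  let ?G = "{(aeval f x, aeval f y) | f. True}"
  have "aeval f y = 0" if "aeval f x = 0" for f
  proof -
    have "aeval (f mod min_poly x) x = 0"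
      using that by (simp add: minus_mult_div_eq_mod[symmetric])
    then have "f mod min_poly x = 0"
      using min_poly_degree_less[of "f mod min_poly x" x] degree_mod_less[of "min_poly x" f] by auto
    then have "f = min_poly x * (f div min_poly x)" by (metis mult_div_mod_eq add.right_neutral)
    then show ?thesis by (metis aeval_mult assms mult_zero_left)
  qed
  then have "alg_graph ?G"
    unfolding alg_graph_def
  proof (intro conjI allI impI, goal_cases)
    case (1 c)
    show ?case by (auto intro!: exI[of _ "[:c:]"])
  next
    case (2 a b c d)
    then show ?case by (auto simp flip: aeval_add)
  next
    case (3 a b c d)
    then show ?case by (auto simp flip: aeval_mult)
  qed force
  from extend_to_galois[OF this] obtain \<sigma> where \<sigma>: "\<sigma> \<in> Gal" "\<forall>(a, b)\<in>?G. \<sigma> a = b" by (elim bexE)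
  have "(x, y) = (aeval [:0, 1:] x, aeval [:0, 1:] y)" by simp
  then have "(x, y) \<in> ?G" by blast
  from bspec[OF \<sigma>(2) this] have "\<sigma> x = y" by simp
  with \<sigma>(1) show ?thesis by (intro bexI[of _ \<sigma>])
qed

lemma finite_galois_orbit: "finite {\<sigma> x | \<sigma>. \<sigma> \<in> Gal}"
proof (rule finite_subset)
  show "{\<sigma> x | \<sigma>. \<sigma> \<in> Gal} \<subseteq> {y. aeval (min_poly x) y = 0}"
    by (auto simp: gal_aeval[symmetric] gal_0)
qed (intro finite_aeval_roots, simp)

lemma galois_group_sel [simp]: "\<sigma> \<otimes>\<^bsub>galois_group\<^esub> \<tau> = \<sigma> \<circ> \<tau>" "\<one>\<^bsub>galois_group\<^esub> = id"
  by (simp_all add: galois_group_def)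

lemma gal_comp: "\<sigma> \<in> Gal \<Longrightarrow> \<tau> \<in> Gal \<Longrightarrow> \<sigma> \<circ> \<tau> \<in> Gal"
  by (auto simp: galois_iff bij_comp)

lemma gal_id: "id \<in> Gal" by (simp add: galois_iff)

lemma gal_inv: assumes "\<sigma> \<in> Gal" shows "inv' \<sigma> \<in> Gal"
proof -
  note b = gal_bij[OF assms]
  have i: "\<sigma> (inv' \<sigma> x) = x" "inv' \<sigma> (\<sigma> x) = x" for x
    using b by (simp_all add: bij_is_surj surj_f_inv_f bij_is_inj)
  show ?thesis
    unfolding galois_iff using b bij_imp_bij_inv[OF b] i
    by (metis gal_add[OF assms] gal_mult[OF assms] gal_to_ac[OF assms])
qed

lemma group_galois: "group galois_group"
proof (rule groupI)
  fix \<sigma> :: "'a alg_closure \<Rightarrow> 'a alg_closure" assume s: "\<sigma> \<in> Gal"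
  have "inv' \<sigma> \<circ> \<sigma> = id" using gal_bij[OF s] by (simp add: bij_is_inj)
  then show "\<exists>\<tau>\<in>Gal. \<tau> \<otimes>\<^bsub>galois_group\<^esub> \<sigma> = \<one>\<^bsub>galois_group\<^esub>"
    using gal_inv[OF s] by auto
qed (auto simp: gal_comp gal_id comp_assoc)

lemma galois_inv_eq: assumes "\<sigma> \<in> Gal" shows "inv\<^bsub>galois_group\<^esub> \<sigma> = inv' \<sigma>"
proof -
  interpret group galois_group by (rule group_galois)
  have "inv' \<sigma> \<circ> \<sigma> = id" using gal_bij[OF assms] by (simp add: bij_is_inj)
  then show ?thesis using inv_equality[of "inv' \<sigma>" \<sigma>] gal_inv[OF assms] assms by simp
qed

lemma gal_inv_cancel:
  assumes "\<sigma> \<in> Gal"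
  shows "\<sigma> (inv' \<sigma> x) = x" "inv' \<sigma> (\<sigma> x) = x"
  using gal_bij[OF assms] by (simp_all add: bij_is_surj surj_f_inv_f bij_is_inj)

section \<open>The valuation of the algebraic closure\<close>

lemma aeval_reflect_poly: "x \<noteq> 0 \<Longrightarrow> aeval (reflect_poly f) x = x ^ degree f * aeval f (inverse x)"
proof -
  assume "x \<noteq> 0"
  have "map_poly to_ac (reflect_poly f) = reflect_poly (map_poly to_ac f)"
    by (rule poly_eqI) (simp add: coeff_map_poly coeff_reflect_poly degree_map_poly)
  then show ?thesis
    using \<open>x \<noteq> 0\<close> by (simp add: aeval_def poly_reflect_poly_nz degree_map_poly)
qed

lemma min_poly_unique:
  assumes "Polynomial.lead_coeff f = 1" "aeval f x = 0" "degree f \<le> degree (min_poly x)"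
  shows "f = min_poly x"
proof (rule ccontr)
  assume ne: "f \<noteq> min_poly x"
  have "f \<noteq> 0" using assms(1) by auto
  then have deg: "degree f = degree (min_poly x)" using assms min_poly_minimal[of f x] by simp
  let ?d = "f - min_poly x"
  have "poly.coeff ?d (degree (min_poly x)) = 0"
    using assms(1) deg lead_coeff_min_poly[of x] by simp
  moreover have "degree ?d \<le> degree (min_poly x)" using deg by (intro degree_diff_le) auto
  moreover have "?d \<noteq> 0" using ne by simp
  ultimately have "degree ?d < degree (min_poly x)"
    by (metis leading_coeff_0_iff order_le_less)
  then show False using min_poly_degree_less[of ?d x] assms(2) ne by simp
qed

text \<open>This and the two following lemmas allow the coefficients to form an ideal instead of a
  subring.\<close>

lemma rspan_add_gen:
  assumes "\<And>x y. x \<in> J \<Longrightarrow> y \<in> J \<Longrightarrow> x + y \<in> J" "x \<in> rspan J B" "y \<in> rspan J B"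
  shows "x + y \<in> rspan J B"
proof -
  obtain c where c: "x = (\<Sum>b\<in>B. c b * b)" "\<forall>b\<in>B. c b \<in> J" using assms(2) by (auto simp: rspan_def)
  obtain d where d: "y = (\<Sum>b\<in>B. d b * b)" "\<forall>b\<in>B. d b \<in> J" using assms(3) by (auto simp: rspan_def)
  show ?thesis using c d assms(1) unfolding rspan_def
    by (intro CollectI exI[of _ "\<lambda>b. c b + d b"]) (auto simp: sum.distrib distrib_right)
qed

lemma rspan_sum_gen:
  assumes "0 \<in> J" "\<And>x y. x \<in> J \<Longrightarrow> y \<in> J \<Longrightarrow> x + y \<in> J" "\<And>i. i \<in> I \<Longrightarrow> f i \<in> rspan J B"
  shows "(\<Sum>i\<in>I. f i) \<in> rspan J B"
  using assms(3)
proof (induction I rule: infinite_finite_induct)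
  case (insert i I)
  then show ?case using rspan_add_gen[of J, OF assms(2)] by auto
qed (auto simp: rspan_def assms(1) intro!: exI[of _ "\<lambda>_. 0"])

lemma rspan_scale_gen:
  assumes "\<And>y. y \<in> R \<Longrightarrow> r * y \<in> J" "x \<in> rspan R B"
  shows "r * x \<in> rspan J B"
proof -
  obtain c where c: "x = (\<Sum>b\<in>B. c b * b)" "\<forall>b\<in>B. c b \<in> R" using assms(2) by (auto simp: rspan_def)
  then show ?thesis using assms(1) unfolding rspan_def
    by (intro CollectI exI[of _ "\<lambda>b. r * c b"]) (auto simp: sum_distrib_left mult.assoc)
qed

context local_field
begin

abbreviation "OK \<equiv> closure_integers v"
abbreviation "MK \<equiv> closure_prime v"
abbreviation "acO \<equiv> to_ac ` local_integers v"
abbreviation "acM \<equiv> to_ac ` local_prime v"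

lemma closure_integers_iff:
  "x \<in> OK \<longleftrightarrow> (\<exists>f. Polynomial.lead_coeff f = 1 \<and> cbound 1 f \<and> aeval f x = 0)"
  by (auto simp: closure_integers_def cbound_def aeval_def local_integers_def)

lemma acO_I: "v a \<le> 1 \<Longrightarrow> to_ac a \<in> acO"
  and acM_I: "v a < 1 \<Longrightarrow> to_ac a \<in> acM"
  by (auto simp: local_integers_def local_prime_def)

lemma subring_acO: "subring_set acO"
proof
  fix x y assume "x \<in> acO" "y \<in> acO"
  then obtain a b where ab: "x = to_ac a" "y = to_ac b" "v a \<le> 1" "v b \<le> 1"
    by (auto simp: local_integers_def)
  have "x + y = to_ac (a + b)" "x * y = to_ac (a * b)" using ab by auto
  then show "x + y \<in> acO" "x * y \<in> acO"
    using acO_I[OF v_add_leI[OF ab(3,4)]] acO_I[OF v_mult_le_1[OF ab(3,4)]] by simp_all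
next
  fix x assume "x \<in> acO"
  then obtain a where a: "x = to_ac a" "v a \<le> 1" by (auto simp: local_integers_def)
  then have "- x = to_ac (- a)" "v (- a) \<le> 1" by auto
  then show "- x \<in> acO" using acO_I by metis
next
  show "0 \<in> acO" by (rule image_eqI[of _ _ 0]) (auto simp: local_integers_def)
  show "1 \<in> acO" by (rule image_eqI[of _ _ 1]) (auto simp: local_integers_def)
qed

sublocale acO: subring_set acO by (rule subring_acO)

lemma acM_ideal: "x \<in> acM \<Longrightarrow> y \<in> acM \<Longrightarrow> x + y \<in> acM" "r \<in> acO \<Longrightarrow> x \<in> acM \<Longrightarrow> r * x \<in> acM"
proof -
  assume "x \<in> acM" "y \<in> acM"
  then obtain a b where ab: "x = to_ac a" "y = to_ac b" "v a < 1" "v b < 1"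
    by (auto simp: local_prime_def)
  then have "x + y = to_ac (a + b)" "v (a + b) < 1" by (auto intro: v_add_lessI)
  then show "x + y \<in> acM" using acM_I by metis
next
  assume "r \<in> acO" "x \<in> acM"
  then obtain a b where ab: "r = to_ac a" "x = to_ac b" "v a \<le> 1" "v b < 1"
    by (auto simp: local_prime_def local_integers_def)
  then have "r * x = to_ac (a * b)" "v (a * b) < 1" by (auto intro: v_mult_less_1')
  then show "r * x \<in> acM" using acM_I by metis
qed

text \<open>Either the minimal polynomial of \<open>z\<close> is integral, or \<open>1\<close> lies in the extension of the maximal
  ideal to the ring generated by \<open>z\<close>. A primitive multiple of the minimal polynomial of \<open>1/z\<close> has,
  by Hensel factorisation, its first unit coefficient at one of its two ends.\<close>

lemma integral_dichotomy:
  "cbound 1 (min_poly z) \<or> (\<exists>g. (\<forall>i. v (poly.coeff g i) < 1) \<and> aeval g z = 1)"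
proof (cases "z = 0")
  case True
  have "[:0, 1:] = min_poly z"
    using True degree_min_poly_pos[of z] by (intro min_poly_unique) auto
  then have "cbound 1 (min_poly z)"
    by (auto simp: cbound_def coeff_pCons split: nat.split simp flip: \<open>[:0, 1:] = min_poly z\<close>)
  then show ?thesis ..
next
  case z: False
  define t where "t = inverse z"
  have t: "t \<noteq> 0" "inverse t = z" using z by (auto simp: t_def)
  define p n where "p = min_poly t" and "n = degree p"
  have "finite ((\<lambda>i. v (poly.coeff p i)) ` {..n})" by simp
  obtain j where j: "j \<le> n" "\<And>i. i \<le> n \<Longrightarrow> v (poly.coeff p i) \<le> v (poly.coeff p j)"
  proof -
    have "Max ((\<lambda>i. v (poly.coeff p i)) ` {..n}) \<in> (\<lambda>i. v (poly.coeff p i)) ` {..n}"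
      by (intro Max_in) auto
    then obtain j where j: "j \<le> n" "Max ((\<lambda>i. v (poly.coeff p i)) ` {..n}) = v (poly.coeff p j)" by blast
    show ?thesis
    proof (rule that[OF j(1)])
      fix i assume "i \<le> n"
      then show "v (poly.coeff p i) \<le> v (poly.coeff p j)" unfolding j(2)[symmetric] by (intro Max_ge) auto
    qed
  qed
  have "poly.coeff p n = 1" using lead_coeff_min_poly[of t] by (simp add: p_def n_def)
  then have pj: "v (poly.coeff p j) \<ge> 1" using j(2)[of n] by simp
  then have pj0: "poly.coeff p j \<noteq> 0" using v_0 by (metis not_one_le_zero)
  \<comment> \<open>Dividing by a coefficient of largest size makes the polynomial primitive:
    integral with at least one unit coefficient.\<close>
  define F where "F = smult (inverse (poly.coeff p j)) p"
  have vF: "v (poly.coeff F i) = v (poly.coeff p i) / v (poly.coeff p j)" for i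
    by (simp add: F_def v_mult v_inverse divide_inverse mult.commute)
  have F1: "cbound 1 F"
    unfolding cbound_def vF
  proof
    fix i
    show "v (poly.coeff p i) / v (poly.coeff p j) \<le> 1"
      using j(2)[of i] pj by (cases "i \<le> n") (auto simp: n_def coeff_eq_0 divide_le_eq)
  qed
  have degF: "degree F = n" using pj0 by (simp add: F_def n_def)
  have Ft: "aeval F t = 0" by (simp add: F_def p_def)
  define r where "r = (LEAST i. v (poly.coeff F i) = 1)"
  have Fj: "v (poly.coeff F j) = 1" using pj0 by (simp add: vF)
  have r: "v (poly.coeff F r) = 1" unfolding r_def by (rule LeastI[of _ j]) (rule Fj)
  have rn: "r \<le> n" unfolding r_def using Least_le[of "\<lambda>i. v (poly.coeff F i) = 1" j] Fj j(1) by linarith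
  have less: "v (poly.coeff F i) < 1" if "i < r" for i
    using not_less_Least[OF that[unfolded r_def]] F1 by (auto simp: cbound_def less_le)
  have refl: "aeval (reflect_poly F) z = 0" using z Ft by (simp add: aeval_reflect_poly t_def)
  consider "r = 0" | "r = n" | "0 < r" "r < n" using rn by linarith
  then show ?thesis
  proof cases
    \<comment> \<open>With a unit constant term, the reversed polynomial made monic is integral, and
      by comparison of degrees it is the minimal polynomial of \<open>z\<close>.\<close>
    case 1
    then have F0: "v (poly.coeff F 0) = 1" using r by simp
    then have F00: "poly.coeff F 0 \<noteq> 0" by auto
    define H where "H = smult (inverse (poly.coeff F 0)) (reflect_poly F)"
    have "cbound 1 H" using F0 F1
      by (auto simp: H_def cbound_def v_mult v_inverse coeff_reflect_poly)
    moreover have "H = min_poly z"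
    proof (rule min_poly_unique)
      have deg: "degree (reflect_poly F) = n" using F00 degF by (simp add: degree_reflect_poly_eq)
      then have "degree H = n" using F00 by (simp add: H_def)
      then show "Polynomial.lead_coeff H = 1" using F00 degF by (simp add: H_def coeff_reflect_poly)
      show "aeval H z = 0" by (simp add: H_def refl)
      have "aeval (reflect_poly (min_poly z)) t = 0" using t by (simp add: aeval_reflect_poly)
      then have "n \<le> degree (reflect_poly (min_poly z))"
        unfolding n_def p_def by (intro min_poly_minimal) auto
      also have "\<dots> \<le> degree (min_poly z)" by (rule degree_reflect_poly_le)
      finally show "degree H \<le> degree (min_poly z)" using \<open>degree H = n\<close> by simp
    qed
    ultimately show ?thesis by simp
  next
    \<comment> \<open>Only the leading coefficient is a unit. The reversed polynomial, divided by
      it, has constant term 1 and small other coefficients, so subtracting it from 1 gives the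
      required \<open>g\<close>.\<close>
    case 2
    then have Fn: "v (poly.coeff F n) = 1" using r by simp
    then have Fn0: "poly.coeff F n \<noteq> 0" by auto
    define g where "g = 1 - smult (inverse (poly.coeff F n)) (reflect_poly F)"
    have "aeval g z = 1" by (simp add: g_def refl)
    moreover have "v (poly.coeff g i) < 1" for i
    proof (cases "i = 0")
      case True
      then show ?thesis using Fn0 degF by (simp add: g_def)
    next
      case False
      then have "poly.coeff g i = - inverse (poly.coeff F n) * (if i \<le> n then poly.coeff F (n - i) else 0)"
        by (auto simp: g_def coeff_reflect_poly degF not_le)
      moreover have "v (poly.coeff F (n - i)) < 1" if "i \<le> n" using less[of "n - i"] 2 False that by simp
      ultimately show ?thesis using Fn by (auto simp: v_mult v_inverse)
    qed
    ultimately show ?thesis by blast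
  next
    \<comment> \<open>Hensel factorisation would split the minimal polynomial of \<open>t\<close>
      into factors of smaller degree.\<close>
    case 3
    then obtain g h where gh: "F = g * h" "degree g = r"
      using hensel_factorisation[of F r] F1 degF r less by blast
    have nz: "g \<noteq> 0" "h \<noteq> 0" using gh degF 3 by auto
    then have "degree h = n - r" using gh degF by (simp add: degree_mult_eq)
    have "aeval g t * aeval h t = 0" using Ft gh by (metis aeval_mult)
    then have "aeval g t = 0 \<or> aeval h t = 0" by simp
    then have "g = 0 \<or> h = 0"
      using min_poly_degree_less[of g t] min_poly_degree_less[of h t] gh(2) \<open>degree h = n - r\<close> 3
      by (auto simp: n_def p_def)
    with nz show ?thesis by simp
  qed
qed

text \<open>This takes the place of the determinant trick. If \<open>z\<close> were not integral,
  the dichotomy would put 1 into the maximal ideal times the ring generated by \<open>z\<close>; the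
  module spanned by \<open>B\<close>, being stable under \<open>z\<close>, would equal its own
  multiple by the maximal ideal, and Nakayama's lemma makes it zero.\<close>

lemma integral_if_stable:
  assumes B: "finite B" "\<not> B \<subseteq> {0}" and z: "\<And>b. b \<in> B \<Longrightarrow> z * b \<in> rspan acO B"
  shows "cbound 1 (min_poly z)"
proof (rule ccontr)
  assume "\<not> ?thesis"
  then obtain g where g: "\<And>i. v (poly.coeff g i) < 1" "aeval g z = 1" using integral_dichotomy by blast
  have zi: "z ^ i * b \<in> rspan acO B" if b: "b \<in> B" for i b
  proof (induction i)
    case 0
    show ?case using acO.rspan_base[OF B(1) b] by simp
  next
    case (Suc i)
    then obtain c where c: "z ^ i * b = (\<Sum>b\<in>B. c b * b)" "\<forall>b\<in>B. c b \<in> acO" by (auto simp: rspan_def)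
    have "z ^ Suc i * b = z * (\<Sum>b\<in>B. c b * b)" using c(1) by (simp add: mult.assoc)
    also have "\<dots> = (\<Sum>b\<in>B. c b * (z * b))" by (simp add: sum_distrib_left mult.left_commute)
    also have "\<dots> \<in> rspan acO B"
    proof (rule acO.rspan_sum)
      fix b assume "b \<in> B"
      then show "c b * (z * b) \<in> rspan acO B" using c(2) z by (intro acO.rspan_scale[of "c b" "z * b"]) auto
    qed
    finally show ?case .
  qed
  have "B \<subseteq> rspan acM B"
  proof
    fix b assume b: "b \<in> B"
    have "b = (\<Sum>i\<le>degree g. to_ac (poly.coeff g i) * (z ^ i * b))"
      using g(2) unfolding aeval_altdef by (simp flip: mult.assoc sum_distrib_right)
    also have "\<dots> \<in> rspan acM B"
    proof (rule rspan_sum_gen)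
      show "0 \<in> acM" using acM_I[of 0] by simp
    next
      fix i
      show "to_ac (poly.coeff g i) * (z ^ i * b) \<in> rspan acM B"
      proof (rule rspan_scale_gen[OF _ zi[OF b]])
        fix y assume "y \<in> acO"
        from acM_ideal(2)[OF this acM_I[OF g(1)[of i]]] show "to_ac (poly.coeff g i) * y \<in> acM"
          by (simp add: mult.commute)
      qed
    qed (rule acM_ideal)
    finally show "b \<in> rspan acM B" .
  qed
  moreover have "j \<noteq> 1 \<and> inverse (1 - j) \<in> acO" if jM: "j \<in> acM" for j
  proof -
    obtain a where a: "j = to_ac a" "v a < 1" using jM by (auto simp: local_prime_def)
    have v1: "v (1 - a) = 1" using v_unit_add[of "- a" 1] a by simp
    have "inverse (1 - j) = to_ac (inverse (1 - a))" using a by simp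
    moreover have "v (inverse (1 - a)) \<le> 1" using v1 by (simp add: v_inverse)
    ultimately have "inverse (1 - j) \<in> acO" using acO_I by metis
    moreover have "j \<noteq> 1" using a by auto
    ultimately show ?thesis by simp
  qed
  moreover have "acM \<subseteq> acO" by (auto simp: local_prime_def local_integers_def)
  ultimately have "B \<subseteq> {0}"
    using acM_ideal B(1) by (intro nakayama[OF subring_acO, of acM B]) auto
  with B(2) show False by simp
qed

text \<open>The powers of \<open>x\<close> below the degree of a monic integral equation span a
  module stable under \<open>x\<close>. From here on integrality no longer depends on the choice of
  an equation.\<close>

lemma closure_integers_iff_min_poly: "x \<in> OK \<longleftrightarrow> cbound 1 (min_poly x)"
proof
  assume "cbound 1 (min_poly x)"
  then show "x \<in> OK" unfolding closure_integers_iff using lead_coeff_min_poly aeval_min_poly by blast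
next
  assume "x \<in> OK"
  then obtain f where f: "Polynomial.lead_coeff f = 1" "cbound 1 f" "aeval f x = 0"
    by (auto simp: closure_integers_iff)
  define B where "B = (\<lambda>i. x ^ i) ` {..<degree f}"
  have "degree f \<noteq> 0"
  proof
    assume "degree f = 0"
    then have "f = [:1:]" using f(1) by (metis degree_eq_zeroE coeff_pCons_0)
    then show False using f(3) by simp
  qed
  then have "1 \<in> B" unfolding B_def by (intro image_eqI[of _ _ 0]) auto
  moreover have "x * b \<in> rspan acO B" if b: "b \<in> B" for b
  proof -
    obtain i where i: "b = x ^ i" "i < degree f" using b by (auto simp: B_def)
    show ?thesis
    proof (cases "Suc i < degree f")
      case True
      then have "x * b \<in> B" using i by (auto simp: B_def intro!: image_eqI[of _ _ "Suc i"])
      then show ?thesis by (intro acO.rspan_base) (auto simp: B_def)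
    next
      case False
      then have eq: "Suc i = degree f" using i by simp
      have "x * b + (\<Sum>i<degree f. to_ac (poly.coeff f i) * x ^ i) = 0"
      proof -
        have "aeval f x = (\<Sum>i<degree f. to_ac (poly.coeff f i) * x ^ i) + x ^ degree f"
          using f(1) unfolding aeval_altdef by (simp add: lessThan_Suc_atMost[symmetric])
        moreover have "x * b = x ^ degree f" using i(1) by (simp add: eq[symmetric])
        ultimately show ?thesis using f(3) by (simp add: add.commute)
      qed
      then have "x * b = - (\<Sum>i<degree f. to_ac (poly.coeff f i) * x ^ i)" by (simp add: eq_neg_iff_add_eq_0)
      also have "\<dots> \<in> rspan acO B"
        using f(2) by (intro acO.rspan_minus acO.rspan_sum acO.rspan_scale acO.rspan_base acO_I)
          (auto simp: B_def cbound_def)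
      finally show ?thesis .
    qed
  qed
  ultimately show "cbound 1 (min_poly x)"
    by (intro integral_if_stable[of B]) (auto simp: B_def)
qed

lemma power_mem_rspan:
  assumes "x \<in> OK"
  shows "\<exists>n>0. x ^ n \<in> rspan acO ((\<lambda>i. x ^ i) ` {..<n})"
proof -
  let ?f = "min_poly x" let ?n = "degree (min_poly x)"
  obtain m where m: "?n = Suc m" using degree_min_poly_pos[of x] by (metis Suc_pred)
  have "x ^ ?n + (\<Sum>i<?n. to_ac (poly.coeff ?f i) * x ^ i) = 0"
    using aeval_min_poly[of x] lead_coeff_min_poly[of x]
    unfolding aeval_altdef by (simp add: m lessThan_Suc_atMost[symmetric] add_ac)
  then have "x ^ ?n = - (\<Sum>i<?n. to_ac (poly.coeff ?f i) * x ^ i)" by (simp add: eq_neg_iff_add_eq_0)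
  also have "\<dots> \<in> rspan acO ((\<lambda>i. x ^ i) ` {..<?n})"
    using assms unfolding closure_integers_iff_min_poly
    by (intro acO.rspan_minus acO.rspan_sum acO.rspan_scale acO.rspan_base acO_I)
      (auto simp: cbound_def)
  finally show ?thesis using degree_min_poly_pos by blast
qed

text \<open>The products of powers of \<open>x\<close> and \<open>y\<close> below the two exponents
  span a module stable under both, hence under their sum and product.\<close>

lemma subring_OK: "subring_set OK"
proof
  have zeroone: "to_ac c \<in> OK" if "v c \<le> 1" for c
    unfolding closure_integers_iff using that
    by (intro exI[of _ "[:-c, 1:]"]) (auto simp: cbound_def coeff_pCons split: nat.split)
  show "0 \<in> OK" "1 \<in> OK" using zeroone[of 0] zeroone[of 1] by auto
  have key: "x + y \<in> OK \<and> x * y \<in> OK" if xy: "x \<in> OK" "y \<in> OK" for x y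
  proof -
    obtain n m where n: "n > 0" "x ^ n \<in> rspan acO ((\<lambda>i. x ^ i) ` {..<n})"
      and m: "m > 0" "y ^ m \<in> rspan acO ((\<lambda>i. y ^ i) ` {..<m})"
      using power_mem_rspan[OF xy(1)] power_mem_rspan[OF xy(2)] by blast
    define B where "B = (\<lambda>(i, j). x ^ i * y ^ j) ` ({..<n} \<times> {..<m})"
    have fin: "finite B" by (simp add: B_def)
    have base: "x ^ i * y ^ j \<in> rspan acO B" if "i < n" "j < m" for i j
      using that fin by (intro acO.rspan_base) (auto simp: B_def)
    have xB: "x * b \<in> rspan acO B" if b: "b \<in> B" for b
    proof -
      obtain i j where ij: "b = x ^ i * y ^ j" "i < n" "j < m" using b by (auto simp: B_def)
      show ?thesis
      proof (cases "Suc i < n")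
        case True
        then show ?thesis using base[of "Suc i" j] ij by (simp add: mult.assoc)
      next
        case False
        then have "x * b = x ^ n * y ^ j" using ij by (metis less_antisym mult.assoc power_Suc not_less_eq)
        also have "\<dots> \<in> rspan acO B"
          using ij(3) base by (intro acO.rspan_mult[OF n(2) acO.rspan_base[of "{y ^ j}" "y ^ j"]]) auto
        finally show ?thesis .
      qed
    qed
    have yB: "y * b \<in> rspan acO B" if b: "b \<in> B" for b
    proof -
      obtain i j where ij: "b = x ^ i * y ^ j" "i < n" "j < m" using b by (auto simp: B_def)
      show ?thesis
      proof (cases "Suc j < m")
        case True
        then show ?thesis using base[of i "Suc j"] ij by (simp add: mult.left_commute)
      next
        case False
        then have "y * b = x ^ i * y ^ m" using ij by (metis less_antisym mult.left_commute power_Suc not_less_eq)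
        also have "\<dots> \<in> rspan acO B"
          using ij(2) base by (intro acO.rspan_mult[OF acO.rspan_base[of "{x ^ i}" "x ^ i"] m(2)]) auto
        finally show ?thesis .
      qed
    qed
    have xspan: "x * s \<in> rspan acO B" if "s \<in> rspan acO B" for s
      using acO.rspan_mult[OF acO.rspan_base[of "{x}" x] that, of B] xB by simp
    have B: "finite B" "\<not> B \<subseteq> {0}"
    proof -
      have "1 \<in> B" unfolding B_def using n m by (intro image_eqI[of _ _ "(0, 0)"]) auto
      then show "\<not> B \<subseteq> {0}" by auto
    qed (rule fin)
    have "(x + y) * b \<in> rspan acO B" if "b \<in> B" for b
      using acO.rspan_add[OF xB[OF that] yB[OF that]] by (simp add: distrib_right)
    moreover have "(x * y) * b \<in> rspan acO B" if "b \<in> B" for b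
      using xspan[OF yB[OF that]] by (simp add: mult.assoc)
    ultimately show ?thesis
      unfolding closure_integers_iff_min_poly using integral_if_stable[OF B] by blast
  qed
  show "x \<in> OK \<Longrightarrow> y \<in> OK \<Longrightarrow> x + y \<in> OK" "x \<in> OK \<Longrightarrow> y \<in> OK \<Longrightarrow> x * y \<in> OK" for x y
    using key by auto
  show "x \<in> OK \<Longrightarrow> - x \<in> OK" for x
    using key[of "to_ac (-1)" x] zeroone[of "-1"] by simp
qed

sublocale OK: subring_set OK by (rule subring_OK)

lemma to_ac_mem_OK_iff: "to_ac c \<in> OK \<longleftrightarrow> v c \<le> 1"
proof -
  have "[:- c, 1:] = min_poly (to_ac c)"
    using degree_min_poly_pos[of "to_ac c"] by (intro min_poly_unique) auto
  then have "to_ac c \<in> OK \<longleftrightarrow> cbound 1 [:- c, 1:]" by (simp add: closure_integers_iff_min_poly)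
  then show ?thesis by (auto simp: cbound_def coeff_pCons split: nat.split)
qed

text \<open>If \<open>x\<close> is not integral, the dichotomy writes 1 as a polynomial in
  \<open>x\<close> with small coefficients. One minus this polynomial vanishes at \<open>x\<close>
  and has a unit constant term, so its reversal is an integral equation for the inverse of
  \<open>x\<close>.\<close>

lemma valuation_ring: "x \<in> OK \<or> inverse x \<in> OK"
proof (cases "x = 0 \<or> x \<in> OK")
  case False
  then obtain g where g: "\<And>i. v (poly.coeff g i) < 1" "aeval g x = 1"
    using integral_dichotomy[of x] closure_integers_iff_min_poly[of x] by blast
  define P where "P = 1 - g"
  have P0: "v (poly.coeff P 0) = 1"
    using v_unit_add[of "- poly.coeff g 0" 1] g(1) by (simp add: P_def)
  then have P00: "poly.coeff P 0 \<noteq> 0" by auto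
  have P1: "v (poly.coeff P i) \<le> 1" for i
    using P0 g(1)[of i] by (cases i) (auto simp: P_def less_imp_le)
  define H where "H = smult (inverse (poly.coeff P 0)) (reflect_poly P)"
  have "Polynomial.lead_coeff H = 1"
    using P00 by (simp add: H_def degree_reflect_poly_eq coeff_reflect_poly)
  moreover have "cbound 1 H"
    using P0 P1 by (auto simp: H_def cbound_def v_mult v_inverse coeff_reflect_poly)
  moreover have "aeval H (inverse x) = 0"
    using False g(2) by (simp add: H_def aeval_reflect_poly P_def)
  ultimately show ?thesis unfolding closure_integers_iff by blast
qed (use OK.zero_mem in auto)

lemma closure_prime_iff: "x \<in> MK \<longleftrightarrow> x \<in> OK \<and> (x = 0 \<or> inverse x \<notin> OK)"
proof -
  have "x \<in> Units (ring_on OK) \<longleftrightarrow> x \<in> OK \<and> x \<noteq> 0 \<and> inverse x \<in> OK"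
  proof
    assume "x \<in> Units (ring_on OK)"
    then obtain y where "x \<in> OK" "y \<in> OK" "y * x = 1" by (auto simp: Units_def)
    then show "x \<in> OK \<and> x \<noteq> 0 \<and> inverse x \<in> OK"
      by (metis inverse_unique mult.commute mult_zero_right zero_neq_one)
  next
    assume "x \<in> OK \<and> x \<noteq> 0 \<and> inverse x \<in> OK"
    then show "x \<in> Units (ring_on OK)" by (auto simp: Units_def intro!: bexI[of _ "inverse x"])
  qed
  then show ?thesis by (auto simp: closure_prime_def)
qed

end

section \<open>The maximal ideal of the integral closure and the extended absolute value\<close>

context local_field
begin

lemma MK_imp_OK: "x \<in> MK \<Longrightarrow> x \<in> OK"
  by (simp add: closure_prime_iff)

lemma zero_mem_MK: "0 \<in> MK"
  by (simp add: closure_prime_iff OK.zero_mem)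

lemma one_notin_MK: "1 \<notin> MK"
  by (simp add: closure_prime_iff OK.one_mem)

lemma MK_mult: assumes "r \<in> OK" "x \<in> MK" shows "r * x \<in> MK"
proof (cases "r = 0 \<or> x = 0")
  case False
  have "inverse (r * x) \<notin> OK"
  proof
    assume "inverse (r * x) \<in> OK"
    from OK.mult_mem[OF assms(1) this] have "inverse x \<in> OK" using False by (simp add: mult.assoc[symmetric])
    then show False using assms(2) False by (simp add: closure_prime_iff)
  qed
  then show ?thesis using assms by (simp add: closure_prime_iff OK.mult_mem)
qed (auto simp: zero_mem_MK)

lemma MK_mult': "x \<in> MK \<Longrightarrow> r \<in> OK \<Longrightarrow> x * r \<in> MK"
  using MK_mult[of r x] by (simp add: mult.commute)

text \<open>In a valuation ring one of the two quotients of \<open>x\<close> and \<open>y\<close> is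
  integral, so the sum is an integral multiple of one summand.\<close>

lemma MK_add: assumes "x \<in> MK" "y \<in> MK" shows "x + y \<in> MK"
proof -
  have key: "x + y \<in> MK" if xy: "x \<in> MK" "y \<in> MK" "y \<noteq> 0" "x * inverse y \<in> OK" for x y
  proof -
    have "(x * inverse y + 1) * y = x + y" using xy(3) by (simp add: field_simps)
    then show ?thesis using MK_mult[OF OK.add_mem[OF xy(4) OK.one_mem] xy(2)] by simp
  qed
  show ?thesis
  proof (cases "x = 0 \<or> y = 0")
    case False
    then show ?thesis
      using valuation_ring[of "x * inverse y"] key[of x y] key[of y x] assms
      by (auto simp: add.commute mult.commute)
  qed (use assms in auto)
qed

lemma MK_minus: "x \<in> MK \<Longrightarrow> - x \<in> MK"
  using MK_mult[of "-1" x] OK.minus_mem[OF OK.one_mem] by simp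

lemma MK_diff: "x \<in> MK \<Longrightarrow> y \<in> MK \<Longrightarrow> x - y \<in> MK"
  using MK_add[of x "- y"] MK_minus by simp

lemma MK_sum: "(\<And>i. i \<in> I \<Longrightarrow> f i \<in> MK) \<Longrightarrow> (\<Sum>i\<in>I. f i) \<in> MK"
  by (induction I rule: infinite_finite_induct) (auto intro: zero_mem_MK MK_add)

lemma MK_prime: assumes "x \<in> OK" "y \<in> OK" "x * y \<in> MK" shows "x \<in> MK \<or> y \<in> MK"
proof (rule ccontr)
  assume "\<not> ?thesis"
  then have *: "x \<noteq> 0" "y \<noteq> 0" "inverse x \<in> OK" "inverse y \<in> OK"
    using assms by (auto simp: closure_prime_iff)
  from MK_mult[OF OK.mult_mem[OF *(3,4)] assms(3)] * have "1 \<in> MK" by (simp add: field_simps)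
  then show False using one_notin_MK by simp
qed

lemma MK_power: "x \<in> OK \<Longrightarrow> x ^ n \<in> MK \<Longrightarrow> x \<in> MK"
  by (induction n) (use one_notin_MK MK_prime OK.power_mem in auto)

lemma MK_trans: "x - y \<in> MK \<Longrightarrow> y - z \<in> MK \<Longrightarrow> x - z \<in> MK"
  using MK_add[of "x - y" "y - z"] by simp

lemma MK_sym: "x - y \<in> MK \<Longrightarrow> y - x \<in> MK"
  using MK_minus[of "x - y"] by simp

lemma MK_prod_mset:
  assumes "\<And>x. x \<in># A \<Longrightarrow> f x \<in> OK" "(\<Prod>x\<in>#A. f x) \<in> MK"
  shows "\<exists>x. x \<in># A \<and> f x \<in> MK"
  using assms
proof (induction A)
  case (add x A)
  have "(\<Prod>x\<in>#B. f x) \<in> OK" if "\<And>x. x \<in># B \<Longrightarrow> f x \<in> OK" for B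
    using that by (induction B) (auto intro: OK.one_mem OK.mult_mem)
  then have "(\<Prod>x\<in>#A. f x) \<in> OK" using add.prems by simp
  then have "f x \<in> MK \<or> (\<Prod>x\<in>#A. f x) \<in> MK" using add.prems by (intro MK_prime) auto
  then show ?case using add by auto
qed (use one_notin_MK in auto)

lemma power_diff_MK: "x \<in> OK \<Longrightarrow> y \<in> OK \<Longrightarrow> x - y \<in> MK \<Longrightarrow> x ^ n - y ^ n \<in> MK"
proof (induction n)
  case (Suc n)
  have "x ^ Suc n - y ^ Suc n = x * (x ^ n - y ^ n) + (x - y) * y ^ n" by (simp add: algebra_simps)
  also have "\<dots> \<in> MK"
    using Suc by (intro MK_add[OF MK_mult MK_mult'] OK.power_mem) auto
  finally show ?case .
qed (simp add: zero_mem_MK)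

lemma to_ac_mem_MK_iff: "to_ac c \<in> MK \<longleftrightarrow> v c < 1"
proof (cases "c = 0")
  case False
  have "to_ac c \<in> MK \<longleftrightarrow> v c \<le> 1 \<and> \<not> v (inverse c) \<le> 1"
    using False to_ac_mem_OK_iff[of "inverse c"] by (simp add: closure_prime_iff to_ac_mem_OK_iff)
  moreover have "v c > 0" using False v_nonneg[of c] v_eq_0[of c] by linarith
  ultimately show ?thesis by (auto simp: v_inverse inverse_le_1_iff)
qed (simp add: zero_mem_MK)

lemma of_nat_mem_MK_iff: "of_nat n \<in> MK \<longleftrightarrow> res_char dvd n"
  using to_ac_mem_MK_iff[of "of_nat n"] nat_v_less_1_iff by simp

subsection \<open>Galois invariance\<close>

lemma gal_mem_OK: "\<sigma> \<in> Gal \<Longrightarrow> x \<in> OK \<Longrightarrow> \<sigma> x \<in> OK"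
  unfolding closure_integers_iff by (metis gal_aeval gal_0)

lemma gal_mem_OK_iff: assumes "\<sigma> \<in> Gal" shows "\<sigma> x \<in> OK \<longleftrightarrow> x \<in> OK"
  using gal_mem_OK[OF assms, of x] gal_mem_OK[OF gal_inv[OF assms], of "\<sigma> x"] gal_inv_cancel[OF assms]
  by auto

lemma gal_mem_MK_iff: assumes "\<sigma> \<in> Gal" shows "\<sigma> x \<in> MK \<longleftrightarrow> x \<in> MK"
  using gal_mem_OK_iff[OF assms, of x] gal_mem_OK_iff[OF assms, of "inverse x"]
  by (simp add: closure_prime_iff gal_inverse[OF assms] gal_eq_0_iff[OF assms])

text \<open>Conjugates have equal size. Otherwise the quotient of \<open>\<sigma> x\<close> by
  \<open>x\<close> would lie in the maximal ideal, and with it, as a product of Galois translates,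
  the quotient of every iterate of \<open>x\<close> by \<open>x\<close>. The orbit is finite, so
  some iterate returns to \<open>x\<close> and 1 would lie in the ideal.\<close>

lemma gal_quotient_unit:
  assumes s: "\<sigma> \<in> Gal" and x: "x \<noteq> 0"
  shows "x * inverse (\<sigma> x) \<in> OK"
proof (rule ccontr)
  assume n: "x * inverse (\<sigma> x) \<notin> OK"
  have nz: "\<sigma> x \<noteq> 0" using x gal_eq_0_iff[OF s] by simp
  have u: "\<sigma> x * inverse x \<in> MK"
    using n valuation_ring[of "x * inverse (\<sigma> x)"] x nz by (simp add: closure_prime_iff mult.commute)
  have sj: "\<sigma> ^^ j \<in> Gal" for j
    by (induction j) (simp_all only: funpow.simps gal_id gal_comp[OF s])
  have MKj: "(\<sigma> ^^ Suc j) x * inverse x \<in> MK" for j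
  proof (induction j)
    case 0
    then show ?case using u by simp
  next
    case (Suc j)
    have "(\<sigma> ^^ Suc j) (\<sigma> x * inverse x) \<in> MK" using u gal_mem_MK_iff[OF sj[of "Suc j"]] by blast
    moreover have "(\<sigma> ^^ Suc j) (\<sigma> x * inverse x) = (\<sigma> ^^ Suc (Suc j)) x * inverse ((\<sigma> ^^ Suc j) x)"
      unfolding gal_mult[OF sj[of "Suc j"]] gal_inverse[OF sj[of "Suc j"]] by (simp add: funpow_swap1)
    moreover have "(\<sigma> ^^ Suc j) x \<noteq> 0" using x gal_eq_0_iff[OF sj[of "Suc j"]] by simp
    then have "(\<sigma> ^^ Suc (Suc j)) x * inverse x =
        (\<sigma> ^^ Suc (Suc j)) x * inverse ((\<sigma> ^^ Suc j) x) * ((\<sigma> ^^ Suc j) x * inverse x)"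
      by (simp add: mult.assoc)
    ultimately show ?case using MK_mult[OF MK_imp_OK Suc] by metis
  qed
  have "\<not> inj (\<lambda>j. (\<sigma> ^^ j) x)"
  proof
    assume "inj (\<lambda>j. (\<sigma> ^^ j) x)"
    moreover have "range (\<lambda>j. (\<sigma> ^^ j) x) \<subseteq> {\<sigma> x | \<sigma>. \<sigma> \<in> Gal}" using sj by blast
    from finite_subset[OF this finite_galois_orbit] have "finite (range (\<lambda>j. (\<sigma> ^^ j) x))" .
    ultimately show False using finite_imageD infinite_UNIV_nat by blast
  qed
  then obtain i j where ij: "i < j" "(\<sigma> ^^ i) x = (\<sigma> ^^ j) x"
    unfolding inj_def by (metis linorder_neqE_nat)
  then have "(\<sigma> ^^ i) x = (\<sigma> ^^ i) ((\<sigma> ^^ (j - i)) x)"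
    by (metis comp_apply funpow_add le_add_diff_inverse less_imp_le)
  then have "(\<sigma> ^^ (j - i)) x = x" using gal_eq_iff[OF sj[of i]] by metis
  then have "x * inverse x \<in> MK" using MKj[of "j - i - 1"] ij(1) by (simp add: Suc_diff_Suc)
  then show False using x one_notin_MK by simp
qed

text \<open>Up to sign the constant term of the minimal polynomial is the product of its roots. Each
  root is a conjugate of \<open>x\<close> and differs from it by a unit, so the constant term
  differs by a unit from a power of \<open>x\<close>.\<close>

lemma ex_power_unit:
  assumes "x \<noteq> 0"
  shows "\<exists>k c. k > 0 \<and> c \<noteq> 0 \<and> x ^ k * inverse (to_ac c) \<in> OK \<and> to_ac c * inverse (x ^ k) \<in> OK"
proof -
  let ?p = "map_poly to_ac (min_poly x)"
  have lead: "Polynomial.lead_coeff ?p = 1" using lead_coeff_min_poly[of x]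
    by (simp add: degree_map_poly coeff_map_poly)
  obtain A where A: "size A = degree ?p" "?p = smult (Polynomial.lead_coeff ?p) (\<Prod>a\<in>#A. [:- a, 1:])"
    using alg_closed_imp_factorization[of ?p] lead by (metis leading_coeff_0_iff zero_neq_one)
  have pA: "poly ?p y = (\<Prod>a\<in>#A. y - a)" for y
    by (subst A(2)) (simp add: lead poly_prod_mset)
  have roots: "aeval (min_poly x) a = 0" if "a \<in># A" for a
    unfolding aeval_def pA using that by (intro prod_mset_zero_iff[THEN iffD2]) auto
  have unit: "x * inverse a \<in> OK \<and> a * inverse x \<in> OK \<and> a \<noteq> 0" if aA: "a \<in># A" for a
  proof -
    obtain \<sigma> where \<sigma>: "\<sigma> \<in> Gal" "\<sigma> x = a" using conjugate_if_root[OF roots[OF aA]] by blast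
    have a: "a \<noteq> 0" using \<sigma> assms gal_eq_0_iff by blast
    have "inv' \<sigma> a = x" using gal_inv_cancel(2)[OF \<sigma>(1)] \<sigma>(2) by blast
    then show ?thesis using gal_quotient_unit[OF \<sigma>(1) assms] gal_quotient_unit[OF gal_inv[OF \<sigma>(1)] a] \<sigma>(2) a by auto
  qed
  define c where "c = poly.coeff (min_poly x) 0"
  have c: "to_ac c = (\<Prod>a\<in>#A. - a)"
    using pA[of 0] by (simp add: c_def poly_0_coeff_0 coeff_map_poly)
  have "x ^ size B * inverse (\<Prod>a\<in>#B. - a) \<in> OK \<and> (\<Prod>a\<in>#B. - a) * inverse (x ^ size B) \<in> OK \<and> (\<Prod>a\<in>#B. - a) \<noteq> 0"
    if "\<And>a. a \<in># B \<Longrightarrow> a \<in># A" for B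
    using that
  proof (induction B)
    case (add b B)
    have b: "x * inverse b \<in> OK" "b * inverse x \<in> OK" "b \<noteq> 0" using unit add.prems by auto
    have IH: "x ^ size B * inverse (\<Prod>a\<in>#B. - a) \<in> OK" "(\<Prod>a\<in>#B. - a) * inverse (x ^ size B) \<in> OK"
      "(\<Prod>a\<in>#B. - a) \<noteq> 0" using add by auto
    have eq1: "x ^ size (add_mset b B) * inverse (\<Prod>a\<in>#add_mset b B. - a) =
        - ((x * inverse b) * (x ^ size B * inverse (\<Prod>a\<in>#B. - a)))"
      by (simp add: field_simps)
    have eq2: "(\<Prod>a\<in>#add_mset b B. - a) * inverse (x ^ size (add_mset b B)) =
        - ((b * inverse x) * ((\<Prod>a\<in>#B. - a) * inverse (x ^ size B)))"
      by (simp add: field_simps)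
    have eq3: "(\<Prod>a\<in>#add_mset b B. - a) \<noteq> 0" using b(3) IH(3) by simp
    show ?case
      by (intro conjI eq3)
        (simp_all only: eq1 eq2 OK.minus_mem[OF OK.mult_mem[OF b(1) IH(1)]] OK.minus_mem[OF OK.mult_mem[OF b(2) IH(2)]])
  qed (auto intro: OK.one_mem)
  from this[of A] have "x ^ size A * inverse (to_ac c) \<in> OK" "to_ac c * inverse (x ^ size A) \<in> OK" "to_ac c \<noteq> 0"
    unfolding c by auto
  moreover have "size A > 0" using A(1) degree_min_poly_pos[of x] by (simp add: degree_map_poly)
  ultimately show ?thesis by (intro exI[of _ "size A"] exI[of _ c]) auto
qed

subsection \<open>The extended absolute value\<close>

text \<open>The power \<open>x ^ k\<close> and \<open>c\<close> differ by a unit, so an extension of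
  \<open>v\<close> must give \<open>x\<close> the \<open>k\<close>-th root of
  \<open>v c\<close>.\<close>

definition val_rep :: "'l alg_closure \<Rightarrow> nat \<Rightarrow> 'l \<Rightarrow> bool" where
  "val_rep x k c \<longleftrightarrow> k > 0 \<and> c \<noteq> 0 \<and> x ^ k * inverse (to_ac c) \<in> OK \<and> to_ac c * inverse (x ^ k) \<in> OK"

text \<open>The extension of \<open>v\<close> to the closure. The representation is arbitrary;
  \<open>w_power_eq\<close> shows that every other one gives the same value.\<close>

definition w :: "'l alg_closure \<Rightarrow> real" where
  "w x = (if x = 0 then 0 else (SOME r. \<exists>k c. val_rep x k c \<and> r = root k (v c)))"

lemma ex_val_rep: "x \<noteq> 0 \<Longrightarrow> \<exists>k c. val_rep x k c"
  using ex_power_unit[of x] by (simp add: val_rep_def)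

lemma val_rep_power:
  assumes "val_rep x k c" "n > 0" shows "val_rep x (k * n) (c ^ n)"
  using assms OK.power_mem[of _ n]
  by (auto simp: val_rep_def power_mult power_mult_distrib[symmetric] power_inverse[symmetric])

lemma val_rep_unique:
  assumes "val_rep x k c" "val_rep x k d" "x \<noteq> 0" shows "v c = v d"
proof -
  have nz: "c \<noteq> 0" "d \<noteq> 0" using assms by (auto simp: val_rep_def)
  have "to_ac (c * inverse d) \<in> OK" "to_ac (d * inverse c) \<in> OK"
    using OK.mult_mem[of "to_ac c * inverse (x ^ k)" "x ^ k * inverse (to_ac d)"]
      OK.mult_mem[of "to_ac d * inverse (x ^ k)" "x ^ k * inverse (to_ac c)"] assms
    by (auto simp: val_rep_def field_simps)
  then have "v c / v d \<le> 1" "v d / v c \<le> 1"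
    unfolding to_ac_mem_OK_iff by (simp_all add: v_mult v_inverse divide_inverse)
  moreover have "v c > 0" "v d > 0" using nz v_nonneg v_eq_0 by (metis less_le)+
  ultimately show ?thesis by (simp add: divide_le_eq)
qed

lemma w_eq_root: assumes "x \<noteq> 0" shows "\<exists>k c. val_rep x k c \<and> w x = root k (v c)"
proof -
  have "\<exists>r k c. val_rep x k c \<and> r = root k (v c)" using ex_val_rep[OF assms] by blast
  from someI_ex[OF this] show ?thesis using assms by (simp add: w_def)
qed

lemma w_nonneg [simp]: "w x \<ge> 0"
proof (cases "x = 0")
  case False
  then obtain k c where "val_rep x k c" "w x = root k (v c)" using w_eq_root by blast
  then show ?thesis by (simp add: val_rep_def real_root_ge_0_iff)
qed (simp add: w_def)

lemma w_power_eq: assumes "val_rep x k c" "x \<noteq> 0" shows "w x ^ k = v c"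
proof -
  obtain l d where vld: "val_rep x l d" and w: "w x = root l (v d)" using w_eq_root[OF assms(2)] by blast
  have pos: "l > 0" "k > 0" using vld assms by (auto simp: val_rep_def)
  have "v (c ^ l) = v (d ^ k)"
    using val_rep_unique[OF val_rep_power[OF assms(1) pos(1)], of "d ^ k"]
      val_rep_power[OF vld pos(2)] assms(2) by (simp add: mult.commute)
  then have "(w x ^ k) ^ l = v c ^ l"
    using pos by (simp add: w v_power power_mult[symmetric] mult.commute[of k l]) (simp add: power_mult)
  then show ?thesis using pos power_eq_imp_eq_base[of "w x ^ k" l "v c"] by simp
qed

lemma w_0 [simp]: "w 0 = 0" by (simp add: w_def)

lemma w_eq_0_iff [simp]: "w x = 0 \<longleftrightarrow> x = 0"
proof
  assume w: "w x = 0"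
  show "x = 0"
  proof (rule ccontr)
    assume x: "x \<noteq> 0"
    then obtain k c where kc: "val_rep x k c" using ex_val_rep by blast
    from w_power_eq[OF kc x] w kc show False by (auto simp: val_rep_def power_0_left)
  qed
qed simp

lemma w_mult: "w (x * y) = w x * w y"
proof (cases "x = 0 \<or> y = 0")
  case False
  then obtain k c l d where kc: "val_rep x k c" and ld: "val_rep y l d" using ex_val_rep by blast
  have pos: "k > 0" "l > 0" using kc ld by (auto simp: val_rep_def)
  have 1: "val_rep x (k * l) (c ^ l)" "val_rep y (k * l) (d ^ k)"
    using val_rep_power[OF kc pos(2)] val_rep_power[OF ld pos(1)] by (simp_all add: mult.commute)
  then have "val_rep (x * y) (k * l) (c ^ l * d ^ k)"
    using OK.mult_mem[of "x ^ (k * l) * inverse (to_ac (c ^ l))" "y ^ (k * l) * inverse (to_ac (d ^ k))"]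
     OK.mult_mem[of "to_ac (c ^ l) * inverse (x ^ (k * l))" "to_ac (d ^ k) * inverse (y ^ (k * l))"]
    by (auto simp: val_rep_def power_mult_distrib mult_ac)
  from w_power_eq[OF this] have "w (x * y) ^ (k * l) = (w x * w y) ^ (k * l)"
    using False w_power_eq[OF 1(1)] w_power_eq[OF 1(2)] by (simp add: v_mult power_mult_distrib)
  then show ?thesis using pos power_eq_imp_eq_base[of "w (x * y)" "k * l" "w x * w y"] by simp
qed auto

lemma w_to_ac: "w (to_ac c) = v c"
proof (cases "c = 0")
  case False
  then have "val_rep (to_ac c) 1 c" by (simp add: val_rep_def OK.one_mem)
  from w_power_eq[OF this] False show ?thesis by simp
qed simp

lemma w_1 [simp]: "w 1 = 1" using w_to_ac[of 1] by simp

lemma w_power: "w (x ^ n) = w x ^ n"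
  by (induction n) (auto simp: w_mult)

text \<open>A representation reduces the claim to \<open>c\<close> in the base field. An element
  with an integral power is integral: otherwise its inverse is, and \<open>x\<close> is
  \<open>x ^ k\<close> times a power of that inverse.\<close>

lemma w_le_1_iff: "w x \<le> 1 \<longleftrightarrow> x \<in> OK"
proof (cases "x = 0")
  case False
  then obtain k c where kc: "val_rep x k c" using ex_val_rep by blast
  then have k: "k > 0" by (simp add: val_rep_def)
  have "w x \<le> 1 \<longleftrightarrow> w x ^ k \<le> 1" using k by (simp add: power_le_one_iff)
  also have "\<dots> \<longleftrightarrow> to_ac c \<in> OK" by (simp add: w_power_eq[OF kc False] to_ac_mem_OK_iff)
  also have "\<dots> \<longleftrightarrow> x ^ k \<in> OK"
  proof -
    have *: "to_ac c * (x ^ k * inverse (to_ac c)) = x ^ k" "x ^ k * (to_ac c * inverse (x ^ k)) = to_ac c"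
      using kc False by (simp_all add: val_rep_def field_simps)
    have "x ^ k * inverse (to_ac c) \<in> OK" "to_ac c * inverse (x ^ k) \<in> OK"
      using kc by (simp_all add: val_rep_def)
    then show ?thesis using OK.mult_mem[of "to_ac c" "x ^ k * inverse (to_ac c)"]
      OK.mult_mem[of "x ^ k" "to_ac c * inverse (x ^ k)"] unfolding * by blast
  qed
  also have "\<dots> \<longleftrightarrow> x \<in> OK"
  proof
    assume xk: "x ^ k \<in> OK"
    show "x \<in> OK"
    proof (rule ccontr)
      assume n: "x \<notin> OK"
      then have "inverse x \<in> OK" using valuation_ring by blast
      from OK.mult_mem[OF xk OK.power_mem[OF this, of "k - 1"]]
      have "x ^ k * inverse x ^ (k - 1) \<in> OK" .
      moreover have "x ^ k * inverse x ^ (k - 1) = x"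
        using k False by (cases k) (auto simp: power_inverse)
      ultimately show False using n by simp
    qed
  qed (rule OK.power_mem)
  finally show ?thesis .
qed (simp add: OK.zero_mem)

lemma w_inverse: "w (inverse x) = inverse (w x)"
proof (cases "x = 0")
  case False
  then have "w (inverse x) * w x = 1" by (simp flip: w_mult)
  then show ?thesis by (metis inverse_unique inverse_inverse_eq mult.commute)
qed simp

lemma w_less_1_iff: "w x < 1 \<longleftrightarrow> x \<in> MK"
proof (cases "x = 0")
  case False
  then have "w x > 0" using w_nonneg[of x] w_eq_0_iff[of x] by linarith
  then show ?thesis
    using False w_le_1_iff[of x] w_le_1_iff[of "inverse x"]
    by (auto simp: closure_prime_iff w_inverse inverse_le_1_iff)
qed (simp add: zero_mem_MK)

text \<open>Division by the larger summand turns the inequality into closure of the integers under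
  adding 1.\<close>

lemma w_add_le_max: "w (x + y) \<le> max (w x) (w y)"
proof -
  have key: "w (x + y) \<le> w y" if le: "w x \<le> w y" for x y
  proof (cases "y = 0")
    case True
    then show ?thesis using le by simp
  next
    case False
    then have pos: "w y > 0" using w_nonneg[of y] w_eq_0_iff[of y] by linarith
    have "w (x * inverse y) \<le> 1" using le pos by (simp add: w_mult w_inverse flip: divide_real_def)
    then have "w (x * inverse y + 1) \<le> 1" unfolding w_le_1_iff by (rule OK.add_mem[OF _ OK.one_mem])
    then have "w ((x + y) * inverse y) \<le> 1" using False by (simp add: distrib_right)
    then show ?thesis using pos by (simp add: w_mult w_inverse flip: divide_real_def)
  qed
  show ?thesis using key[of x y] key[of y x] by (cases "w x \<le> w y") (auto simp: add.commute)
qed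

lemma w_add_leI: "w x \<le> r \<Longrightarrow> w y \<le> r \<Longrightarrow> w (x + y) \<le> r"
  using w_add_le_max[of x y] by linarith

lemma w_sum_leI: "(\<And>i. i \<in> A \<Longrightarrow> w (f i) \<le> r) \<Longrightarrow> 0 \<le> r \<Longrightarrow> w (\<Sum>i\<in>A. f i) \<le> r"
  by (induction A rule: infinite_finite_induct) (auto intro: w_add_leI)

end

section \<open>Topology of pointwise convergence\<close>

text \<open>\<open>U\<close> contains the trace on \<open>A\<close> of a basic neighbourhood of
  \<open>\<sigma>\<close> for pointwise convergence.\<close>

abbreviation near :: "('a \<Rightarrow> 'b) set \<Rightarrow> ('a \<Rightarrow> 'b) \<Rightarrow> ('a \<Rightarrow> 'b) set \<Rightarrow> bool" where
  "near A \<sigma> U \<equiv> \<exists>F. finite F \<and> (\<forall>\<tau>\<in>A. (\<forall>x\<in>F. \<tau> x = \<sigma> x) \<longrightarrow> \<tau> \<in> U)"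

lemma openin_pointwise_iff:
  "openin (product_topology (\<lambda>_. discrete_topology UNIV) UNIV) U \<longleftrightarrow> (\<forall>\<sigma>\<in>U. near UNIV \<sigma> U)"
proof
  assume o: "openin (product_topology (\<lambda>_. discrete_topology UNIV) UNIV) U"
  show "\<forall>\<sigma>\<in>U. near UNIV \<sigma> U"
  proof
    fix \<sigma> assume s: "\<sigma> \<in> U"
    obtain V where V: "finite {i. V i \<noteq> UNIV}" "\<sigma> \<in> PiE UNIV V" "PiE UNIV V \<subseteq> U"
      using o s unfolding openin_product_topology_alt by (auto simp del: openin_discrete_topology)
    have "\<tau> \<in> U" if t: "\<forall>x\<in>{i. V i \<noteq> UNIV}. \<tau> x = \<sigma> x" for \<tau>
    proof -
      have "\<tau> i \<in> V i" for i using t V(2) by (cases "V i = UNIV") (auto simp: PiE_iff)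
      then show ?thesis using V(3) by (auto simp: PiE_iff subset_iff)
    qed
    then show "near UNIV \<sigma> U" using V(1) by (intro exI[of _ "{i. V i \<noteq> UNIV}"]) auto
  qed
next
  assume U: "\<forall>\<sigma>\<in>U. near UNIV \<sigma> U"
  show "openin (product_topology (\<lambda>_. discrete_topology UNIV) UNIV) U"
    unfolding openin_product_topology_alt
  proof (intro ballI)
    fix \<sigma> assume "\<sigma> \<in> U"
    from bspec[OF U this] obtain F where F: "finite F" "\<And>\<tau>. (\<forall>x\<in>F. \<tau> x = \<sigma> x) \<Longrightarrow> \<tau> \<in> U" by auto
    define V where "V = (\<lambda>i. if i \<in> F then {\<sigma> i} else UNIV)"
    have "PiE UNIV V \<subseteq> U"
    proof
      fix \<tau> assume "\<tau> \<in> PiE UNIV V"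
      then have "\<tau> i \<in> V i" for i by (auto simp: PiE_iff)
      then show "\<tau> \<in> U" by (intro F(2)) (metis V_def singletonD)
    qed
    moreover have "\<sigma> \<in> PiE UNIV V" "finite {i \<in> UNIV. V i \<noteq> topspace (discrete_topology UNIV)}"
      by (auto simp: V_def intro: finite_subset[OF _ F(1)])
    ultimately show "\<exists>V. finite {i \<in> UNIV. V i \<noteq> topspace (discrete_topology UNIV)} \<and>
       (\<forall>i\<in>UNIV. openin (discrete_topology UNIV) (V i)) \<and> \<sigma> \<in> PiE UNIV V \<and> PiE UNIV V \<subseteq> U"
      by (intro exI[of _ V]) auto
  qed
qed

lemma topspace_krull [simp]: "topspace krull_topology = Gal"
  by (auto simp: krull_topology_def)

lemma openin_krull_iff: "openin krull_topology U \<longleftrightarrow> U \<subseteq> Gal \<and> (\<forall>\<sigma>\<in>U. near Gal \<sigma> U)"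
proof
  assume "openin krull_topology U"
  then obtain T where T: "openin (product_topology (\<lambda>_. discrete_topology UNIV) UNIV) T" "U = T \<inter> Gal"
    by (auto simp: krull_topology_def openin_subtopology)
  then show "U \<subseteq> Gal \<and> (\<forall>\<sigma>\<in>U. near Gal \<sigma> U)" unfolding openin_pointwise_iff by fast
next
  assume U: "U \<subseteq> Gal \<and> (\<forall>\<sigma>\<in>U. near Gal \<sigma> U)"
  \<comment> \<open>The union of basic open sets of the full function space, one for every finite
    set that witnesses openness of \<open>U\<close> at one of its points.\<close>
  define T where "T = {\<tau>. \<exists>\<sigma>\<in>U. \<exists>F. finite F \<and> (\<forall>x\<in>F. \<tau> x = \<sigma> x) \<and> (\<forall>\<tau>\<in>Gal. (\<forall>x\<in>F. \<tau> x = \<sigma> x) \<longrightarrow> \<tau> \<in> U)}"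
  have "openin (product_topology (\<lambda>_. discrete_topology UNIV) UNIV) T"
    unfolding openin_pointwise_iff
  proof
    fix \<tau> assume "\<tau> \<in> T"
    then obtain \<sigma> F where *: "\<sigma> \<in> U" "finite F" "\<forall>x\<in>F. \<tau> x = \<sigma> x" "\<forall>\<tau>\<in>Gal. (\<forall>x\<in>F. \<tau> x = \<sigma> x) \<longrightarrow> \<tau> \<in> U"
      unfolding T_def by blast
    then show "near UNIV \<tau> T" unfolding T_def by (intro exI[of _ F]) auto
  qed
  moreover have "U = T \<inter> Gal"
  proof (intro equalityI subsetI)
    fix \<sigma> assume s: "\<sigma> \<in> U"
    with U obtain F where "finite F" "\<forall>\<tau>\<in>Gal. (\<forall>x\<in>F. \<tau> x = \<sigma> x) \<longrightarrow> \<tau> \<in> U" by meson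
    then have "\<sigma> \<in> T" unfolding T_def using s by blast
    with U s show "\<sigma> \<in> T \<inter> Gal" by blast
  qed (auto simp: T_def)
  ultimately show "openin krull_topology U" by (auto simp: krull_topology_def openin_subtopology)
qed

lemma closedin_krull_pointwise:
  assumes "\<And>\<sigma>. \<sigma> \<in> Gal \<Longrightarrow> \<sigma> \<notin> C \<Longrightarrow> near Gal \<sigma> (- C)"
  shows "closedin krull_topology (Gal \<inter> C)"
  unfolding closedin_def openin_krull_iff using assms by auto

text \<open>The Galois group lies in the product of the finite root sets of minimal polynomials,
  which is compact by Tychonoff. It is closed, because compatibility with sums, products and
  constants is tested at finitely many points at a time and bijectivity follows by
  \<open>hom_imp_gal\<close>.\<close>

lemma compact_krull: "compact_space (krull_topology :: ('l::field alg_closure \<Rightarrow> 'l alg_closure) topology)"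
proof -
  let ?T = "product_topology (\<lambda>_::'l alg_closure. discrete_topology (UNIV::'l alg_closure set)) UNIV"
  let ?R = "PiE UNIV (\<lambda>x. {y. aeval (min_poly x) y = 0})"
  have "compactin ?T ?R"
    unfolding compactin_PiE by (auto simp: compactin_discrete_topology intro!: finite_aeval_roots)
  moreover have "closedin ?T Gal"
    unfolding closedin_def openin_pointwise_iff
  proof (intro conjI ballI)
    fix \<sigma> :: "'l alg_closure \<Rightarrow> 'l alg_closure"
    assume "\<sigma> \<in> topspace ?T - Gal"
    then have "\<sigma> \<notin> Gal" by simp
    then consider x y where "\<sigma> (x + y) \<noteq> \<sigma> x + \<sigma> y" | x y where "\<sigma> (x * y) \<noteq> \<sigma> x * \<sigma> y"
      | c where "\<sigma> (to_ac c) \<noteq> to_ac c" using hom_imp_gal by blast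
    then show "near UNIV \<sigma> (topspace ?T - Gal)"
    proof cases
      case 1
      then show ?thesis by (intro exI[of _ "{x, y, x + y}"]) (auto simp: galois_iff)
    next
      case 2
      then show ?thesis by (intro exI[of _ "{x, y, x * y}"]) (auto simp: galois_iff)
    next
      case 3
      then show ?thesis by (intro exI[of _ "{to_ac c}"]) (auto simp: galois_iff)
    qed
  qed auto
  moreover have "Gal \<subseteq> ?R" by (auto simp: gal_aeval[symmetric] gal_0)
  ultimately have "compactin ?T Gal" using closed_compactin by blast
  then show ?thesis unfolding krull_topology_def by (rule compact_space_subtopology)
qed

section \<open>Roots of unity and Frobenius elements\<close>

text \<open>The inner binomial coefficients are divisible by \<open>p\<close>. Keeping the error
  term inside \<open>R\<close> allows the use both in the integral closure and for rings of
  functions.\<close>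

lemma (in subring_set) prime_power_add:
  assumes p: "prime (p::nat)" and ab: "a \<in> R" "b \<in> R"
  shows "\<exists>z\<in>R. (a + b) ^ (p ^ k) = a ^ (p ^ k) + b ^ (p ^ k) + of_nat p * z"
proof -
  have prime: "\<exists>z\<in>R. (a + b) ^ p = a ^ p + b ^ p + of_nat p * z" if ab: "a \<in> R" "b \<in> R" for a b
  proof -
    have p2: "p = Suc (Suc (p - 2))" using prime_ge_2_nat[OF p] by simp
    have "(a + b) ^ p = (\<Sum>i\<le>p. of_nat (p choose i) * a ^ i * b ^ (p - i))" by (rule binomial_ring)
    also have "{..p} = insert 0 (insert p {1..<p})" using prime_gt_0_nat[OF p] by auto
    also have "(\<Sum>i\<in>\<dots>. of_nat (p choose i) * a ^ i * b ^ (p - i)) =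
        b ^ p + a ^ p + (\<Sum>i=1..<p. of_nat (p choose i) * a ^ i * b ^ (p - i))"
      using prime_gt_0_nat[OF p] by (subst sum.insert; simp)+
    also have "(\<Sum>i=1..<p. of_nat (p choose i) * a ^ i * b ^ (p - i)) =
        (\<Sum>i=1..<p. of_nat p * (of_nat ((p choose i) div p) * a ^ i * b ^ (p - i)))"
    proof (rule sum.cong[OF refl])
      fix i assume "i \<in> {1..<p}"
      then have "p dvd (p choose i)" using p by (intro dvd_choose_prime) auto
      then have "of_nat (p choose i) = (of_nat p * of_nat ((p choose i) div p) :: 'a)"
        by (simp flip: of_nat_mult)
      then show "of_nat (p choose i) * a ^ i * b ^ (p - i) = of_nat p * (of_nat ((p choose i) div p) * a ^ i * b ^ (p - i))"
        by (simp add: mult.assoc)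
    qed
    finally show ?thesis
      by (intro bexI[of _ "\<Sum>i=1..<p. of_nat ((p choose i) div p) * a ^ i * b ^ (p - i)"])
        (auto simp: sum_distrib_left add.commute intro!: sum_mem mult_mem of_nat_mem power_mem ab)
  qed
  show ?thesis
  proof (induction k)
    case 0
    show ?case by (intro bexI[of _ 0]) (auto simp: zero_mem)
  next
    case (Suc k)
    let ?A = "a ^ (p ^ k)" let ?B = "b ^ (p ^ k)"
    obtain z where z: "z \<in> R" "(a + b) ^ (p ^ k) = ?A + ?B + of_nat p * z" using Suc by blast
    have AB: "?A \<in> R" "?B \<in> R" "of_nat p * z \<in> R" using ab z by (auto intro: power_mem mult_mem of_nat_mem)
    obtain z1 where z1: "z1 \<in> R" "(?A + ?B + of_nat p * z) ^ p = (?A + ?B) ^ p + (of_nat p * z) ^ p + of_nat p * z1"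
      using prime[OF add_mem[OF AB(1,2)] AB(3)] by blast
    obtain z2 where z2: "z2 \<in> R" "(?A + ?B) ^ p = ?A ^ p + ?B ^ p + of_nat p * z2"
      using prime[OF AB(1,2)] by blast
    have pp: "(of_nat p * z) ^ p = of_nat p * (z * (of_nat p * z) ^ (p - 1))"
      using prime_gt_0_nat[OF p] by (cases p) (auto simp: mult.assoc)
    have "(a + b) ^ (p ^ Suc k) = ((a + b) ^ (p ^ k)) ^ p" by (simp add: power_mult[symmetric] mult.commute)
    also have "\<dots> = ?A ^ p + ?B ^ p + of_nat p * (z2 + z * (of_nat p * z) ^ (p - 1) + z1)"
      unfolding z(2) z1(2) z2(2) pp by (simp add: algebra_simps)
    finally have "(a + b) ^ (p ^ Suc k) = a ^ (p ^ Suc k) + b ^ (p ^ Suc k) +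
        of_nat p * (z2 + z * (of_nat p * z) ^ (p - 1) + z1)"
      by (simp only: power_mult[symmetric] power_Suc2)
    moreover have "z2 + z * (of_nat p * z) ^ (p - 1) + z1 \<in> R"
      using z(1) z1(1) z2(1) AB(3) by (intro add_mem mult_mem power_mem of_nat_mem)
    ultimately show ?case by blast
  qed
qed

text \<open>Split off the part \<open>l ^ k\<close> of \<open>N\<close> belonging to a prime
  \<open>l\<close>. An \<open>l ^ (k - 1)\<close>-th root of a non-trivial \<open>l\<close>-th root
  of unity has exact order \<open>l ^ k\<close>, and its product with an element of the coprime
  order \<open>M\<close> has exact order \<open>N\<close>.\<close>

lemma ex_primitive_root_of_unity:
  assumes "N > 0"
    and char_0: "\<And>n. of_nat n = (0 :: 'l::field) \<Longrightarrow> n = 0"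
  shows "\<exists>\<zeta> :: 'l alg_closure. \<forall>i. \<zeta> ^ i = 1 \<longleftrightarrow> N dvd i"
  using assms(1)
proof (induction N rule: less_induct)
  case (less N)
  show ?case
  proof (cases "N = 1")
    case True
    then show ?thesis by (intro exI[of _ 1]) simp
  next
    case False
    then obtain l where l: "prime l" "l dvd N" using prime_factor_nat by blast
    define k where "k = multiplicity l N"
    obtain M where M: "N = l ^ k * M" "\<not> l dvd M"
      using multiplicity_decompose'[of N l] l less.prems
      by (metis k_def neq0_conv not_prime_unit)
    have k: "k > 0" using l M by (metis gr0I mult_1 power_0)
    have l1: "l > 1" using l(1) by (rule prime_gt_1_nat)
    have M0: "M > 0" using less.prems M by (auto intro: Nat.gr0I)
    have "1 < l ^ k" by (rule one_less_power[OF l1 k])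
    then have "M < N" using M0 M(1) by simp
    then obtain \<xi> :: "'l alg_closure" where \<xi>: "\<And>i. \<xi> ^ i = 1 \<longleftrightarrow> M dvd i" using less.IH M0 by blast
    obtain \<eta> :: "'l alg_closure" where \<eta>: "\<eta> ^ l = 1" "\<eta> \<noteq> 1"
    proof -
      \<comment> \<open>The quotient of X^l - 1 by X - 1. Its value at 1 is \<open>l\<close>, which
        is non-zero, so its roots are non-trivial.\<close>
      let ?p = "\<Sum>i<l. Polynomial.monom (1::'l alg_closure) i"
      have pe: "poly ?p x = (\<Sum>i<l. x ^ i)" for x by (simp add: poly_sum poly_monom)
      have c: "poly.coeff ?p i = (if i < l then 1 else 0)" for i by (simp add: coeff_sum)
      have "degree ?p \<ge> l - 1" using l1 by (intro le_degree) (simp add: c)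
      then have "degree ?p > 0" using l1 by simp
      then obtain x where x: "poly ?p x = 0" using alg_closed_imp_poly_has_root by blast
      have "x ^ l - 1 = (x - 1) * poly ?p x" unfolding pe by (rule power_diff_1_eq)
      then have 1: "x ^ l = 1" using x by simp
      have "x \<noteq> 1"
      proof
        assume "x = 1"
        then have "of_nat l = (0 :: 'l alg_closure)" using x pe by simp
        then have "to_ac (of_nat l) = (0 :: 'l alg_closure)" by simp
        then have "of_nat l = (0 :: 'l)" by (simp del: to_ac_of_nat)
        then show False using char_0[of l] l1 by simp
      qed
      with 1 show ?thesis using that by blast
    qed
    obtain \<theta> :: "'l alg_closure" where \<theta>: "\<theta> ^ (l ^ (k - 1)) = \<eta>"
      using nth_root_exists[of "l ^ (k - 1)" \<eta>] l1 by auto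
    have lk: "l ^ k = l ^ (k - 1) * l" using k by (metis power_minus_mult)
    have \<theta>1: "\<theta> ^ (l ^ k) = 1" by (simp only: lk power_mult \<theta> \<eta>)
    have \<theta>ord: "\<theta> ^ i = 1 \<longleftrightarrow> l ^ k dvd i" for i
    proof
      assume "l ^ k dvd i"
      then show "\<theta> ^ i = 1" using \<theta>1 by (auto simp: power_mult elim!: dvdE)
    next
      assume i: "\<theta> ^ i = 1"
      show "l ^ k dvd i"
      proof (cases "i = 0")
        case False
        obtain x y where xy: "i * x = l ^ k * y + gcd i (l ^ k)" using bezout_nat[OF False] by blast
        have "\<theta> ^ (i * x) = 1" "\<theta> ^ (l ^ k * y) = 1" using i \<theta>1 by (simp_all add: power_mult)
        then have g: "\<theta> ^ gcd i (l ^ k) = 1" using xy by (metis mult_1 power_add)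
        have "gcd i (l ^ k) dvd l ^ k" by simp
        then obtain j where j: "j \<le> k" "gcd i (l ^ k) = l ^ j" using divides_primepow_nat[OF l(1)] by blast
        have "j = k"
        proof (rule ccontr)
          assume "j \<noteq> k"
          then have "l ^ j dvd l ^ (k - 1)" using j by (intro le_imp_power_dvd) simp
          then obtain r where "l ^ (k - 1) = l ^ j * r" by blast
          then have "\<theta> ^ (l ^ (k - 1)) = 1" using g j by (simp add: power_mult)
          then show False using \<theta> \<eta> by simp
        qed
        then show ?thesis using j by (metis gcd_dvd1)
      qed simp
    qed
    have cop: "coprime (l ^ k) M" using l M(2) by (simp add: prime_imp_coprime_nat)
    have "(\<theta> * \<xi>) ^ i = 1 \<longleftrightarrow> N dvd i" for i
    proof
      assume "N dvd i"
      then have "l ^ k dvd i" "M dvd i" using M by (auto dest: dvd_mult_left dvd_mult_right)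
      then have "\<theta> ^ i = 1" "\<xi> ^ i = 1" using \<theta>ord \<xi> by blast+
      then show "(\<theta> * \<xi>) ^ i = 1" by (simp add: power_mult_distrib)
    next
      assume 1: "(\<theta> * \<xi>) ^ i = 1"
      have "\<theta> ^ (i * M) = 1"
      proof -
        have "(\<theta> * \<xi>) ^ (i * M) = 1" using 1 by (simp add: power_mult)
        moreover have "\<xi> ^ (i * M) = 1" using \<xi>[of "i * M"] by simp
        ultimately show ?thesis by (simp add: power_mult_distrib)
      qed
      then have "l ^ k dvd i" using \<theta>ord[of "i * M"] cop by (simp add: coprime_dvd_mult_left_iff)
      moreover have "\<xi> ^ (i * l ^ k) = 1"
      proof -
        have "(\<theta> * \<xi>) ^ (i * l ^ k) = 1" using 1 by (simp add: power_mult)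
        moreover have "\<theta> ^ (i * l ^ k) = 1" using \<theta>ord[of "i * l ^ k"] by simp
        ultimately show ?thesis by (simp add: power_mult_distrib)
      qed
      then have "M dvd i" using \<xi>[of "i * l ^ k"] cop by (simp add: coprime_dvd_mult_left_iff coprime_commute)
      ultimately show "N dvd i" unfolding M(1) using cop by (rule divides_mult)
    qed
    then show ?thesis by blast
  qed
qed

text \<open>The first \<open>N\<close> powers of \<open>\<zeta>\<close> are distinct and already
  exhaust the at most \<open>N\<close> roots of X^N - 1.\<close>

lemma root_of_unity_is_power:
  fixes \<zeta> :: "'a::field"
  assumes N: "N > 0" and \<zeta>: "\<And>i. \<zeta> ^ i = 1 \<longleftrightarrow> N dvd i" and \<xi>: "\<xi> ^ N = 1"
  shows "\<exists>i. \<xi> = \<zeta> ^ i"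
proof -
  let ?p = "Polynomial.monom (1::'a) N - 1"
  have "poly.coeff ?p N = 1" using N by simp
  then have nz: "?p \<noteq> 0" by (metis coeff_0 zero_neq_one)
  have deg: "degree ?p \<le> N" by (intro degree_diff_le) (auto simp: degree_monom_le)
  have R: "{x. poly ?p x = 0} = {x. x ^ N = 1}" by (auto simp: poly_monom)
  have fin: "finite {x::'a. x ^ N = 1}" using poly_roots_finite[OF nz] R by simp
  have "\<zeta> \<noteq> 0" using \<zeta>[of N] N by (auto simp: power_0_left)
  have inj: "inj_on (\<lambda>i. \<zeta> ^ i) {..<N}"
  proof (rule linorder_inj_onI)
    fix i j assume ij: "i < j" "i \<in> {..<N}" "j \<in> {..<N}"
    show "\<zeta> ^ i \<noteq> \<zeta> ^ j"
    proof
      assume "\<zeta> ^ i = \<zeta> ^ j"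
      then have "\<zeta> ^ (j - i) = 1" using ij(1) \<open>\<zeta> \<noteq> 0\<close> by (simp add: power_diff)
      then have "N dvd j - i" using \<zeta> by blast
      then show False using ij by (auto dest: dvd_imp_le)
    qed
  qed auto
  have sub: "(\<lambda>i. \<zeta> ^ i) ` {..<N} \<subseteq> {x. x ^ N = 1}"
    by (auto simp: \<zeta> simp flip: power_mult)
  have "card {x::'a. x ^ N = 1} \<le> N" using card_poly_roots_bound[OF nz] deg R by simp
  moreover have "card ((\<lambda>i. \<zeta> ^ i) ` {..<N}) = N" using inj by (simp add: card_image)
  ultimately have "(\<lambda>i. \<zeta> ^ i) ` {..<N} = {x. x ^ N = 1}"
    using fin sub by (intro card_seteq) auto
  then show ?thesis using \<xi> by blast
qed

section \<open>Roots of unity of order prime to the residue characteristic, and Frobenius on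
  residues\<close>

context local_field
begin

abbreviation "q \<equiv> residue_card v"

lemma q_pos: "q > 0" and q_gt_1: "q > 1"
  using residue_card_ge_2 by auto

lemma power_char_add_MK:
  assumes "a \<in> OK" "b \<in> OK"
  shows "(a + b) ^ (res_char ^ k) - (a ^ (res_char ^ k) + b ^ (res_char ^ k)) \<in> MK"
proof -
  obtain z where z: "z \<in> OK" "(a + b) ^ (res_char ^ k) = a ^ (res_char ^ k) + b ^ (res_char ^ k) + of_nat res_char * z"
    using OK.prime_power_add[OF prime_res_char assms] by blast
  have "of_nat res_char \<in> MK" by (simp add: of_nat_mem_MK_iff)
  then show ?thesis using z MK_mult' by simp
qed

lemma power_q_power_add_MK:
  assumes "a \<in> OK" "b \<in> OK"
  shows "(a + b) ^ (q ^ n) - (a ^ (q ^ n) + b ^ (q ^ n)) \<in> MK"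
proof -
  obtain k where "q = res_char ^ k" using residue_card_power_of_char by blast
  then show ?thesis using power_char_add_MK[OF assms, of "k * n"] by (simp add: power_mult)
qed

lemma to_ac_power_q_MK: "v a \<le> 1 \<Longrightarrow> to_ac a ^ (q ^ n) - to_ac a \<in> MK"
proof (induction n)
  case (Suc n)
  have "to_ac (a ^ q - a) \<in> MK" using Suc.prems by (simp add: to_ac_mem_MK_iff power_residue_card del: to_ac_diff)
  then have 1: "to_ac a ^ q - to_ac a \<in> MK" by simp
  have "(to_ac a ^ q) ^ (q ^ n) - to_ac a ^ (q ^ n) \<in> MK"
    using Suc.prems 1 by (intro power_diff_MK OK.power_mem) (simp_all add: to_ac_mem_OK_iff)
  from MK_trans[OF this Suc.IH[OF Suc.prems]] show ?case by (simp add: power_mult)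
qed (simp add: zero_mem_MK)

lemma aeval_mem_OK: "cbound 1 f \<Longrightarrow> x \<in> OK \<Longrightarrow> aeval f x \<in> OK"
  unfolding aeval_altdef by (intro OK.sum_mem OK.mult_mem OK.power_mem) (auto simp: to_ac_mem_OK_iff cbound_def)

lemma cbound_pConsD: "cbound r (pCons a f) \<Longrightarrow> v a \<le> r \<and> cbound r f"
  unfolding cbound_def by (metis coeff_pCons_0 coeff_pCons_Suc)

text \<open>Modulo the maximal ideal the power map is additive, and it fixes the residues of the
  base field, hence the coefficients.\<close>

lemma aeval_power_q_MK: "cbound 1 f \<Longrightarrow> x \<in> OK \<Longrightarrow> aeval f x ^ (q ^ n) - aeval f (x ^ (q ^ n)) \<in> MK"
proof (induction f)
  case 0
  have "q ^ n > 0" using q_pos by simp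
  from zero_power[OF this, where 'a = "'l alg_closure"] show ?case by (simp only: aeval_0 zero_mem_MK diff_zero)
next
  case (pCons a f)
  have a: "v a \<le> 1" and f: "cbound 1 f" using cbound_pConsD[OF pCons.prems(1)] by auto
  have aOK: "to_ac a \<in> OK" "x * aeval f x \<in> OK"
    using a f pCons.prems by (auto simp: to_ac_mem_OK_iff intro: OK.mult_mem aeval_mem_OK)
  have 1: "aeval (pCons a f) x ^ (q ^ n) - (to_ac a ^ (q ^ n) + (x * aeval f x) ^ (q ^ n)) \<in> MK"
    using power_q_power_add_MK[OF aOK] by simp
  have "(to_ac a ^ (q ^ n) + (x * aeval f x) ^ (q ^ n)) - aeval (pCons a f) (x ^ (q ^ n)) =
     (to_ac a ^ (q ^ n) - to_ac a) + x ^ (q ^ n) * (aeval f x ^ (q ^ n) - aeval f (x ^ (q ^ n)))"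
    by (simp add: algebra_simps power_mult_distrib)
  also have "\<dots> \<in> MK"
    using pCons.IH[OF f pCons.prems(2)] to_ac_power_q_MK[OF a] pCons.prems(2)
    by (intro MK_add MK_mult OK.power_mem)
  finally show ?case using MK_trans[OF 1] by blast
qed

lemma root_of_unity_OK: "x ^ N = 1 \<Longrightarrow> N > 0 \<Longrightarrow> x \<in> OK"
proof -
  assume x: "x ^ N = 1" "N > 0"
  then have "w x ^ N = 1" by (simp flip: w_power)
  then have "w x = 1" using x power_eq_imp_eq_base[of "w x" N 1] by simp
  then show ?thesis using w_le_1_iff[of x] by simp
qed

text \<open>The quotient \<open>z\<close> is congruent to 1. If it were different from 1, the sum of
  its first \<open>N\<close> powers would vanish, yet this sum is congruent to \<open>N\<close>, a
  unit.\<close>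

lemma roots_of_unity_eq_if_MK:
  assumes N: "N > 0" "\<not> res_char dvd N" and x: "x ^ N = 1" and y: "y ^ N = 1" and xy: "x - y \<in> MK"
  shows "x = y"
proof (rule ccontr)
  assume ne: "x \<noteq> y"
  have y0: "y \<noteq> 0" using y N by (auto simp: power_0_left)
  have "inverse y ^ N = 1" using y by (simp add: power_inverse)
  then have iy: "inverse y \<in> OK" using N root_of_unity_OK by blast
  define z where "z = x * inverse y"
  have z: "z ^ N = 1" using x y by (simp add: z_def power_mult_distrib power_inverse)
  have z1: "z - 1 \<in> MK" using MK_mult'[OF xy iy] y0 by (simp add: z_def left_diff_distrib)
  have "z \<noteq> 1" using ne y0 by (auto simp: z_def field_simps)
  have zOK: "z \<in> OK" using z N root_of_unity_OK by blast
  have "z ^ N - 1 = (z - 1) * (\<Sum>i<N. z ^ i)" by (rule power_diff_1_eq)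
  then have s0: "(\<Sum>i<N. z ^ i) = 0" using z \<open>z \<noteq> 1\<close> by simp
  have "(\<Sum>i<N. z ^ i - 1) \<in> MK"
    using power_diff_MK[OF zOK OK.one_mem z1] by (intro MK_sum) simp
  then have "- of_nat N \<in> MK" using s0 by (simp add: sum_subtractf)
  then have "of_nat N \<in> MK" using MK_minus by fastforce
  then show False using N(2) of_nat_mem_MK_iff by blast
qed

text \<open>A Teichmueller lift: X^N - 1 splits in the closure into linear factors, and its value at
  \<open>x\<close> lies in a prime ideal, so one of the factors does.\<close>

lemma root_of_unity_lift:
  assumes x: "x \<in> OK" "x ^ N - 1 \<in> MK" and N: "N > 0"
  shows "\<exists>\<zeta>. \<zeta> ^ N = 1 \<and> x - \<zeta> \<in> MK"
proof -
  let ?p = "Polynomial.monom (1::'l alg_closure) N - 1"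
  have c: "poly.coeff ?p N = 1" using N by simp
  then have nz: "?p \<noteq> 0" by (metis coeff_0 zero_neq_one)
  have "degree ?p \<le> N" by (intro degree_diff_le) (auto simp: degree_monom_le)
  then have "degree ?p = N" using c by (simp add: le_antisym le_degree)
  then have lead: "Polynomial.lead_coeff ?p = 1" using c by simp
  obtain A where A: "?p = smult (Polynomial.lead_coeff ?p) (\<Prod>a\<in>#A. [:- a, 1:])"
    using alg_closed_imp_factorization[OF nz] by blast
  have pA: "y ^ N - 1 = (\<Prod>a\<in>#A. y - a)" for y
  proof -
    have "poly ?p y = (\<Prod>a\<in>#A. y - a)" by (subst A) (simp only: lead poly_smult poly_prod_mset, simp add: image_mset.compositionality comp_def)
    then show ?thesis by (simp add: poly_monom)
  qed
  have r: "a ^ N = 1" if "a \<in># A" for a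
  proof -
    have "(\<Prod>b\<in>#A. a - b) = 0" using that by (intro prod_mset_zero_iff[THEN iffD2]) auto
    then have "a ^ N - 1 = 0" unfolding pA .
    then show ?thesis by simp
  qed
  then have "x - a \<in> OK" if "a \<in># A" for a
    using that N x root_of_unity_OK OK.diff_mem by blast
  then obtain a where "a \<in># A" "x - a \<in> MK"
    using MK_prod_mset[of A "\<lambda>a. x - a"] x(2) unfolding pA by blast
  then show ?thesis using r by blast
qed

lemma finite_residue_representatives:
  "\<exists>h. finite (h ` local_integers v) \<and> (\<forall>a. v a \<le> 1 \<longrightarrow> v (h a) \<le> 1 \<and> v (a - h a) < 1)"
proof -
  define g where "g = (\<lambda>C. SOME a. v a \<le> 1 \<and> residue_class a = C)"
  define h where "h = (\<lambda>a. g (residue_class a))"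
  have h: "v (h a) \<le> 1 \<and> residue_class (h a) = residue_class a" if "v a \<le> 1" for a
    unfolding h_def g_def by (rule someI[of _ a]) (use that in simp)
  have "h ` local_integers v = g ` carrier residue_ring"
    unfolding h_def carrier_residue_ring image_image ..
  then have "finite (h ` local_integers v)" using finite_residue by simp
  moreover have "v (a - h a) < 1" if "v a \<le> 1" for a
    using h[OF that] residue_class_eq_iff[of a "h a"] that by metis
  ultimately show ?thesis using h by blast
qed

text \<open>The ring generated by \<open>x\<close> is a finite module, so its image modulo the
  maximal ideal is finite and two powers of \<open>x\<close> are congruent. A factor
  \<open>res_char\<close> of the exponent can be removed, because raising to that power is additive
  on residues and the ideal is prime.\<close>

lemma ex_power_eq_one_MK:
  assumes x: "x \<in> OK" "x \<notin> MK"
  shows "\<exists>N>0. \<not> res_char dvd N \<and> x ^ N - 1 \<in> MK"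
proof -
  obtain n where n: "n > 0" "x ^ n \<in> rspan acO ((\<lambda>i. x ^ i) ` {..<n})"
    using power_mem_rspan[OF x(1)] by blast
  define B where "B = (\<lambda>i. x ^ i) ` {..<n}"
  have B: "finite B" "B \<subseteq> OK" using x by (auto simp: B_def OK.power_mem)
  have span: "x ^ k \<in> rspan acO B" for k
  proof (induction k)
    case 0
    have "1 \<in> B" unfolding B_def using n by (intro image_eqI[of _ _ 0]) auto
    then show ?case using B by (simp add: acO.rspan_base)
  next
    case (Suc k)
    have "x * b \<in> rspan acO B" if b: "b \<in> B" for b
    proof -
      obtain i where i: "b = x ^ i" "i < n" using b by (auto simp: B_def)
      show ?thesis
      proof (cases "Suc i < n")
        case True
        then have "x ^ Suc i \<in> B" unfolding B_def by blast
        then show ?thesis using B acO.rspan_base i by simp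
      next
        case False
        then have "Suc i = n" using i by simp
        then show ?thesis using n(2) i by (auto simp: B_def)
      qed
    qed
    from acO.rspan_mult[OF acO.rspan_base[of "{x}" x] Suc, of B] this show ?case by simp
  qed
  obtain h where h: "finite (h ` local_integers v)" "\<And>a. v a \<le> 1 \<Longrightarrow> v (h a) \<le> 1 \<and> v (a - h a) < 1"
    using finite_residue_representatives by blast
  \<comment> \<open>Combinations whose coefficients are chosen representatives of residues: a finite
    set that meets the residue of every power of \<open>x\<close>.\<close>
  define Y where "Y = (\<lambda>c. \<Sum>b\<in>B. to_ac (c b) * b) ` (B \<rightarrow>\<^sub>E h ` local_integers v)"
  have "finite Y" unfolding Y_def by (rule finite_imageI) (rule finite_PiE[OF B(1) h(1)])
  have "\<exists>y\<in>Y. x ^ k - y \<in> MK" for k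
  proof -
    obtain c where c: "x ^ k = (\<Sum>b\<in>B. c b * b)" "\<forall>b\<in>B. c b \<in> acO" using span[of k] by (auto simp: rspan_def)
    then obtain d where d: "\<forall>b\<in>B. v (d b) \<le> 1 \<and> c b = to_ac (d b)"
      using bchoice[of B "\<lambda>b a. v a \<le> 1 \<and> c b = to_ac a"] by (auto simp: local_integers_def)
    define y where "y = (\<Sum>b\<in>B. to_ac (h (d b)) * b)"
    have "y = (\<Sum>b\<in>B. to_ac ((\<lambda>b\<in>B. h (d b)) b) * b)" by (simp add: y_def)
    then have "y \<in> Y" unfolding Y_def using d
      by (intro image_eqI[of _ _ "\<lambda>b\<in>B. h (d b)"]) (auto simp: local_integers_def)
    moreover have "x ^ k - y = (\<Sum>b\<in>B. to_ac (d b - h (d b)) * b)"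
      using d by (simp add: c(1) y_def left_diff_distrib sum_subtractf)
    then have "x ^ k - y \<in> MK"
      using d h(2) B by (auto simp del: to_ac_diff intro!: MK_sum MK_mult' simp: to_ac_mem_MK_iff)
    ultimately show ?thesis by blast
  qed
  then obtain f where f: "\<And>k. f k \<in> Y" "\<And>k. x ^ k - f k \<in> MK" by metis
  have "\<not> inj f"
  proof
    assume "inj f"
    moreover have "finite (range f)" using f(1) \<open>finite Y\<close> by (meson finite_subset image_subsetI)
    ultimately show False using finite_imageD infinite_UNIV_nat by blast
  qed
  then obtain k l where kl: "k < l" "f k = f l" unfolding inj_def by (metis linorder_neqE_nat)
  have "x ^ l - x ^ k \<in> MK" using MK_trans[OF f(2) MK_sym[OF f(2)[of k, unfolded kl(2)]]] .
  moreover have "x ^ l - x ^ k = x ^ k * (x ^ (l - k) - 1)"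
    using kl(1) by (simp add: right_diff_distrib flip: power_add)
  ultimately have "x ^ k * (x ^ (l - k) - 1) \<in> MK" by simp
  then have "x ^ k \<in> MK \<or> x ^ (l - k) - 1 \<in> MK"
    using x by (intro MK_prime OK.power_mem OK.diff_mem OK.one_mem)
  then have N0: "x ^ (l - k) - 1 \<in> MK" using x MK_power by blast
  have "\<exists>N>0. \<not> res_char dvd N \<and> x ^ N - 1 \<in> MK" if "M > 0" "x ^ M - 1 \<in> MK" for M
    using that
  proof (induction M rule: less_induct)
    case (less M)
    show ?case
    proof (cases "res_char dvd M")
      case True
      then obtain L where L: "M = res_char * L" by blast
      have p1: "res_char > 1" using prime_gt_1_nat[OF prime_res_char] .
      have L0: "L > 0" "L < M" using L less.prems p1 by (auto intro: Nat.gr0I)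
      have y: "x ^ L \<in> OK" "x ^ L - 1 \<in> OK" using x by (auto intro: OK.power_mem OK.diff_mem OK.one_mem)
      have "(x ^ L - 1 + 1) ^ (res_char ^ 1) - ((x ^ L - 1) ^ (res_char ^ 1) + 1 ^ (res_char ^ 1)) \<in> MK"
        by (rule power_char_add_MK[OF y(2) OK.one_mem])
      then have "x ^ M - ((x ^ L - 1) ^ res_char + 1) \<in> MK" by (simp add: L mult.commute power_mult)
      from MK_diff[OF less.prems(2) this] have "(x ^ L - 1) ^ res_char \<in> MK" by simp
      then have "x ^ L - 1 \<in> MK" using MK_power y(2) by blast
      then show ?thesis using less.IH L0 by blast
    qed (use less.prems in blast)
  qed
  from this[OF _ N0] kl(1) show ?thesis by simp
qed

text \<open>The minimal polynomial at \<open>z ^ q\<close> is congruent to the \<open>q\<close>-th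
  power of its value at \<open>z\<close>, that is to zero. Hence \<open>z ^ q\<close> is congruent
  to a conjugate of \<open>z\<close>; both are roots of unity of order prime to the residue
  characteristic, so they are equal.\<close>

lemma frobenius_on_root_of_unity:
  fixes z :: "'l alg_closure"
  assumes N: "N > 0" "\<not> res_char dvd N" and z: "z ^ N = 1"
  shows "\<exists>\<sigma>\<in>Gal. \<sigma> z = z ^ q"
proof -
  have zOK: "z \<in> OK" using root_of_unity_OK[OF z N(1)] .
  let ?f = "min_poly z"
  have f: "cbound 1 ?f" using zOK closure_integers_iff_min_poly by blast
  have "aeval ?f z ^ (q ^ 1) - aeval ?f (z ^ (q ^ 1)) \<in> MK" by (rule aeval_power_q_MK[OF f zOK])
  then have "- aeval ?f (z ^ q) \<in> MK" using q_pos by (simp add: power_0_left)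
  then have fM: "aeval ?f (z ^ q) \<in> MK" using MK_minus by fastforce
  let ?p = "map_poly to_ac ?f"
  have lead: "Polynomial.lead_coeff ?p = 1" using lead_coeff_min_poly[of z]
    by (simp add: degree_map_poly coeff_map_poly)
  then have nz: "?p \<noteq> 0" by auto
  obtain A where A: "?p = smult (Polynomial.lead_coeff ?p) (\<Prod>a\<in>#A. [:- a, 1:])"
    using alg_closed_imp_factorization[OF nz] by blast
  have pA: "aeval ?f y = (\<Prod>a\<in>#A. y - a)" for y
    unfolding aeval_def by (subst A) (simp add: lead poly_prod_mset)
  have r: "\<exists>\<sigma>\<in>Gal. \<sigma> z = a" if "a \<in># A" for a
  proof -
    have "(\<Prod>b\<in>#A. a - b) = 0" using that by (intro prod_mset_zero_iff[THEN iffD2]) auto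
    then have "aeval ?f a = 0" unfolding pA .
    then show ?thesis by (rule conjugate_if_root)
  qed
  have aOK: "z ^ q - a \<in> OK" if "a \<in># A" for a
    using r[OF that] zOK gal_mem_OK by (auto intro!: OK.diff_mem OK.power_mem)
  obtain a where a: "a \<in># A" "z ^ q - a \<in> MK"
    using MK_prod_mset[of A "\<lambda>a. z ^ q - a"] fM aOK unfolding pA by blast
  obtain \<sigma> where s: "\<sigma> \<in> Gal" "\<sigma> z = a" using r[OF a(1)] by blast
  have "a ^ N = 1" using s z by (metis gal_1 gal_power)
  moreover have "(z ^ q) ^ N = 1" using z by (metis mult.commute power_mult power_one)
  ultimately have "z ^ q = a" using roots_of_unity_eq_if_MK[OF N _ _ a(2)] by blast
  then show ?thesis using s by blast
qed

text \<open>A common exponent \<open>N\<close> serves all units in \<open>Y\<close>. An automorphism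
  raising a primitive \<open>N\<close>-th root of unity to its \<open>q\<close>-th power does the
  same to all \<open>N\<close>-th roots of unity, and these represent the residues of those
  units.\<close>

lemma frobenius_on_finite_set:
  assumes X: "finite Y" "Y \<subseteq> OK"
  shows "\<exists>\<sigma>\<in>Gal. \<forall>x\<in>Y. \<sigma> x - x ^ q \<in> MK"
proof -
  have "\<exists>N>0. \<not> res_char dvd N \<and> (\<forall>x\<in>Y - MK. x ^ N - 1 \<in> MK)"
    using X
  proof (induction Y)
    case empty
    have "\<not> res_char dvd 1" using prime_res_char by (simp add: prime_nat_iff)
    then show ?case by (intro exI[of _ 1]) auto
  next
    case (insert x Y)
    then obtain N where N: "N > 0" "\<not> res_char dvd N" "\<forall>x\<in>Y - MK. x ^ N - 1 \<in> MK" by auto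
    have mult: "y ^ (N * M) - 1 \<in> MK" if "y \<in> OK" "y ^ N - 1 \<in> MK" for y N M
      using power_diff_MK[OF OK.power_mem[OF that(1)] OK.one_mem that(2), of M] by (simp add: power_mult)
    show ?case
    proof (cases "x \<in> MK")
      case True
      then show ?thesis using N by (intro exI[of _ N]) auto
    next
      case False
      then obtain M where M: "M > 0" "\<not> res_char dvd M" "x ^ M - 1 \<in> MK"
        using ex_power_eq_one_MK insert.prems by blast
      have "\<not> res_char dvd N * M" using N(2) M(2) prime_dvd_mult_iff[OF prime_res_char] by blast
      moreover have "y ^ (N * M) - 1 \<in> MK" if "y \<in> insert x Y - MK" for y
      proof (cases "y = x")
        case True
        then show ?thesis using mult[of x M N] M insert.prems by (simp add: mult.commute)
      next
        case False
        then show ?thesis using mult[of y N M] N(3) insert.prems that by auto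
      qed
      ultimately show ?thesis using N(1) M(1) by (intro exI[of _ "N * M"]) auto
    qed
  qed
  then obtain N where N: "N > 0" "\<not> res_char dvd N" "\<And>x. x \<in> Y \<Longrightarrow> x \<notin> MK \<Longrightarrow> x ^ N - 1 \<in> MK" by auto
  obtain \<zeta> :: "'l alg_closure" where \<zeta>: "\<And>i. \<zeta> ^ i = 1 \<longleftrightarrow> N dvd i"
    using ex_primitive_root_of_unity[OF N(1) char_0] by blast
  have \<zeta>N: "\<zeta> ^ N = 1" using \<zeta> by simp
  obtain \<sigma> where s: "\<sigma> \<in> Gal" "\<sigma> \<zeta> = \<zeta> ^ q" using frobenius_on_root_of_unity[OF N(1,2) \<zeta>N] by blast
  have "\<sigma> x - x ^ q \<in> MK" if x: "x \<in> Y" for x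
  proof (cases "x \<in> MK")
    case True
    then have "\<sigma> x \<in> MK" using gal_mem_MK_iff[OF s(1)] by blast
    moreover have "x ^ q \<in> MK"
      using True MK_mult'[of x "x ^ (q - 1)"] MK_imp_OK OK.power_mem q_pos by (metis power_eq_if neq0_conv)
    ultimately show ?thesis by (rule MK_diff)
  next
    case False
    have xO: "x \<in> OK" using x X by blast
    obtain \<xi> where \<xi>: "\<xi> ^ N = 1" "x - \<xi> \<in> MK" using root_of_unity_lift[OF xO N(3)[OF x False] N(1)] by blast
    obtain i where i: "\<xi> = \<zeta> ^ i" using root_of_unity_is_power[OF N(1) \<zeta> \<xi>(1)] by blast
    have "\<sigma> \<xi> = \<xi> ^ q" using s by (simp add: i gal_power mult.commute flip: power_mult)
    have "\<sigma> (x - \<xi>) \<in> MK" using \<xi>(2) gal_mem_MK_iff[OF s(1)] by blast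
    then have 1: "\<sigma> x - \<xi> ^ q \<in> MK" using \<open>\<sigma> \<xi> = \<xi> ^ q\<close> by (simp add: gal_diff[OF s(1)])
    have "\<xi> ^ q - x ^ q \<in> MK"
      using root_of_unity_OK[OF \<xi>(1) N(1)] xO MK_sym[OF \<xi>(2)] by (intro power_diff_MK)
    from MK_trans[OF 1 this] show ?thesis .
  qed
  with s show ?thesis by blast
qed

text \<open>The condition at a single integer is closed and finitely many conditions are compatible,
  so compactness of the Galois group supplies one automorphism for all of them.\<close>

lemma frobenius_nonempty: "frobenius v \<noteq> {}"
proof -
  define C where "C = (\<lambda>x. Gal \<inter> {\<sigma>. \<sigma> x - x ^ q \<in> MK})"
  have closed: "closedin krull_topology (C x)" for x
    unfolding C_def by (intro closedin_krull_pointwise exI[of _ "{x}"]) auto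
  have fin: "\<Inter>\<F> \<noteq> {}" if F: "finite \<F>" "\<F> \<subseteq> C ` OK" for \<F>
  proof -
    obtain Y where Y: "Y \<subseteq> OK" "finite Y" "\<F> = C ` Y" using finite_subset_image[OF F] by blast
    obtain \<sigma> where "\<sigma> \<in> Gal" "\<forall>x\<in>Y. \<sigma> x - x ^ q \<in> MK" using frobenius_on_finite_set[OF Y(2,1)] by blast
    then have "\<sigma> \<in> \<Inter>\<F>" unfolding Y(3) C_def by blast
    then show ?thesis by blast
  qed
  have "\<Inter>(C ` OK) \<noteq> {}"
    using compact_krull[unfolded compact_space_fip, rule_format, of "C ` OK"] closed fin by blast
  then obtain \<sigma> where \<sigma>: "\<forall>x\<in>OK. \<sigma> \<in> C x" by blast
  moreover have "\<sigma> \<in> Gal" using \<sigma> OK.one_mem by (auto simp: C_def)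
  ultimately have "\<sigma> \<in> frobenius v" by (auto simp: frobenius_def C_def)
  then show ?thesis by blast
qed

end

section \<open>The Weil monoid\<close>

context local_field
begin

text \<open>One predicate for inertia in degree 0, Frobenius elements in degree 1 and, over all
  degrees, the Weil monoid.\<close>

definition deg_is :: "('l alg_closure \<Rightarrow> 'l alg_closure) \<Rightarrow> nat \<Rightarrow> bool" where
  "deg_is \<sigma> n \<longleftrightarrow> \<sigma> \<in> Gal \<and> (\<forall>x\<in>OK. \<sigma> x - x ^ (q ^ n) \<in> MK)"

lemma deg_is_Gal: "deg_is \<sigma> n \<Longrightarrow> \<sigma> \<in> Gal" by (simp add: deg_is_def)

lemma deg_isD: "deg_is \<sigma> n \<Longrightarrow> x \<in> OK \<Longrightarrow> \<sigma> x - x ^ (q ^ n) \<in> MK" by (simp add: deg_is_def)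

lemma inertia_iff: "\<sigma> \<in> inertia v \<longleftrightarrow> deg_is \<sigma> 0"
  by (simp add: inertia_def deg_is_def)

lemma frobenius_iff: "\<sigma> \<in> frobenius v \<longleftrightarrow> deg_is \<sigma> 1"
  by (simp add: frobenius_def deg_is_def)

lemma deg_is_id: "deg_is id 0"
  by (simp add: deg_is_def gal_id zero_mem_MK)

lemma deg_is_comp: assumes "deg_is \<sigma> n" "deg_is \<tau> m" shows "deg_is (\<sigma> \<circ> \<tau>) (n + m)"
  unfolding deg_is_def
proof (intro conjI ballI)
  fix x assume x: "x \<in> OK"
  have tx: "\<tau> x \<in> OK" using gal_mem_OK deg_is_Gal[OF assms(2)] x by blast
  have "\<sigma> (\<tau> x) - \<tau> x ^ (q ^ n) \<in> MK" using deg_isD[OF assms(1) tx] .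
  moreover have "\<tau> x ^ (q ^ n) - (x ^ (q ^ m)) ^ (q ^ n) \<in> MK"
    using deg_isD[OF assms(2) x] tx x by (intro power_diff_MK OK.power_mem)
  ultimately have "\<sigma> (\<tau> x) - (x ^ (q ^ m)) ^ (q ^ n) \<in> MK" by (rule MK_trans)
  then show "(\<sigma> \<circ> \<tau>) x - x ^ (q ^ (n + m)) \<in> MK"
    by (simp add: power_add mult.commute flip: power_mult)
qed (intro gal_comp deg_is_Gal[OF assms(1)] deg_is_Gal[OF assms(2)])

lemma deg_is_cancel_left:
  assumes "deg_is (\<sigma> \<circ> \<tau>) (n + m)" "deg_is \<sigma> n" "\<tau> \<in> Gal"
  shows "deg_is \<tau> m"
  unfolding deg_is_def
proof (intro conjI ballI)
  fix x assume x: "x \<in> OK"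
  have s: "\<sigma> \<in> Gal" using assms(2) by (rule deg_is_Gal)
  have "\<sigma> (x ^ (q ^ m)) - (x ^ (q ^ m)) ^ (q ^ n) \<in> MK"
    using deg_isD[OF assms(2) OK.power_mem[OF x]] .
  then have "\<sigma> (x ^ (q ^ m)) - x ^ (q ^ (n + m)) \<in> MK"
    by (simp add: power_add mult.commute flip: power_mult)
  moreover have "\<sigma> (\<tau> x) - x ^ (q ^ (n + m)) \<in> MK" using deg_isD[OF assms(1) x] by simp
  ultimately have "\<sigma> (\<tau> x) - \<sigma> (x ^ (q ^ m)) \<in> MK" using MK_trans MK_sym by blast
  then have "\<sigma> (\<tau> x - x ^ (q ^ m)) \<in> MK" by (simp add: gal_diff[OF s])
  then show "\<tau> x - x ^ (q ^ m) \<in> MK" using gal_mem_MK_iff[OF s] by blast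
qed (fact assms(3))

lemma deg_is_cancel_right:
  assumes "deg_is (\<sigma> \<circ> \<tau>) (n + m)" "deg_is \<tau> m" "\<sigma> \<in> Gal"
  shows "deg_is \<sigma> n"
  unfolding deg_is_def
proof (intro conjI ballI)
  fix x assume x: "x \<in> OK"
  have t: "\<tau> \<in> Gal" using assms(2) by (rule deg_is_Gal)
  define y where "y = inv' \<tau> x"
  have ty: "\<tau> y = x" using gal_inv_cancel(1)[OF t] by (simp add: y_def)
  have y: "y \<in> OK" using x gal_mem_OK_iff[OF t] ty by blast
  have "x - y ^ (q ^ m) \<in> MK" using deg_isD[OF assms(2) y] ty by simp
  then have "x ^ (q ^ n) - (y ^ (q ^ m)) ^ (q ^ n) \<in> MK" using x y by (intro power_diff_MK OK.power_mem)
  then have "x ^ (q ^ n) - y ^ (q ^ (n + m)) \<in> MK"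
    by (simp add: power_add mult.commute flip: power_mult)
  moreover have "\<sigma> x - y ^ (q ^ (n + m)) \<in> MK" using deg_isD[OF assms(1) y] ty by simp
  ultimately show "\<sigma> x - x ^ (q ^ n) \<in> MK" using MK_trans MK_sym by blast
qed (fact assms(3))

lemma gal_comp_inv:
  assumes "\<sigma> \<in> Gal"
  shows "\<sigma> \<circ> inv' \<sigma> = id" "inv' \<sigma> \<circ> \<sigma> = id"
  using gal_inv_cancel[OF assms] by auto

lemma deg_is_inertia_inv: "deg_is u 0 \<Longrightarrow> deg_is (inv' u) 0"
  using deg_is_cancel_left[of u "inv' u" 0 0] deg_is_id gal_comp_inv[of u] gal_inv[of u] deg_is_Gal[of u 0]
  by simp

lemma deg_is_conj:
  assumes "\<tau> \<in> Gal" "deg_is \<sigma> n"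
  shows "deg_is (\<tau> \<circ> \<sigma> \<circ> inv' \<tau>) n"
  unfolding deg_is_def
proof (intro conjI ballI)
  fix x assume x: "x \<in> OK"
  define y where "y = inv' \<tau> x"
  have ty: "\<tau> y = x" using gal_inv_cancel(1)[OF assms(1)] by (simp add: y_def)
  have y: "y \<in> OK" using x gal_mem_OK_iff[OF assms(1)] ty by blast
  have "\<tau> (\<sigma> y - y ^ (q ^ n)) \<in> MK" using deg_isD[OF assms(2) y] gal_mem_MK_iff[OF assms(1)] by blast
  then show "(\<tau> \<circ> \<sigma> \<circ> inv' \<tau>) x - x ^ (q ^ n) \<in> MK"
    using ty by (simp add: gal_diff[OF assms(1)] gal_power[OF assms(1)] flip: y_def)
qed (intro gal_comp gal_inv assms(1) deg_is_Gal[OF assms(2)])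

text \<open>With \<open>d\<close> the difference of the two degrees, take a root \<open>x\<close> of
  X^(q^d) = 1 + X. Two degrees for \<open>\<sigma>\<close> would make the powers of \<open>x\<close>
  with exponents \<open>q ^ n\<close> and \<open>q ^ m\<close> congruent, but they differ by 1
  modulo the maximal ideal.\<close>

lemma deg_is_unique: assumes "deg_is \<sigma> n" "deg_is \<sigma> m" shows "n = m"
proof (rule ccontr)
  have key: False if nm: "deg_is \<sigma> n" "deg_is \<sigma> m" "n < m" for n m
  proof -
    define d where "d = m - n"
    have d: "d > 0" "m = d + n" using nm by (auto simp: d_def)
    let ?p = "Polynomial.monom 1 (q ^ d) - [:1, 1:] :: 'l alg_closure poly"
    have qd: "1 < q ^ d" by (rule one_less_power[OF q_gt_1 d(1)])
    have c0: "poly.coeff [:1, 1:] (q ^ d) = (0 :: 'l)" "poly.coeff [:1, 1:] (q ^ d) = (0 :: 'l alg_closure)"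
      by (rule coeff_eq_0, rule le_less_trans[OF _ qd], simp)+
    have "poly.coeff ?p (q ^ d) \<noteq> 0"
      by (simp only: coeff_diff c0 coeff_monom) simp
    then have "q ^ d \<le> degree ?p" by (rule le_degree)
    then have "degree ?p > 0" using qd by linarith
    then obtain x where "poly ?p x = 0" using alg_closed_imp_poly_has_root by blast
    then have x: "x ^ (q ^ d) = 1 + x" by (simp add: poly_monom)
    have xO: "x \<in> OK"
    proof -
      let ?f = "Polynomial.monom 1 (q ^ d) - [:1, 1:] :: 'l poly"
      have "poly.coeff ?f (q ^ d) = 1" by (simp only: coeff_diff c0 coeff_monom) simp
      moreover have "degree ?f \<le> q ^ d" using qd by (intro degree_diff_le) (auto simp: degree_monom_le)
      ultimately have "degree ?f = q ^ d" by (simp add: le_antisym le_degree)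
      then have "Polynomial.lead_coeff ?f = 1" using \<open>poly.coeff ?f (q ^ d) = 1\<close> by simp
      moreover have "cbound 1 ?f"
        by (intro cbound_diff cbound_monom) (auto simp: cbound_def coeff_pCons split: nat.split)
      moreover have "aeval ?f x = 0" using x by simp
      ultimately show ?thesis unfolding closure_integers_iff by blast
    qed
    have "x ^ (q ^ n) - x ^ (q ^ m) \<in> MK"
      using MK_trans[OF MK_sym[OF deg_isD[OF nm(1) xO]] deg_isD[OF nm(2) xO]] .
    then have "x ^ (q ^ n) - (x ^ (q ^ d)) ^ (q ^ n) \<in> MK" by (simp add: d power_add flip: power_mult)
    then have 1: "x ^ (q ^ n) - (1 + x) ^ (q ^ n) \<in> MK" by (simp add: x)
    have "(1 + x) ^ (q ^ n) - (1 ^ (q ^ n) + x ^ (q ^ n)) \<in> MK"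
      by (rule power_q_power_add_MK[OF OK.one_mem xO])
    from MK_add[OF 1 this] have "- 1 \<in> MK" by simp
    then show False using MK_minus one_notin_MK by fastforce
  qed
  assume "n \<noteq> m"
  then show False using key[of n m] key[of m n] assms by (cases "n < m") auto
qed

definition frob :: "'l alg_closure \<Rightarrow> 'l alg_closure" where "frob = (SOME \<phi>. deg_is \<phi> 1)"

lemma deg_is_frob: "deg_is frob 1"
  unfolding frob_def using frobenius_nonempty by (intro someI_ex[of "\<lambda>\<phi>. deg_is \<phi> 1"]) (auto simp: frobenius_iff)

lemma deg_is_frob_power: "deg_is (frob ^^ n) n"
proof (induction n)
  case (Suc n)
  from deg_is_comp[OF deg_is_frob this] show ?case by (simp only: funpow.simps plus_1_eq_Suc)
qed (simp add: deg_is_id flip: id_def)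

lemma normal_inertia: "inertia v \<lhd> (galois_group :: ('l alg_closure \<Rightarrow> 'l alg_closure) monoid)"
proof -
  interpret G: group "galois_group :: ('l alg_closure \<Rightarrow> 'l alg_closure) monoid" by (rule group_galois)
  have sub: "subgroup (inertia v) galois_group"
  proof (rule G.subgroupI)
    show "inertia v \<subseteq> Gal" by (auto simp: inertia_def)
    show "inertia v \<noteq> {}" using deg_is_id inertia_iff by blast
  next
    fix u assume "u \<in> inertia v"
    then show "inv\<^bsub>galois_group\<^esub> u \<in> inertia v"
      using deg_is_inertia_inv deg_is_Gal galois_inv_eq unfolding inertia_iff by metis
  next
    fix u u' assume "u \<in> inertia v" "u' \<in> inertia v"
    then show "u \<otimes>\<^bsub>galois_group\<^esub> u' \<in> inertia v" using deg_is_comp[of u 0 u' 0] by (simp add: inertia_iff)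
  qed
  show ?thesis
    unfolding G.normal_inv_iff
  proof (intro conjI ballI sub)
    fix x h :: "'l alg_closure \<Rightarrow> 'l alg_closure" assume "x \<in> Gal" "h \<in> inertia v"
    then show "x \<otimes>\<^bsub>galois_group\<^esub> h \<otimes>\<^bsub>galois_group\<^esub> inv\<^bsub>galois_group\<^esub> x \<in> inertia v"
      using deg_is_conj[of x h 0] by (simp add: inertia_iff galois_inv_eq)
  qed
qed

lemma inertia_coset: assumes "deg_is \<sigma> n" shows "inertia v #>\<^bsub>galois_group\<^esub> \<sigma> = {\<tau>. deg_is \<tau> n}"
proof (intro equalityI subsetI)
  fix \<tau> assume "\<tau> \<in> inertia v #>\<^bsub>galois_group\<^esub> \<sigma>"
  then obtain u where "deg_is u 0" "\<tau> = u \<circ> \<sigma>" by (auto simp: r_coset_def inertia_iff)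
  then show "\<tau> \<in> {\<tau>. deg_is \<tau> n}" using deg_is_comp[OF _ assms, of u 0] by simp
next
  fix \<tau> assume "\<tau> \<in> {\<tau>. deg_is \<tau> n}"
  then have t: "deg_is \<tau> n" by simp
  have s: "\<sigma> \<in> Gal" using assms deg_is_Gal by blast
  have eq: "\<tau> = (\<tau> \<circ> inv' \<sigma>) \<circ> \<sigma>" using gal_comp_inv(2)[OF s] by (simp add: comp_assoc)
  have "deg_is (\<tau> \<circ> inv' \<sigma>) 0"
    using deg_is_cancel_right[of "\<tau> \<circ> inv' \<sigma>" \<sigma> 0 n] eq t assms gal_comp[OF deg_is_Gal[OF t] gal_inv[OF s]]
    by simp
  then show "\<tau> \<in> inertia v #>\<^bsub>galois_group\<^esub> \<sigma>" using eq by (auto simp: r_coset_def inertia_iff)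
qed

lemma frobenius_power:
  "frobenius v [^]\<^bsub>galois_group Mod inertia v\<^esub> n = {\<tau>. deg_is \<tau> (n::nat)}"
proof (induction n)
  case 0
  then show ?case by (auto simp: FactGroup_def inertia_iff)
next
  case (Suc n)
  have "{\<tau>. deg_is \<tau> n} <#>\<^bsub>galois_group\<^esub> frobenius v = {\<tau>. deg_is \<tau> (Suc n)}"
  proof (intro equalityI subsetI)
    fix \<tau> assume "\<tau> \<in> {\<tau>. deg_is \<tau> n} <#>\<^bsub>galois_group\<^esub> frobenius v"
    then obtain \<sigma> \<sigma>' where "deg_is \<sigma> n" "deg_is \<sigma>' 1" "\<tau> = \<sigma> \<circ> \<sigma>'"
      by (auto simp: set_mult_def frobenius_iff)
    then show "\<tau> \<in> {\<tau>. deg_is \<tau> (Suc n)}" using deg_is_comp[of \<sigma> n \<sigma>' 1] by simp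
  next
    fix \<tau> assume "\<tau> \<in> {\<tau>. deg_is \<tau> (Suc n)}"
    then have t: "deg_is \<tau> (n + 1)" by simp
    have f: "frob \<in> Gal" using deg_is_frob deg_is_Gal by blast
    have eq: "\<tau> = (\<tau> \<circ> inv' frob) \<circ> frob" using gal_comp_inv(2)[OF f] by (simp add: comp_assoc)
    have "deg_is (\<tau> \<circ> inv' frob) n"
      using deg_is_cancel_right[of "\<tau> \<circ> inv' frob" frob n 1] eq t deg_is_frob
        gal_comp[OF deg_is_Gal[OF t] gal_inv[OF f]] by simp
    then show "\<tau> \<in> {\<tau>. deg_is \<tau> n} <#>\<^bsub>galois_group\<^esub> frobenius v"
      using eq deg_is_frob unfolding set_mult_def frobenius_iff[symmetric] by force
  qed
  with Suc show ?case by (simp add: FactGroup_def)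
qed

lemma weil_monoid_iff: "\<sigma> \<in> weil_monoid v \<longleftrightarrow> (\<exists>n. deg_is \<sigma> n)"
proof
  assume "\<sigma> \<in> weil_monoid v"
  then obtain n :: nat where n: "\<sigma> \<in> Gal" "inertia v #>\<^bsub>galois_group\<^esub> \<sigma> = {\<tau>. deg_is \<tau> n}"
    by (auto simp: weil_monoid_def frobenius_power)
  have "id \<circ> \<sigma> \<in> inertia v #>\<^bsub>galois_group\<^esub> \<sigma>"
    using deg_is_id unfolding r_coset_def inertia_iff[symmetric] galois_group_sel by blast
  then show "\<exists>n. deg_is \<sigma> n" using n by auto
next
  assume "\<exists>n. deg_is \<sigma> n"
  then show "\<sigma> \<in> weil_monoid v"
    by (auto simp: weil_monoid_def frobenius_power inertia_coset deg_is_Gal)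
qed

lemma weil_monoid_subset_group: "weil_monoid v \<subseteq> weil_group v"
proof
  fix \<sigma> assume "\<sigma> \<in> weil_monoid v"
  then obtain n :: nat where n: "\<sigma> \<in> Gal" "inertia v #>\<^bsub>galois_group\<^esub> \<sigma> = frobenius v [^]\<^bsub>galois_group Mod inertia v\<^esub> n"
    by (auto simp: weil_monoid_def)
  have "inertia v #>\<^bsub>galois_group\<^esub> \<sigma> = frobenius v [^]\<^bsub>galois_group Mod inertia v\<^esub> int n"
    unfolding n(2) by (rule int_pow_int[symmetric])
  with n(1) show "\<sigma> \<in> weil_group v" unfolding weil_group_def by blast
qed

lemma weil_group_comp_inertia: assumes "\<sigma> \<in> weil_group v" "u \<in> inertia v" shows "\<sigma> \<circ> u \<in> weil_group v"
proof -
  interpret N: normal "inertia v" "galois_group :: ('l alg_closure \<Rightarrow> 'l alg_closure) monoid" by (rule normal_inertia)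
  have s: "\<sigma> \<in> Gal" using assms(1) unfolding weil_group_def by blast
  have u: "u \<in> Gal" using assms(2) unfolding inertia_def by blast
  have "inertia v #>\<^bsub>galois_group\<^esub> (\<sigma> \<circ> u) = inertia v #>\<^bsub>galois_group\<^esub> \<sigma>"
  proof -
    have "deg_is (\<sigma> \<circ> u \<circ> inv' \<sigma>) 0" using deg_is_conj[OF s, of u 0] assms(2) by (simp add: inertia_iff)
    then have "\<sigma> \<circ> u \<circ> inv' \<sigma> \<in> inertia v" by (simp add: inertia_iff)
    moreover have "\<sigma> \<circ> u = (\<sigma> \<circ> u \<circ> inv' \<sigma>) \<circ> \<sigma>" using gal_comp_inv(2)[OF s] by (simp add: comp_assoc)
    ultimately have "\<sigma> \<circ> u \<in> inertia v #>\<^bsub>galois_group\<^esub> \<sigma>" by (auto simp: r_coset_def)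
    then show ?thesis using N.repr_independence[of "\<sigma> \<circ> u" "inertia v" \<sigma>] s N.subgroup_axioms by simp
  qed
  then show ?thesis using assms(1) gal_comp[OF s u] unfolding weil_group_def by simp
qed

section \<open>Topology of the Weil monoid and of its compactification\<close>

lemma topspace_weil [simp]: "topspace (weil_topology v) = weil_group v"
proof
  show "topspace (weil_topology v) \<subseteq> weil_group v"
    using openin_weil_topology[of v "topspace (weil_topology v)"] by blast
  have "openin (weil_topology v) (weil_group v)"
    unfolding openin_weil_topology
  proof (intro conjI ballI subset_refl)
    fix \<sigma> assume "\<sigma> \<in> weil_group v"
    then have "{u \<in> inertia v. \<sigma> \<circ> u \<in> weil_group v} = topspace (subtopology krull_topology (inertia v))"
      using weil_group_comp_inertia by (auto simp: inertia_def)
    then show "openin (subtopology krull_topology (inertia v)) {u \<in> inertia v. \<sigma> \<circ> u \<in> weil_group v}" by (metis openin_topspace)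
  qed
  then show "weil_group v \<subseteq> topspace (weil_topology v)" by (rule openin_subset)
qed

abbreviation "Wtop \<equiv> subtopology (weil_topology v) (weil_monoid v)"

lemma topspace_Wtop [simp]: "topspace Wtop = weil_monoid v"
  using weil_monoid_subset_group by auto

text \<open>The definition asks for openness at every \<open>u\<close> in every translate by a fixed
  \<open>\<sigma>\<close>. Taking \<open>\<sigma> \<circ> u\<close> as the new base point reduces
  this to neighbourhoods of the identity in inertia.\<close>

lemma openin_Wtop_if_local:
  assumes U: "U \<subseteq> weil_monoid v"
    and loc: "\<And>\<sigma>. \<sigma> \<in> U \<Longrightarrow> \<exists>F. finite F \<and> (\<forall>u\<in>inertia v. (\<forall>x\<in>F. u x = x) \<longrightarrow> \<sigma> \<circ> u \<in> U)"
  shows "openin Wtop U"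
proof -
  have "openin (weil_topology v) U"
    unfolding openin_weil_topology
  proof (intro conjI ballI)
    show "U \<subseteq> weil_group v" using U weil_monoid_subset_group by blast
    fix \<sigma> assume s: "\<sigma> \<in> weil_group v"
    \<comment> \<open>An open subset of the whole Galois group whose trace on inertia is the
      preimage of \<open>U\<close>.\<close>
    define T where "T = {u \<in> Gal. \<exists>u0\<in>inertia v. \<sigma> \<circ> u0 \<in> U \<and> (\<exists>F. finite F \<and> (\<forall>x\<in>F. u x = u0 x) \<and>
        (\<forall>u'\<in>inertia v. (\<forall>x\<in>F. u' x = u0 x) \<longrightarrow> \<sigma> \<circ> u' \<in> U))}"
    have "openin krull_topology T"
      unfolding openin_krull_iff
    proof (intro conjI ballI)
      fix u assume "u \<in> T"
      then obtain u0 F where "u0 \<in> inertia v" "\<sigma> \<circ> u0 \<in> U" "finite F" "\<forall>x\<in>F. u x = u0 x"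
        "\<forall>u'\<in>inertia v. (\<forall>x\<in>F. u' x = u0 x) \<longrightarrow> \<sigma> \<circ> u' \<in> U" by (auto simp: T_def)
      then show "\<exists>F. finite F \<and> (\<forall>\<tau>\<in>Gal. (\<forall>x\<in>F. \<tau> x = u x) \<longrightarrow> \<tau> \<in> T)"
        unfolding T_def by (intro exI[of _ F]) auto
    qed (auto simp: T_def)
    moreover have "{u \<in> inertia v. \<sigma> \<circ> u \<in> U} = T \<inter> inertia v"
    proof (intro equalityI subsetI)
      fix u assume "u \<in> {u \<in> inertia v. \<sigma> \<circ> u \<in> U}"
      then have u: "deg_is u 0" "\<sigma> \<circ> u \<in> U" by (auto simp: inertia_iff)
      obtain F where F: "finite F" "\<forall>u'\<in>inertia v. (\<forall>x\<in>F. u' x = x) \<longrightarrow> (\<sigma> \<circ> u) \<circ> u' \<in> U"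
        using loc[OF u(2)] by blast
      have "\<sigma> \<circ> u' \<in> U" if u': "u' \<in> inertia v" "\<forall>x\<in>F. u' x = u x" for u'
      proof -
        have uG: "u \<in> Gal" using u(1) deg_is_Gal by blast
        have "inv' u \<circ> u' \<in> inertia v"
          using deg_is_comp[OF deg_is_inertia_inv[OF u(1)], of u' 0] u'(1) by (simp add: inertia_iff)
        moreover have "\<forall>x\<in>F. (inv' u \<circ> u') x = x" using u'(2) gal_inv_cancel(2)[OF uG] by simp
        ultimately have "(\<sigma> \<circ> u) \<circ> (inv' u \<circ> u') \<in> U" using F(2) by blast
        moreover have "(\<sigma> \<circ> u) \<circ> (inv' u \<circ> u') = \<sigma> \<circ> u'"
          using gal_inv_cancel(1)[OF uG] by (auto simp: fun_eq_iff)
        ultimately show ?thesis by simp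
      qed
      then have "u \<in> T" unfolding T_def
        using u F(1) deg_is_Gal[OF u(1)]
        by (intro CollectI conjI bexI[of _ u] exI[of _ F]) (auto simp: inertia_iff)
      then show "u \<in> T \<inter> inertia v" using u by (simp add: inertia_iff)
    qed (auto simp: T_def)
    ultimately show "openin (subtopology krull_topology (inertia v)) {u \<in> inertia v. \<sigma> \<circ> u \<in> U}"
      by (auto simp: openin_subtopology)
  qed
  then show ?thesis using U by (auto simp: openin_subtopology)
qed

lemma openin_Wtop_basic:
  assumes "finite F"
  shows "openin Wtop {\<tau>. (\<exists>n\<in>D. deg_is \<tau> n) \<and> (\<forall>x\<in>F. \<tau> x = g x)}"
proof (rule openin_Wtop_if_local)
  fix \<sigma> assume "\<sigma> \<in> {\<tau>. (\<exists>n\<in>D. deg_is \<tau> n) \<and> (\<forall>x\<in>F. \<tau> x = g x)}"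
  then obtain n where n: "n \<in> D" "deg_is \<sigma> n" "\<forall>x\<in>F. \<sigma> x = g x" by blast
  have "deg_is (\<sigma> \<circ> u) n" if "u \<in> inertia v" for u
    using deg_is_comp[OF n(2), of u 0] that by (simp add: inertia_iff)
  then show "\<exists>F'. finite F' \<and> (\<forall>u\<in>inertia v. (\<forall>x\<in>F'. u x = x) \<longrightarrow>
      \<sigma> \<circ> u \<in> {\<tau>. (\<exists>n\<in>D. deg_is \<tau> n) \<and> (\<forall>x\<in>F. \<tau> x = g x)})"
    using n assms by (intro exI[of _ F]) auto
qed (auto simp: weil_monoid_iff)

lemma compact_inertia: "compactin krull_topology (inertia v)"
proof -
  have "inertia v = Gal \<inter> {\<sigma>. \<forall>x\<in>OK. \<sigma> x - x \<in> MK}" by (auto simp: inertia_def)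
  moreover have "closedin krull_topology (Gal \<inter> {\<sigma>. \<forall>x\<in>OK. \<sigma> x - x \<in> MK})"
  proof (rule closedin_krull_pointwise)
    fix \<sigma> :: "'l alg_closure \<Rightarrow> 'l alg_closure"
    assume "\<sigma> \<notin> {\<sigma>. \<forall>x\<in>OK. \<sigma> x - x \<in> MK}"
    then obtain x where x: "x \<in> OK" "\<sigma> x - x \<notin> MK" by blast
    show "near Gal \<sigma> (- {\<sigma>. \<forall>x\<in>OK. \<sigma> x - x \<in> MK})"
    proof (intro exI conjI ballI impI)
      show "finite {x}" by simp
      fix \<tau> assume "\<forall>y\<in>{x}. \<tau> y = \<sigma> y"
      then have "\<tau> x - x \<notin> MK" using x(2) by simp
      then show "\<tau> \<in> - {\<sigma>. \<forall>x\<in>OK. \<sigma> x - x \<in> MK}"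
        using x(1) by (intro ComplI) (drule CollectD, drule bspec, assumption, simp)
    qed
  qed
  ultimately show ?thesis using compact_krull closedin_compact_space by metis
qed

text \<open>The elements of degree \<open>n\<close> are a continuous translate of the compact
  inertia group by \<open>frob ^^ n\<close>.\<close>

lemma compact_Wtop_deg: "compactin Wtop {\<tau>. deg_is \<tau> n}"
proof -
  let ?\<rho> = "frob ^^ n"
  have \<rho>: "deg_is ?\<rho> n" by (rule deg_is_frob_power)
  have \<rho>G: "?\<rho> \<in> Gal" using \<rho> deg_is_Gal by blast
  have \<rho>W: "?\<rho> \<in> weil_group v" using \<rho> weil_monoid_iff weil_monoid_subset_group by blast
  have comp: "deg_is (?\<rho> \<circ> u) n" if "u \<in> inertia v" for u
    using deg_is_comp[OF \<rho>, of u 0] that by (simp add: inertia_iff)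
  have "continuous_map (subtopology krull_topology (inertia v)) Wtop (\<lambda>u. ?\<rho> \<circ> u)"
    unfolding continuous_map_def
  proof (intro conjI allI impI)
    have "?\<rho> \<circ> u \<in> weil_monoid v" if "u \<in> inertia v" for u
      using comp[OF that] unfolding weil_monoid_iff by blast
    then show "(\<lambda>u. ?\<rho> \<circ> u) \<in> topspace (subtopology krull_topology (inertia v)) \<rightarrow> topspace Wtop"
      unfolding topspace_Wtop by simp
    fix U assume "openin Wtop U"
    then obtain T where T: "openin (weil_topology v) T" "U = T \<inter> weil_monoid v" by (auto simp: openin_subtopology)
    have "{u \<in> topspace (subtopology krull_topology (inertia v)). ?\<rho> \<circ> u \<in> U} = {u \<in> inertia v. ?\<rho> \<circ> u \<in> T}"
      using comp T(2) by (auto simp: weil_monoid_iff inertia_def)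
    then show "openin (subtopology krull_topology (inertia v))
        {u \<in> topspace (subtopology krull_topology (inertia v)). ?\<rho> \<circ> u \<in> U}"
      using T(1) \<rho>W unfolding openin_weil_topology by simp
  qed
  moreover have "compactin (subtopology krull_topology (inertia v)) (inertia v)"
    using compact_inertia by (simp add: compactin_subtopology)
  ultimately have "compactin Wtop ((\<lambda>u. ?\<rho> \<circ> u) ` inertia v)" by (rule image_compactin[rotated])
  moreover have "(\<lambda>u. ?\<rho> \<circ> u) ` inertia v = {\<tau>. deg_is \<tau> n}"
  proof (intro equalityI subsetI)
    fix \<tau> assume "\<tau> \<in> {\<tau>. deg_is \<tau> n}"
    then have t: "deg_is \<tau> n" by simp
    have eq: "\<tau> = ?\<rho> \<circ> (inv' ?\<rho> \<circ> \<tau>)" using gal_comp_inv(1)[OF \<rho>G] by (simp flip: comp_assoc)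
    have "deg_is (inv' ?\<rho> \<circ> \<tau>) 0"
      using deg_is_cancel_left[of ?\<rho> "inv' ?\<rho> \<circ> \<tau>" n 0] eq t \<rho> gal_comp[OF gal_inv[OF \<rho>G] deg_is_Gal[OF t]]
      by simp
    then show "\<tau> \<in> (\<lambda>u. ?\<rho> \<circ> u) ` inertia v" using eq inertia_iff by blast
  qed (use comp in auto)
  ultimately show ?thesis by simp
qed

text \<open>The elements of degree below \<open>N\<close> form a finite union of compact cosets,
  closed in the Weil monoid; the complement is therefore a neighbourhood of the added point.
  Approaching zero includes growing degree.\<close>

lemma openin_Q_large_degree: "openin (Q_topology v) (insert None (Some ` {\<tau>. \<exists>n\<ge>N. deg_is \<tau> n}))"
proof -
  let ?C = "{\<tau>. \<exists>n<N. deg_is \<tau> n}" and ?D = "{\<tau>. \<exists>n\<ge>N. deg_is \<tau> n}"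
  have "compactin Wtop (\<Union>n<N. {\<tau>. deg_is \<tau> n})" by (intro compactin_Union) (auto intro: compact_Wtop_deg)
  moreover have "(\<Union>n<N. {\<tau>. deg_is \<tau> n}) = ?C" by auto
  ultimately have comp: "compactin Wtop ?C" by simp
  have "openin Wtop ?D" using openin_Wtop_basic[of "{}" "{N..}"] by (simp add: Bex_def conj_commute)
  moreover have eq: "weil_monoid v - ?C = ?D"
    by (auto simp: weil_monoid_iff dest: deg_is_unique) (metis not_less)
  ultimately have "closedin Wtop ?C" unfolding closedin_def topspace_Wtop eq by (auto simp: weil_monoid_iff)
  with comp have "openin (Alexandroff_compactification Wtop) (insert None (Some ` (topspace Wtop - ?C)))"
    unfolding openin_Alexandroff_compactification by blast
  then show ?thesis unfolding Q_topology_def topspace_Wtop eq .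
qed

lemma openin_Q_basic:
  assumes "finite F"
  shows "openin (Q_topology v) (Some ` {\<tau>. deg_is \<tau> n \<and> (\<forall>x\<in>F. \<tau> x = g x)})"
  using openin_Wtop_basic[OF assms, of "{n}" g] by (simp add: Q_topology_def)

lemma topspace_Q [simp]: "topspace (Q_topology v) = insert None (Some ` weil_monoid v)"
  by (simp only: Q_topology_def topspace_Alexandroff_compactification topspace_Wtop)

lemma compact_Q: "compact_space (Q_topology v)"
  by (simp add: Q_topology_def)

end

section \<open>Homomorphisms of algebras and contraction of fibers\<close>

lemma base_field_sel [simp]:
  "carrier (base_field :: 'l::field ring) = UNIV" "monoid.mult (base_field :: 'l ring) = (*)"
  "ring.add (base_field :: 'l ring) = (+)" "monoid.one (base_field :: 'l ring) = 1"
  "ring.zero (base_field :: 'l ring) = 0"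
  by (simp_all add: ring_of_type_algebra_def)

lemma closure_algebra_sel [simp]:
  "carrier closure_algebra = UNIV" "monoid.mult closure_algebra = (*)" "ring.add closure_algebra = (+)"
  "monoid.one closure_algebra = 1" "ring.zero closure_algebra = 0" "module.smult closure_algebra c x = to_ac c * x"
  by (simp_all add: closure_algebra_def)

lemma cring_closure_algebra: "cring (closure_algebra :: ('l::field, 'l alg_closure) module)"
proof -
  have "\<exists>y. y + x = 0 \<and> x + y = 0" for x :: "'l alg_closure" by (intro exI[of _ "- x"]) simp
  then show ?thesis by unfold_locales (auto simp: algebra_simps Units_def)
qed

lemma finsum_closure_algebra:
  fixes f :: "'b \<Rightarrow> 'l::field alg_closure"
  shows "finite A \<Longrightarrow> finsum closure_algebra f A = sum f A"
proof (induction A rule: finite_induct)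
  case empty
  interpret cring "closure_algebra :: ('l, 'l alg_closure) module" by (rule cring_closure_algebra)
  show ?case by simp
next
  case (insert x F)
  interpret cring "closure_algebra :: ('l, 'l alg_closure) module" by (rule cring_closure_algebra)
  show ?case using insert by (subst finsum_insert) auto
qed

lemma alg_homD:
  assumes "h \<in> alg_hom E E'"
  shows "x \<in> carrier E \<Longrightarrow> h x \<in> carrier E'"
    and "x \<in> carrier E \<Longrightarrow> y \<in> carrier E \<Longrightarrow> h (x \<otimes>\<^bsub>E\<^esub> y) = h x \<otimes>\<^bsub>E'\<^esub> h y"
    and "x \<in> carrier E \<Longrightarrow> y \<in> carrier E \<Longrightarrow> h (x \<oplus>\<^bsub>E\<^esub> y) = h x \<oplus>\<^bsub>E'\<^esub> h y"
    and "h \<one>\<^bsub>E\<^esub> = \<one>\<^bsub>E'\<^esub>"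
    and "x \<in> carrier E \<Longrightarrow> h (c \<odot>\<^bsub>E\<^esub> x) = c \<odot>\<^bsub>E'\<^esub> h x"
    and "h \<in> extensional (carrier E)"
    and "h \<in> ring_hom E E'"
  using assms by (auto simp: alg_hom_def ring_hom_def)

lemma algebra_cring: "Module.algebra R E \<Longrightarrow> cring E"
  by (simp add: Module.algebra_def)

lemma alg_hom_ring_hom_cring:
  assumes "h \<in> alg_hom E E'" "cring E" "cring E'" shows "ring_hom_cring E E' h"
  using assms alg_homD(7)[OF assms(1)] by (simp add: ring_hom_cring_def ring_hom_cring_axioms_def)

lemma alg_hom_finsum:
  assumes h: "h \<in> alg_hom E E'" and E: "cring E" "cring E'" and f: "f \<in> A \<rightarrow> carrier E"
  shows "h (finsum E f A) = finsum E' (\<lambda>i. h (f i)) A"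
  using ring_hom_cring.hom_finsum[OF alg_hom_ring_hom_cring[OF h E] f] by (simp add: comp_def)

lemma algebra_smult_closed: "Module.algebra base_field E \<Longrightarrow> x \<in> carrier E \<Longrightarrow> c \<odot>\<^bsub>E\<^esub> x \<in> carrier E"
proof -
  assume "Module.algebra base_field E" "x \<in> carrier E"
  then interpret Module.algebra base_field E by simp
  show ?thesis using \<open>x \<in> carrier E\<close> by simp
qed

lemma alg_hom_power:
  assumes h: "h \<in> alg_hom E E'" and E: "cring E" "cring E'" and x: "x \<in> carrier E"
  shows "h (x [^]\<^bsub>E\<^esub> (n::nat)) = h x [^]\<^bsub>E'\<^esub> n"
proof -
  interpret E: cring E by (rule E)
  interpret E': cring E' by (rule E)
  show ?thesis using x by (induction n) (auto simp: alg_homD[OF h])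
qed

lemma alg_hom_alg_eval:
  assumes h: "h \<in> alg_hom E E'" and E: "Module.algebra base_field E" "Module.algebra base_field E'" and x: "x \<in> carrier E"
  shows "h (alg_eval E f x) = alg_eval E' f (h x)"
proof -
  have c: "cring E" "cring E'" using E algebra_cring by blast+
  interpret E: cring E by (rule c)
  interpret E': cring E' by (rule c)
  have t: "poly.coeff f i \<odot>\<^bsub>E\<^esub> (x [^]\<^bsub>E\<^esub> i) \<in> carrier E" for i
    using x algebra_smult_closed[OF E(1)] by simp
  have "h (alg_eval E f x) = (\<Oplus>\<^bsub>E'\<^esub>i\<in>{..degree f}. h (poly.coeff f i \<odot>\<^bsub>E\<^esub> (x [^]\<^bsub>E\<^esub> i)))"
    unfolding alg_eval_def using t by (intro alg_hom_finsum[OF h c]) auto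
  also have "\<dots> = alg_eval E' f (h x)"
    unfolding alg_eval_def
    using x by (intro E'.finsum_cong') (auto simp: alg_homD[OF h] alg_hom_power[OF h c] algebra_smult_closed[OF E(2)])
  finally show ?thesis .
qed

lemma alg_eval_closure_algebra: "alg_eval closure_algebra f x = aeval f x"
proof -
  have p: "x [^]\<^bsub>closure_algebra\<^esub> (n::nat) = x ^ n" for n
  proof -
    interpret cring "closure_algebra :: ('a, 'a alg_closure) module" by (rule cring_closure_algebra)
    show ?thesis by (induction n) auto
  qed
  show ?thesis unfolding alg_eval_def aeval_altdef by (subst finsum_closure_algebra) (auto simp: p)
qed

lemma algebra_closure_algebra: "Module.algebra base_field (closure_algebra :: ('l::field, 'l alg_closure) module)"
  by (rule algebraI) (auto simp: cring_closure_algebra algebra_simps)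

lemma fiber_aeval:
  assumes "s \<in> alg_hom E closure_algebra" "Module.algebra base_field E" "x \<in> carrier E"
  shows "s (alg_eval E f x) = aeval f (s x)"
  using alg_hom_alg_eval[OF assms(1,2) algebra_closure_algebra assms(3)] by (simp add: alg_eval_closure_algebra)

lemma alg_hom_compose:
  assumes "f \<in> alg_hom E E'" "g \<in> alg_hom E' E''" "cring E" "Module.algebra base_field E"
  shows "compose (carrier E) g f \<in> alg_hom E E''"
proof -
  interpret cring E by fact
  note f = alg_homD[OF assms(1)] and g = alg_homD[OF assms(2)]
  have "compose (carrier E) g f \<in> ring_hom E E''"
    by (rule ring_hom_memI) (simp_all add: compose_def f(1-4) g(1-4))
  then show ?thesis
    unfolding alg_hom_def using algebra_smult_closed[OF assms(4)] f(1,5) g(5) by (simp add: compose_def)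
qed

lemma lin_span_memI:
  assumes "finite T" "T \<subseteq> S" "c \<in> T \<rightarrow> C" "x = (\<Oplus>\<^bsub>E\<^esub>s\<in>T. c s \<odot>\<^bsub>E\<^esub> s)"
  shows "x \<in> lin_span E C S"
  using assms unfolding lin_span_def by blast

text \<open>The coefficients do not depend on the point \<open>s\<close>, so the values of several
  points at \<open>x\<close> can be compared term by term.\<close>

lemma fiber_lin_span:
  assumes E: "Module.algebra base_field E" and S: "S \<subseteq> carrier E" and x: "x \<in> lin_span E C S"
  shows "\<exists>T c. finite T \<and> T \<subseteq> S \<and> c \<in> T \<rightarrow> C \<and> (\<forall>s\<in>alg_hom E closure_algebra. s x = (\<Sum>t\<in>T. to_ac (c t) * s t))"
proof -
  obtain T c where T: "finite T" "T \<subseteq> S" "c \<in> T \<rightarrow> C" "x = (\<Oplus>\<^bsub>E\<^esub>t\<in>T. c t \<odot>\<^bsub>E\<^esub> t)"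
    using x unfolding lin_span_def by blast
  have *: "s x = (\<Sum>t\<in>T. to_ac (c t) * s t)" if s: "s \<in> alg_hom E closure_algebra" for s
  proof -
    have "s x = (\<Oplus>\<^bsub>closure_algebra\<^esub>t\<in>T. s (c t \<odot>\<^bsub>E\<^esub> t))"
      unfolding T(4) using T S algebra_smult_closed[OF E]
      by (intro alg_hom_finsum[OF s algebra_cring[OF E] cring_closure_algebra]) auto
    also have "\<dots> = (\<Sum>t\<in>T. to_ac (c t) * s t)"
      unfolding finsum_closure_algebra[OF T(1)] using T S by (intro sum.cong) (auto simp: alg_homD[OF s])
    finally show ?thesis .
  qed
  show ?thesis using T(1-3) * by blast
qed

lemma alg_hom_eqI_span:
  assumes s: "s \<in> alg_hom E closure_algebra" "s' \<in> alg_hom E closure_algebra" and E: "Module.algebra base_field E"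
    and S: "S \<subseteq> carrier E" "lin_span E UNIV S = carrier E" and eq: "\<And>a. a \<in> S \<Longrightarrow> s a = s' a"
  shows "s = s'"
proof (rule extensionalityI[of _ "carrier E"])
  fix x assume "x \<in> carrier E"
  then have "x \<in> lin_span E UNIV S" using S by simp
  from fiber_lin_span[OF E S(1) this] s obtain T c where T: "T \<subseteq> S" "s x = (\<Sum>t\<in>T. to_ac (c t) * s t)"
    "s' x = (\<Sum>t\<in>T. to_ac (c t) * s' t)" by blast
  show "s x = s' x" unfolding T(2,3) using eq T(1) by (intro sum.cong) auto
qed (use alg_homD(6)[OF s(1)] alg_homD(6)[OF s(2)] in auto)

text \<open>In every field factor the component of \<open>x\<close> is a root of some
  \<open>f i\<close>. The product of all \<open>f i\<close> evaluated at \<open>x\<close> has zero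
  components and vanishes, so in the closure \<open>s x\<close> is a root of one of these finitely
  many polynomials.\<close>

lemma finite_etale_fiber_values:
  fixes E :: "('l::field, 'x) module"
  assumes "finite_etale E" and x: "x \<in> carrier E"
  shows "finite {s x | s. s \<in> alg_hom E closure_algebra}"
proof -
  obtain n :: nat and L :: "nat \<Rightarrow> ('l, 'x) module" and h where E: "Module.algebra base_field E" and L': "\<forall>i<n. finite_separable_extension (L i)"
    and h: "bij_betw h (carrier E) (\<Pi>\<^sub>E i\<in>{..<n}. carrier (L i))"
    and hi': "\<forall>i<n. (\<lambda>x\<in>carrier E. h x i) \<in> alg_hom E (L i)"
    using assms(1)[unfolded finite_etale_def] by (elim conjE exE) (rule that, assumption+)
  note L = L'[rule_format] and hi = hi'[rule_format]
  interpret E: cring E using E by (rule algebra_cring)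
  have La: "Module.algebra base_field (L i)" if "i < n" for i
    using L[OF that] by (simp add: finite_separable_extension_def)
  have "\<exists>f. f \<noteq> 0 \<and> alg_eval (L i) f (h x i) = \<zero>\<^bsub>L i\<^esub>" if i: "i < n" for i
  proof -
    have "h x i \<in> carrier (L i)" using alg_homD(1)[OF hi[OF i] x] x by simp
    then obtain f where f: "coprime f (pderiv f)" "alg_eval (L i) f (h x i) = \<zero>\<^bsub>L i\<^esub>"
      using L[OF i] unfolding finite_separable_extension_def by blast
    moreover have "f \<noteq> 0" using f(1) by auto
    ultimately show ?thesis by blast
  qed
  then obtain f where f: "\<And>i. i < n \<Longrightarrow> f i \<noteq> 0 \<and> alg_eval (L i) (f i) (h x i) = \<zero>\<^bsub>L i\<^esub>" by metis
  define u where "u = (\<lambda>i. alg_eval E (f i) x)"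
  have uE: "u i \<in> carrier E" for i
    unfolding u_def alg_eval_def using x algebra_smult_closed[OF E] by (intro E.finsum_closed) auto
  have hu: "h (u i) i = \<zero>\<^bsub>L i\<^esub>" if "i < n" for i
    using alg_hom_alg_eval[OF hi[OF that] E La[OF that] x, of "f i"] f[OF that] uE[of i] x by (simp add: u_def)
  define P where "P = finprod E u {..<n}"
  have PE: "P \<in> carrier E" unfolding P_def using uE by (intro E.finprod_closed) auto
  have "P = \<zero>\<^bsub>E\<^esub>"
  proof -
    have hz: "h y i = \<zero>\<^bsub>L i\<^esub>" if i: "i < n" and y: "y = \<zero>\<^bsub>E\<^esub>" for y i
      using ring_hom_cring.hom_zero[OF alg_hom_ring_hom_cring[OF hi[OF i] algebra_cring[OF E] algebra_cring[OF La[OF i]]]] y by simp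
    have hP: "h P i = \<zero>\<^bsub>L i\<^esub>" if i: "i < n" for i
    proof -
      interpret Li: cring "L i" using La[OF i] by (rule algebra_cring)
      have "P = u i \<otimes>\<^bsub>E\<^esub> finprod E u ({..<n} - {i})"
        unfolding P_def using uE i
        by (subst insert_Diff[symmetric, of i "{..<n}"], simp, subst E.finprod_insert) auto
      moreover have "finprod E u ({..<n} - {i}) \<in> carrier E" using uE by (intro E.finprod_closed) auto
      ultimately have "h P i = h (u i) i \<otimes>\<^bsub>L i\<^esub> h (finprod E u ({..<n} - {i})) i"
        and "h (finprod E u ({..<n} - {i})) i \<in> carrier (L i)"
        using alg_homD(2)[OF hi[OF i] uE[of i]] alg_homD(1)[OF hi[OF i]] uE PE by auto
      then show ?thesis using hu[OF i] by simp
    qed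
    have "h P = h \<zero>\<^bsub>E\<^esub>"
    proof (rule PiE_ext)
      show "h P \<in> (\<Pi>\<^sub>E i\<in>{..<n}. carrier (L i))" "h \<zero>\<^bsub>E\<^esub> \<in> (\<Pi>\<^sub>E i\<in>{..<n}. carrier (L i))"
        using h PE by (auto simp: bij_betw_def)
    qed (use hP hz in auto)
    then show ?thesis using h PE by (auto simp: bij_betw_def inj_on_def)
  qed
  have "s x \<in> (\<Union>i<n. {y. aeval (f i) y = 0})" if s: "s \<in> alg_hom E closure_algebra" for s
  proof -
    interpret S: ring_hom_cring E closure_algebra s
      by (rule alg_hom_ring_hom_cring[OF s algebra_cring[OF E] cring_closure_algebra])
    have su: "s (u i) = aeval (f i) (s x)" for i
      unfolding u_def by (rule fiber_aeval[OF s E x])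
    have "finprod E u I \<in> carrier E \<and> (s (finprod E u I) = 0 \<longrightarrow> (\<exists>i\<in>I. s (u i) = 0))" if "finite I" for I
      using that
    proof (induction I)
      case empty
      then show ?case using alg_homD(4)[OF s] by simp
    next
      case (insert i I)
      then have "finprod E u (insert i I) = u i \<otimes>\<^bsub>E\<^esub> finprod E u I" using uE by (intro E.finprod_insert) auto
      then show ?case using insert uE alg_homD(2)[OF s uE] by auto
    qed
    from this[of "{..<n}"] have "\<exists>i<n. s (u i) = 0"
      using \<open>P = \<zero>\<^bsub>E\<^esub>\<close> S.hom_zero by (auto simp: P_def)
    then show ?thesis using su by auto
  qed
  then have "{s x | s. s \<in> alg_hom E closure_algebra} \<subseteq> (\<Union>i<n. {y. aeval (f i) y = 0})" by blast
  moreover have "finite (\<Union>i<n. {y. aeval (f i) y = 0})" using f by (intro finite_UN_I) (auto intro: finite_aeval_roots)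
  ultimately show ?thesis by (rule finite_subset)
qed

section \<open>Points of an object and the contraction caused by the Frobenius lift\<close>

definition shift :: "('l, 'x) module \<Rightarrow> ('x \<Rightarrow> 'x) \<Rightarrow> ('x \<Rightarrow> 'l alg_closure) \<Rightarrow> nat \<Rightarrow> 'x \<Rightarrow> 'l::field alg_closure" where
  "shift E \<psi> s n = (\<lambda>x\<in>carrier E. s ((\<psi> ^^ n) x))"

definition gact :: "('l, 'x) module \<Rightarrow> ('l alg_closure \<Rightarrow> 'l alg_closure) \<Rightarrow> ('x \<Rightarrow> 'l alg_closure) \<Rightarrow> 'x \<Rightarrow> 'l::field alg_closure" where
  "gact E \<sigma> s = (\<lambda>x\<in>carrier E. \<sigma> (s x))"

locale lambda_object = local_field v for v :: "'l::field \<Rightarrow> real" +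
  fixes E :: "('l, nat \<Rightarrow> 'l) module" and \<psi> :: "(nat \<Rightarrow> 'l) \<Rightarrow> nat \<Rightarrow> 'l"
  assumes obj: "(E, \<psi>) \<in> lambda_objects v"
begin

abbreviation "F \<equiv> alg_hom E (closure_algebra :: ('l, 'l alg_closure) module)"

lemma etale: "finite_etale E" and alg: "Module.algebra base_field E" and psi: "\<psi> \<in> alg_hom E E"
  using obj by (auto simp: lambda_objects_def finite_etale_def)

definition A :: "(nat \<Rightarrow> 'l) set" where "A = (SOME A. integral_model v E \<psi> A)"

lemma model: "integral_model v E \<psi> A"
proof -
  have "\<exists>A. integral_model v E \<psi> A" using obj by (simp add: lambda_objects_def)
  from someI_ex[OF this] show ?thesis unfolding A_def .
qed

sublocale E: cring E by (rule algebra_cring[OF alg])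

lemma A_sub: "A \<subseteq> carrier E"
  using model subringE(1)[of A E] by (auto simp: integral_model_def subcring_def)

lemma A_mult: "a \<in> A \<Longrightarrow> b \<in> A \<Longrightarrow> a \<otimes>\<^bsub>E\<^esub> b \<in> A" and A_one: "\<one>\<^bsub>E\<^esub> \<in> A"
  using model subringE(3,6)[of A E] by (auto simp: integral_model_def subcring_def)

lemma A_gens: "\<exists>S. S \<subseteq> A \<and> finite S \<and> A \<subseteq> lin_span E (local_integers v) S"
  using model unfolding integral_model_def by (elim conjE exE) (rule exI, intro conjI, assumption+, rule equalityD1)

lemma A_span: "lin_span E UNIV A = carrier E"
  using model by (simp add: integral_model_def)

lemma psi_A: "a \<in> A \<Longrightarrow> \<psi> a \<in> A"
  using model by (auto simp: integral_model_def)

lemma psi_cong: "a \<in> A \<Longrightarrow> \<psi> a \<ominus>\<^bsub>E\<^esub> a [^]\<^bsub>E\<^esub> q \<in> lin_span E (local_prime v) A"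
  using model by (simp add: integral_model_def)

lemma psi_pow_closed: "x \<in> carrier E \<Longrightarrow> (\<psi> ^^ n) x \<in> carrier E"
  using alg_homD(1)[OF psi] by (induction n) auto

lemma psi_pow_A: "x \<in> A \<Longrightarrow> (\<psi> ^^ n) x \<in> A"
  using psi_A by (induction n) auto

lemma shift_mem: assumes "s \<in> F" shows "shift E \<psi> s n \<in> F"
proof (induction n)
  case 0
  have "shift E \<psi> s 0 = s"
    using alg_homD(6)[OF assms] by (auto simp: shift_def extensional_def fun_eq_iff)
  then show ?case using assms by simp
next
  case (Suc n)
  have "shift E \<psi> s (Suc n) = compose (carrier E) (shift E \<psi> s n) \<psi>"
    using alg_homD(1)[OF psi] by (auto simp: shift_def compose_def fun_eq_iff funpow_swap1)
  then show ?case using alg_hom_compose[OF psi Suc E.is_cring alg] by simp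
qed

lemma gact_mem: assumes "\<sigma> \<in> Gal" "s \<in> F" shows "gact E \<sigma> s \<in> F"
proof -
  note s = alg_homD[OF assms(2)]
  have "gact E \<sigma> s \<in> ring_hom E closure_algebra"
    by (rule ring_hom_memI)
      (use s(1-4) in \<open>simp_all add: gact_def gal_add[OF assms(1)] gal_mult[OF assms(1)] gal_1[OF assms(1)]\<close>)
  then show ?thesis
    unfolding alg_hom_def using s(5) algebra_smult_closed[OF alg]
    by (simp add: gact_def gal_mult[OF assms(1)] gal_to_ac[OF assms(1)])
qed

text \<open>The image of the model under \<open>s\<close> is a finite module, stable under
  multiplication by \<open>s a\<close> and non-zero because it contains 1.\<close>

lemma fiber_OK: assumes s: "s \<in> F" and a: "a \<in> A" shows "s a \<in> OK"
proof -
  obtain S where S: "S \<subseteq> A" "finite S" "A \<subseteq> lin_span E (local_integers v) S" using A_gens by blast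
  have SE: "S \<subseteq> carrier E" using S A_sub by blast
  have span: "s b \<in> rspan acO (s ` S)" if b: "b \<in> A" for b
  proof -
    obtain T c where T: "finite T" "T \<subseteq> S" "c \<in> T \<rightarrow> local_integers v" "s b = (\<Sum>t\<in>T. to_ac (c t) * s t)"
      using fiber_lin_span[OF alg SE subsetD[OF S(3) b]] s by blast
    show ?thesis unfolding T(4)
      using T S(2) by (intro acO.rspan_sum acO.rspan_scale acO.rspan_base) auto
  qed
  have "s a * b \<in> rspan acO (s ` S)" if b: "b \<in> s ` S" for b
  proof -
    obtain t where t: "t \<in> S" "b = s t" using b by blast
    have "s a * b = s (a \<otimes>\<^bsub>E\<^esub> t)"
    proof -
      have "a \<in> carrier E" "t \<in> carrier E" using t a A_sub S(1) by auto
      from alg_homD(2)[OF s this] show ?thesis using t(2) by simp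
    qed
    then show ?thesis using span A_mult a t S(1) by auto
  qed
  moreover have "\<not> s ` S \<subseteq> {0}"
  proof
    assume 0: "s ` S \<subseteq> {0}"
    have "s \<one>\<^bsub>E\<^esub> \<in> rspan acO (s ` S)" using span A_one by blast
    then obtain c where "s \<one>\<^bsub>E\<^esub> = (\<Sum>b\<in>s ` S. c b * b)" by (auto simp: rspan_def)
    also have "\<dots> = 0" using 0 by (intro sum.neutral) auto
    finally show False using alg_homD(4)[OF s] by simp
  qed
  ultimately have "cbound 1 (min_poly (s a))"
    using S(2) by (intro integral_if_stable[of "s ` S"]) auto
  then show ?thesis by (simp add: closure_integers_iff_min_poly)
qed

lemma fiber_eqI: "s \<in> F \<Longrightarrow> s' \<in> F \<Longrightarrow> (\<And>a. a \<in> A \<Longrightarrow> s a = s' a) \<Longrightarrow> s = s'"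
  using alg_hom_eqI_span[OF _ _ alg A_sub A_span] by blast

lemma ex_finite_separating: "\<exists>S\<subseteq>A. finite S \<and> (\<forall>s\<in>F. \<forall>s'\<in>F. (\<forall>a\<in>S. s a = s' a) \<longrightarrow> s = s')"
proof -
  obtain S where S: "S \<subseteq> A" "finite S" "A \<subseteq> lin_span E (local_integers v) S" using A_gens by blast
  have SE: "S \<subseteq> carrier E" using S A_sub by blast
  have "s = s'" if ss': "s \<in> F" "s' \<in> F" "\<forall>a\<in>S. s a = s' a" for s s'
  proof (rule fiber_eqI[OF ss'(1,2)])
    fix a assume a: "a \<in> A"
    obtain T c where T: "T \<subseteq> S" "s a = (\<Sum>t\<in>T. to_ac (c t) * s t)" "s' a = (\<Sum>t\<in>T. to_ac (c t) * s' t)"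
      using fiber_lin_span[OF alg SE subsetD[OF S(3) a]] ss'(1,2) by blast
    show "s a = s' a" unfolding T(2,3) using ss'(3) T(1) by (intro sum.cong) auto
  qed
  then show ?thesis using S by blast
qed

text \<open>A point is determined by its values at finitely many generators, and each generator has
  finitely many possible values.\<close>

lemma finite_F: "finite F"
proof -
  obtain S where S: "S \<subseteq> A" "finite S" "\<And>s s'. s \<in> F \<Longrightarrow> s' \<in> F \<Longrightarrow> (\<forall>a\<in>S. s a = s' a) \<Longrightarrow> s = s'"
    using ex_finite_separating by metis
  have "inj_on (\<lambda>s. restrict s S) F"
  proof (rule inj_onI)
    fix s s' assume *: "s \<in> F" "s' \<in> F" "restrict s S = restrict s' S"
    then have "\<forall>a\<in>S. s a = s' a" by (auto dest: fun_cong simp: restrict_def fun_eq_iff split: if_splits)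
    then show "s = s'" using S(3) * by blast
  qed
  moreover have "(\<lambda>s. restrict s S) ` F \<subseteq> (\<Pi>\<^sub>E a\<in>S. {s a | s. s \<in> F})" by auto
  moreover have "finite (\<Pi>\<^sub>E a\<in>S. {s a | s. s \<in> F})"
    using S(1,2) A_sub finite_etale_fiber_values[OF etale] by (intro finite_PiE) auto
  ultimately show ?thesis using finite_imageD finite_subset by blast
qed

lemma fiber_psi_minus_power:
  assumes s: "s \<in> F" and a: "a \<in> A"
  shows "s (\<psi> a) = s a ^ q + s (\<psi> a \<ominus>\<^bsub>E\<^esub> a [^]\<^bsub>E\<^esub> q)"
proof -
  have aE: "a \<in> carrier E" "\<psi> a \<in> carrier E" using a psi_A A_sub by auto
  have p: "x [^]\<^bsub>closure_algebra\<^esub> (n::nat) = x ^ n" for n and x :: "'l alg_closure"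
  proof -
    interpret cring "closure_algebra :: ('l, 'l alg_closure) module" by (rule cring_closure_algebra)
    show ?thesis by (induction n) auto
  qed
  have "\<psi> a = a [^]\<^bsub>E\<^esub> q \<oplus>\<^bsub>E\<^esub> (\<psi> a \<ominus>\<^bsub>E\<^esub> a [^]\<^bsub>E\<^esub> q)"
    using aE by (simp add: E.minus_eq) (subst E.a_lcomm, simp_all add: E.r_neg)
  then have "s (\<psi> a) = s (a [^]\<^bsub>E\<^esub> q) + s (\<psi> a \<ominus>\<^bsub>E\<^esub> a [^]\<^bsub>E\<^esub> q)"
    using alg_homD(3)[OF s, of "a [^]\<^bsub>E\<^esub> q" "\<psi> a \<ominus>\<^bsub>E\<^esub> a [^]\<^bsub>E\<^esub> q"] aE by simp
  then show ?thesis
    using alg_hom_power[OF s E.is_cring cring_closure_algebra aE(1)] p by simp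
qed

text \<open>Every coefficient is a non-unit and contributes at least one factor
  \<open>v unif\<close> to the distance of the two points.\<close>

lemma fiber_prime_span:
  assumes s: "s \<in> F" "s' \<in> F" and d: "d \<in> lin_span E (local_prime v) A"
    and b: "\<And>a. a \<in> A \<Longrightarrow> w (s a - s' a) \<le> e"
  shows "w (s d - s' d) \<le> v unif * e"
proof -
  have e0: "e \<ge> 0" using b[OF A_one] w_nonneg order_trans by blast
  obtain T c where T: "T \<subseteq> A" "c \<in> T \<rightarrow> local_prime v" "s d = (\<Sum>t\<in>T. to_ac (c t) * s t)" "s' d = (\<Sum>t\<in>T. to_ac (c t) * s' t)"
    using fiber_lin_span[OF alg A_sub d] s by blast
  have "s d - s' d = (\<Sum>t\<in>T. to_ac (c t) * (s t - s' t))"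
    unfolding T(3,4) by (simp add: right_diff_distrib sum_subtractf)
  also have "w \<dots> \<le> v unif * e"
  proof (rule w_sum_leI)
    fix t assume t: "t \<in> T"
    then have "v (c t) \<le> v unif" using T(2) unif(3) by (auto simp: local_prime_def)
    then show "w (to_ac (c t) * (s t - s' t)) \<le> v unif * e"
      using b[of t] T(1) t by (auto simp: w_mult w_to_ac intro!: mult_mono)
  qed (use e0 unif in simp)
  finally show ?thesis .
qed

lemma fiber_prime_MK:
  assumes s: "s \<in> F" and d: "d \<in> lin_span E (local_prime v) A" shows "s d \<in> MK"
proof -
  obtain T c where T: "T \<subseteq> A" "c \<in> T \<rightarrow> local_prime v" "s d = (\<Sum>t\<in>T. to_ac (c t) * s t)"
    using fiber_lin_span[OF alg A_sub d] s by blast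
  show ?thesis unfolding T(3)
    using T fiber_OK[OF s] by (intro MK_sum MK_mult') (auto simp: to_ac_mem_MK_iff local_prime_def)
qed

lemma v_q_le: "v (of_nat q) \<le> v unif"
proof -
  obtain k where k: "q = res_char ^ k" using residue_card_power_of_char by blast
  have "k \<noteq> 0" using k q_gt_1 by (intro notI) simp
  then have "res_char dvd q" using k by (simp add: dvd_power)
  then show ?thesis using nat_v_less_1_iff unif(3) by blast
qed

text \<open>The cofactor of \<open>x - y\<close> in \<open>x ^ q - y ^ q\<close> is congruent modulo
  \<open>x - y\<close> to q times \<open>y ^ (q - 1)\<close>, and q is divisible by the uniformizer;
  hence it is at most the larger of \<open>e\<close> and \<open>v unif\<close>.\<close>

lemma w_power_q_diff:
  assumes x: "x \<in> OK" "y \<in> OK" and e: "w (x - y) \<le> e" "e \<le> 1"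
  shows "w (x ^ q - y ^ q) \<le> max e (v unif) * e"
proof -
  have e0: "e \<ge> 0" using e(1) w_nonneg order_trans by blast
  have "x ^ q - y ^ q = (x - y) * (\<Sum>i<q. y ^ (q - Suc i) * x ^ i)"
    by (rule power_diff_sumr2)
  moreover have "w (\<Sum>i<q. y ^ (q - Suc i) * x ^ i) \<le> max e (v unif)"
  proof -
    have pd: "w (x ^ n - y ^ n) \<le> e" for n
    proof (induction n)
      case (Suc n)
      have "x ^ Suc n - y ^ Suc n = x * (x ^ n - y ^ n) + (x - y) * y ^ n" by (simp add: algebra_simps)
      moreover have "w (x * (x ^ n - y ^ n)) \<le> 1 * e"
        unfolding w_mult using Suc x e0 by (intro mult_mono) (auto simp: w_le_1_iff)
      moreover have "w ((x - y) * y ^ n) \<le> e * 1"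
        unfolding w_mult using e(1) e0 OK.power_mem[OF x(2), of n] by (intro mult_mono) (auto simp: w_le_1_iff)
      ultimately show ?case using w_add_leI by simp
    qed (use e0 in simp)
    have "y ^ (q - 1) = y ^ (q - Suc i) * y ^ i" if "i < q" for i
      using that by (simp flip: power_add)
    then have "(\<Sum>i<q. y ^ (q - 1)) = (\<Sum>i<q. y ^ (q - Suc i) * y ^ i)" by (intro sum.cong) auto
    then have split: "(\<Sum>i<q. y ^ (q - Suc i) * x ^ i) =
        (\<Sum>i<q. y ^ (q - Suc i) * (x ^ i - y ^ i)) + (\<Sum>i<q. y ^ (q - 1))"
      by (simp only: right_diff_distrib sum_subtractf) simp
    have w1: "w (\<Sum>i<q. y ^ (q - Suc i) * (x ^ i - y ^ i)) \<le> e"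
    proof (rule w_sum_leI)
      fix i
      have "w (y ^ (q - Suc i) * (x ^ i - y ^ i)) \<le> 1 * e"
        unfolding w_mult using pd e0 OK.power_mem[OF x(2), of "q - Suc i"] by (intro mult_mono) (auto simp: w_le_1_iff)
      then show "w (y ^ (q - Suc i) * (x ^ i - y ^ i)) \<le> e" by simp
    qed (use e0 in simp)
    have "w (\<Sum>i<q. y ^ (q - 1)) \<le> v unif * 1"
    proof -
      have eq: "(\<Sum>i<q. y ^ (q - 1)) = to_ac (of_nat q) * y ^ (q - 1)" by simp
      show ?thesis unfolding eq w_mult w_to_ac
        using v_q_le OK.power_mem[OF x(2), of "q - 1"] by (intro mult_mono) (auto simp: w_le_1_iff)
    qed
    then have w2: "w (\<Sum>i<q. y ^ (q - 1)) \<le> max e (v unif)" by simp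
    have "w (\<Sum>i<q. y ^ (q - Suc i) * (x ^ i - y ^ i)) \<le> max e (v unif)" using w1 by simp
    from w_add_leI[OF this w2] show ?thesis unfolding split .
  qed
  ultimately show ?thesis
    using mult_mono[OF e(1), of "w (\<Sum>i<q. y ^ (q - Suc i) * x ^ i)" "max e (v unif)"] e0
    by (simp only: w_mult mult.commute[of _ e] w_nonneg)
qed

text \<open>Write \<open>\<psi> a\<close> as the sum of \<open>a\<close> to the power q and an
  element of the prime times \<open>A\<close>. Both parts bring the two points closer by the same
  factor.\<close>

lemma contraction_step:
  assumes s: "s \<in> F" "s' \<in> F" and e: "e \<le> 1" and b: "\<And>a. a \<in> A \<Longrightarrow> w (s a - s' a) \<le> e" and a: "a \<in> A"
  shows "w (s (\<psi> a) - s' (\<psi> a)) \<le> max e (v unif) * e"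
proof -
  let ?d = "\<psi> a \<ominus>\<^bsub>E\<^esub> a [^]\<^bsub>E\<^esub> q"
  have e0: "e \<ge> 0" using b[OF A_one] w_nonneg order_trans by blast
  have "s (\<psi> a) - s' (\<psi> a) = (s a ^ q - s' a ^ q) + (s ?d - s' ?d)"
    unfolding fiber_psi_minus_power[OF s(1) a] fiber_psi_minus_power[OF s(2) a] by simp
  moreover have "w (s a ^ q - s' a ^ q) \<le> max e (v unif) * e"
    by (rule w_power_q_diff[OF fiber_OK[OF s(1) a] fiber_OK[OF s(2) a] b[OF a] e])
  moreover have "w (s ?d - s' ?d) \<le> max e (v unif) * e"
    using fiber_prime_span[OF s psi_cong[OF a] b] e0 by (meson max.cobounded2 mult_right_mono order_trans)
  ultimately show ?thesis using w_add_leI by simp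
qed

text \<open>The distance of the shifted points never exceeds the initial \<open>e\<close>, so the
  factor of the first step stays valid in all later ones.\<close>

lemma contraction_iterate:
  assumes s: "s \<in> F" "s' \<in> F" and e: "e < 1" and b: "\<And>a. a \<in> A \<Longrightarrow> w (s a - s' a) \<le> e"
  shows "a \<in> A \<Longrightarrow> w (s ((\<psi> ^^ n) a) - s' ((\<psi> ^^ n) a)) \<le> e * max e (v unif) ^ n"
proof (induction n arbitrary: a)
  case 0
  then show ?case using b by simp
next
  case (Suc n)
  define r where "r = max e (v unif)"
  have e0: "e \<ge> 0" using b[OF A_one] w_nonneg order_trans by blast
  have r: "0 \<le> r" "r \<le> 1" using e unif by (auto simp: r_def)
  define e' where "e' = e * r ^ n"
  have e': "e' \<le> e" using e0 r by (simp add: e'_def mult_left_le power_le_one)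
  have e'0: "e' \<ge> 0" using e0 r by (simp add: e'_def)
  have *: "shift E \<psi> s n b = s ((\<psi> ^^ n) b)" "shift E \<psi> s' n b = s' ((\<psi> ^^ n) b)" if "b \<in> A" for b
    using that A_sub by (auto simp: shift_def)
  have "w (shift E \<psi> s n b - shift E \<psi> s' n b) \<le> e'" if "b \<in> A" for b
    using Suc.IH[OF that] that by (simp add: * e'_def r_def)
  from contraction_step[OF shift_mem[OF s(1)] shift_mem[OF s(2)] _ this Suc.prems]
  have "w (shift E \<psi> s n (\<psi> a) - shift E \<psi> s' n (\<psi> a)) \<le> max e' (v unif) * e'" using e e' by simp
  then have "w (s ((\<psi> ^^ Suc n) a) - s' ((\<psi> ^^ Suc n) a)) \<le> max e' (v unif) * e'"
    using *[OF psi_A[OF Suc.prems]] by (simp add: funpow_swap1)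
  also have "\<dots> \<le> r * e'" using e' e'0 by (intro mult_right_mono) (auto simp: r_def)
  also have "\<dots> = e * r ^ Suc n" by (simp add: e'_def)
  finally show ?case by (simp only: r_def)
qed

text \<open>The fiber and the set of generators are finite, so distances between different values at
  generators are bounded below. Once the contraction falls below this bound, the shifted points
  agree.\<close>

lemma eventually_equal:
  assumes s: "s \<in> F" "s' \<in> F" and M: "\<And>a. a \<in> A \<Longrightarrow> s a - s' a \<in> MK"
  shows "\<exists>N. \<forall>n\<ge>N. shift E \<psi> s n = shift E \<psi> s' n"
proof -
  obtain S where S: "S \<subseteq> A" "finite S" "A \<subseteq> lin_span E (local_integers v) S" using A_gens by blast
  have SE: "S \<subseteq> carrier E" using S A_sub by blast
  \<comment> \<open>Strictly below 1 because only finitely many generators are involved; the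
    ultrametric inequality extends the bound from the generators to all of \<open>A\<close>.\<close>
  define e where "e = Max (insert 0 ((\<lambda>a. w (s a - s' a)) ` S))"
  have "e \<in> insert 0 ((\<lambda>a. w (s a - s' a)) ` S)" unfolding e_def using S by (intro Max_in) auto
  then have e: "0 \<le> e" "e < 1" using M S(1) by (auto simp: w_less_1_iff)
  have eS: "w (s a - s' a) \<le> e" if "a \<in> S" for a
    unfolding e_def using S that by (intro Max_ge) auto
  have eA: "w (s a - s' a) \<le> e" if a: "a \<in> A" for a
  proof -
    obtain T c where T: "T \<subseteq> S" "c \<in> T \<rightarrow> local_integers v" "s a = (\<Sum>t\<in>T. to_ac (c t) * s t)" "s' a = (\<Sum>t\<in>T. to_ac (c t) * s' t)"
      using fiber_lin_span[OF alg SE subsetD[OF S(3) a]] s by blast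
    have "s a - s' a = (\<Sum>t\<in>T. to_ac (c t) * (s t - s' t))"
      unfolding T(3,4) by (simp add: right_diff_distrib sum_subtractf)
    also have "w \<dots> \<le> e"
    proof (rule w_sum_leI[OF _ e(1)])
      fix t assume t: "t \<in> T"
      have "w (to_ac (c t) * (s t - s' t)) \<le> 1 * e"
        unfolding w_mult w_to_ac using t T eS by (intro mult_mono) (auto simp: local_integers_def)
      then show "w (to_ac (c t) * (s t - s' t)) \<le> e" by simp
    qed
    finally show ?thesis .
  qed
  define r where "r = max e (v unif)"
  have r: "0 < r" "r < 1" using e unif by (auto simp: r_def)
  \<comment> \<open>The value \<open>1\<close> is inserted so that the minimum also exists when no
    two points differ on \<open>S\<close>.\<close>
  define D where "D = insert 1 {w (t a - t' a) | t t' a. t \<in> F \<and> t' \<in> F \<and> a \<in> S \<and> t a \<noteq> t' a}"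
  have "finite D"
  proof -
    have "D \<subseteq> insert 1 ((\<lambda>(t, t', a). w (t a - t' a)) ` (F \<times> F \<times> S))" by (auto simp: D_def image_def)
    then show ?thesis using finite_F S(2) finite_subset by fastforce
  qed
  have "Min D \<in> D" using \<open>finite D\<close> by (intro Min_in) (auto simp: D_def)
  then have "Min D > 0" by (auto simp: D_def) (metis less_eq_real_def right_minus_eq w_eq_0_iff w_nonneg)
  then obtain N where N: "r ^ N < Min D" using real_arch_pow_inv r by blast
  have "shift E \<psi> s n = shift E \<psi> s' n" if n: "n \<ge> N" for n
  proof (rule ccontr)
    assume ne: "shift E \<psi> s n \<noteq> shift E \<psi> s' n"
    have "\<exists>a\<in>S. shift E \<psi> s n a \<noteq> shift E \<psi> s' n a"
    proof (rule ccontr)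
      assume "\<not> ?thesis"
      then have eq: "\<And>a. a \<in> S \<Longrightarrow> shift E \<psi> s n a = shift E \<psi> s' n a" by blast
      have "shift E \<psi> s n = shift E \<psi> s' n"
      proof (rule fiber_eqI[OF shift_mem[OF s(1)] shift_mem[OF s(2)]])
        fix a assume a: "a \<in> A"
        obtain T c where T: "T \<subseteq> S" "shift E \<psi> s n a = (\<Sum>t\<in>T. to_ac (c t) * shift E \<psi> s n t)"
          "shift E \<psi> s' n a = (\<Sum>t\<in>T. to_ac (c t) * shift E \<psi> s' n t)"
          using fiber_lin_span[OF alg SE subsetD[OF S(3) a]] shift_mem[OF s(1)] shift_mem[OF s(2)] by blast
        show "shift E \<psi> s n a = shift E \<psi> s' n a" unfolding T(2,3) using eq T(1) by (intro sum.cong) auto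
      qed
      with ne show False by simp
    qed
    then obtain a where a: "a \<in> S" "shift E \<psi> s n a \<noteq> shift E \<psi> s' n a" by blast
    have "w (shift E \<psi> s n a - shift E \<psi> s' n a) \<in> D"
      unfolding D_def using a shift_mem s by blast
    then have "Min D \<le> w (shift E \<psi> s n a - shift E \<psi> s' n a)" using \<open>finite D\<close> by (rule Min_le[rotated])
    also have "\<dots> = w (s ((\<psi> ^^ n) a) - s' ((\<psi> ^^ n) a))" using a(1) SE by (auto simp: shift_def)
    also have "\<dots> \<le> e * r ^ n" unfolding r_def using a(1) S(1) contraction_iterate[OF s e(2) eA] by blast
    also have "\<dots> \<le> r ^ n" using e r by (simp add: mult_left_le_one_le)
    also have "\<dots> \<le> r ^ N" using r n by (intro power_decreasing) auto
    finally show False using N by simp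
  qed
  then show ?thesis by blast
qed

lemma ex_uniform_stabilisation:
  "\<exists>N. \<forall>s\<in>F. \<forall>s'\<in>F. (\<forall>a\<in>A. s a - s' a \<in> MK) \<longrightarrow> (\<forall>n\<ge>N. shift E \<psi> s n = shift E \<psi> s' n)"
proof -
  have "\<exists>N. (\<forall>a\<in>A. fst p a - snd p a \<in> MK) \<longrightarrow> (\<forall>n\<ge>N. shift E \<psi> (fst p) n = shift E \<psi> (snd p) n)" if "p \<in> F \<times> F" for p
    using eventually_equal[of "fst p" "snd p"] that by (cases p) auto
  then obtain N where N: "\<And>p. p \<in> F \<times> F \<Longrightarrow> (\<forall>a\<in>A. fst p a - snd p a \<in> MK) \<longrightarrow> (\<forall>n\<ge>N p. shift E \<psi> (fst p) n = shift E \<psi> (snd p) n)"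
    by metis
  have fin: "finite (N ` (F \<times> F))" using finite_F by simp
  have "N (s, s') \<le> Max (N ` (F \<times> F))" if "s \<in> F" "s' \<in> F" for s s'
    using fin that by (intro Max_ge) auto
  then have le: "N (s, s') \<le> n" if "s \<in> F" "s' \<in> F" "Max (N ` (F \<times> F)) \<le> n" for s s' n
    using that order_trans by blast
  show ?thesis
  proof (intro exI[of _ "Max (N ` (F \<times> F))"] ballI impI allI)
    fix s s' n assume *: "s \<in> F" "s' \<in> F" "\<forall>a\<in>A. s a - s' a \<in> MK" "Max (N ` (F \<times> F)) \<le> n"
    then show "shift E \<psi> s n = shift E \<psi> s' n" using N[of "(s, s')"] le[OF *(1,2,4)] by simp
  qed
qed

lemma fiber_shift_cong:
  assumes s: "s \<in> F" and a: "a \<in> A" shows "s ((\<psi> ^^ n) a) - s a ^ (q ^ n) \<in> MK"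
proof (induction n)
  case (Suc n)
  have pa: "(\<psi> ^^ n) a \<in> A" using psi_pow_A a by blast
  have "s (\<psi> ((\<psi> ^^ n) a)) - s ((\<psi> ^^ n) a) ^ q \<in> MK"
    using fiber_psi_minus_power[OF s pa] fiber_prime_MK[OF s psi_cong[OF pa]] by simp
  moreover have "s ((\<psi> ^^ n) a) ^ q - (s a ^ (q ^ n)) ^ q \<in> MK"
    using Suc fiber_OK[OF s] a pa by (intro power_diff_MK OK.power_mem) auto
  ultimately have "s (\<psi> ((\<psi> ^^ n) a)) - (s a ^ (q ^ n)) ^ q \<in> MK" by (rule MK_trans)
  then show ?case by (simp add: mult.commute flip: power_mult)
qed (simp add: zero_mem_MK)

lemma shift_shift: "shift E \<psi> (shift E \<psi> s n) m = shift E \<psi> s (n + m)"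
  using psi_pow_closed by (auto simp: shift_def fun_eq_iff funpow_add)

lemma shift_0: "s \<in> F \<Longrightarrow> shift E \<psi> s 0 = s"
  using extensional_arb[OF alg_homD(6), of s E] by (auto simp: shift_def fun_eq_iff restrict_def)

lemma shift_gact: "shift E \<psi> (gact E \<sigma> s) n = gact E \<sigma> (shift E \<psi> s n)"
  using psi_pow_closed by (auto simp: shift_def gact_def fun_eq_iff)

lemma gact_gact: "gact E \<sigma> (gact E \<tau> s) = gact E (\<sigma> \<circ> \<tau>) s"
  by (auto simp: gact_def fun_eq_iff)

lemma gact_id: "s \<in> F \<Longrightarrow> gact E id s = s"
  using extensional_arb[OF alg_homD(6), of s E] by (auto simp: gact_def fun_eq_iff restrict_def)

text \<open>At elements of the model both \<open>\<rho> \<circ> s\<close> and the shift of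
  \<open>s\<close> by \<open>j\<close> are congruent to the \<open>q ^ j\<close>-th power of
  \<open>s\<close>. Congruent points agree after \<open>N\<close> further shifts.\<close>

theorem ex_stable:
  "\<exists>N. \<forall>s\<in>F. \<forall>n\<ge>N. \<forall>\<rho> j. deg_is \<rho> j \<longrightarrow> gact E \<rho> (shift E \<psi> s n) = shift E \<psi> s (n + j)"
proof -
  obtain N where N: "\<And>s s' n. s \<in> F \<Longrightarrow> s' \<in> F \<Longrightarrow> (\<And>a. a \<in> A \<Longrightarrow> s a - s' a \<in> MK) \<Longrightarrow> n \<ge> N \<Longrightarrow>
      shift E \<psi> s n = shift E \<psi> s' n"
    using ex_uniform_stabilisation by metis
  have "gact E \<rho> (shift E \<psi> s n) = shift E \<psi> s (n + j)" if s: "s \<in> F" and n: "n \<ge> N" and \<rho>: "deg_is \<rho> j" for s n \<rho> j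
  proof -
    have G: "\<rho> \<in> Gal" using \<rho> deg_is_Gal by blast
    have "gact E \<rho> s a - shift E \<psi> s j a \<in> MK" if a: "a \<in> A" for a
    proof -
      have aE: "a \<in> carrier E" using a A_sub by blast
      have "\<rho> (s a) - s a ^ (q ^ j) \<in> MK" using deg_isD[OF \<rho> fiber_OK[OF s a]] .
      from MK_trans[OF this MK_sym[OF fiber_shift_cong[OF s a]]]
      show ?thesis using aE by (simp add: gact_def shift_def)
    qed
    then have "shift E \<psi> (gact E \<rho> s) n = shift E \<psi> (shift E \<psi> s j) n"
      by (intro N gact_mem[OF G s] shift_mem[OF s] n)
    then show ?thesis by (simp add: shift_gact shift_shift add.commute)
  qed
  then show ?thesis by blast
qed

end

section \<open>The action of the monoid on the fibers\<close>

context local_field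
begin

definition deg :: "('l alg_closure \<Rightarrow> 'l alg_closure) \<Rightarrow> nat" where "deg \<rho> = (THE n. deg_is \<rho> n)"

lemma deg_eq: "deg_is \<rho> n \<Longrightarrow> deg \<rho> = n"
  unfolding deg_def using deg_is_unique by (intro the_equality)

lemma deg_is_deg: "\<rho> \<in> weil_monoid v \<Longrightarrow> deg_is \<rho> (deg \<rho>)"
  using deg_eq weil_monoid_iff by auto

definition stable_from :: "('l, nat \<Rightarrow> 'l) module \<Rightarrow> ((nat \<Rightarrow> 'l) \<Rightarrow> nat \<Rightarrow> 'l) \<Rightarrow> nat \<Rightarrow> bool" where
  "stable_from E \<psi> N \<longleftrightarrow> (\<forall>s\<in>alg_hom E closure_algebra. \<forall>n\<ge>N. \<forall>\<rho> j. deg_is \<rho> j \<longrightarrow>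
     gact E \<rho> (shift E \<psi> s n) = shift E \<psi> s (n + j))"

definition stab :: "('l, nat \<Rightarrow> 'l) module \<Rightarrow> ((nat \<Rightarrow> 'l) \<Rightarrow> nat \<Rightarrow> 'l) \<Rightarrow> nat" where
  "stab E \<psi> = (SOME N. stable_from E \<psi> N)"

text \<open>The action of \<open>0\<close>.\<close>

definition retr :: "('l, nat \<Rightarrow> 'l) module \<Rightarrow> ((nat \<Rightarrow> 'l) \<Rightarrow> nat \<Rightarrow> 'l) \<Rightarrow>
    ((nat \<Rightarrow> 'l) \<Rightarrow> 'l alg_closure) \<Rightarrow> (nat \<Rightarrow> 'l) \<Rightarrow> 'l alg_closure" where
  "retr E \<psi> s = gact E (inv' (frob ^^ stab E \<psi>)) (shift E \<psi> s (stab E \<psi>))"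

text \<open>Composition with automorphisms is an action from the left, so the inverse of
  \<open>\<rho>\<close> is needed for a right action. The value at \<open>None\<close> is the one
  that all \<open>Some \<rho>\<close> of sufficiently large degree share, by
  \<open>retr_eq\<close>.\<close>

definition qact :: "('l alg_closure \<Rightarrow> 'l alg_closure) option \<Rightarrow> ('l, nat \<Rightarrow> 'l) module \<Rightarrow> ((nat \<Rightarrow> 'l) \<Rightarrow> nat \<Rightarrow> 'l) \<Rightarrow>
    ((nat \<Rightarrow> 'l) \<Rightarrow> 'l alg_closure) \<Rightarrow> (nat \<Rightarrow> 'l) \<Rightarrow> 'l alg_closure" where
  "qact r E \<psi> s = (case r of None \<Rightarrow> retr E \<psi> s | Some \<rho> \<Rightarrow> gact E (inv' \<rho>) (shift E \<psi> s (deg \<rho>)))"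

lemma carrier_Q: "carrier (Q_monoid v) = insert None (Some ` weil_monoid v)"
  by (simp add: Q_monoid_def adjoin_zero_def)

lemma Some_mem_Q: "deg_is \<rho> n \<Longrightarrow> Some \<rho> \<in> carrier (Q_monoid v)"
  unfolding carrier_Q using weil_monoid_iff by blast

lemma mult_Q: "None \<otimes>\<^bsub>Q_monoid v\<^esub> r = None" "r \<otimes>\<^bsub>Q_monoid v\<^esub> None = None"
  "Some \<rho> \<otimes>\<^bsub>Q_monoid v\<^esub> Some \<rho>' = Some (\<rho> \<circ> \<rho>')"
  by (cases r) (simp_all add: Q_monoid_def adjoin_zero_def)

lemma inv_comp: "\<sigma> \<in> Gal \<Longrightarrow> \<tau> \<in> Gal \<Longrightarrow> inv' (\<sigma> \<circ> \<tau>) = inv' \<tau> \<circ> inv' \<sigma>"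
  using o_inv_distrib[OF gal_bij gal_bij] by blast

lemma inv_inv: "\<sigma> \<in> Gal \<Longrightarrow> inv' (inv' \<sigma>) = \<sigma>"
  using inv_inv_eq[OF gal_bij] by blast

end

context lambda_object
begin

lemma stab: "s \<in> F \<Longrightarrow> n \<ge> stab E \<psi> \<Longrightarrow> deg_is \<rho> j \<Longrightarrow> gact E \<rho> (shift E \<psi> s n) = shift E \<psi> s (n + j)"
proof -
  have "\<exists>N. stable_from E \<psi> N" using ex_stable unfolding stable_from_def .
  from someI_ex[OF this] have "stable_from E \<psi> (stab E \<psi>)" unfolding stab_def .
  then show "s \<in> F \<Longrightarrow> n \<ge> stab E \<psi> \<Longrightarrow> deg_is \<rho> j \<Longrightarrow> gact E \<rho> (shift E \<psi> s n) = shift E \<psi> s (n + j)"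
    unfolding stable_from_def by blast
qed

text \<open>Write \<open>\<rho>\<close> as \<open>\<kappa>\<close> times the chosen power of
  \<open>frob\<close>, with \<open>\<kappa>\<close> of degree \<open>n - stab E \<psi>\<close>.
  Stability cancels \<open>\<kappa>\<close> against the additional shifts. This is continuity of the
  action at zero.\<close>

lemma retr_eq:
  assumes s: "s \<in> F" and n: "n \<ge> stab E \<psi>" and \<rho>: "deg_is \<rho> n"
  shows "retr E \<psi> s = gact E (inv' \<rho>) (shift E \<psi> s n)"
proof -
  let ?N = "stab E \<psi>" let ?f = "frob ^^ ?N"
  have f: "deg_is ?f ?N" by (rule deg_is_frob_power)
  have fG: "?f \<in> Gal" and \<rho>G: "\<rho> \<in> Gal" using f \<rho> deg_is_Gal by blast+
  define \<kappa> where "\<kappa> = \<rho> \<circ> inv' ?f"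
  have \<kappa>G: "\<kappa> \<in> Gal" unfolding \<kappa>_def by (intro gal_comp gal_inv \<rho>G fG)
  have \<kappa>f: "\<kappa> \<circ> ?f = \<rho>" using gal_comp_inv(2)[OF fG] by (simp add: \<kappa>_def comp_assoc)
  have "deg_is \<kappa> (n - ?N)"
    using deg_is_cancel_right[of \<kappa> ?f "n - ?N" ?N] \<kappa>f \<rho> n f \<kappa>G by simp
  from stab[OF s order_refl this] have "gact E \<kappa> (shift E \<psi> s ?N) = shift E \<psi> s n" using n by simp
  then have "gact E (inv' \<rho>) (shift E \<psi> s n) = gact E (inv' \<rho> \<circ> \<kappa>) (shift E \<psi> s ?N)"
    by (simp flip: gact_gact)
  also have "inv' \<rho> \<circ> \<kappa> = inv' ?f"
    using gal_comp_inv(2)[OF \<rho>G] by (simp add: \<kappa>_def flip: comp_assoc)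
  finally show ?thesis by (simp add: retr_def)
qed

lemma retr_mem: "s \<in> F \<Longrightarrow> retr E \<psi> s \<in> F"
  unfolding retr_def using deg_is_Gal[OF deg_is_frob_power] by (intro gact_mem gal_inv shift_mem)

text \<open>Conjugating the power of \<open>frob\<close> by \<open>\<tau>\<close> preserves its
  degree, and the retraction may be computed with the conjugate instead.\<close>

lemma gact_retr:
  assumes s: "s \<in> F" and \<tau>: "\<tau> \<in> Gal"
  shows "gact E \<tau> (retr E \<psi> s) = retr E \<psi> (gact E \<tau> s)"
proof -
  let ?N = "stab E \<psi>" let ?f = "frob ^^ ?N"
  have f: "deg_is ?f ?N" by (rule deg_is_frob_power)
  have fG: "?f \<in> Gal" using f deg_is_Gal by blast
  define g where "g = \<tau> \<circ> ?f \<circ> inv' \<tau>"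
  have g: "deg_is g ?N" unfolding g_def by (rule deg_is_conj[OF \<tau> f])
  have ts: "gact E \<tau> s \<in> F" by (rule gact_mem[OF \<tau> s])
  have "retr E \<psi> (gact E \<tau> s) = gact E (inv' g) (shift E \<psi> (gact E \<tau> s) ?N)"
    by (rule retr_eq[OF ts order_refl g])
  also have "\<dots> = gact E (inv' g \<circ> \<tau>) (shift E \<psi> s ?N)" by (simp add: shift_gact gact_gact)
  also have "inv' g \<circ> \<tau> = \<tau> \<circ> inv' ?f"
  proof -
    have "inv' g = \<tau> \<circ> inv' ?f \<circ> inv' \<tau>"
      unfolding g_def by (simp add: inv_comp gal_comp gal_inv \<tau> fG inv_inv comp_assoc)
    then show ?thesis using gal_comp_inv(2)[OF \<tau>] by (simp add: comp_assoc)
  qed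
  finally show ?thesis by (simp only: retr_def[of E \<psi> s] gact_gact)
qed

text \<open>Stability turns \<open>n\<close> further shifts into the action of any
  \<open>\<rho>\<close> of degree \<open>n\<close>. Both absorption laws of the zero element come
  from these identities, as does idempotence of the retraction.\<close>

lemma retr_shift:
  assumes s: "s \<in> F" and \<rho>: "deg_is \<rho> n"
  shows "retr E \<psi> (shift E \<psi> s n) = gact E \<rho> (retr E \<psi> s)" "shift E \<psi> (retr E \<psi> s) n = gact E \<rho> (retr E \<psi> s)"
proof -
  let ?N = "stab E \<psi>"
  show "shift E \<psi> (retr E \<psi> s) n = gact E \<rho> (retr E \<psi> s)"
  proof -
    have "shift E \<psi> (retr E \<psi> s) n = gact E (inv' (frob ^^ ?N)) (shift E \<psi> s (?N + n))"
      by (simp add: retr_def shift_gact shift_shift)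
    also have "shift E \<psi> s (?N + n) = shift E \<psi> (gact E \<rho> s) ?N"
      using stab[OF s order_refl \<rho>] by (simp add: shift_gact)
    finally show ?thesis using gact_retr[OF s deg_is_Gal[OF \<rho>]] by (simp add: retr_def)
  qed
  have "retr E \<psi> (shift E \<psi> s n) = gact E (inv' (frob ^^ ?N)) (shift E \<psi> s (?N + n))"
    by (simp add: retr_def shift_shift add.commute)
  also have "shift E \<psi> s (?N + n) = shift E \<psi> (gact E \<rho> s) ?N"
    using stab[OF s order_refl \<rho>] by (simp add: shift_gact)
  finally show "retr E \<psi> (shift E \<psi> s n) = gact E \<rho> (retr E \<psi> s)"
    using gact_retr[OF s deg_is_Gal[OF \<rho>]] by (simp add: retr_def)
qed

lemma gact_inv_cancel: "\<rho> \<in> Gal \<Longrightarrow> s \<in> F \<Longrightarrow> gact E (inv' \<rho>) (gact E \<rho> s) = s"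
  by (simp add: gact_gact gal_comp_inv gact_id)

lemma retr_retr: assumes "s \<in> F" shows "retr E \<psi> (retr E \<psi> s) = retr E \<psi> s"
  using retr_shift(2)[OF assms deg_is_frob_power[of "stab E \<psi>"]] retr_mem[OF assms]
    gact_inv_cancel[OF deg_is_Gal[OF deg_is_frob_power]]
  by (subst retr_def) simp

lemma qact_mem: assumes r: "r \<in> carrier (Q_monoid v)" and s: "s \<in> F" shows "qact r E \<psi> s \<in> F"
proof (cases r)
  case None
  then show ?thesis using retr_mem[OF s] by (simp add: qact_def)
next
  case (Some \<rho>)
  then have "deg_is \<rho> (deg \<rho>)" using r deg_is_deg by (auto simp: carrier_Q)
  from gact_mem[OF gal_inv[OF deg_is_Gal[OF this]] shift_mem[OF s]]
  show ?thesis using Some by (simp add: qact_def)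
qed

text \<open>Moving a Galois automorphism past the action conjugates the index: this is the relation
  that the semidirect product encodes.\<close>

lemma gact_qact:
  assumes \<tau>: "\<tau> \<in> Gal" and r: "r \<in> carrier (Q_monoid v)" and s: "s \<in> F"
  shows "gact E \<tau> (qact r E \<psi> s) = qact (map_option (\<lambda>\<rho>. \<tau> \<circ> \<rho> \<circ> inv' \<tau>) r) E \<psi> (gact E \<tau> s)"
proof (cases r)
  case None
  then show ?thesis using gact_retr[OF s \<tau>] by (simp add: qact_def)
next
  case (Some \<rho>)
  then have \<rho>: "deg_is \<rho> (deg \<rho>)" using r deg_is_deg by (auto simp: carrier_Q)
  let ?g = "\<tau> \<circ> \<rho> \<circ> inv' \<tau>"
  have "deg ?g = deg \<rho>" by (rule deg_eq[OF deg_is_conj[OF \<tau> \<rho>]])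
  moreover have "inv' ?g \<circ> \<tau> = \<tau> \<circ> inv' \<rho>"
  proof -
    have "inv' ?g = \<tau> \<circ> inv' \<rho> \<circ> inv' \<tau>"
      by (simp add: inv_comp gal_comp gal_inv \<tau> deg_is_Gal[OF \<rho>] inv_inv comp_assoc)
    then show ?thesis using gal_comp_inv(2)[OF \<tau>] by (simp add: comp_assoc)
  qed
  ultimately show ?thesis using Some by (simp add: qact_def shift_gact gact_gact)
qed

lemma qact_qact:
  assumes r: "r \<in> carrier (Q_monoid v)" "r' \<in> carrier (Q_monoid v)" and s: "s \<in> F"
  shows "qact r' E \<psi> (qact r E \<psi> s) = qact (r \<otimes>\<^bsub>Q_monoid v\<^esub> r') E \<psi> s"
proof (cases r)
  case None
  note rN = this
  show ?thesis
  proof (cases r')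
    case None
    then show ?thesis using rN retr_retr[OF s] by (simp add: qact_def mult_Q)
  next
    case (Some \<rho>')
    then have \<rho>': "deg_is \<rho>' (deg \<rho>')" using r deg_is_deg by (auto simp: carrier_Q)
    then show ?thesis
      using rN Some retr_shift(2)[OF s \<rho>'] gact_inv_cancel[OF deg_is_Gal[OF \<rho>'] retr_mem[OF s]]
      by (simp add: qact_def mult_Q)
  qed
next
  case (Some \<rho>)
  note rS = this
  then have \<rho>: "deg_is \<rho> (deg \<rho>)" using r deg_is_deg by (auto simp: carrier_Q)
  note \<rho>G = deg_is_Gal[OF \<rho>]
  show ?thesis
  proof (cases r')
    case None
    have "retr E \<psi> (gact E (inv' \<rho>) (shift E \<psi> s (deg \<rho>))) = gact E (inv' \<rho>) (retr E \<psi> (shift E \<psi> s (deg \<rho>)))"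
      by (rule gact_retr[symmetric, OF shift_mem[OF s] gal_inv[OF \<rho>G]])
    also have "\<dots> = retr E \<psi> s"
      using retr_shift(1)[OF s \<rho>] gact_inv_cancel[OF \<rho>G retr_mem[OF s]] by simp
    finally show ?thesis using rS None by (simp add: qact_def mult_Q)
  next
    case (Some \<rho>')
    then have \<rho>': "deg_is \<rho>' (deg \<rho>')" using r deg_is_deg by (auto simp: carrier_Q)
    have "deg (\<rho> \<circ> \<rho>') = deg \<rho> + deg \<rho>'" by (rule deg_eq[OF deg_is_comp[OF \<rho> \<rho>']])
    then show ?thesis using rS Some
      by (simp add: qact_def mult_Q shift_gact gact_gact shift_shift inv_comp[OF \<rho>G deg_is_Gal[OF \<rho>']])
  qed
qed

lemma qact_inertia: assumes "u \<in> inertia v" "s \<in> F" shows "qact (Some u) E \<psi> s = gact E (inv' u) s"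
proof -
  have "deg u = 0" using assms(1) deg_eq inertia_iff by blast
  then show ?thesis using shift_0[OF assms(2)] by (simp add: qact_def)
qed

end

lemma (in local_field) lambda_objectI: "(E, \<psi>) \<in> lambda_objects v \<Longrightarrow> lambda_object v E \<psi>"
  by (intro lambda_object.intro lambda_object_axioms.intro local_field_axioms)

lemma (in local_field) qact_natural:
  assumes C: "(E, \<psi>) \<in> lambda_objects v" and Y: "(E', \<phi>) \<in> lambda_objects v"
    and f: "f \<in> alg_hom E E'" "\<And>x. x \<in> carrier E \<Longrightarrow> f (\<psi> x) = \<phi> (f x)"
    and s: "s \<in> alg_hom E' closure_algebra"
  shows "gact E \<sigma> (qact r E \<psi> (compose (carrier E) s f)) = compose (carrier E) (gact E' \<sigma> (qact r E' \<phi> s)) f"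
proof -
  interpret C: lambda_object v E \<psi> by (rule lambda_objectI[OF C])
  interpret Y: lambda_object v E' \<phi> by (rule lambda_objectI[OF Y])
  have fE: "f x \<in> carrier E'" if "x \<in> carrier E" for x using alg_homD(1)[OF f(1) that] .
  have fpow: "f ((\<psi> ^^ n) x) = (\<phi> ^^ n) (f x)" if "x \<in> carrier E" for x n
    using that by (induction n) (auto simp: f(2) C.psi_pow_closed)
  have fs: "compose (carrier E) s f \<in> C.F" by (rule alg_hom_compose[OF f(1) s C.E.is_cring C.alg])
  have sh: "gact E \<tau> (shift E \<psi> (compose (carrier E) s f) n) = compose (carrier E) (gact E' \<tau> (shift E' \<phi> s n)) f" for \<tau> n
    using C.psi_pow_closed fE by (auto simp: gact_def shift_def compose_def fun_eq_iff fpow)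
  have q: "qact r E \<psi> (compose (carrier E) s f) = compose (carrier E) (qact r E' \<phi> s) f"
  proof (cases r)
    case (Some \<rho>)
    then show ?thesis by (simp add: qact_def sh)
  next
    case None
    \<comment> \<open>The two objects have different stabilisation indices; beyond both of them the
      retractions are given by one formula, which commutes with \<open>f\<close>.\<close>
    define n where "n = max (stab E \<psi>) (stab E' \<phi>)"
    have n: "n \<ge> stab E \<psi>" "n \<ge> stab E' \<phi>" by (auto simp: n_def)
    show ?thesis
      using None C.retr_eq[OF fs n(1) deg_is_frob_power] Y.retr_eq[OF s n(2) deg_is_frob_power]
      by (simp add: qact_def sh)
  qed
  show ?thesis unfolding q using fE by (auto simp: gact_def compose_def fun_eq_iff)
qed

subsection \<open>The homomorphism to the fundamental monoid\<close>

context local_field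
begin

definition Phi :: "('l alg_closure \<Rightarrow> 'l alg_closure) option \<times> ('l alg_closure \<Rightarrow> 'l alg_closure)
    \<Rightarrow> 'l lambda_alg \<Rightarrow> ((nat \<Rightarrow> 'l) \<Rightarrow> 'l alg_closure) \<Rightarrow> (nat \<Rightarrow> 'l) \<Rightarrow> 'l alg_closure" where
  "Phi p = (\<lambda>C\<in>lambda_objects v. \<lambda>s\<in>fiber C. gact (fst C) (inv' (snd p)) (qact (fst p) (fst C) (snd C) s))"

abbreviation "SD \<equiv> semidirect (Q_monoid v) galois_group conj_action"

abbreviation "SDtop \<equiv> prod_topology (Q_topology v) (krull_topology :: ('l alg_closure \<Rightarrow> 'l alg_closure) topology)"

lemma carrier_SD: "carrier SD = carrier (Q_monoid v) \<times> Gal"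
  by (simp add: semidirect_def)

lemma Phi_apply:
  assumes "(E, \<psi>) \<in> lambda_objects v" "s \<in> alg_hom E closure_algebra"
  shows "Phi (r, \<sigma>) (E, \<psi>) s = gact E (inv' \<sigma>) (qact r E \<psi> s)"
  using assms by (simp add: Phi_def fiber_def)

lemma Phi_mem: assumes "p \<in> carrier SD" shows "Phi p \<in> carrier (fundamental_monoid v)"
proof -
  obtain r \<sigma> where p: "p = (r, \<sigma>)" "r \<in> carrier (Q_monoid v)" "\<sigma> \<in> Gal" using assms by (auto simp: carrier_SD)
  have "Phi p \<in> (\<Pi>\<^sub>E C\<in>lambda_objects v. fiber C \<rightarrow>\<^sub>E fiber C)"
  proof (intro PiE_I)
    fix C s assume C: "C \<in> lambda_objects v" and s: "s \<in> fiber C"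
    obtain E \<psi> where C': "C = (E, \<psi>)" by (cases C)
    interpret C: lambda_object v E \<psi> using C C' by (intro lambda_objectI) simp
    show "Phi p C s \<in> fiber C"
      using C s p C.gact_mem[OF gal_inv[OF p(3)] C.qact_mem[OF p(2)]] by (simp add: Phi_def C' fiber_def)
  qed (auto simp: Phi_def)
  moreover have "Phi p C (fiber_map C Y f s) = fiber_map C Y f (Phi p Y s)"
    if C: "C \<in> lambda_objects v" "Y \<in> lambda_objects v" and f: "f \<in> lambda_homs C Y" and s: "s \<in> fiber Y" for C Y f s
  proof -
    obtain E \<psi> E' \<phi> where XY: "C = (E, \<psi>)" "Y = (E', \<phi>)" by (cases C; cases Y)
    interpret C: lambda_object v E \<psi> using C XY by (intro lambda_objectI) simp
    have f': "f \<in> alg_hom E E'" "\<And>x. x \<in> carrier E \<Longrightarrow> f (\<psi> x) = \<phi> (f x)"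
      using f by (auto simp: XY lambda_homs_def)
    have s': "s \<in> alg_hom E' closure_algebra" using s by (simp add: XY fiber_def)
    have "compose (carrier E) s f \<in> C.F" by (rule alg_hom_compose[OF f'(1) s' C.E.is_cring C.alg])
    then show ?thesis
      using qact_natural[OF C(1)[unfolded XY] C(2)[unfolded XY] f' s'] C s s'
      by (simp add: Phi_def p fiber_map_def XY fiber_def)
  qed
  ultimately show ?thesis by (simp add: fundamental_monoid_def functor_End_def)
qed

lemma mult_fundamental:
  "\<alpha> \<otimes>\<^bsub>fundamental_monoid v\<^esub> \<beta> = (\<lambda>C\<in>lambda_objects v. compose (fiber C) (\<beta> C) (\<alpha> C))"
  by (simp add: fundamental_monoid_def functor_End_def)

lemma Phi_mult:
  assumes p: "p \<in> carrier SD" "p' \<in> carrier SD"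
  shows "Phi (p \<otimes>\<^bsub>SD\<^esub> p') = Phi p \<otimes>\<^bsub>fundamental_monoid v\<^esub> Phi p'"
proof -
  obtain r \<sigma> where p1: "p = (r, \<sigma>)" "r \<in> carrier (Q_monoid v)" "\<sigma> \<in> Gal" using p by (auto simp: carrier_SD)
  obtain r' \<sigma>' where p2: "p' = (r', \<sigma>')" "r' \<in> carrier (Q_monoid v)" "\<sigma>' \<in> Gal" using p by (auto simp: carrier_SD)
  \<comment> \<open>The conjugate of \<open>r'\<close> that occurs in the semidirect product; the
    same \<open>c\<close> arises when \<open>qact r'\<close> is moved past
    \<open>inv' \<sigma>\<close>.\<close>
  define c where "c = map_option (\<lambda>\<rho>. \<sigma> \<circ> \<rho> \<circ> inv' \<sigma>) r'"
  have c: "c \<in> carrier (Q_monoid v)"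
  proof (cases r')
    case (Some \<rho>)
    then have "deg_is \<rho> (deg \<rho>)" using p2(2) deg_is_deg by (auto simp: carrier_Q)
    from Some_mem_Q[OF deg_is_conj[OF p1(3) this]] show ?thesis using Some by (simp add: c_def)
  qed (simp add: c_def carrier_Q)
  have cc: "map_option (\<lambda>\<rho>. inv' \<sigma> \<circ> \<rho> \<circ> inv' (inv' \<sigma>)) c = r'"
    using gal_comp_inv(2)[OF p1(3)]
    by (cases r') (simp_all add: c_def inv_inv[OF p1(3)] comp_assoc, simp flip: comp_assoc)
  have pp: "p \<otimes>\<^bsub>SD\<^esub> p' = (r \<otimes>\<^bsub>Q_monoid v\<^esub> c, \<sigma> \<circ> \<sigma>')"
    by (simp add: semidirect_def p1 p2 conj_action_def c_def galois_inv_eq)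
  have "Phi (p \<otimes>\<^bsub>SD\<^esub> p') C s = Phi p' C (Phi p C s)"
    if C: "C \<in> lambda_objects v" and s: "s \<in> fiber C" for C s
  proof -
    obtain E \<psi> where C': "C = (E, \<psi>)" by (cases C)
    interpret C: lambda_object v E \<psi> using C C' by (intro lambda_objectI) simp
    have s': "s \<in> C.F" using s by (simp add: C' fiber_def)
    note XO = C[unfolded C']
    have q: "qact r E \<psi> s \<in> C.F" by (rule C.qact_mem[OF p1(2) s'])
    have g: "gact E (inv' \<sigma>) (qact r E \<psi> s) \<in> C.F" by (rule C.gact_mem[OF gal_inv[OF p1(3)] q])
    have "Phi p' C (Phi p C s) =
        gact E (inv' \<sigma>') (qact r' E \<psi> (gact E (inv' \<sigma>) (qact r E \<psi> s)))"
      unfolding C' p1(1) p2(1) Phi_apply[OF XO s'] Phi_apply[OF XO g] ..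
    also have "qact r' E \<psi> (gact E (inv' \<sigma>) (qact r E \<psi> s)) = gact E (inv' \<sigma>) (qact c E \<psi> (qact r E \<psi> s))"
      using C.gact_qact[OF gal_inv[OF p1(3)] c q] cc by simp
    also have "qact c E \<psi> (qact r E \<psi> s) = qact (r \<otimes>\<^bsub>Q_monoid v\<^esub> c) E \<psi> s"
      by (rule C.qact_qact[OF p1(2) c s'])
    finally show ?thesis
      unfolding pp C' Phi_apply[OF XO s'] by (simp add: C.gact_gact inv_comp[OF p1(3) p2(3)])
  qed
  moreover have "Phi p C \<in> fiber C \<rightarrow>\<^sub>E fiber C" if "C \<in> lambda_objects v" for C
    using Phi_mem[OF p(1)] that by (auto simp: fundamental_monoid_def functor_End_def)
  ultimately show ?thesis
    unfolding mult_fundamental by (intro ext) (auto simp: Phi_def compose_def)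
qed

text \<open>An inertia element has degree 0, so in the first component it acts by its inverse alone
  and cancels against the change of the second component.\<close>

lemma Phi_inertia_rel: assumes "(p, p') \<in> inertia_rel v" shows "p \<in> carrier SD \<and> p' \<in> carrier SD \<and> Phi p = Phi p'"
proof -
  obtain r \<sigma> u where *: "p = (r, \<sigma>)" "p' = (r \<otimes>\<^bsub>Q_monoid v\<^esub> Some u, inv\<^bsub>galois_group\<^esub> u \<circ> \<sigma>)"
    "r \<in> carrier (Q_monoid v)" "\<sigma> \<in> Gal" "u \<in> inertia v"
    using assms by (auto simp: inertia_rel_def)
  have u: "deg_is u 0" "u \<in> Gal" using *(5) by (auto simp: inertia_iff dest: deg_is_Gal)
  have uQ: "Some u \<in> carrier (Q_monoid v)" by (rule Some_mem_Q[OF u(1)])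
  have ru: "r \<otimes>\<^bsub>Q_monoid v\<^esub> Some u \<in> carrier (Q_monoid v)"
  proof (cases r)
    case (Some \<rho>)
    then have "deg_is \<rho> (deg \<rho>)" using *(3) deg_is_deg by (auto simp: carrier_Q)
    from Some_mem_Q[OF deg_is_comp[OF this u(1)]] show ?thesis using Some by (simp add: mult_Q)
  qed (simp add: mult_Q carrier_Q)
  have p': "p' = (r \<otimes>\<^bsub>Q_monoid v\<^esub> Some u, inv' u \<circ> \<sigma>)" using *(2) galois_inv_eq[OF u(2)] by simp
  have inv': "inv' (inv' u \<circ> \<sigma>) = inv' \<sigma> \<circ> u"
    by (simp add: inv_comp gal_inv u *(4) inv_inv)
  have "Phi p C s = Phi p' C s" if C: "C \<in> lambda_objects v" and s: "s \<in> fiber C" for C s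
  proof -
    obtain E \<psi> where C': "C = (E, \<psi>)" by (cases C)
    interpret C: lambda_object v E \<psi> using C C' by (intro lambda_objectI) simp
    have s': "s \<in> C.F" using s by (simp add: C' fiber_def)
    note XO = C[unfolded C']
    have q: "qact r E \<psi> s \<in> C.F" by (rule C.qact_mem[OF *(3) s'])
    have "Phi p' C s = gact E (inv' \<sigma> \<circ> u) (qact (Some u) E \<psi> (qact r E \<psi> s))"
      unfolding p' C' Phi_apply[OF XO s'] inv' C.qact_qact[OF *(3) uQ s'] ..
    also have "\<dots> = gact E (inv' \<sigma> \<circ> u \<circ> inv' u) (qact r E \<psi> s)"
      by (simp add: C.qact_inertia[OF *(5) q] C.gact_gact)
    also have "inv' \<sigma> \<circ> u \<circ> inv' u = inv' \<sigma>"
      using gal_comp_inv(1)[OF u(2)] by (simp add: comp_assoc)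
    finally show ?thesis unfolding C' *(1) Phi_apply[OF XO s'] ..
  qed
  then have "Phi p = Phi p'" by (intro ext) (auto simp: Phi_def)
  then show ?thesis using * p' ru gal_comp[OF gal_inv[OF u(2)] *(4)] by (simp add: carrier_SD)
qed

subsection \<open>Continuity\<close>

lemma continuous_map_to_discrete:
  assumes "\<And>x. x \<in> topspace T \<Longrightarrow> f x \<in> S"
    and "\<And>x. x \<in> topspace T \<Longrightarrow> \<exists>U. openin T U \<and> x \<in> U \<and> (\<forall>y\<in>U. f y = f x)"
  shows "continuous_map T (discrete_topology S) f"
  unfolding continuous_map_def
proof (intro conjI allI impI)
  fix V assume "openin (discrete_topology S) V"
  show "openin T {x \<in> topspace T. f x \<in> V}"
  proof (subst openin_subopen, intro ballI)
    fix x assume x: "x \<in> {x \<in> topspace T. f x \<in> V}"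
    then have xT: "x \<in> topspace T" and fx: "f x \<in> V" by simp_all
    from assms(2)[OF xT] obtain U where U: "openin T U" "x \<in> U" "\<forall>y\<in>U. f y = f x" by (elim exE conjE)
    have "U \<subseteq> {x \<in> topspace T. f x \<in> V}"
    proof
      fix y assume y: "y \<in> U"
      have "f y = f x" by (rule bspec[OF U(3) y])
      then show "y \<in> {x \<in> topspace T. f x \<in> V}" using fx subsetD[OF openin_subset[OF U(1)] y] by simp
    qed
    with U(1,2) show "\<exists>U. openin T U \<and> x \<in> U \<and> U \<subseteq> {x \<in> topspace T. f x \<in> V}" by (intro exI conjI)
  qed
qed (use assms(1) in auto)

lemma openin_krull_basic: "finite Z \<Longrightarrow> openin krull_topology {\<tau>\<in>Gal. \<forall>z\<in>Z. \<tau> z = g z}"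
  unfolding openin_krull_iff by (auto intro!: exI[of _ Z])

text \<open>The action on one object is determined by finitely many values, of the finitely many
  points at a finite separating set. Near a pair with first component \<open>Some \<rho>\<close> it
  suffices to agree at finitely many elements; near the zero element large degree suffices.\<close>

lemma Phi_locally_constant:
  assumes C: "(E, \<psi>) \<in> lambda_objects v" and p: "p \<in> carrier SD"
  shows "\<exists>U. openin SDtop U \<and> p \<in> U \<and> (\<forall>p'\<in>U. Phi p' (E, \<psi>) = Phi p (E, \<psi>))"
proof -
  interpret C: lambda_object v E \<psi> by (rule lambda_objectI[OF C])
  obtain r \<sigma> where p1: "p = (r, \<sigma>)" "r \<in> carrier (Q_monoid v)" "\<sigma> \<in> Gal" using p by (auto simp: carrier_SD)
  obtain S where S: "S \<subseteq> C.A" "finite S" "\<And>s s'. s \<in> C.F \<Longrightarrow> s' \<in> C.F \<Longrightarrow> (\<forall>a\<in>S. s a = s' a) \<Longrightarrow> s = s'"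
    using C.ex_finite_separating by metis
  have SE: "S \<subseteq> carrier E" using S(1) C.A_sub by blast
  have key: "Phi p' (E, \<psi>) = Phi p (E, \<psi>)"
    if p': "p' = (r', \<sigma>')" "r' \<in> carrier (Q_monoid v)" "\<sigma>' \<in> Gal"
      and eq: "\<And>s a. s \<in> C.F \<Longrightarrow> a \<in> S \<Longrightarrow>
        inv' \<sigma>' (qact r' E \<psi> s a) = inv' \<sigma> (qact r E \<psi> s a)" for p' r' \<sigma>'
  proof -
    have "Phi p' (E, \<psi>) s = Phi p (E, \<psi>) s" if s: "s \<in> C.F" for s
      unfolding p'(1) p1(1) Phi_apply[OF C s]
    proof (rule S(3))
      show "gact E (inv' \<sigma>') (qact r' E \<psi> s) \<in> C.F" "gact E (inv' \<sigma>) (qact r E \<psi> s) \<in> C.F"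
        by (intro C.gact_mem gal_inv C.qact_mem p' p1 s)+
      show "\<forall>a\<in>S. gact E (inv' \<sigma>') (qact r' E \<psi> s) a = gact E (inv' \<sigma>) (qact r E \<psi> s) a"
        using eq[OF s] SE by (auto simp: gact_def)
    qed
    then show ?thesis using C by (intro ext) (auto simp: Phi_def fiber_def)
  qed
  \<comment> \<open>It is the inverses that have to agree, so \<open>\<sigma>'\<close> and
    \<open>\<sigma>\<close> are compared at the images under \<open>inv' \<sigma>\<close> of the
    values in question.\<close>
  define Z where "Z = (\<lambda>(s, a). inv' \<sigma> (qact r E \<psi> s a)) ` (C.F \<times> S)"
  have Z: "finite Z" unfolding Z_def using C.finite_F S(2) by simp
  define V where "V = {\<tau>\<in>Gal. \<forall>z\<in>Z. \<tau> z = \<sigma> z}"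
  have V: "openin krull_topology V" unfolding V_def by (rule openin_krull_basic[OF Z])
  have V_inv: "inv' \<sigma>' (qact r E \<psi> s a) = inv' \<sigma> (qact r E \<psi> s a)"
    if "\<sigma>' \<in> V" "s \<in> C.F" "a \<in> S" for \<sigma>' s a
  proof -
    have G: "\<sigma>' \<in> Gal" and z: "\<forall>z\<in>Z. \<sigma>' z = \<sigma> z" using that by (auto simp: V_def)
    have "inv' \<sigma> (qact r E \<psi> s a) \<in> Z" unfolding Z_def using that by force
    then have "\<sigma>' (inv' \<sigma> (qact r E \<psi> s a)) = qact r E \<psi> s a"
      using z gal_inv_cancel(1)[OF p1(3)] by simp
    then show ?thesis using gal_inv_cancel(2)[OF G] by metis
  qed
  show ?thesis
  proof (cases r)
    case None
    define D where "D = insert None (Some ` {\<tau>. \<exists>n\<ge>stab E \<psi>. deg_is \<tau> n})"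
    have D: "openin (Q_topology v) D" unfolding D_def by (rule openin_Q_large_degree)
    have q: "qact r' E \<psi> s = qact r E \<psi> s" if "r' \<in> D" "s \<in> C.F" for r' s
      using that None C.retr_eq[OF that(2)] by (auto simp: D_def qact_def deg_eq)
    show ?thesis
    proof (intro exI[of _ "D \<times> V"] conjI ballI)
      show "openin SDtop (D \<times> V)" using D V by (simp add: openin_prod_Times_iff)
      show "p \<in> D \<times> V" using p1 None by (auto simp: D_def V_def)
      fix p' assume "p' \<in> D \<times> V"
      then obtain r' \<sigma>' where p': "p' = (r', \<sigma>')" "r' \<in> D" "\<sigma>' \<in> V" by auto
      have "r' \<in> carrier (Q_monoid v)" using p'(2) Some_mem_Q unfolding D_def by (auto simp: carrier_Q)
      moreover have "\<sigma>' \<in> Gal" using p'(3) by (simp add: V_def)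
      ultimately show "Phi p' (E, \<psi>) = Phi p (E, \<psi>)"
        by (rule key[OF p'(1)]) (simp add: q[OF p'(2)] V_inv[OF p'(3)])
    qed
  next
    case (Some \<rho>)
    then have \<rho>: "deg_is \<rho> (deg \<rho>)" using p1(2) deg_is_deg by (auto simp: carrier_Q)
    \<comment> \<open>The image of \<open>Z\<close> under \<open>\<sigma>\<close> consists of the
      values \<open>qact r E \<psi> s a\<close>. Agreement of \<open>\<tau>\<close> and
      \<open>\<rho>\<close> there makes their inverses agree at the shifted values.\<close>
    define D where "D = Some ` {\<tau>. deg_is \<tau> (deg \<rho>) \<and> (\<forall>x\<in>\<sigma> ` Z. \<tau> x = \<rho> x)}"
    have D: "openin (Q_topology v) D" unfolding D_def by (rule openin_Q_basic) (use Z in simp)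
    have q: "qact r' E \<psi> s a = qact r E \<psi> s a" if r': "r' \<in> D" and s: "s \<in> C.F" "a \<in> S" for r' s a
    proof -
      obtain \<tau> where \<tau>: "r' = Some \<tau>" "deg_is \<tau> (deg \<rho>)" "\<forall>x\<in>\<sigma> ` Z. \<tau> x = \<rho> x" using r' by (auto simp: D_def)
      have aE: "a \<in> carrier E" using s SE by blast
      have qr: "qact r E \<psi> s a = inv' \<rho> (shift E \<psi> s (deg \<rho>) a)" using Some aE by (simp add: qact_def gact_def)
      have "inv' \<sigma> (qact r E \<psi> s a) \<in> Z" unfolding Z_def using s by force
      then have "\<sigma> (inv' \<sigma> (qact r E \<psi> s a)) \<in> \<sigma> ` Z" by blast
      then have "qact r E \<psi> s a \<in> \<sigma> ` Z" by (simp add: gal_inv_cancel(1)[OF p1(3)])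
      then have "\<tau> (qact r E \<psi> s a) = \<rho> (qact r E \<psi> s a)" using \<tau>(3) by blast
      then have "\<tau> (qact r E \<psi> s a) = shift E \<psi> s (deg \<rho>) a"
        using gal_inv_cancel(1)[OF deg_is_Gal[OF \<rho>]] by (simp add: qr)
      then have "qact r E \<psi> s a = inv' \<tau> (shift E \<psi> s (deg \<rho>) a)"
        using gal_inv_cancel(2)[OF deg_is_Gal[OF \<tau>(2)]] by metis
      then show ?thesis using \<tau>(1) deg_eq[OF \<tau>(2)] aE by (simp add: qact_def gact_def)
    qed
    show ?thesis
    proof (intro exI[of _ "D \<times> V"] conjI ballI)
      show "openin SDtop (D \<times> V)" using D V by (simp add: openin_prod_Times_iff)
      show "p \<in> D \<times> V" using p1 Some \<rho> by (auto simp: D_def V_def)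
      fix p' assume "p' \<in> D \<times> V"
      then obtain r' \<sigma>' where p': "p' = (r', \<sigma>')" "r' \<in> D" "\<sigma>' \<in> V" by auto
      have "r' \<in> carrier (Q_monoid v)" using p'(2) Some_mem_Q unfolding D_def by blast
      moreover have "\<sigma>' \<in> Gal" using p'(3) by (simp add: V_def)
      ultimately show "Phi p' (E, \<psi>) = Phi p (E, \<psi>)"
        by (rule key[OF p'(1)]) (simp add: q[OF p'(2)] V_inv[OF p'(3)])
    qed
  qed
qed

lemma topspace_SD: "topspace SDtop = carrier SD"
  by (simp add: carrier_SD carrier_Q)

lemma continuous_Phi:
  "continuous_map SDtop (fundamental_monoid_topology v) Phi"
  unfolding fundamental_monoid_topology_def functor_End_topology_def
proof (rule continuous_map_into_subtopology)
  show "Phi \<in> topspace SDtop \<rightarrow>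
      carrier (functor_End (lambda_objects v) lambda_homs fiber fiber_map)"
    using Phi_mem unfolding topspace_SD fundamental_monoid_def by auto
  show "continuous_map SDtop
     (product_topology (\<lambda>A. discrete_topology (fiber A \<rightarrow>\<^sub>E fiber A)) (lambda_objects v)) Phi"
    unfolding continuous_map_componentwise
  proof (intro conjI ballI)
    show "Phi ` topspace SDtop \<subseteq> extensional (lambda_objects v)"
      by (auto simp: Phi_def)
    fix C assume C: "C \<in> lambda_objects v"
    show "continuous_map SDtop (discrete_topology (fiber C \<rightarrow>\<^sub>E fiber C)) (\<lambda>p. Phi p C)"
    proof (rule continuous_map_to_discrete)
      fix p assume "p \<in> topspace SDtop"
      then have p: "p \<in> carrier SD" by (simp only: topspace_SD)
      show "Phi p C \<in> fiber C \<rightarrow>\<^sub>E fiber C"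
        using Phi_mem[OF p] C by (auto simp: fundamental_monoid_def functor_End_def)
      show "\<exists>U. openin SDtop U \<and> p \<in> U \<and> (\<forall>p'\<in>U. Phi p' C = Phi p C)"
        using Phi_locally_constant[of "fst C" "snd C" p] C p by simp
    qed
  qed
qed

end

section \<open>Quotients of compact monoids\<close>

text \<open>A continuous surjection from a compact to a Hausdorff space is a quotient map.\<close>

lemma topological_monoid_iso_quotient:
  fixes T :: "'a topology" and U :: "'b topology" and M :: "('a, 'c) monoid_scheme" and N :: "('b, 'd) monoid_scheme"
  assumes cont: "continuous_map T U f" and T: "compact_space T" and U: "Hausdorff_space U"
    and top: "topspace T = carrier M" "topspace U = carrier N"
    and surj: "f ` carrier M = carrier N"
    and closed: "\<And>x y. x \<in> carrier M \<Longrightarrow> y \<in> carrier M \<Longrightarrow> x \<otimes>\<^bsub>M\<^esub> y \<in> carrier M"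
    and mult: "\<And>x y. x \<in> carrier M \<Longrightarrow> y \<in> carrier M \<Longrightarrow> f (x \<otimes>\<^bsub>M\<^esub> y) = f x \<otimes>\<^bsub>N\<^esub> f y"
    and r: "r = {(x, y). x \<in> carrier M \<and> y \<in> carrier M \<and> f x = f y}"
  shows "topological_monoid_iso N U (quotient_monoid M r) (quotient_topology T r)"
proof -
  define g where "g = (\<lambda>a. {x \<in> carrier M. f x = a})"
  have g_f: "r `` {x} = g (f x)" if "x \<in> carrier M" for x
    using that by (auto simp: r g_def)
  have quot: "carrier M // r = g ` carrier N"
    unfolding quotient_def surj[symmetric] using g_f by auto
  have inj: "inj_on g (carrier N)"
  proof (rule inj_onI)
    fix a b assume "a \<in> carrier N" "b \<in> carrier N" and eq: "g a = g b"
    then obtain x where "x \<in> carrier M" "f x = a" using surj by (metis imageE)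
    then have "x \<in> g a" by (simp add: g_def)
    then have "x \<in> g b" using eq by simp
    then show "a = b" using \<open>f x = a\<close> by (simp add: g_def)
  qed
  have top_q: "topspace (quotient_topology T r) = carrier M // r"
  proof (rule antisym)
    show "topspace (quotient_topology T r) \<subseteq> carrier M // r"
      using openin_topspace[of "quotient_topology T r"] unfolding openin_quotient_topology top by (rule conjunct1)
    have "{x \<in> topspace T. r `` {x} \<in> carrier M // r} = topspace T"
      using top by (auto intro: quotientI)
    then have "openin (quotient_topology T r) (carrier M // r)"
      unfolding openin_quotient_topology using openin_topspace[of T] by (simp add: top(1))
    then show "carrier M // r \<subseteq> topspace (quotient_topology T r)" by (rule openin_subset)
  qed
  have cmap: "closed_map T U f" using continuous_imp_closed_map[OF cont T U] .
  have gf_in: "r `` {x} \<in> g ` W \<longleftrightarrow> f x \<in> W" if "x \<in> carrier M" "W \<subseteq> carrier N" for x W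
    unfolding g_f[OF that(1)] using inj that surj by (auto dest: inj_onD)
  have hom: "homeomorphic_map U (quotient_topology T r) g"
  proof (rule bijective_open_imp_homeomorphic_map)
    show "g ` topspace U = topspace (quotient_topology T r)" unfolding top_q quot top ..
    show "inj_on g (topspace U)" unfolding top by (rule inj)
    show "open_map U (quotient_topology T r) g"
      unfolding open_map_def
    proof (intro allI impI)
      fix W assume W: "openin U W"
      then have WN: "W \<subseteq> carrier N" using openin_subset top(2) by metis
      have "{x \<in> topspace T. r `` {x} \<in> g ` W} = {x \<in> topspace T. f x \<in> W}"
        using gf_in[OF _ WN] by (auto simp: top)
      moreover have "openin T {x \<in> topspace T. f x \<in> W}" by (rule openin_continuous_map_preimage[OF cont W])
      ultimately show "openin (quotient_topology T r) (g ` W)"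
        unfolding openin_quotient_topology top quot using WN by auto
    qed
    show "continuous_map U (quotient_topology T r) g"
      unfolding continuous_map_def
    proof (intro conjI allI impI)
      show "g \<in> topspace U \<rightarrow> topspace (quotient_topology T r)" unfolding top_q quot top by auto
      fix V assume V: "openin (quotient_topology T r) V"
      define Z where "Z = {x \<in> topspace T. r `` {x} \<in> V}"
      have Z: "openin T Z" using V unfolding openin_quotient_topology Z_def by (rule conjunct2)
      \<comment> \<open>\<open>Z\<close> is a union of fibers of \<open>f\<close>, so the image of
        its complement is exactly the complement of the preimage of \<open>V\<close> under
        \<open>g\<close>.\<close>
      have "closedin U (f ` (topspace T - Z))" using cmap Z unfolding closed_map_def by blast
      then have op: "openin U (topspace U - f ` (topspace T - Z))" by blast
      have "topspace U - f ` (topspace T - Z) = {a \<in> topspace U. g a \<in> V}"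
      proof (rule Set.set_eqI)
        fix a
        show "a \<in> topspace U - f ` (topspace T - Z) \<longleftrightarrow> a \<in> {a \<in> topspace U. g a \<in> V}"
        proof (cases "a \<in> carrier N")
          case True
          then obtain x where x: "x \<in> carrier M" "f x = a" using surj by (metis imageE)
          have Zx: "y \<in> Z \<longleftrightarrow> g a \<in> V" if "y \<in> carrier M" "f y = a" for y
            using that g_f[OF that(1)] by (simp add: Z_def top)
          show ?thesis using True x Zx by (auto simp: top)
        qed (simp add: top)
      qed
      with op show "openin U {a \<in> topspace U. g a \<in> V}" by simp
    qed
  qed
  have "g \<in> iso N (quotient_monoid M r)"
  proof (rule isoI)
    show "bij_betw g (carrier N) (carrier (quotient_monoid M r))"
      using inj by (simp add: quotient_monoid_def quot bij_betw_def)
    show "g \<in> hom N (quotient_monoid M r)"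
    proof (rule homI)
      fix a b assume ab: "a \<in> carrier N" "b \<in> carrier N"
      obtain x y where x: "x \<in> carrier M" "f x = a" and y: "y \<in> carrier M" "f y = b"
        using ab surj by (metis imageE)
      have "r `` {x' \<otimes>\<^bsub>M\<^esub> y'} = g (a \<otimes>\<^bsub>N\<^esub> b)" if "x' \<in> g a" "y' \<in> g b" for x' y'
      proof -
        have "x' \<in> carrier M" "y' \<in> carrier M" "f x' = a" "f y' = b" using that by (auto simp: g_def)
        then show ?thesis using g_f[OF closed] mult by simp
      qed
      moreover have "x \<in> g a" "y \<in> g b" using x y by (auto simp: g_def)
      ultimately have "(\<Union>x'\<in>g a. \<Union>y'\<in>g b. r `` {x' \<otimes>\<^bsub>M\<^esub> y'}) = g (a \<otimes>\<^bsub>N\<^esub> b)" by blast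
      then show "g (a \<otimes>\<^bsub>N\<^esub> b) = g a \<otimes>\<^bsub>quotient_monoid M r\<^esub> g b" by (simp add: quotient_monoid_def)
    qed (simp add: quotient_monoid_def quot)
  qed
  then show ?thesis unfolding topological_monoid_iso_def using hom by blast
qed

section \<open>Algebras of functions with values in the algebraic closure\<close>

definition cst :: "'l::field \<Rightarrow> 'b \<Rightarrow> 'l alg_closure" where "cst c = (\<lambda>_. to_ac c)"

lemma cst_apply: "cst c t = to_ac c" by (simp add: cst_def)

text \<open>Evaluation at a point is unfolded on demand only, so that identities between functions
  can be handled as identities in a commutative ring.\<close>

lemmas fun_apply = plus_fun_apply zero_fun_apply times_fun_apply one_fun_apply cst_apply minus_apply uminus_apply
declare plus_fun_apply [simp del] zero_fun_apply [simp del] times_fun_apply [simp del] one_fun_apply [simp del]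
  minus_apply [simp del] uminus_apply [simp del]

lemma cst_simps: "cst (a + b) = cst a + cst b" "cst (a * b) = cst a * cst b" "cst 1 = 1" "cst 0 = 0" "cst (- a) = - cst a"
  by (auto simp: fun_eq_iff fun_apply)

lemma sum_fun_apply: "(\<Sum>i\<in>I. f i) t = (\<Sum>i\<in>I. f i t)"
  by (induction I rule: infinite_finite_induct) (auto simp: fun_apply)

lemma prod_fun_apply: "(\<Prod>i\<in>I. f i) t = (\<Prod>i\<in>I. f i t)"
  by (induction I rule: infinite_finite_induct) (auto simp: fun_apply)

lemma power_fun_apply: "(f ^ n) t = f t ^ n"
  by (induction n) (auto simp: fun_apply)

text \<open>An algebra \<open>D\<close> of functions with unit \<open>e\<close>, transported along \<open>\<kappa>\<close> to another carrier type.\<close>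

definition fmod :: "(('b \<Rightarrow> 'l::field alg_closure) \<Rightarrow> 'x) \<Rightarrow> ('x \<Rightarrow> 'b \<Rightarrow> 'l alg_closure) \<Rightarrow> ('b \<Rightarrow> 'l alg_closure) set \<Rightarrow>
    ('b \<Rightarrow> 'l alg_closure) \<Rightarrow> ('l, 'x) module" where
  "fmod \<kappa> \<iota> D e = \<lparr>carrier = \<kappa> ` D, monoid.mult = (\<lambda>x y. \<kappa> (\<iota> x * \<iota> y)), one = \<kappa> e, ring.zero = \<kappa> 0,
     add = (\<lambda>x y. \<kappa> (\<iota> x + \<iota> y)), module.smult = (\<lambda>c x. \<kappa> (cst c * \<iota> x))\<rparr>"

text \<open>The unit \<open>e\<close> is a parameter since it is rarely the constant function 1: for
  functions supported on a finite set it is the indicator of that set, and for a field factor it is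
  an idempotent. The left inverse \<open>\<iota>\<close> makes \<open>\<kappa>\<close> injective on
  \<open>D\<close>.\<close>

locale fun_ring =
  fixes \<kappa> :: "('b \<Rightarrow> 'l::field alg_closure) \<Rightarrow> 'x" and \<iota> D e
  assumes dec [simp]: "f \<in> D \<Longrightarrow> \<iota> (\<kappa> f) = f"
    and add_D: "f \<in> D \<Longrightarrow> g \<in> D \<Longrightarrow> f + g \<in> D"
    and mult_D: "f \<in> D \<Longrightarrow> g \<in> D \<Longrightarrow> f * g \<in> D"
    and cst_D: "f \<in> D \<Longrightarrow> cst c * f \<in> D"
    and e_D: "e \<in> D" and e_mult: "f \<in> D \<Longrightarrow> e * f = f"
begin

abbreviation "E \<equiv> fmod \<kappa> \<iota> D e"

lemma zero_D: "0 \<in> D"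
  using cst_D[OF e_D, of 0] by (simp add: cst_simps)

lemma minus_D: "f \<in> D \<Longrightarrow> - f \<in> D"
  using cst_D[of f "-1"] by (simp add: cst_simps)

lemma diff_D: "f \<in> D \<Longrightarrow> g \<in> D \<Longrightarrow> f - g \<in> D"
  using add_D[of f "- g"] minus_D by simp

lemma sum_D: "(\<And>i. i \<in> I \<Longrightarrow> f i \<in> D) \<Longrightarrow> (\<Sum>i\<in>I. f i) \<in> D"
  by (induction I rule: infinite_finite_induct) (auto intro: zero_D add_D)

lemma fmod_sel [simp]:
  "carrier E = \<kappa> ` D" "\<one>\<^bsub>E\<^esub> = \<kappa> e" "\<zero>\<^bsub>E\<^esub> = \<kappa> 0"
  "f \<in> D \<Longrightarrow> g \<in> D \<Longrightarrow> \<kappa> f \<otimes>\<^bsub>E\<^esub> \<kappa> g = \<kappa> (f * g)"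
  "f \<in> D \<Longrightarrow> g \<in> D \<Longrightarrow> \<kappa> f \<oplus>\<^bsub>E\<^esub> \<kappa> g = \<kappa> (f + g)"
  "f \<in> D \<Longrightarrow> c \<odot>\<^bsub>E\<^esub> \<kappa> f = \<kappa> (cst c * f)"
  by (simp_all add: fmod_def)

lemma kappa_eq_iff: "f \<in> D \<Longrightarrow> g \<in> D \<Longrightarrow> \<kappa> f = \<kappa> g \<longleftrightarrow> f = g"
  by (metis dec)

lemma cring_E: "cring E"
proof (rule cringI)
  show "abelian_group E"
  proof (rule abelian_groupI)
    fix x assume "x \<in> carrier E"
    then obtain f where "x = \<kappa> f" "f \<in> D" by auto
    then show "\<exists>y\<in>carrier E. y \<oplus>\<^bsub>E\<^esub> x = \<zero>\<^bsub>E\<^esub>"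
      using minus_D by (intro bexI[of _ "\<kappa> (- f)"]) auto
  qed (auto simp: add_D zero_D algebra_simps)
  show "comm_monoid E"
    by (rule comm_monoidI) (auto simp: mult_D e_D e_mult mult.assoc, simp add: mult.commute)
qed (auto simp: mult_D add_D distrib_right)

lemma algebra_E: "Module.algebra base_field E"
proof (rule algebraI)
  show "cring (base_field :: 'l ring)"
  proof -
    have "\<exists>y. y + x = 0 \<and> x + y = 0" for x :: 'l by (intro exI[of _ "- x"]) simp
    then show ?thesis by unfold_locales (auto simp: algebra_simps Units_def)
  qed
qed (auto simp: cring_E cst_D add_D mult_D cst_simps distrib_left distrib_right mult.assoc)

lemma finsum_E: "finite S \<Longrightarrow> (\<And>s. s \<in> S \<Longrightarrow> f s \<in> D) \<Longrightarrow> (\<Oplus>\<^bsub>E\<^esub>s\<in>S. \<kappa> (f s)) = \<kappa> (\<Sum>s\<in>S. f s)"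
proof (induction S rule: finite_induct)
  case empty
  interpret cring E by (rule cring_E)
  show ?case unfolding finsum_empty sum.empty fmod_sel(3) ..
next
  case (insert x S)
  interpret cring E by (rule cring_E)
  have "(\<Oplus>\<^bsub>E\<^esub>s\<in>insert x S. \<kappa> (f s)) = \<kappa> (f x) \<oplus>\<^bsub>E\<^esub> (\<Oplus>\<^bsub>E\<^esub>s\<in>S. \<kappa> (f s))"
    using insert by (intro finsum_insert) auto
  also have "\<dots> = \<kappa> (f x + sum f S)"
    unfolding insert.IH[OF insert.prems[OF insertI2], simplified] using insert.prems by (intro fmod_sel(5) sum_D) auto
  finally show ?case unfolding sum.insert[OF insert.hyps] .
qed

text \<open>The factor \<open>e\<close> corrects the exponent 0, where \<open>f ^ 0\<close> is the
  constant function 1 and not the unit of the algebra.\<close>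

lemma power_E: "f \<in> D \<Longrightarrow> \<kappa> f [^]\<^bsub>E\<^esub> (n::nat) = \<kappa> (e * f ^ n) \<and> e * f ^ n \<in> D"
proof (induction n)
  case 0
  interpret cring E by (rule cring_E)
  show ?case using e_D by simp
next
  case (Suc n)
  interpret cring E by (rule cring_E)
  have eq: "e * f ^ Suc n = (e * f ^ n) * f" by (simp only: power_Suc2 mult.assoc)
  have "\<kappa> f [^]\<^bsub>E\<^esub> Suc n = \<kappa> (e * f ^ n) \<otimes>\<^bsub>E\<^esub> \<kappa> f" using Suc by (simp only: nat_pow_Suc)
  also have "\<dots> = \<kappa> (e * f ^ Suc n)" unfolding eq using Suc by (intro fmod_sel(4)) auto
  finally show ?case using mult_D[of "e * f ^ n" f] Suc unfolding eq by simp
qed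

lemma alg_eval_E:
  assumes f: "f \<in> D"
  shows "alg_eval E p (\<kappa> f) = \<kappa> (\<lambda>t. e t * aeval p (f t))" "(\<lambda>t. e t * aeval p (f t)) \<in> D"
proof -
  have eq: "(\<lambda>t. e t * aeval p (f t)) = (\<Sum>i\<le>Polynomial.degree p. cst (poly.coeff p i) * (e * f ^ i))"
    by (auto simp: fun_eq_iff fun_apply aeval_altdef sum_distrib_left sum_fun_apply power_fun_apply intro!: sum.cong)
  interpret cring E by (rule cring_E)
  have "alg_eval E p (\<kappa> f) = (\<Oplus>\<^bsub>E\<^esub>i\<in>{..Polynomial.degree p}. \<kappa> (cst (poly.coeff p i) * (e * f ^ i)))"
    unfolding alg_eval_def using power_E[OF f] by (intro finsum_cong') (auto simp: cst_D)
  also have "\<dots> = \<kappa> (\<lambda>t. e t * aeval p (f t))"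
    unfolding eq using power_E[OF f] cst_D by (intro finsum_E) auto
  finally show "alg_eval E p (\<kappa> f) = \<kappa> (\<lambda>t. e t * aeval p (f t))" .
  show "(\<lambda>t. e t * aeval p (f t)) \<in> D" unfolding eq using power_E[OF f] by (intro sum_D cst_D) auto
qed

lemma lin_span_subset: "S \<subseteq> D \<Longrightarrow> lin_span E R (\<kappa> ` S) \<subseteq> \<kappa> ` {\<Sum>s\<in>U. cst (c s) * s | c U. finite U \<and> U \<subseteq> S \<and> (\<forall>s\<in>U. c s \<in> R)}"
proof
  fix x assume S: "S \<subseteq> D" and "x \<in> lin_span E R (\<kappa> ` S)"
  then obtain c U where U: "finite U" "U \<subseteq> \<kappa> ` S" "c \<in> U \<rightarrow> R" "x = (\<Oplus>\<^bsub>E\<^esub>s\<in>U. c s \<odot>\<^bsub>E\<^esub> s)"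
    unfolding lin_span_def by blast
  interpret cring E by (rule cring_E)
  obtain V where V: "V \<subseteq> S" "U = \<kappa> ` V" "inj_on \<kappa> V"
    using U(2) by (meson subset_image_inj)
  have VD: "V \<subseteq> D" using V S by blast
  have fin: "finite V" using U(1) V finite_image_iff by blast
  have "x = (\<Oplus>\<^bsub>E\<^esub>s\<in>V. c (\<kappa> s) \<odot>\<^bsub>E\<^esub> \<kappa> s)"
    unfolding U(4) V(2) using VD V(3) cst_D by (intro finsum_reindex) auto
  also have "\<dots> = (\<Oplus>\<^bsub>E\<^esub>s\<in>V. \<kappa> (cst (c (\<kappa> s)) * s))"
    using VD cst_D by (intro finsum_cong') auto
  also have "\<dots> = \<kappa> (\<Sum>s\<in>V. cst (c (\<kappa> s)) * s)" using VD by (intro finsum_E fin cst_D) auto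
  finally show "x \<in> \<kappa> ` {\<Sum>s\<in>U. cst (c s) * s | c U. finite U \<and> U \<subseteq> S \<and> (\<forall>s\<in>U. c s \<in> R)}"
    using U(3) V fin by (auto intro!: imageI exI[of _ "\<lambda>s. c (\<kappa> s)"] exI[of _ V])
qed

lemma lin_spanI: assumes S: "S \<subseteq> D" "finite U" "U \<subseteq> S" "\<forall>s\<in>U. c s \<in> R"
  shows "\<kappa> (\<Sum>s\<in>U. cst (c s) * s) \<in> lin_span E R (\<kappa> ` S)"
proof -
  interpret cring E by (rule cring_E)
  have UD: "U \<subseteq> D" using S by blast
  have inj: "inj_on \<kappa> U" using UD by (intro inj_on_inverseI[of _ \<iota>]) auto
  have "(\<Oplus>\<^bsub>E\<^esub>s\<in>\<kappa> ` U. c (\<iota> s) \<odot>\<^bsub>E\<^esub> s) = (\<Oplus>\<^bsub>E\<^esub>s\<in>U. c (\<iota> (\<kappa> s)) \<odot>\<^bsub>E\<^esub> \<kappa> s)"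
    using UD inj cst_D by (intro finsum_reindex) auto
  also have "\<dots> = (\<Oplus>\<^bsub>E\<^esub>s\<in>U. \<kappa> (cst (c s) * s))" using UD cst_D by (intro finsum_cong') auto
  also have "\<dots> = \<kappa> (\<Sum>s\<in>U. cst (c s) * s)" using UD by (intro finsum_E S(2) cst_D) auto
  finally have "\<kappa> (\<Sum>s\<in>U. cst (c s) * s) = (\<Oplus>\<^bsub>E\<^esub>s\<in>\<kappa> ` U. c (\<iota> s) \<odot>\<^bsub>E\<^esub> s)" ..
  then show ?thesis
    by (intro lin_span_memI[of "\<kappa> ` U" _ "\<lambda>s. c (\<iota> s)"]) (use S UD in auto)
qed

lemma lin_span_rspan:
  assumes S: "S \<subseteq> D" "finite S" and R: "0 \<in> R"
  shows "lin_span E R (\<kappa> ` S) = \<kappa> ` rspan (cst ` R) S"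
proof (rule antisym)
  show "lin_span E R (\<kappa> ` S) \<subseteq> \<kappa> ` rspan (cst ` R) S"
  proof
    fix x assume "x \<in> lin_span E R (\<kappa> ` S)"
    from subsetD[OF lin_span_subset[OF S(1)] this]
    obtain c U where U: "finite U" "U \<subseteq> S" "\<forall>s\<in>U. c s \<in> R" "x = \<kappa> (\<Sum>s\<in>U. cst (c s) * s)" by blast
    have "(\<Sum>s\<in>U. cst (c s) * s) = (\<Sum>s\<in>S. cst (if s \<in> U then c s else 0) * s)"
      using U S by (intro sum.mono_neutral_cong_left) (auto simp: cst_simps)
    then show "x \<in> \<kappa> ` rspan (cst ` R) S"
      unfolding U(4) rspan_def using U R
      by (intro imageI CollectI exI[of _ "\<lambda>s. cst (if s \<in> U then c s else 0)"]) auto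
  qed
  show "\<kappa> ` rspan (cst ` R) S \<subseteq> lin_span E R (\<kappa> ` S)"
  proof
    fix x assume "x \<in> \<kappa> ` rspan (cst ` R) S"
    then obtain c where c: "x = \<kappa> (\<Sum>b\<in>S. c b * b)" "\<forall>b\<in>S. c b \<in> cst ` R" by (auto simp: rspan_def)
    then obtain d where d: "\<forall>b\<in>S. c b = cst (d b) \<and> d b \<in> R" unfolding image_iff by (metis (no_types))
    then have "x = \<kappa> (\<Sum>b\<in>S. cst (d b) * b)" unfolding c(1) by (metis (no_types, lifting) sum.cong)
    then show "x \<in> lin_span E R (\<kappa> ` S)" using d lin_spanI[OF S(1,2) order_refl, of d R] by simp
  qed
qed

end

text \<open>In characteristic zero the derivative is non-zero and of smaller degree, so a common
  divisor \<open>c\<close> cannot vanish at \<open>x\<close>. Its cofactor in the minimal polynomial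
  then does and has full degree, which leaves degree 0 for \<open>c\<close>.\<close>

lemma (in local_field) coprime_min_poly_pderiv: 
  fixes x :: "'l alg_closure" shows "coprime (min_poly x) (pderiv (min_poly x))"
proof (rule coprimeI)
  fix c assume c: "c dvd min_poly x" "c dvd pderiv (min_poly x)"
  let ?p = "min_poly x" and ?n = "Polynomial.degree (min_poly x)"
  have n: "?n > 0" by (rule degree_min_poly_pos)
  have "poly.coeff (pderiv ?p) (?n - 1) = of_nat ?n"
    using n lead_coeff_min_poly[of x] by (simp add: coeff_pderiv)
  moreover have "of_nat ?n \<noteq> (0::'l)" using char_0[of ?n] n by auto
  ultimately have p'0: "pderiv ?p \<noteq> 0" by auto
  obtain k where k: "?p = c * k" using c(1) by (elim dvdE)
  have ck: "c \<noteq> 0" "k \<noteq> 0" using k min_poly_nonzero[of x] by auto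
  have "aeval c x * aeval k x = 0" using k aeval_min_poly[of x] by (simp flip: aeval_mult)
  moreover have "aeval c x \<noteq> 0"
  proof
    assume "aeval c x = 0"
    then have "?n \<le> Polynomial.degree c" using min_poly_minimal ck by blast
    also have "\<dots> \<le> Polynomial.degree (pderiv ?p)" using c(2) p'0 by (rule dvd_imp_degree_le)
    also have "\<dots> \<le> ?n - 1" by (intro degree_le) (auto simp: coeff_pderiv coeff_eq_0)
    also have "\<dots> < ?n" using n by simp
    finally show False by simp
  qed
  ultimately have "?n \<le> Polynomial.degree k" using min_poly_minimal ck by auto
  then have "Polynomial.degree c = 0" using k ck by (simp add: degree_mult_eq)
  then show "is_unit c" using ck(1) by (metis is_unit_iff_degree)
qed

text \<open>A finite-dimensional algebra of functions on finitely many points, with values in a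
  field, is reduced, hence etale. Its field factors and its points are read off from the evaluations
  at elements of \<open>T\<close>.\<close>

locale point_algebra = local_field v + fun_ring \<kappa> \<iota> C e
  for v :: "'l::field \<Rightarrow> real" and \<kappa> :: "('b \<Rightarrow> 'l alg_closure) \<Rightarrow> 'x" and \<iota> C e +
  fixes T B
  assumes finite_T: "finite T" and e_def: "e = (\<lambda>t. if t \<in> T then 1 else 0)"
    and B: "finite B" "B \<subseteq> C" "C \<subseteq> rspan (range cst) B"
begin

lemma e_apply: "e t = (if t \<in> T then 1 else 0)" by (simp add: e_def)

lemma prod_C: "finite I \<Longrightarrow> (\<And>i. i \<in> I \<Longrightarrow> f i \<in> C) \<Longrightarrow> e * (\<Prod>i\<in>I. f i) \<in> C"
proof (induction I rule: finite_induct)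
  case (insert i I)
  then have "f i * (e * prod f I) \<in> C" by (simp add: mult_D)
  moreover have "e * prod f (insert i I) = f i * (e * prod f I)"
    unfolding prod.insert[OF insert.hyps] by (rule mult.left_commute)
  ultimately show ?case by simp
qed (simp add: e_D)

lemma ex_inverse_at:
  assumes f: "f \<in> C" and r: "r \<in> T" "f r \<noteq> 0"
  shows "\<exists>g\<in>C. f r * g r = 1"
proof -
  obtain p where p: "aeval p (f r) = inverse (f r)" using inverse_eq_aeval[OF r(2)] by (elim exE)
  show ?thesis using alg_eval_E(2)[OF f, of p] p r
    by (intro bexI[of _ "\<lambda>t. e t * aeval p (f t)"]) (simp_all add: e_apply)
qed

text \<open>Equal kernels of evaluation; the classes of points of \<open>T\<close> correspond to the
  field factors.\<close>

definition equiv_pt :: "'b \<Rightarrow> 'b \<Rightarrow> bool" where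
  "equiv_pt r s \<longleftrightarrow> (\<forall>f\<in>C. f r = 0 \<longleftrightarrow> f s = 0)"

text \<open>A function vanishing at exactly one of the two points can be normalised to 1 at the
  other one by an inverse taken within the algebra. If it vanishes at \<open>r\<close>, its
  normalisation is subtracted from the unit.\<close>

lemma ex_separating:
  assumes rs: "r \<in> T" "s \<in> T" "\<not> equiv_pt r s"
  shows "\<exists>u\<in>C. u r = 1 \<and> u s = 0"
proof -
  obtain f where f: "f \<in> C" "\<not> (f r = 0 \<longleftrightarrow> f s = 0)" using rs(3) by (auto simp: equiv_pt_def)
  show ?thesis
  proof (cases "f r = 0")
    case False
    then obtain g where g: "g \<in> C" "f r * g r = 1" using ex_inverse_at[OF f(1) rs(1)] by blast
    then show ?thesis using f False by (intro bexI[of _ "f * g"]) (auto simp: fun_apply mult_D)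
  next
    case True
    then obtain g where g: "g \<in> C" "f s * g s = 1" using ex_inverse_at[OF f(1) rs(2)] f by blast
    then show ?thesis using f True rs
      by (intro bexI[of _ "e - f * g"] diff_D e_D mult_D) (auto simp: fun_apply e_apply)
  qed
qed

definition eps :: "'b \<Rightarrow> 'b \<Rightarrow> 'l alg_closure" where
  "eps r = (\<lambda>t. if t \<in> T \<and> equiv_pt r t then 1 else 0)"

text \<open>The product of functions that are 1 at \<open>r\<close> and 0 at \<open>s\<close>, over
  all inequivalent \<open>s\<close>. Each factor is also 1 at the points equivalent to
  \<open>r\<close>, because its difference from \<open>e\<close> vanishes at
  \<open>r\<close>.\<close>

lemma eps_C: assumes r: "r \<in> T" shows "eps r \<in> C"
proof -
  obtain u where u: "\<And>s. s \<in> T \<Longrightarrow> \<not> equiv_pt r s \<Longrightarrow> u s \<in> C \<and> u s r = 1 \<and> u s s = 0"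
    using ex_separating[OF r] by metis
  let ?I = "{s\<in>T. \<not> equiv_pt r s}"
  have "eps r = e * (\<Prod>s\<in>?I. u s)"
  proof
    fix t
    show "eps r t = (e * (\<Prod>s\<in>?I. u s)) t"
    proof (cases "t \<in> T")
      case T: True
      show ?thesis
      proof (cases "equiv_pt r t")
        case True
        have "u s t = 1" if s: "s \<in> T" "\<not> equiv_pt r s" for s
        proof -
          have "u s - e \<in> C" using u[OF s] e_D diff_D by blast
          moreover have "(u s - e) r = 0" using u[OF s] r by (simp add: fun_apply e_apply)
          ultimately have "(u s - e) t = 0" using True by (auto simp: equiv_pt_def)
          then show ?thesis using T by (simp add: fun_apply e_apply)
        qed
        then show ?thesis using T True by (simp add: eps_def fun_apply prod_fun_apply e_apply)
      next
        case False
        have "(\<Prod>s\<in>?I. u s t) = 0"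
          using T False u[OF T False] finite_T by (intro prod_zero bexI[of _ t]) auto
        then show ?thesis using False by (simp add: eps_def fun_apply prod_fun_apply)
      qed
    qed (simp add: eps_def fun_apply e_apply)
  qed
  also have "\<dots> \<in> C" using u finite_T by (intro prod_C) auto
  finally show ?thesis .
qed

lemma eps_idem: "eps r * eps r = eps r"
  by (auto simp: eps_def fun_apply fun_eq_iff)

lemma equiv_refl: "equiv_pt r r" by (simp add: equiv_pt_def)

lemma equiv_trans: "equiv_pt r s \<Longrightarrow> equiv_pt r t \<longleftrightarrow> equiv_pt s t"
  by (auto simp: equiv_pt_def)

lemma eps_eq: "equiv_pt r s \<Longrightarrow> eps r = eps s"
  using equiv_trans[of r s] by (auto simp: eps_def fun_eq_iff)

lemma eps_orthogonal: assumes "eps r \<noteq> eps s" shows "eps r * eps s = 0"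
proof -
  have "\<not> (equiv_pt r t \<and> equiv_pt s t)" for t
  proof
    assume "equiv_pt r t \<and> equiv_pt s t"
    then have "eps r = eps t" "eps s = eps t" using eps_eq by blast+
    with assms show False by simp
  qed
  then show ?thesis by (auto simp: eps_def fun_apply fun_eq_iff)
qed

lemma sum_eps: "(\<Sum>d\<in>eps ` T. d) = e"
proof
  fix t
  show "(\<Sum>d\<in>eps ` T. d) t = e t"
  proof (cases "t \<in> T")
    case True
    have "d t = (if d = eps t then 1 else 0)" if d: "d \<in> eps ` T" for d
    proof -
      obtain r where r: "d = eps r" using d by blast
      show ?thesis
      proof (cases "equiv_pt r t")
        case True
        then show ?thesis using \<open>t \<in> T\<close> r eps_eq[OF True] equiv_refl by (simp add: eps_def[of r] eps_def[of t])
      next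
        case False
        have "eps t t = 1" using \<open>t \<in> T\<close> equiv_refl by (simp add: eps_def)
        moreover have "d t = 0" using False r by (simp add: eps_def)
        ultimately have "d \<noteq> eps t" by force
        then show ?thesis using \<open>d t = 0\<close> by simp
      qed
    qed
    then have "(\<Sum>d\<in>eps ` T. d t) = (\<Sum>d\<in>eps ` T. if d = eps t then 1 else 0)" by (intro sum.cong) auto
    also have "\<dots> = 1" using True finite_T by (subst sum.delta) auto
    finally show ?thesis using True by (simp add: sum_fun_apply e_apply)
  next
    case False
    have "d t = 0" if "d \<in> eps ` T" for d using that False by (auto simp: eps_def)
    then have "(\<Sum>d\<in>eps ` T. d t) = 0" by (rule sum.neutral[OF ballI])
    then show ?thesis using False by (simp add: sum_fun_apply e_apply)
  qed
qed

definition factor :: "'b \<Rightarrow> ('b \<Rightarrow> 'l alg_closure) set" where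
  "factor r = {f \<in> C. eps r * f = f}"

lemma fun_ring_factor: "r \<in> T \<Longrightarrow> fun_ring \<kappa> \<iota> (factor r) (eps r)"
  by unfold_locales
    (auto simp: factor_def add_D mult_D cst_D eps_C eps_idem distrib_left mult.left_commute[of _ "cst _"], simp flip: mult.assoc)

lemma factor_zero:
  assumes r: "r \<in> T" and f: "f \<in> factor r" "f r = 0" shows "f = 0"
proof
  fix t
  have "f t = eps r t * f t" using f(1) by (metis (mono_tags, lifting) factor_def mem_Collect_eq times_fun_apply)
  moreover have "equiv_pt r t \<Longrightarrow> f t = 0" using f by (auto simp: equiv_pt_def factor_def)
  ultimately show "f t = 0 t" by (auto simp: eps_def fun_apply split: if_splits)
qed

text \<open>Evaluation at \<open>r\<close> is injective on the factor by \<open>factor_zero\<close>,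
  so inverses and separable equations can be taken from the value \<open>f r\<close> in the
  closure.\<close>

lemma factor_separable_extension:
  assumes r: "r \<in> T"
  shows "finite_separable_extension (fmod \<kappa> \<iota> (factor r) (eps r))"
proof -
  interpret L: fun_ring \<kappa> \<iota> "factor r" "eps r" by (rule fun_ring_factor[OF r])
  interpret Lr: cring L.E by (rule L.cring_E)
  have er: "eps r r = 1" using r equiv_refl by (simp add: eps_def)
  have "Ring.field L.E"
  proof (rule Lr.cring_fieldI2)
    have "eps r \<noteq> 0" using er by (metis zero_fun_apply zero_neq_one)
    then show "\<zero>\<^bsub>L.E\<^esub> \<noteq> \<one>\<^bsub>L.E\<^esub>" using L.kappa_eq_iff[OF L.zero_D L.e_D] by simp
    fix x assume "x \<in> carrier L.E" "x \<noteq> \<zero>\<^bsub>L.E\<^esub>"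
    then obtain f where f: "x = \<kappa> f" "f \<in> factor r" "f \<noteq> 0" by auto
    then have "f r \<noteq> 0" using factor_zero[OF r] by blast
    then obtain p where p: "aeval p (f r) = inverse (f r)" using inverse_eq_aeval by blast
    define g where "g = (\<lambda>t. eps r t * aeval p (f t))"
    have g: "g \<in> factor r" unfolding g_def by (rule L.alg_eval_E(2)[OF f(2)])
    have fg: "f * g - eps r = 0"
    proof (rule factor_zero[OF r])
      show "f * g - eps r \<in> factor r" by (intro L.diff_D L.mult_D L.e_D f g)
      show "(f * g - eps r) r = 0" using p er \<open>f r \<noteq> 0\<close> by (simp add: fun_apply g_def)
    qed
    then have fg: "f * g = eps r" by simp
    then show "\<exists>y\<in>carrier L.E. x \<otimes>\<^bsub>L.E\<^esub> y = \<one>\<^bsub>L.E\<^esub>"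
      using f g by (intro bexI[of _ "\<kappa> g"]) auto
  qed
  moreover have "\<exists>S\<subseteq>carrier L.E. finite S \<and> carrier L.E = lin_span L.E UNIV S"
  proof -
    let ?S = "(\<lambda>b. eps r * b) ` B"
    have S: "?S \<subseteq> factor r" "finite ?S"
      using B eps_C[OF r] by (auto simp: factor_def mult_D eps_idem simp flip: mult.assoc)
    have "factor r \<subseteq> rspan (range cst) ?S"
    proof
      fix f assume f: "f \<in> factor r"
      interpret K: subring_set "range (cst :: 'l \<Rightarrow> 'b \<Rightarrow> _)"
        by unfold_locales (auto simp: image_iff, (metis cst_simps)+)
      have fB: "f \<in> rspan (range cst) B" using f B(3) by (auto simp: factor_def)
      have "eps r \<in> rspan (range cst) {eps r}" by (intro K.rspan_base) auto
      from K.rspan_mult[OF this fB, of ?S] have "eps r * f \<in> rspan (range cst) ?S"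
        using S(2) by (auto intro: K.rspan_base)
      then show "f \<in> rspan (range cst) ?S" using f by (simp add: factor_def)
    qed
    moreover have "rspan (range cst) ?S \<subseteq> factor r"
      unfolding rspan_def using S(1) by (force intro!: L.sum_D L.cst_D)
    ultimately have "factor r = rspan (range cst) ?S" by (rule antisym)
    then have "lin_span L.E UNIV (\<kappa> ` ?S) = carrier L.E" 
      unfolding L.lin_span_rspan[OF S UNIV_I] L.fmod_sel(1) by simp
    then show ?thesis using S by (intro exI[of _ "\<kappa> ` ?S"]) auto
  qed
  moreover have "\<exists>f. coprime f (pderiv f) \<and> alg_eval L.E f x = \<zero>\<^bsub>L.E\<^esub>" if x: "x \<in> carrier L.E" for x
  proof -
    obtain f where f: "x = \<kappa> f" "f \<in> factor r" using x by auto
    have "(\<lambda>t. eps r t * aeval (min_poly (f r)) (f t)) = 0"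
      by (rule factor_zero[OF r L.alg_eval_E(2)[OF f(2)]]) simp
    then show ?thesis
      using coprime_min_poly_pderiv[of "f r"] L.alg_eval_E(1)[OF f(2), of "min_poly (f r)"] f(1)
      by (intro exI[of _ "min_poly (f r)"]) simp
  qed
  ultimately show ?thesis unfolding finite_separable_extension_def using L.algebra_E by blast
qed

text \<open>The distinct \<open>eps r\<close> are orthogonal idempotents with sum \<open>e\<close>,
  and multiplication by them splits the algebra into its factors. The enumeration \<open>b\<close>
  picks one point per class, and the factors use the same transport maps and thus the same carrier
  type.\<close>

theorem finite_etale_fmod: "finite_etale E"
proof -
  obtain b where b: "bij_betw b {..<card (eps ` T)} (eps ` T)"
    using ex_bij_betw_nat_finite[of "eps ` T"] finite_T by (auto simp: atLeast0LessThan)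
  define n where "n = card (eps ` T)"
  note b = b[folded n_def]
  have "\<exists>r\<in>T. b i = eps r" if "i < n" for i using b that by (force simp: bij_betw_def)
  then obtain r where r: "\<And>i. i < n \<Longrightarrow> r i \<in> T \<and> b i = eps (r i)" by metis
  define D where "D = (\<lambda>i. factor (r i))"
  define L where "L = (\<lambda>i. fmod \<kappa> \<iota> (D i) (b i))"
  have Lring: "fun_ring \<kappa> \<iota> (D i) (b i)" if "i < n" for i
    using fun_ring_factor r[OF that] by (simp add: D_def)
  have D_iff: "f \<in> D i \<longleftrightarrow> f \<in> C \<and> b i * f = f" if "i < n" for i f
    using r[OF that] by (simp add: D_def factor_def)
  have bC: "b i \<in> C" if "i < n" for i using r[OF that] eps_C by simp
  have bb: "b i * b i = b i" if "i < n" for i using r[OF that] eps_idem by simp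
  have orth: "b i * b j = 0" if "i < n" "j < n" "i \<noteq> j" for i j
    using r that b eps_orthogonal[of "r i" "r j"] inj_onD[of b "{..<n}" i j] by (auto simp: bij_betw_def)
  have bsum: "(\<Sum>i<n. b i) = e"
    using sum.reindex_bij_betw[OF b, of "\<lambda>d. d"] sum_eps by simp
  have Lsel: "carrier (L i) = \<kappa> ` D i" for i by (simp add: L_def fmod_def)
  define h where "h = (\<lambda>x. \<lambda>i\<in>{..<n}. \<kappa> (b i * \<iota> x))"
  have bD: "b i * f \<in> D i" if "i < n" "f \<in> C" for i f
    using D_iff[OF that(1)] mult_D[OF bC] that bb[OF that(1)] by (simp flip: mult.assoc)
  have "bij_betw h (carrier E) (\<Pi>\<^sub>E i\<in>{..<n}. carrier (L i))"
  proof (rule bij_betw_byWitness[where f' = "\<lambda>y. \<kappa> (\<Sum>i<n. \<iota> (y i))"])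
    show "\<forall>x\<in>carrier E. \<kappa> (\<Sum>i<n. \<iota> (h x i)) = x"
    proof
      fix x assume "x \<in> carrier E"
      then obtain f where f: "x = \<kappa> f" "f \<in> C" by auto
      have "(\<Sum>i<n. \<iota> (h x i)) = (\<Sum>i<n. b i * f)"
        using f bC mult_D by (intro sum.cong) (auto simp: h_def)
      also have "\<dots> = f" unfolding sum_distrib_right[symmetric] bsum using f e_mult by simp
      finally show "\<kappa> (\<Sum>i<n. \<iota> (h x i)) = x" using f by simp
    qed
    show "\<forall>y\<in>\<Pi>\<^sub>E i\<in>{..<n}. carrier (L i). h (\<kappa> (\<Sum>i<n. \<iota> (y i))) = y"
    proof
      fix y assume y: "y \<in> (\<Pi>\<^sub>E i\<in>{..<n}. carrier (L i))"
      have "\<exists>g. y i = \<kappa> g \<and> g \<in> D i" if "i < n" for i using y that by (auto simp: Lsel PiE_iff)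
      then obtain g where g: "\<And>i. i < n \<Longrightarrow> y i = \<kappa> (g i) \<and> g i \<in> D i" by metis
      have gC: "g i \<in> C" if "i < n" for i using g[OF that] D_iff[OF that] by blast
      have "(\<Sum>i<n. \<iota> (y i)) = (\<Sum>i<n. g i)" using g gC by (intro sum.cong) auto
      moreover have sC: "(\<Sum>i<n. g i) \<in> C" using gC by (intro sum_D) auto
      moreover have "b j * (\<Sum>i<n. g i) = g j" if j: "j < n" for j
      proof -
        have "b j * g i = (if i = j then g j else 0)" if i: "i < n" for i
        proof -
          have "b j * g i = b j * (b i * g i)" using D_iff[OF i] g[OF i] by simp
          also have "\<dots> = (b j * b i) * g i" by (simp only: mult.assoc)
          finally show ?thesis using D_iff[OF j] g[OF j] orth[OF j i] by (cases "i = j") auto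
        qed
        then have "(\<Sum>i<n. b j * g i) = (\<Sum>i<n. if i = j then g j else 0)" by (intro sum.cong) auto
        also have "\<dots> = g j" using j by (subst sum.delta) auto
        finally show ?thesis by (simp add: sum_distrib_left)
      qed
      ultimately have "h (\<kappa> (\<Sum>i<n. \<iota> (y i))) = (\<lambda>j\<in>{..<n}. \<kappa> (g j))"
        unfolding h_def by (intro restrict_ext) simp
      also have "\<dots> = y" using y g by (auto simp: fun_eq_iff PiE_iff extensional_def)
      finally show "h (\<kappa> (\<Sum>i<n. \<iota> (y i))) = y" .
    qed
    show "h ` carrier E \<subseteq> (\<Pi>\<^sub>E i\<in>{..<n}. carrier (L i))"
      using bD by (auto simp: h_def Lsel split: if_splits)
    show "(\<lambda>y. \<kappa> (\<Sum>i<n. \<iota> (y i))) ` (\<Pi>\<^sub>E i\<in>{..<n}. carrier (L i)) \<subseteq> carrier E"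
    proof
      fix x assume "x \<in> (\<lambda>y. \<kappa> (\<Sum>i<n. \<iota> (y i))) ` (\<Pi>\<^sub>E i\<in>{..<n}. carrier (L i))"
      then obtain y where y: "x = \<kappa> (\<Sum>i<n. \<iota> (y i))" "y \<in> (\<Pi>\<^sub>E i\<in>{..<n}. carrier (L i))" by blast
      have "\<iota> (y i) \<in> C" if "i < n" for i
      proof -
        have "y i \<in> \<kappa> ` D i" using y that by (auto simp: Lsel PiE_iff)
        then show ?thesis using D_iff[OF that] by auto
      qed
      then show "x \<in> carrier E" unfolding y(1) by (auto intro!: sum_D)
    qed
  qed
  moreover have "(\<lambda>x\<in>carrier E. h x i) \<in> alg_hom E (L i)" if i: "i < n" for i
  proof -
    interpret Li: fun_ring \<kappa> \<iota> "D i" "b i" by (rule Lring[OF i])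
    have hf: "h (\<kappa> f) i = \<kappa> (b i * f)" if "f \<in> C" for f using i that by (simp add: h_def)
    note LE = L_def[THEN fun_cong, of i]
    have "(\<lambda>x\<in>carrier E. h x i) \<in> ring_hom E (L i)"
    proof (rule ring_hom_memI)
      fix x y assume xy: "x \<in> carrier E" "y \<in> carrier E"
      then obtain f g where f: "x = \<kappa> f" "f \<in> C" "y = \<kappa> g" "g \<in> C" by auto
      have "b i * (f * g) = (b i * f) * (b i * g)" using bb[OF i] by (metis mult.assoc mult.left_commute)
      then show "(\<lambda>x\<in>carrier E. h x i) (x \<otimes>\<^bsub>E\<^esub> y) = (\<lambda>x\<in>carrier E. h x i) x \<otimes>\<^bsub>L i\<^esub> (\<lambda>x\<in>carrier E. h x i) y"
        using f hf bD[OF i] by (simp add: LE mult_D)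
      show "(\<lambda>x\<in>carrier E. h x i) (x \<oplus>\<^bsub>E\<^esub> y) = (\<lambda>x\<in>carrier E. h x i) x \<oplus>\<^bsub>L i\<^esub> (\<lambda>x\<in>carrier E. h x i) y"
        using f hf bD[OF i] by (simp add: LE add_D distrib_left)
    next
      fix x assume "x \<in> carrier E"
      then show "(\<lambda>x\<in>carrier E. h x i) x \<in> carrier (L i)" using hf bD[OF i] by (auto simp: LE)
    next
      show "(\<lambda>x\<in>carrier E. h x i) \<one>\<^bsub>E\<^esub> = \<one>\<^bsub>L i\<^esub>"
        using hf[OF e_D] e_D e_mult[OF bC[OF i]] by (simp add: LE mult.commute)
    qed
    moreover have "(\<lambda>x\<in>carrier E. h x i) (c \<odot>\<^bsub>E\<^esub> x) = c \<odot>\<^bsub>L i\<^esub> (\<lambda>x\<in>carrier E. h x i) x" if xE: "x \<in> carrier E" for c x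
    proof -
      obtain f where f: "x = \<kappa> f" "f \<in> C" using xE by auto
      have eq: "b i * (cst c * f) = cst c * (b i * f)" by (rule mult.left_commute)
      show ?thesis using f hf[OF f(2)] hf[OF cst_D[OF f(2)], of c] cst_D[OF f(2), of c] bD[OF i f(2)]
        by (simp add: LE eq)
    qed
    ultimately show ?thesis unfolding alg_hom_def by (intro CollectI conjI IntI allI ballI restrict_extensional)
  qed
  moreover have "finite_separable_extension (L i)" if "i < n" for i
    using factor_separable_extension r[OF that] by (simp add: L_def D_def)
  ultimately show ?thesis unfolding finite_etale_def using algebra_E by blast
qed

end

section \<open>Points of an algebra of functions\<close>

context point_algebra
begin

definition ev :: "'b \<Rightarrow> 'x \<Rightarrow> 'l alg_closure" where
  "ev t = (\<lambda>x\<in>carrier E. \<iota> x t)"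

lemma ev_apply: "f \<in> C \<Longrightarrow> ev t (\<kappa> f) = f t"
  by (simp add: ev_def)

lemma ev_mem: assumes t: "t \<in> T" shows "ev t \<in> alg_hom E closure_algebra"
proof -
  have "ev t \<in> ring_hom E closure_algebra"
    by (rule ring_hom_memI) (use t in \<open>auto simp: ev_apply add_D mult_D e_D fun_apply e_apply\<close>)
  moreover have "ev t (c \<odot>\<^bsub>E\<^esub> x) = c \<odot>\<^bsub>closure_algebra\<^esub> ev t x" if xE: "x \<in> carrier E" for c x
  proof -
    obtain f where f: "x = \<kappa> f" "f \<in> C" using xE by auto
    then show ?thesis using cst_D[OF f(2), of c] by (simp add: ev_apply fun_apply)
  qed
  moreover have "ev t \<in> extensional (carrier E)" unfolding ev_def by (rule restrict_extensional)
  ultimately show ?thesis unfolding alg_hom_def by (intro CollectI conjI IntI allI ballI)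
qed

text \<open>The kernel of a homomorphism contains the kernel of some evaluation, since the product of
  these finitely many ideals is zero.\<close>

theorem fiber_fmod:
  assumes s: "s \<in> alg_hom E closure_algebra"
  shows "\<exists>\<tau>\<in>Gal. \<exists>t\<in>T. s = gact E \<tau> (ev t)"
proof -
  define s' where "s' = (\<lambda>f. s (\<kappa> f))"
  have sm: "s' (f * g) = s' f * s' g" and sa: "s' (f + g) = s' f + s' g" if "f \<in> C" "g \<in> C" for f g
    using alg_homD(2,3)[OF s, of "\<kappa> f" "\<kappa> g"] that by (auto simp: s'_def)
  have sc: "s' (cst c * f) = to_ac c * s' f" if "f \<in> C" for c f
    using alg_homD(5)[OF s, of "\<kappa> f" c] that by (auto simp: s'_def)
  have se: "s' e = 1" using alg_homD(4)[OF s] by (simp add: s'_def)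
  have s0: "s' 0 = 0" using sc[OF e_D, of 0] by (simp add: cst_simps)
  have "\<exists>t\<in>T. \<forall>f\<in>C. f t = 0 \<longrightarrow> s' f = 0"
  proof (rule ccontr)
    assume "\<not> ?thesis"
    then obtain f where f: "\<And>t. t \<in> T \<Longrightarrow> f t \<in> C \<and> f t t = 0 \<and> s' (f t) \<noteq> 0" by metis
    have ne: "s' (e * (\<Prod>t\<in>I. f t)) \<noteq> 0" if "finite I" "I \<subseteq> T" for I
      using that
    proof (induction I rule: finite_induct)
      case (insert i I)
      have eq: "e * (\<Prod>t\<in>insert i I. f t) = f i * (e * (\<Prod>t\<in>I. f t))"
        unfolding prod.insert[OF insert.hyps] by (rule mult.left_commute)
      have "e * (\<Prod>t\<in>I. f t) \<in> C" using insert f by (intro prod_C) auto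
      then have "s' (f i * (e * (\<Prod>t\<in>I. f t))) = s' (f i) * s' (e * (\<Prod>t\<in>I. f t))"
        using insert f[of i] by (intro sm) auto
      then show ?case unfolding eq using insert f[of i] by simp
    qed (simp add: se)
    have "e * (\<Prod>t\<in>T. f t) = 0"
    proof
      fix t
      show "(e * (\<Prod>t\<in>T. f t)) t = 0 t"
      proof (cases "t \<in> T")
        case True
        then have "(\<Prod>i\<in>T. f i t) = 0" using f finite_T by (intro prod_zero) auto
        then show ?thesis by (simp add: fun_apply prod_fun_apply)
      qed (simp add: fun_apply e_apply)
    qed
    with ne[OF finite_T order_refl] s0 show False by simp
  qed
  then obtain t where t: "t \<in> T" "\<And>f. f \<in> C \<Longrightarrow> f t = 0 \<Longrightarrow> s' f = 0" by blast
  \<comment> \<open>By the choice of \<open>t\<close> the value \<open>f t\<close> determines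
    \<open>s' f\<close>; this partial embedding of the closure extends to a Galois
    automorphism.\<close>
  define \<Gamma> where "\<Gamma> = (\<lambda>f. (f t, s' f)) ` C"
  have "alg_graph \<Gamma>"
    unfolding alg_graph_def
  proof (intro conjI allI impI)
    fix c
    show "(to_ac c, to_ac c) \<in> \<Gamma>"
      unfolding \<Gamma>_def using sc[OF e_D, of c] cst_D[OF e_D, of c] se t(1)
      by (intro image_eqI[of _ _ "cst c * e"]) (auto simp: fun_apply e_apply)
  next
    fix a b c d assume "(a, b) \<in> \<Gamma>" "(c, d) \<in> \<Gamma>"
    then obtain f g where fg: "f \<in> C" "g \<in> C" "a = f t" "b = s' f" "c = g t" "d = s' g" by (auto simp: \<Gamma>_def)
    show "(a + c, b + d) \<in> \<Gamma>"
      unfolding \<Gamma>_def using fg sa[OF fg(1,2)] add_D[OF fg(1,2)] by (intro image_eqI[of _ _ "f + g"]) (auto simp: fun_apply)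
    show "(a * c, b * d) \<in> \<Gamma>"
      unfolding \<Gamma>_def using fg sm[OF fg(1,2)] mult_D[OF fg(1,2)] by (intro image_eqI[of _ _ "f * g"]) (auto simp: fun_apply)
  next
    fix b assume "(0, b) \<in> \<Gamma>"
    then obtain f where "f \<in> C" "f t = 0" "b = s' f" by (auto simp: \<Gamma>_def)
    then show "b = 0" using t(2) by simp
  qed
  from extend_to_galois[OF this] obtain \<tau> where \<tau>: "\<tau> \<in> Gal" "\<forall>(x, y)\<in>\<Gamma>. \<tau> x = y" by (elim bexE)
  have \<tau>': "\<tau> (f t) = s' f" if "f \<in> C" for f
    using bspec[OF \<tau>(2), of "(f t, s' f)"] that by (simp add: \<Gamma>_def)
  have "s x = gact E \<tau> (ev t) x" for x
  proof (cases "x \<in> carrier E")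
    case True
    then obtain f where f: "x = \<kappa> f" "f \<in> C" by auto
    then show ?thesis using \<tau>'[OF f(2)] True by (simp add: gact_def ev_apply s'_def)
  next
    case False
    then show ?thesis using extensional_arb[OF alg_homD(6)[OF s] False] by (simp add: gact_def)
  qed
  then show ?thesis using \<tau>(1) t(1) by blast
qed

end

section \<open>Objects given by functions on a finite set\<close>

abbreviation (in local_field) ospan :: "('b \<Rightarrow> 'l alg_closure) set \<Rightarrow> ('b \<Rightarrow> 'l alg_closure) set" where
  "ospan \<equiv> rspan (cst ` local_integers v)"

text \<open>The order spanned by \<open>B\<close> over the local integers is to be an integral
  model, with \<open>\<psi>\<close> composing a function with \<open>\<Psi>\<close> before and
  \<open>\<phi>\<close> after it. All conditions are imposed on generators only; multiples of
  \<open>cst unif\<close> represent the prime times the order.\<close>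

locale fun_model = local_field v for v :: "'l::field \<Rightarrow> real" +
  fixes T :: "'b set" and \<Psi> :: "'b \<Rightarrow> 'b" and \<phi> :: "'l alg_closure \<Rightarrow> 'l alg_closure"
    and B :: "('b \<Rightarrow> 'l alg_closure) set"
  assumes finite_T: "finite T" and finite_B: "finite B"
    and support: "b \<in> B \<Longrightarrow> t \<notin> T \<Longrightarrow> b t = 0"
    and Psi: "t \<in> T \<Longrightarrow> \<Psi> t \<in> T" and phi: "\<phi> \<in> Gal"
    and one: "(\<lambda>t. if t \<in> T then 1 else 0) \<in> ospan B"
    and mult: "b \<in> B \<Longrightarrow> b' \<in> B \<Longrightarrow> b * b' \<in> ospan B"
    and twist: "b \<in> B \<Longrightarrow> (\<lambda>t. if t \<in> T then \<phi> (b (\<Psi> t)) else 0) \<in> ospan B"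
    and frob_lift: "b \<in> B \<Longrightarrow> \<exists>g\<in>ospan B.
      (\<lambda>t. if t \<in> T then \<phi> (b (\<Psi> t)) else 0) - b ^ residue_card v = cst unif * g"

lemma (in local_field) subring_Oc: "subring_set (cst ` local_integers v)"
  by unfold_locales
    (auto simp: image_iff local_integers_def, (metis cst_simps v_0 v_1 v_minus v_add_leI v_mult mult_le_one v_nonneg zero_le_one order_refl)+)

lemma subring_Kc: "subring_set (range (cst :: 'l::field \<Rightarrow> 'b \<Rightarrow> 'l alg_closure))"
  by unfold_locales (auto simp: image_iff, (metis cst_simps)+)

context fun_model
begin

definition "e = (\<lambda>t. if t \<in> T then 1 else (0 :: 'l alg_closure))"
definition "tw f = (\<lambda>t. if t \<in> T then \<phi> (f (\<Psi> t)) else 0)"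
abbreviation "R0 \<equiv> ospan B"
definition "C = rspan (range cst) B"

sublocale Oc: subring_set "cst ` local_integers v :: ('b \<Rightarrow> 'l alg_closure) set" by (rule subring_Oc)
sublocale Kc: subring_set "range cst :: ('b \<Rightarrow> 'l alg_closure) set" by (rule subring_Kc)

text \<open>Objects have carriers in the type of sequences over the base field, so functions are
  encoded by coordinates. The coordinates are chosen, since \<open>B\<close> may be linearly
  dependent.\<close>

definition "coords f = (SOME c. f = (\<Sum>b\<in>B. cst (c b) * b))"
definition "enum_B = (SOME h. bij_betw h {..<card B} B)"
definition encode :: "('b \<Rightarrow> 'l alg_closure) \<Rightarrow> nat \<Rightarrow> 'l" where
  "encode f = (\<lambda>i. if i < card B then coords f (enum_B i) else 0)"
definition "decode = inv_into C encode"

lemma coords: assumes "f \<in> C" shows "f = (\<Sum>b\<in>B. cst (coords f b) * b)"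
proof -
  obtain c where c: "f = (\<Sum>b\<in>B. c b * b)" "\<forall>b\<in>B. c b \<in> range cst" using assms by (auto simp: C_def rspan_def)
  then obtain d where "\<forall>b\<in>B. c b = cst (d b)" unfolding image_iff by metis
  then have "f = (\<Sum>b\<in>B. cst (d b) * b)" unfolding c(1) by (intro sum.cong) auto
  then have "\<exists>c. f = (\<Sum>b\<in>B. cst (c b) * b)" by (rule exI[of "\<lambda>c. f = (\<Sum>b\<in>B. cst (c b) * b)"])
  then show ?thesis unfolding coords_def by (rule someI_ex)
qed

lemma bij_enum_B: "bij_betw enum_B {..<card B} B"
proof -
  have "\<exists>h. bij_betw h {..<card B} B"
    using ex_bij_betw_nat_finite[OF finite_B] by (simp add: atLeast0LessThan)
  then show ?thesis unfolding enum_B_def by (rule someI_ex)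
qed

lemma inj_encode: "inj_on encode C"
proof (rule inj_onI)
  fix f g assume fg: "f \<in> C" "g \<in> C" "encode f = encode g"
  have "coords f b = coords g b" if "b \<in> B" for b
  proof -
    have "b \<in> enum_B ` {..<card B}" using bij_enum_B that by (simp add: bij_betw_def)
    then obtain i where "b = enum_B i" "i < card B" by auto
    then show ?thesis using fun_cong[OF fg(3), of i] by (simp add: encode_def)
  qed
  then have "(\<Sum>b\<in>B. cst (coords f b) * b) = (\<Sum>b\<in>B. cst (coords g b) * b)" by (intro sum.cong) auto
  then show "f = g" using coords[OF fg(1)] coords[OF fg(2)] by simp
qed

lemma R0_C: "R0 \<subseteq> C" unfolding C_def rspan_def by blast

lemma B_R0: "B \<subseteq> R0" using Oc.rspan_base[OF finite_B] by blast

lemma outside_C: assumes "f \<in> C" "t \<notin> T" shows "f t = 0"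
proof -
  have "f t = (\<Sum>b\<in>B. cst (coords f b) * b) t" using coords[OF assms(1)] by simp
  also have "\<dots> = 0" unfolding sum_fun_apply using support assms(2) by (intro sum.neutral) (simp add: fun_apply)
  finally show ?thesis .
qed

lemma e_R0: "e \<in> R0" unfolding e_def by (rule one)

lemma mult_R0: "f \<in> R0 \<Longrightarrow> g \<in> R0 \<Longrightarrow> f * g \<in> R0"
  by (rule Oc.rspan_mult) (auto intro: mult)

lemma e_mult_C: "f \<in> C \<Longrightarrow> e * f = f"
  using outside_C by (auto simp: fun_eq_iff fun_apply e_def)

sublocale point_algebra v encode decode C e T B
proof unfold_locales
  show "decode (encode f) = f" if "f \<in> C" for f
    unfolding decode_def using inj_encode that by (rule inv_into_f_f)
  show "f + g \<in> C" if "f \<in> C" "g \<in> C" for f g using that unfolding C_def by (rule Kc.rspan_add)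
  show "f * g \<in> C" if "f \<in> C" "g \<in> C" for f g
    using that unfolding C_def by (rule Kc.rspan_mult) (use mult R0_C C_def in blast)
  show "cst c * f \<in> C" if "f \<in> C" for f c using that unfolding C_def by (intro Kc.rspan_scale) auto
  show "e \<in> C" using e_R0 R0_C by blast
  show "e * f = f" if "f \<in> C" for f using that by (rule e_mult_C)
  show "e = (\<lambda>t. if t \<in> T then 1 else 0)" by (rule e_def)
  show "B \<subseteq> C" using B_R0 R0_C by blast
  show "C \<subseteq> rspan (range cst) B" by (simp add: C_def)
qed (use finite_T finite_B in auto)

lemma tw_simps: "tw (f + g) = tw f + tw g" "tw (cst c * f) = cst c * tw f" "tw e = e" "tw 0 = 0"
  and tw_mult: "tw (f * g) = tw f * tw g"
  using Psi by (auto simp: tw_def e_def fun_eq_iff fun_apply gal_add[OF phi] gal_mult[OF phi] gal_to_ac[OF phi] gal_0[OF phi] gal_1[OF phi])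

lemma tw_sum: "tw (\<Sum>i\<in>I. f i) = (\<Sum>i\<in>I. tw (f i))"
  by (induction I rule: infinite_finite_induct) (auto simp: tw_simps)

lemma tw_R0: assumes "f \<in> R0" shows "tw f \<in> R0"
proof -
  obtain c where c: "f = (\<Sum>b\<in>B. c b * b)" "\<forall>b\<in>B. c b \<in> cst ` local_integers v" using assms by (auto simp: rspan_def)
  have "tw (c b * b) \<in> R0" if b: "b \<in> B" for b
  proof -
    obtain d where "c b = cst d" "d \<in> local_integers v" using c(2) b by blast
    moreover have "tw b \<in> R0" unfolding tw_def by (rule twist[OF b])
    ultimately show ?thesis by (auto simp: tw_simps intro!: Oc.rspan_scale)
  qed
  then show ?thesis unfolding c(1) tw_sum by (intro Oc.rspan_sum) auto
qed

lemma tw_C: assumes "f \<in> C" shows "tw f \<in> C"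
proof -
  have "tw b \<in> C" if "b \<in> B" for b using tw_R0 B_R0 R0_C that by blast
  then show ?thesis by (subst coords[OF assms]) (auto simp: tw_sum tw_simps(2) intro!: sum_D cst_D)
qed

definition "psi = (\<lambda>x\<in>carrier E. encode (tw (decode x)))"

lemma psi_encode: "f \<in> C \<Longrightarrow> psi (encode f) = encode (tw f)"
  by (simp add: psi_def)

lemma psi_mem: "psi \<in> alg_hom E E"
proof -
  have "psi \<in> ring_hom E E"
    by (rule ring_hom_memI) (auto simp: psi_encode tw_C add_D mult_D e_D tw_simps tw_mult)
  moreover have "psi (c \<odot>\<^bsub>E\<^esub> x) = c \<odot>\<^bsub>E\<^esub> psi x" if xE: "x \<in> carrier E" for c x
  proof -
    obtain f where f: "x = encode f" "f \<in> C" using xE by auto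
    then show ?thesis using cst_D[OF f(2), of c] tw_C[OF f(2)] by (simp add: psi_encode tw_simps)
  qed
  moreover have "psi \<in> extensional (carrier E)" unfolding psi_def by (rule restrict_extensional)
  ultimately show ?thesis unfolding alg_hom_def by (intro CollectI conjI IntI allI ballI)
qed

lemma unif_R0: "v c < 1 \<Longrightarrow> f \<in> R0 \<Longrightarrow> \<exists>g\<in>R0. cst c * f = cst unif * g"
proof -
  assume "v c < 1" "f \<in> R0"
  obtain d where d: "v d \<le> 1" "c = unif * d" using local_prime_eq_unif_mult[OF \<open>v c < 1\<close>] by blast
  have "cst d * f \<in> R0" using d(1) \<open>f \<in> R0\<close> by (intro Oc.rspan_scale imageI) (simp_all add: local_integers_def)
  moreover have "cst c * f = cst unif * (cst d * f)" by (simp add: d(2) cst_simps mult.assoc)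
  ultimately show ?thesis by blast
qed

lemma power_R0: "f \<in> R0 \<Longrightarrow> n > 0 \<Longrightarrow> f ^ n \<in> R0"
proof (induction n)
  case (Suc n)
  then show ?case using mult_R0[of f "f ^ n"] by (cases n) auto
qed simp

text \<open>The functions satisfying the congruence contain \<open>B\<close>. They are closed under
  sums, because the q-th power is additive up to a multiple of the residue characteristic, and under
  integral constants, because c^q is congruent to c.\<close>

lemma frob_lift_R0:
  assumes "f \<in> R0" shows "\<exists>g\<in>R0. tw f - f ^ residue_card v = cst unif * g"
proof -
  define G where "G = {f\<in>R0. \<exists>g\<in>R0. tw f - f ^ residue_card v = cst unif * g}"
  \<comment> \<open>The order \<open>R0\<close> has unit \<open>e\<close> and need not contain the
    constant 1. Functions that fall into \<open>R0\<close> after multiplication by \<open>e\<close>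
    do form a subring with 1, to which \<open>prime_power_add\<close> applies.\<close>
  define R where "R = {f. e * f \<in> R0}"
  have idem: "e * e = e" using e_D e_mult by blast
  interpret R: subring_set R
  proof unfold_locales
    fix x y assume xy: "x \<in> R" "y \<in> R"
    have "e * (x * y) = (e * x) * (e * y)" using idem by (metis mult.assoc mult.left_commute)
    then show "x * y \<in> R" using xy mult_R0 by (simp add: R_def)
    show "x + y \<in> R" using xy by (simp add: R_def distrib_left Oc.rspan_add)
    show "- x \<in> R" using xy by (simp add: R_def Oc.rspan_minus)
  qed (auto simp: R_def e_R0 Oc.rspan_zero)
  have R0_R: "R0 \<subseteq> R" using R0_C e_mult_C by (auto simp: R_def)
  obtain k where k: "residue_card v = res_char ^ k" using residue_card_power_of_char by blast
  have p: "v (of_nat res_char) < 1" using nat_v_less_1_iff[of res_char] by simp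
  have q0: "residue_card v > 0" using q_pos .
  have G_add: "x + y \<in> G" if xy: "x \<in> G" "y \<in> G" for x y
  proof -
    obtain g h where g: "g \<in> R0" "tw x - x ^ residue_card v = cst unif * g" and h: "h \<in> R0" "tw y - y ^ residue_card v = cst unif * h"
      using xy by (auto simp: G_def)
    have xyR: "x \<in> R0" "y \<in> R0" using xy by (auto simp: G_def)
    obtain z where z: "z \<in> R" "(x + y) ^ residue_card v = x ^ residue_card v + y ^ residue_card v + of_nat res_char * z"
      using R.prime_power_add[OF prime_res_char subsetD[OF R0_R xyR(1)] subsetD[OF R0_R xyR(2)], of k] unfolding k by blast
    let ?d = "(x + y) ^ residue_card v - x ^ residue_card v - y ^ residue_card v"
    have dR: "?d \<in> R0" using xyR q0 by (intro Oc.rspan_diff power_R0 Oc.rspan_add)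
    have "?d = e * ?d" using e_mult_C R0_C dR by (simp add: subset_iff)
    also have "\<dots> = cst (of_nat res_char) * (e * z)"
    proof -
      have "?d = of_nat res_char * z" using z(2) by simp
      moreover have "of_nat res_char = (cst (of_nat res_char) :: 'b \<Rightarrow> 'l alg_closure)" by (auto simp: fun_eq_iff fun_apply)
      ultimately show ?thesis by (simp add: mult.left_commute)
    qed
    finally have d: "?d = cst (of_nat res_char) * (e * z)" .
    have "e * z \<in> R0" using z(1) by (simp add: R_def)
    from unif_R0[OF p this] obtain u where u: "u \<in> R0" "cst (of_nat res_char) * (e * z) = cst unif * u" by blast
    have "tw (x + y) - (x + y) ^ residue_card v = (tw x - x ^ residue_card v) + (tw y - y ^ residue_card v) - ?d"
      by (simp add: tw_simps)
    also have "\<dots> = cst unif * (g + h - u)" unfolding g(2) h(2) d u(2) by (simp add: algebra_simps)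
    finally show ?thesis
      unfolding G_def using g(1) h(1) u(1) xyR by (intro CollectI conjI bexI[of _ "g + h - u"] Oc.rspan_add Oc.rspan_diff)
  qed
  have G_scale: "cst c * x \<in> G" if c: "c \<in> local_integers v" and x: "x \<in> G" for c x
  proof -
    obtain g where g: "g \<in> R0" "tw x - x ^ residue_card v = cst unif * g" using x by (auto simp: G_def)
    have xR: "x \<in> R0" using x by (auto simp: G_def)
    have "v (c ^ residue_card v - c) < 1" using power_residue_card c by (simp add: local_integers_def)
    from unif_R0[OF this power_R0[OF xR q0]] obtain h where h: "h \<in> R0"
      "cst (c ^ residue_card v - c) * x ^ residue_card v = cst unif * h" by blast
    have pw: "cst (c ^ n) = (cst c ^ n :: 'b \<Rightarrow> 'l alg_closure)" for n by (auto simp: fun_eq_iff power_fun_apply fun_apply)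
    have "tw (cst c * x) - (cst c * x) ^ residue_card v =
        cst c * (tw x - x ^ residue_card v) - (cst c ^ residue_card v - cst c) * x ^ residue_card v"
      unfolding tw_simps power_mult_distrib by (simp add: algebra_simps)
    also have "cst c ^ residue_card v - cst c = (cst (c ^ residue_card v - c) :: 'b \<Rightarrow> 'l alg_closure)"
      unfolding pw[symmetric] by (auto simp: fun_eq_iff fun_apply)
    also have "cst c * (tw x - x ^ residue_card v) - cst (c ^ residue_card v - c) * x ^ residue_card v = cst unif * (cst c * g - h)"
      unfolding g(2) h(2) by (simp add: algebra_simps)
    finally show ?thesis
      unfolding G_def using g(1) h(1) xR c by (intro CollectI conjI bexI[of _ "cst c * g - h"] Oc.rspan_diff Oc.rspan_scale) auto
  qed
  have G_B: "b \<in> G" if "b \<in> B" for b using that B_R0 frob_lift[OF that] by (auto simp: G_def tw_def)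
  have "tw 0 - 0 ^ residue_card v = cst unif * 0" using q0 by (simp add: tw_simps zero_power)
  then have G_0: "0 \<in> G" unfolding G_def using Oc.rspan_zero by (intro CollectI conjI bexI[of _ 0])
  obtain c where c: "f = (\<Sum>b\<in>B. c b * b)" "\<forall>b\<in>B. c b \<in> cst ` local_integers v" using assms by (auto simp: rspan_def)
  have "(\<Sum>b\<in>I. c b * b) \<in> G" if "finite I" "I \<subseteq> B" for I
    using that
  proof (induction I rule: finite_induct)
    case (insert i I)
    then obtain d where "c i = cst d" "d \<in> local_integers v" using c(2) by blast
    then have "c i * i \<in> G" using G_scale G_B insert by auto
    then show ?case using insert G_add by simp
  qed (simp add: G_0)
  then have "f \<in> G" using finite_B c(1) by blast
  then show ?thesis by (simp add: G_def)
qed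

lemma integral_model_R0: "integral_model v E psi (encode ` R0)"
proof -
  interpret E: cring E by (rule cring_E)
  have sub: "encode ` R0 \<subseteq> carrier E" using R0_C by auto
  have minus: "\<ominus>\<^bsub>E\<^esub> encode f = encode (- f)" if "f \<in> C" for f
    using that minus_D[OF that] by (intro E.minus_equality) auto
  have inR0: "f \<in> R0 \<Longrightarrow> f \<in> C" for f using R0_C by blast
  have "subcring (encode ` R0) E"
  proof (rule E.subcringI', rule E.subringI)
    show "\<one>\<^bsub>E\<^esub> \<in> encode ` R0" using e_R0 by auto
    show "\<ominus>\<^bsub>E\<^esub> h \<in> encode ` R0" if "h \<in> encode ` R0" for h using that minus inR0 Oc.rspan_minus by auto
    show "h \<otimes>\<^bsub>E\<^esub> h' \<in> encode ` R0" if "h \<in> encode ` R0" "h' \<in> encode ` R0" for h h' using that inR0 mult_R0 by auto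
    show "h \<oplus>\<^bsub>E\<^esub> h' \<in> encode ` R0" if "h \<in> encode ` R0" "h' \<in> encode ` R0" for h h' using that inR0 Oc.rspan_add by auto
  qed (rule sub)
  moreover have BC: "B \<subseteq> C" using B_R0 R0_C by blast
  have "encode ` R0 = lin_span E (local_integers v) (encode ` B)"
    using lin_span_rspan[OF BC finite_B, of "local_integers v"] by (simp add: local_integers_def)
  then have "\<exists>S\<subseteq>encode ` R0. finite S \<and> encode ` R0 = lin_span E (local_integers v) S"
    using B_R0 finite_B by (intro exI[of _ "encode ` B"] conjI) auto
  moreover have "lin_span E UNIV (encode ` R0) = carrier E"
  proof (rule antisym)
    show "lin_span E UNIV (encode ` R0) \<subseteq> carrier E"
    proof
      fix x assume "x \<in> lin_span E UNIV (encode ` R0)"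
      from subsetD[OF lin_span_subset[OF R0_C] this] obtain c U
        where "U \<subseteq> R0" "x = encode (\<Sum>s\<in>U. cst (c s) * s)" by blast
      then show "x \<in> carrier E" using inR0 by (auto intro!: sum_D cst_D)
    qed
    show "carrier E \<subseteq> lin_span E UNIV (encode ` R0)"
    proof
      fix x assume "x \<in> carrier E"
      then obtain f where f: "x = encode f" "f \<in> C" by auto
      have "encode (\<Sum>b\<in>B. cst (coords f b) * b) \<in> lin_span E UNIV (encode ` R0)"
        by (rule lin_spanI[OF R0_C finite_B B_R0]) simp
      then show "x \<in> lin_span E UNIV (encode ` R0)" using coords[OF f(2)] f(1) by simp
    qed
  qed
  moreover have "psi ` encode ` R0 \<subseteq> encode ` R0" using psi_encode inR0 tw_R0 by auto
  moreover have "psi a \<ominus>\<^bsub>E\<^esub> a [^]\<^bsub>E\<^esub> residue_card v \<in> lin_span E (local_prime v) (encode ` R0)" if aR: "a \<in> encode ` R0" for a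
  proof -
    obtain f where f: "a = encode f" "f \<in> R0" using aR by blast
    have fq: "f ^ residue_card v \<in> R0" using power_R0[OF f(2)] q_pos by simp
    obtain g where g: "g \<in> R0" "tw f - f ^ residue_card v = cst unif * g" using frob_lift_R0[OF f(2)] by blast
    have "a [^]\<^bsub>E\<^esub> residue_card v = encode (f ^ residue_card v)"
      unfolding f(1) using power_E[OF inR0[OF f(2)]] e_mult_C[OF inR0[OF fq]] by simp
    then have "psi a \<ominus>\<^bsub>E\<^esub> a [^]\<^bsub>E\<^esub> residue_card v = encode (tw f) \<oplus>\<^bsub>E\<^esub> encode (- (f ^ residue_card v))"
      using psi_encode[OF inR0[OF f(2)]] minus[OF inR0[OF fq]] f(1) by (simp add: E.minus_eq)
    also have "\<dots> = encode (tw f - f ^ residue_card v)"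
      using tw_C[OF inR0[OF f(2)]] minus_D[OF inR0[OF fq]] by simp
    also have "\<dots> = encode (\<Sum>s\<in>{g}. cst unif * s)" by (simp add: g(2))
    also have "\<dots> \<in> lin_span E (local_prime v) (encode ` R0)"
      using g(1) unif(2) by (intro lin_spanI[OF R0_C, of "{g}" "\<lambda>_. unif"]) (auto simp: local_prime_def)
    finally show ?thesis .
  qed
  ultimately show ?thesis unfolding integral_model_def by (intro conjI ballI)
qed

theorem fun_model_object: "(E, psi) \<in> lambda_objects v"
  unfolding lambda_objects_def using finite_etale_fmod psi_mem integral_model_R0 by blast

lemma tw_pow: "t \<in> T \<Longrightarrow> (tw ^^ n) f t = (\<phi> ^^ n) (f ((\<Psi> ^^ n) t))"
proof (induction n arbitrary: t)
  case (Suc n)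
  have "(tw ^^ Suc n) f t = \<phi> ((tw ^^ n) f (\<Psi> t))" using Suc.prems by (simp add: tw_def)
  then show ?case using Suc.IH[OF Psi[OF Suc.prems]] by (simp add: funpow_swap1)
qed simp

text \<open>On functions each step twists the values by \<open>\<phi>\<close> and moves the argument
  along \<open>\<Psi>\<close>; the action on the points of a model is thereby computable.\<close>

theorem shift_ev: assumes t: "t \<in> T" shows "shift E psi (ev t) n = gact E (\<phi> ^^ n) (ev ((\<Psi> ^^ n) t))"
proof -
  have *: "(psi ^^ n) (encode f) = encode ((tw ^^ n) f) \<and> (tw ^^ n) f \<in> C" if "f \<in> C" for f
    by (induction n) (auto simp: that psi_encode tw_C)
  have "shift E psi (ev t) n x = gact E (\<phi> ^^ n) (ev ((\<Psi> ^^ n) t)) x" for x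
  proof (cases "x \<in> carrier E")
    case True
    then obtain f where f: "x = encode f" "f \<in> C" by auto
    then show ?thesis using True *[OF f(2)] by (simp add: shift_def gact_def ev_apply tw_pow[OF t])
  qed (simp add: shift_def gact_def)
  then show ?thesis by (rule ext)
qed

end

section \<open>Products of models\<close>

context local_field
begin

text \<open>The order generated by the unit alone, from which finitely many models are multiplied
  together.\<close>

lemma fun_model_unit:
  assumes "finite T" "\<And>t. t \<in> T \<Longrightarrow> \<Psi> t \<in> T" "\<phi> \<in> Gal"
  shows "fun_model v T \<Psi> \<phi> {\<lambda>t. if t \<in> T then 1 else 0}"
proof -
  let ?e = "\<lambda>t. if t \<in> T then 1 else (0 :: 'l alg_closure)"
  interpret Oc: subring_set "cst ` local_integers v :: ('a \<Rightarrow> 'l alg_closure) set" by (rule subring_Oc)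
  have e: "?e \<in> ospan {?e}" by (rule Oc.rspan_base) auto
  have tw: "(\<lambda>t. if t \<in> T then \<phi> (?e (\<Psi> t)) else 0) = ?e" using assms gal_1[OF assms(3)] by (auto simp: fun_eq_iff)
  have ee: "?e * ?e = ?e" by (auto simp: fun_eq_iff fun_apply)
  have eq: "?e ^ q = ?e" using q_pos by (auto simp: fun_eq_iff power_fun_apply zero_power)
  show ?thesis
  proof (unfold_locales)
    fix b b' assume "b \<in> {?e}" "b' \<in> {?e}"
    then have b: "b = ?e" "b' = ?e" by auto
    show "b * b' \<in> ospan {?e}" unfolding b ee by (rule e)
    show "(\<lambda>t. if t \<in> T then \<phi> (b (\<Psi> t)) else 0) \<in> ospan {?e}" unfolding b tw by (rule e)
    show "\<exists>g\<in>ospan {?e}. (\<lambda>t. if t \<in> T then \<phi> (b (\<Psi> t)) else 0) - b ^ q = cst unif * g"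
      unfolding b tw eq by (intro bexI[of _ 0] Oc.rspan_zero) simp
  qed (use assms e in auto)
qed

text \<open>The compositum of two orders over the same data. The defect of a product from being a
  Frobenius lift is a combination of the defects of its factors, as for a derivation, so it keeps
  the factor \<open>cst unif\<close>.\<close>

lemma fun_model_product:
  fixes T :: "'b set"
  assumes "fun_model v T \<Psi> \<phi> B1" "fun_model v T \<Psi> \<phi> B2"
  defines "B \<equiv> (\<lambda>(b, b'). b * b') ` (B1 \<times> B2)"
  shows "fun_model v T \<Psi> \<phi> B"
    and "ospan B1 \<subseteq> ospan B"
    and "ospan B2 \<subseteq> ospan B"
proof -
  interpret M1: fun_model v T \<Psi> \<phi> B1 by fact
  interpret M2: fun_model v T \<Psi> \<phi> B2 by fact
  let ?R = "ospan B"
  have fin: "finite B" unfolding B_def using M1.finite_B M2.finite_B by simp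
  have prod: "f * g \<in> ?R" if "f \<in> M1.R0" "g \<in> M2.R0" for f g
    using that by (rule M1.Oc.rspan_mult) (use fin in \<open>auto simp: B_def intro!: M1.Oc.rspan_base\<close>)
  have e1: "f * M1.e = f" if "f \<in> M1.R0" for f
    using M1.e_mult_C[OF subsetD[OF M1.R0_C that]] by (simp only: mult.commute)
  have e2: "M1.e * f = f" if "f \<in> M2.R0" for f
    by (rule M2.e_mult_C[OF subsetD[OF M2.R0_C that]])
  show "M1.R0 \<subseteq> ?R"
  proof
    fix f assume f: "f \<in> M1.R0"
    show "f \<in> ?R" using prod[OF f M2.e_R0] e1[OF f] by simp
  qed
  show "M2.R0 \<subseteq> ?R"
  proof
    fix f assume f: "f \<in> M2.R0"
    show "f \<in> ?R" using prod[OF M1.e_R0 f] e2[OF f] by simp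
  qed
  show "fun_model v T \<Psi> \<phi> B"
  proof unfold_locales
    show "(\<lambda>t. if t \<in> T then 1 else 0) \<in> ?R"
      using prod[OF M1.e_R0 M2.e_R0] e1[OF M1.e_R0] by (simp add: M1.e_def)
    fix b assume "b \<in> B"
    then obtain b1 b2 where b: "b1 \<in> B1" "b2 \<in> B2" "b = b1 * b2" by (auto simp: B_def)
    have bR: "b1 \<in> M1.R0" "b2 \<in> M2.R0" using b M1.B_R0 M2.B_R0 by auto
    have twb: "(\<lambda>t. if t \<in> T then \<phi> (b (\<Psi> t)) else 0) = M1.tw b1 * M1.tw b2"
      unfolding b(3) M1.tw_mult[symmetric] by (simp add: M1.tw_def)
    show "b t = 0" if "t \<notin> T" for t using M1.support[OF b(1) that] by (simp add: b(3) fun_apply)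
    show "(\<lambda>t. if t \<in> T then \<phi> (b (\<Psi> t)) else 0) \<in> ?R"
      unfolding twb using prod[OF M1.tw_R0[OF bR(1)] M2.tw_R0[OF bR(2)]] by simp
    obtain g1 where g1: "g1 \<in> M1.R0" "M1.tw b1 - b1 ^ q = cst unif * g1" using M1.frob_lift_R0[OF bR(1)] by blast
    obtain g2 where g2: "g2 \<in> M2.R0" "M1.tw b2 - b2 ^ q = cst unif * g2" using M2.frob_lift_R0[OF bR(2)] by blast
    have "M1.tw b1 * M1.tw b2 - b ^ q = (M1.tw b1 - b1 ^ q) * M1.tw b2 + b1 ^ q * (M1.tw b2 - b2 ^ q)"
      unfolding b(3) power_mult_distrib by (simp add: algebra_simps)
    also have "\<dots> = cst unif * (g1 * M1.tw b2 + b1 ^ q * g2)" unfolding g1(2) g2(2) by (simp add: algebra_simps)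
    finally have eq: "M1.tw b1 * M1.tw b2 - b ^ q = cst unif * (g1 * M1.tw b2 + b1 ^ q * g2)" .
    have "g1 * M1.tw b2 + b1 ^ q * g2 \<in> ?R"
      using prod[OF g1(1) M2.tw_R0[OF bR(2)]] prod[OF M1.power_R0[OF bR(1) q_pos] g2(1)]
      by (intro M1.Oc.rspan_add) simp_all
    then show "\<exists>g\<in>?R. (\<lambda>t. if t \<in> T then \<phi> (b (\<Psi> t)) else 0) - b ^ q = cst unif * g"
      unfolding twb using eq by blast
    fix b' assume "b' \<in> B"
    then obtain b1' b2' where b': "b1' \<in> B1" "b2' \<in> B2" "b' = b1' * b2'" by (auto simp: B_def)
    have "b * b' = (b1 * b1') * (b2 * b2')" unfolding b(3) b'(3) by (simp add: algebra_simps)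
    then show "b * b' \<in> ?R" using prod[OF M1.mult[OF b(1) b'(1)] M2.mult[OF b(2) b'(2)]] by simp
  qed (use M1.finite_T fin M1.Psi M1.phi in auto)
qed

lemma fun_model_common:
  assumes "finite T" "\<And>t. t \<in> T \<Longrightarrow> \<Psi> t \<in> T" "\<phi> \<in> Gal"
    and "finite D" "\<And>d. d \<in> D \<Longrightarrow> fun_model v T \<Psi> \<phi> (B d)"
  shows "\<exists>B'. fun_model v T \<Psi> \<phi> B' \<and> (\<forall>d\<in>D. ospan (B d) \<subseteq> ospan B')"
  using assms(4,5)
proof (induction D rule: finite_induct)
  case empty
  have "fun_model v T \<Psi> \<phi> {\<lambda>t. if t \<in> T then 1 else 0}" by (rule fun_model_unit[OF assms(1-3)])
  then show ?case by (intro exI conjI) auto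
next
  case (insert d D)
  then obtain B' where B': "fun_model v T \<Psi> \<phi> B'"
    "\<forall>d\<in>D. ospan (B d) \<subseteq> ospan B'" by auto
  have d: "fun_model v T \<Psi> \<phi> (B d)" using insert.prems by simp
  note pr = fun_model_product[OF d B'(1)]
  show ?case
  proof (intro exI conjI ballI, rule pr(1))
    fix d' assume "d' \<in> insert d D"
    then show "ospan (B d') \<subseteq> ospan ((\<lambda>(b, b'). b * b') ` (B d \<times> B'))"
      using pr(2) order_trans[OF _ pr(3)] B'(2) by (elim insertE) auto
  qed
qed

end

section \<open>Objects mapped into algebras of functions\<close>

context lambda_object
begin

text \<open>The functions \<open>\<lambda>t. pr t a\<close> on \<open>T\<close>, for
  \<open>a\<close> in the model \<open>A\<close>, are the image of \<open>A\<close>. As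
  \<open>\<Psi>\<close> corresponds to the shift of points, products, \<open>\<psi>\<close> and the
  Frobenius congruence carry over from \<open>A\<close> pointwise.\<close>

lemma fun_model_coordinate:
  fixes T :: "'b set"
  assumes T: "finite T" "\<And>t. t \<in> T \<Longrightarrow> \<Psi> t \<in> T"
    and pr: "\<And>t. t \<in> T \<Longrightarrow> pr t \<in> F" "\<And>t. t \<in> T \<Longrightarrow> pr (\<Psi> t) = shift E \<psi> (pr t) 1"
  shows "\<exists>B. fun_model v T \<Psi> id B \<and> (\<forall>a\<in>A. (\<lambda>t. if t \<in> T then pr t a else 0) \<in> ospan B)"
proof -
  define u where "u a = (\<lambda>t. if t \<in> T then pr t a else 0)" for a
  obtain S where S: "S \<subseteq> A" "finite S" "A \<subseteq> lin_span E (local_integers v) S" using A_gens by blast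
  have SE: "S \<subseteq> carrier E" using S A_sub by blast
  interpret Oc: subring_set "cst ` local_integers v :: ('b \<Rightarrow> 'l alg_closure) set" by (rule subring_Oc)
  let ?R = "ospan (u ` S)"
  have uA: "u a \<in> ?R" if a: "a \<in> A" for a
  proof -
    obtain U c where U: "finite U" "U \<subseteq> S" "c \<in> U \<rightarrow> local_integers v" "\<forall>s\<in>F. s a = (\<Sum>t\<in>U. to_ac (c t) * s t)"
      using fiber_lin_span[OF alg SE subsetD[OF S(3) a]] by blast
    have "u a = (\<Sum>x\<in>U. cst (c x) * u x)"
      using U(4) pr(1) by (auto simp: fun_eq_iff u_def sum_fun_apply fun_apply)
    also have "\<dots> \<in> ?R" using U S(2) by (intro Oc.rspan_sum Oc.rspan_scale Oc.rspan_base) auto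
    finally show ?thesis .
  qed
  have u1: "u \<one>\<^bsub>E\<^esub> = (\<lambda>t. if t \<in> T then 1 else 0)"
    using alg_homD(4)[OF pr(1)] by (auto simp: u_def fun_eq_iff)
  have um: "u a * u b = u (a \<otimes>\<^bsub>E\<^esub> b)" if "a \<in> A" "b \<in> A" for a b
  proof -
    have "a \<in> carrier E" "b \<in> carrier E" using that A_sub by auto
    then show ?thesis using alg_homD(2)[OF pr(1)] by (auto simp: u_def fun_eq_iff fun_apply)
  qed
  have tw: "(\<lambda>t. if t \<in> T then id (u a (\<Psi> t)) else 0) = u (\<psi> a)" if "a \<in> A" for a
  proof -
    have "a \<in> carrier E" using that A_sub by auto
    then show ?thesis using T(2) pr(2) by (auto simp: u_def fun_eq_iff shift_def)
  qed
  have fl: "\<exists>g\<in>?R. u (\<psi> a) - u a ^ q = cst unif * g" if a: "a \<in> A" for a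
  proof -
    let ?d = "\<psi> a \<ominus>\<^bsub>E\<^esub> a [^]\<^bsub>E\<^esub> q"
    obtain U c where U: "finite U" "U \<subseteq> A" "c \<in> U \<rightarrow> local_prime v" "\<forall>s\<in>F. s ?d = (\<Sum>t\<in>U. to_ac (c t) * s t)"
      using fiber_lin_span[OF alg A_sub psi_cong[OF a]] by blast
    have "\<exists>y. v y \<le> 1 \<and> c x = unif * y" if "x \<in> U" for x
      using U(3) that by (intro local_prime_eq_unif_mult) (auto simp: local_prime_def)
    then obtain y where y: "\<And>x. x \<in> U \<Longrightarrow> v (y x) \<le> 1 \<and> c x = unif * y x" by metis
    have "u (\<psi> a) - u a ^ q = cst unif * (\<Sum>x\<in>U. cst (y x) * u x)"
    proof
      fix t
      show "(u (\<psi> a) - u a ^ q) t = (cst unif * (\<Sum>x\<in>U. cst (y x) * u x)) t"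
      proof (cases "t \<in> T")
        case True
        have "pr t (\<psi> a) - pr t a ^ q = (\<Sum>x\<in>U. to_ac (c x) * pr t x)"
          using fiber_psi_minus_power[OF pr(1)[OF True] a] U(4) pr(1)[OF True] by simp
        also have "\<dots> = to_ac unif * (\<Sum>x\<in>U. to_ac (y x) * pr t x)"
          using y by (auto simp: sum_distrib_left mult.assoc intro!: sum.cong)
        finally show ?thesis using True by (simp add: u_def fun_apply power_fun_apply sum_fun_apply)
      qed (use q_pos in \<open>simp add: u_def fun_apply power_fun_apply sum_fun_apply zero_power\<close>)
    qed
    moreover have "(\<Sum>x\<in>U. cst (y x) * u x) \<in> ?R"
      using y U(2) uA by (intro Oc.rspan_sum Oc.rspan_scale imageI) (auto simp: local_integers_def)
    ultimately show ?thesis by blast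
  qed
  have "fun_model v T \<Psi> id (u ` S)"
  proof unfold_locales
    fix b assume "b \<in> u ` S"
    then obtain a where a: "b = u a" "a \<in> A" using S(1) by blast
    show "b t = 0" if "t \<notin> T" for t using that by (simp add: a u_def)
    show "(\<lambda>t. if t \<in> T then id (b (\<Psi> t)) else 0) \<in> ?R" unfolding a(1) tw[OF a(2)] by (rule uA[OF psi_A[OF a(2)]])
    show "\<exists>g\<in>?R. (\<lambda>t. if t \<in> T then id (b (\<Psi> t)) else 0) - b ^ q = cst unif * g"
      unfolding a(1) tw[OF a(2)] by (rule fl[OF a(2)])
    fix b' assume "b' \<in> u ` S"
    then obtain a' where a': "b' = u a'" "a' \<in> A" using S(1) by blast
    show "b * b' \<in> ?R" unfolding a(1) a'(1) um[OF a(2) a'(2)] by (rule uA[OF A_mult[OF a(2) a'(2)]])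
  next
    show "(\<lambda>t. if t \<in> T then 1 else 0) \<in> ?R" using uA[OF A_one] u1 by simp
  qed (use T S(2) gal_id in auto)
  then show ?thesis using uA unfolding u_def by blast
qed

text \<open>This morphism pulls the evaluation at \<open>t\<close> back to the point
  \<open>pr t\<close>, so by naturality what an endomorphism of the fiber functor does to
  evaluations determines what it does to the points of \<open>E\<close>.\<close>

lemma coordinate_hom:
  fixes T :: "'b set"
  assumes M: "fun_model v T \<Psi> id B"
    and pr: "\<And>t. t \<in> T \<Longrightarrow> pr t \<in> F" "\<And>t. t \<in> T \<Longrightarrow> pr (\<Psi> t) = shift E \<psi> (pr t) 1"
    and uA: "\<forall>a\<in>A. (\<lambda>t. if t \<in> T then pr t a else 0) \<in> ospan B"
    and C_def: "C = fun_model.C B" and k_def: "\<kappa> = fun_model.encode B"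
    and M_def: "M = (fmod \<kappa> (fun_model.decode B) C (fun_model.e T), fun_model.psi T \<Psi> id B)"
  shows "\<exists>f\<in>lambda_homs (E, \<psi>) M. \<forall>x\<in>carrier E. \<exists>g\<in>C. f x = \<kappa> g \<and> (\<forall>t\<in>T. g t = pr t x)"
proof -
  interpret M: fun_model v T \<Psi> id B by fact
  define u where "u a = (\<lambda>t. if t \<in> T then pr t a else 0)" for a
  have uC: "u x \<in> M.C" if x: "x \<in> carrier E" for x
  proof -
    have "x \<in> lin_span E UNIV A" using x A_span by simp
    from fiber_lin_span[OF alg A_sub this] obtain U c where
      U: "finite U" "U \<subseteq> A" "\<forall>s\<in>F. s x = (\<Sum>t\<in>U. to_ac (c t) * s t)" by blast
    have "u x = (\<Sum>y\<in>U. cst (c y) * u y)"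
      using U(3) pr(1) by (auto simp: fun_eq_iff u_def sum_fun_apply fun_apply)
    also have "\<dots> \<in> M.C"
      using U(2) uA M.R0_C by (intro M.sum_D M.cst_D) (auto simp: u_def)
    finally show ?thesis .
  qed
  define f where "f = (\<lambda>x\<in>carrier E. M.encode (u x))"
  have fx: "f x = M.encode (u x)" if "x \<in> carrier E" for x using that by (simp add: f_def)
  have "f \<in> ring_hom E M.E"
  proof (rule ring_hom_memI)
    fix x y assume xy: "x \<in> carrier E" "y \<in> carrier E"
    have "u (x \<otimes>\<^bsub>E\<^esub> y) = u x * u y" "u (x \<oplus>\<^bsub>E\<^esub> y) = u x + u y"
      using alg_homD(2,3)[OF pr(1) xy] by (auto simp: u_def fun_eq_iff fun_apply)
    then show "f (x \<otimes>\<^bsub>E\<^esub> y) = f x \<otimes>\<^bsub>M.E\<^esub> f y" "f (x \<oplus>\<^bsub>E\<^esub> y) = f x \<oplus>\<^bsub>M.E\<^esub> f y"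
      using fx xy uC[OF xy(1)] uC[OF xy(2)] by simp_all
  next
    have "u \<one>\<^bsub>E\<^esub> = M.e" using alg_homD(4)[OF pr(1)] by (auto simp: u_def M.e_def fun_eq_iff)
    then show "f \<one>\<^bsub>E\<^esub> = \<one>\<^bsub>M.E\<^esub>" using fx by simp
  qed (use fx uC in auto)
  moreover have "f (c \<odot>\<^bsub>E\<^esub> x) = c \<odot>\<^bsub>M.E\<^esub> f x" if x: "x \<in> carrier E" for c x
  proof -
    have "u (c \<odot>\<^bsub>E\<^esub> x) = cst c * u x"
      using alg_homD(5)[OF pr(1) x] by (auto simp: u_def fun_eq_iff fun_apply)
    then show ?thesis using fx[OF x] fx[OF algebra_smult_closed[OF alg x]] uC[OF x] by simp
  qed
  moreover have "f \<in> extensional (carrier E)" unfolding f_def by (rule restrict_extensional)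
  ultimately have "f \<in> alg_hom E M.E" unfolding alg_hom_def by (intro CollectI conjI IntI allI ballI)
  moreover have "f (\<psi> x) = M.psi (f x)" if x: "x \<in> carrier E" for x
  proof -
    have "M.tw (u x) = u (\<psi> x)"
      using pr(2) M.Psi x by (auto simp: u_def M.tw_def fun_eq_iff shift_def)
    then show ?thesis using fx[OF x] fx[OF alg_homD(1)[OF psi x]] M.psi_encode[OF uC[OF x]] by simp
  qed
  ultimately have "f \<in> lambda_homs (E, \<psi>) M" unfolding M_def k_def C_def lambda_homs_def by simp
  moreover have "\<forall>x\<in>carrier E. \<exists>g\<in>C. f x = \<kappa> g \<and> (\<forall>t\<in>T. g t = pr t x)"
    using fx uC unfolding C_def k_def u_def by force
  ultimately show ?thesis by blast
qed

end

section \<open>Density of the image\<close>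

text \<open>All points of the objects in \<open>Y\<close> form the single tuple
  \<open>tt id 0\<close>. One object of functions on the orbit of this tuple maps compatibly to
  every coordinate, so \<open>\<alpha>\<close> needs to be known at one point of one object
  only.\<close>

lemma (in local_field) Phi_dense:
  assumes \<alpha>: "\<alpha> \<in> carrier (fundamental_monoid v)" and Y: "finite Y" "Y \<subseteq> lambda_objects v"
  shows "\<exists>p\<in>carrier SD. \<forall>C\<in>Y. Phi p C = \<alpha> C"
proof -
  define D where "D = Sigma Y fiber"
  define tt where "tt g n = (\<lambda>d\<in>D. gact (fst (fst d)) g (shift (fst (fst d)) (snd (fst d)) (snd d) n))" for g n
  define T where "T = (\<lambda>(g, n). tt g n) ` (Gal \<times> UNIV)"
  define \<Psi> where "\<Psi> t = (\<lambda>d\<in>D. shift (fst (fst d)) (snd (fst d)) (t d) 1)"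
    for t :: "'l lambda_alg \<times> ((nat \<Rightarrow> 'l) \<Rightarrow> 'l alg_closure) \<Rightarrow> (nat \<Rightarrow> 'l) \<Rightarrow> 'l alg_closure"
  have Dobj: "lambda_object v (fst (fst d)) (snd (fst d))" "snd d \<in> alg_hom (fst (fst d)) closure_algebra" if "d \<in> D" for d
    using that Y(2) lambda_objectI[of "fst (fst d)" "snd (fst d)"] by (auto simp: D_def fiber_def)
  have ttF: "tt g n d \<in> alg_hom (fst (fst d)) closure_algebra" if g: "g \<in> Gal" and d: "d \<in> D" for g n d
  proof -
    interpret C: lambda_object v "fst (fst d)" "snd (fst d)" by (rule Dobj[OF d])
    show ?thesis using d C.gact_mem[OF g C.shift_mem[OF Dobj(2)[OF d]]] by (simp add: tt_def)
  qed
  have Ptt: "\<Psi> (tt g n) = tt g (Suc n)" for g n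
  proof
    fix d
    show "\<Psi> (tt g n) d = tt g (Suc n) d"
    proof (cases "d \<in> D")
      case True
      interpret C: lambda_object v "fst (fst d)" "snd (fst d)" by (rule Dobj[OF True])
      show ?thesis using True by (simp add: \<Psi>_def tt_def C.shift_gact C.shift_shift)
    qed (simp add: \<Psi>_def tt_def)
  qed
  have finD: "finite D"
    unfolding D_def
  proof (rule finite_SigmaI[OF Y(1)])
    fix C assume "C \<in> Y"
    then interpret C: lambda_object v "fst C" "snd C" using Y(2) lambda_objectI[of "fst C" "snd C"] by auto
    show "finite (fiber C)" using C.finite_F by (simp add: fiber_def case_prod_beta)
  qed
  have finT: "finite T"
  proof (rule finite_subset)
    show "T \<subseteq> (\<Pi>\<^sub>E d\<in>D. alg_hom (fst (fst d)) closure_algebra)"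
    proof
      fix t assume "t \<in> T"
      then obtain g n where t: "t = tt g n" "g \<in> Gal" by (auto simp: T_def)
      show "t \<in> (\<Pi>\<^sub>E d\<in>D. alg_hom (fst (fst d)) closure_algebra)"
        unfolding t(1) by (rule PiE_I, rule ttF[OF t(2)]) (simp_all add: tt_def)
    qed
    show "finite (\<Pi>\<^sub>E d\<in>D. alg_hom (fst (fst d)) (closure_algebra :: ('l, 'l alg_closure) module))"
    proof (rule finite_PiE[OF finD])
      fix d assume "d \<in> D"
      then interpret C: lambda_object v "fst (fst d)" "snd (fst d)" by (rule Dobj)
      show "finite (alg_hom (fst (fst d)) (closure_algebra :: ('l, 'l alg_closure) module))" by (rule C.finite_F)
    qed
  qed
  have PT: "\<Psi> t \<in> T" if tT: "t \<in> T" for t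
  proof -
    obtain g n where "t = tt g n" "g \<in> Gal" using tT by (auto simp: T_def)
    then show ?thesis unfolding T_def using Ptt[of g n] by (intro image_eqI[of _ _ "(g, Suc n)"]) auto
  qed
  have TF: "t d \<in> alg_hom (fst (fst d)) closure_algebra" if tT: "t \<in> T" "d \<in> D" for t d
  proof -
    obtain g n where "t = tt g n" "g \<in> Gal" using tT(1) by (auto simp: T_def)
    then show ?thesis using ttF[OF _ tT(2)] by simp
  qed
  have PTs: "\<Psi> t d = shift (fst (fst d)) (snd (fst d)) (t d) 1" if "d \<in> D" for t d
    using that by (simp add: \<Psi>_def)
  let ?A = "\<lambda>d. lambda_object.A v (fst (fst d)) (snd (fst d))"
  define good where "good d B \<longleftrightarrow> fun_model v T \<Psi> id B \<and>
    (\<forall>a\<in>?A d. (\<lambda>t. if t \<in> T then t d a else 0) \<in> ospan B)" for d B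
  have "\<exists>B. good d B" if d: "d \<in> D" for d
  proof -
    interpret C: lambda_object v "fst (fst d)" "snd (fst d)" by (rule Dobj[OF d])
    show ?thesis unfolding good_def
      using finT PT TF[OF _ d] PTs[OF d] by (intro C.fun_model_coordinate[where pr = "\<lambda>t. t d"]) auto
  qed
  then obtain B where "\<And>d. d \<in> D \<Longrightarrow> good d (B d)" by metis
  note B = this[unfolded good_def, THEN conjunct1] this[unfolded good_def, THEN conjunct2]
  have "\<exists>B'. fun_model v T \<Psi> id B' \<and> (\<forall>d\<in>D. ospan (B d) \<subseteq> ospan B')"
    by (rule fun_model_common[OF finT _ gal_id finD]) (rule PT B(1), assumption)+
  then obtain B' where B': "fun_model v T \<Psi> id B'"
    "\<forall>d\<in>D. ospan (B d) \<subseteq> ospan B'" by (elim exE conjE) (rule that)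
  interpret M: fun_model v T \<Psi> id B' by (rule B'(1))
  let ?M = "(M.E, M.psi)"
  have Mobj: "?M \<in> lambda_objects v" by (rule M.fun_model_object)
  have t0: "tt id 0 \<in> T" unfolding T_def using gal_id by (intro image_eqI[of _ _ "(id, 0)"]) auto
  have nat: "\<alpha> C (fiber_map C C' f s) = fiber_map C C' f (\<alpha> C' s)"
    if "C \<in> lambda_objects v" "C' \<in> lambda_objects v" "f \<in> lambda_homs C C'" "s \<in> fiber C'" for C C' f s
    using \<alpha> that by (simp add: fundamental_monoid_def functor_End_def)
  have mem: "\<alpha> C \<in> fiber C \<rightarrow>\<^sub>E fiber C" if "C \<in> lambda_objects v" for C
    using \<alpha> that by (auto simp: fundamental_monoid_def functor_End_def)
  have ev0: "M.ev (tt id 0) \<in> fiber ?M" using M.ev_mem[OF t0] by (simp add: fiber_def)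
  then have "\<alpha> ?M (M.ev (tt id 0)) \<in> fiber ?M" using mem[OF Mobj] by blast
  then have "\<alpha> ?M (M.ev (tt id 0)) \<in> alg_hom M.E closure_algebra" by (simp add: fiber_def)
  \<comment> \<open>The image under \<open>\<alpha>\<close> of the evaluation at the tuple is a
    Galois twist of the evaluation at another tuple of the orbit, and every tuple there is the
    original one shifted by some \<open>n\<close> and moved by some \<open>g\<close>.\<close>
  from M.fiber_fmod[OF this] obtain \<tau> t1 where \<tau>: "\<tau> \<in> Gal" "t1 \<in> T" "\<alpha> ?M (M.ev (tt id 0)) = gact M.E \<tau> (M.ev t1)" by blast
  obtain g n where g: "g \<in> Gal" "t1 = tt g n" using \<tau>(2) by (auto simp: T_def)
  let ?f = "frob ^^ n"
  have f: "deg_is ?f n" by (rule deg_is_frob_power)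
  \<comment> \<open>A pair with first component of degree \<open>n\<close> also applies the inverse
    of \<open>?f\<close>; \<open>\<mu>\<close> contains \<open>?f\<close> so that the total
    automorphism becomes \<open>\<tau> \<circ> g\<close>.\<close>
  define \<mu> where "\<mu> = \<tau> \<circ> g \<circ> ?f"
  have \<mu>: "\<mu> \<in> Gal" unfolding \<mu>_def by (intro gal_comp \<tau> g deg_is_Gal[OF f])
  have "Phi (Some ?f, inv' \<mu>) C = \<alpha> C" if C: "C \<in> Y" for C
  proof -
    obtain E \<psi> where C': "C = (E, \<psi>)" by (cases C)
    have Co: "(E, \<psi>) \<in> lambda_objects v" using C C' Y(2) by blast
    interpret C: lambda_object v E \<psi> by (rule lambda_objectI[OF Co])
    have "Phi (Some ?f, inv' \<mu>) (E, \<psi>) s = \<alpha> (E, \<psi>) s" if s: "s \<in> C.F" for s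
    proof -
      define d where "d = ((E, \<psi>), s)"
      have d: "d \<in> D" using C C' s by (simp add: d_def D_def fiber_def)
      have "\<exists>h\<in>lambda_homs (E, \<psi>) ?M. \<forall>x\<in>carrier E. \<exists>k\<in>M.C. h x = M.encode k \<and> (\<forall>t\<in>T. k t = t d x)"
      proof (rule C.coordinate_hom[OF B'(1) _ _ _ refl refl refl])
        show "t d \<in> C.F" if "t \<in> T" for t using TF[OF that d] by (simp add: d_def)
        show "\<Psi> t d = shift E \<psi> (t d) 1" for t using PTs[OF d] by (simp add: d_def)
        show "\<forall>a\<in>C.A. (\<lambda>t. if t \<in> T then t d a else 0) \<in> M.R0"
          using B(2)[OF d] subsetD[OF bspec[OF B'(2) d]] by (auto simp: d_def)
      qed
      then obtain h where h: "h \<in> lambda_homs (E, \<psi>) ?M"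
        "\<forall>x\<in>carrier E. \<exists>k\<in>M.C. h x = M.encode k \<and> (\<forall>t\<in>T. k t = t d x)" by blast
      have comp: "compose (carrier E) (gact M.E \<kappa> (M.ev t)) h = gact E \<kappa> (t d)" if t: "t \<in> T" for \<kappa> t
      proof
        fix x
        show "compose (carrier E) (gact M.E \<kappa> (M.ev t)) h x = gact E \<kappa> (t d) x"
        proof (cases "x \<in> carrier E")
          case True
          then obtain k where "k \<in> M.C" "h x = M.encode k" "\<forall>t\<in>T. k t = t d x" using h(2) by blast
          then show ?thesis using True t by (simp add: compose_def gact_def M.ev_apply)
        qed (simp add: compose_def gact_def)
      qed
      have "tt id 0 d = s" using d C.gact_id[OF s] C.shift_0[OF s] by (simp add: tt_def d_def)
      then have s0: "fiber_map (E, \<psi>) ?M h (gact M.E id (M.ev (tt id 0))) = s"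
        using comp[OF t0, of id] C.gact_id[OF s] by (simp add: fiber_map_def)
      have ev_id: "gact M.E id (M.ev (tt id 0)) = M.ev (tt id 0)"
        by (auto simp: gact_def M.ev_def fun_eq_iff)
      have "\<alpha> (E, \<psi>) s = fiber_map (E, \<psi>) ?M h (\<alpha> ?M (M.ev (tt id 0)))"
        using nat[OF Co Mobj h(1) ev0] s0 unfolding ev_id by simp
      also have "\<dots> = gact E \<tau> (t1 d)"
        unfolding \<tau>(3) using comp[OF \<tau>(2), of \<tau>] by (simp add: fiber_map_def)
      also have "\<dots> = gact E (\<tau> \<circ> g) (shift E \<psi> s n)"
        using d by (simp add: g(2) tt_def) (simp add: d_def C.gact_gact)
      finally have al: "\<alpha> (E, \<psi>) s = gact E (\<tau> \<circ> g) (shift E \<psi> s n)" .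
      have "Phi (Some ?f, inv' \<mu>) (E, \<psi>) s = gact E (inv' (inv' \<mu>)) (gact E (inv' ?f) (shift E \<psi> s n))"
        unfolding Phi_apply[OF Co s] by (simp add: qact_def deg_eq[OF f])
      also have "\<dots> = gact E (\<mu> \<circ> inv' ?f) (shift E \<psi> s n)" by (simp add: C.gact_gact inv_inv[OF \<mu>])
      also have "\<mu> \<circ> inv' ?f = \<tau> \<circ> g"
        unfolding \<mu>_def using gal_comp_inv(1)[OF deg_is_Gal[OF f]] by (simp add: comp_assoc)
      finally show ?thesis unfolding al .
    qed
    moreover have "Phi (Some ?f, inv' \<mu>) C \<in> extensional (fiber C)" "\<alpha> C \<in> extensional (fiber C)"
      using Co C' mem[OF Co] by (auto simp: Phi_def PiE_iff)
    ultimately show ?thesis unfolding C' by (intro extensionalityI[of _ "fiber (E, \<psi>)"]) (auto simp: fiber_def)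
  qed
  moreover have "(Some ?f, inv' \<mu>) \<in> carrier SD"
    using Some_mem_Q[OF f] gal_inv[OF \<mu>] by (simp add: carrier_SD)
  ultimately show ?thesis by blast
qed

text \<open>The image is compact, hence closed in the Hausdorff product of finite discrete spaces,
  while a basic neighbourhood restricts only finitely many objects and so is met by the
  image.\<close>

theorem (in local_field) Phi_surj: "Phi ` carrier SD = carrier (fundamental_monoid v)"
proof (rule antisym)
  show "Phi ` carrier SD \<subseteq> carrier (fundamental_monoid v)" using Phi_mem by blast
  let ?P = "product_topology (\<lambda>C. discrete_topology (fiber C \<rightarrow>\<^sub>E fiber C)) (lambda_objects v)"
  have ftop: "fundamental_monoid_topology v = subtopology ?P (carrier (fundamental_monoid v))"
    by (simp add: fundamental_monoid_topology_def functor_End_topology_def fundamental_monoid_def)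
  have cont: "continuous_map SDtop ?P Phi"
    using continuous_Phi unfolding ftop by (rule continuous_map_into_fulltopology)
  have "compactin ?P (Phi ` topspace SDtop)"
  proof (rule image_compactin[OF _ cont])
    have "compact_space SDtop" using compact_Q compact_krull[where 'l = 'l] by (simp add: compact_space_prod_topology)
    then show "compactin SDtop (topspace SDtop)" by (simp only: compact_space_def)
  qed
  moreover have haus: "Hausdorff_space ?P" by (simp add: Hausdorff_space_product_topology)
  ultimately have closed: "closedin ?P (Phi ` carrier SD)"
    unfolding topspace_SD by (intro compactin_imp_closedin)
  show "carrier (fundamental_monoid v) \<subseteq> Phi ` carrier SD"
  proof
    fix \<alpha> assume \<alpha>: "\<alpha> \<in> carrier (fundamental_monoid v)"
    have \<alpha>P: "\<alpha> \<in> topspace ?P"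
      using \<alpha> by (simp add: fundamental_monoid_def functor_End_def)
    show "\<alpha> \<in> Phi ` carrier SD"
    proof (rule ccontr)
      assume "\<alpha> \<notin> Phi ` carrier SD"
      then have a: "\<alpha> \<in> topspace ?P - Phi ` carrier SD" using \<alpha>P by simp
      have op: "openin ?P (topspace ?P - Phi ` carrier SD)" using closed unfolding closedin_def by (rule conjunct2)
      from bspec[OF iffD1[OF openin_product_topology_alt op] a] obtain W where W: "finite {i \<in> lambda_objects v. W i \<noteq> fiber i \<rightarrow>\<^sub>E fiber i}"
        "\<alpha> \<in> Pi\<^sub>E (lambda_objects v) W" "Pi\<^sub>E (lambda_objects v) W \<subseteq> topspace ?P - Phi ` carrier SD"
        by (simp only: topspace_discrete_topology) (elim exE conjE)
      define Y where "Y = {i \<in> lambda_objects v. W i \<noteq> fiber i \<rightarrow>\<^sub>E fiber i}"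
      have Y: "finite Y" "Y \<subseteq> lambda_objects v" using W(1) by (auto simp: Y_def)
      obtain p where p: "p \<in> carrier SD" "\<forall>C\<in>Y. Phi p C = \<alpha> C" using Phi_dense[OF \<alpha> Y] by blast
      have "Phi p C \<in> W C" if "C \<in> lambda_objects v" for C
      proof (cases "C \<in> Y")
        case True
        then show ?thesis using p(2) W(2) that by auto
      next
        case False
        then have "W C = fiber C \<rightarrow>\<^sub>E fiber C" using that by (simp add: Y_def)
        then show ?thesis using Phi_mem[OF p(1)] that by (auto simp: fundamental_monoid_def functor_End_def)
      qed
      moreover have "Phi p \<in> extensional (lambda_objects v)" by (simp add: Phi_def)
      ultimately have "Phi p \<in> Pi\<^sub>E (lambda_objects v) W" by (auto simp: PiE_iff)
      then show False using W(3) p(1) by blast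
    qed
  qed
qed

section \<open>Separation of points\<close>

context fun_model
begin

lemma Phi_Some_ev:
  assumes \<rho>: "deg_is \<rho> n" and t: "t \<in> T" and f: "f \<in> C"
  shows "Phi (Some \<rho>, \<sigma>) (E, psi) (ev t) (encode f) = inv' \<sigma> (inv' \<rho> ((\<phi> ^^ n) (f ((\<Psi> ^^ n) t))))"
  unfolding Phi_apply[OF fun_model_object ev_mem[OF t]]
  using f by (simp add: qact_def deg_eq[OF \<rho>] shift_ev[OF t] gact_def ev_apply)

text \<open>The zero element acts like any element of sufficiently large degree; the bound
  \<open>k\<close> lets \<open>n\<close> be chosen beyond the length of a chain.\<close>

lemma Phi_None_ev:
  assumes t: "t \<in> T"
  shows "\<exists>n\<ge>k. \<forall>f\<in>C. Phi (None, \<sigma>) (E, psi) (ev t) (encode f) =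
    inv' \<sigma> (inv' (frob ^^ n) ((\<phi> ^^ n) (f ((\<Psi> ^^ n) t))))"
proof -
  interpret M: lambda_object v E psi by (rule lambda_objectI[OF fun_model_object])
  define n where "n = max k (stab E psi)"
  have r: "retr E psi (ev t) = gact E (inv' (frob ^^ n)) (shift E psi (ev t) n)"
    by (rule M.retr_eq[OF ev_mem[OF t] _ deg_is_frob_power]) (simp add: n_def)
  show ?thesis
    unfolding Phi_apply[OF fun_model_object ev_mem[OF t]]
    by (intro exI[of _ n] conjI ballI) (simp_all add: n_def[symmetric] qact_def r shift_ev[OF t] gact_def ev_apply, simp add: n_def)
qed

end

section \<open>Chains of points, and pairs of finite degree\<close>

context local_field
begin

definition delta :: "nat \<Rightarrow> 'l alg_closure \<Rightarrow> nat \<Rightarrow> 'l alg_closure" where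
  "delta i y = (\<lambda>t. if t = i then y else 0)"

text \<open>Points \<open>0, \<dots>, k\<close>, each moved to the next one. Functions supported at \<open>i < k\<close> have values divisible by
  \<open>\<pi>\<^sup>i\<^sup>+\<^sup>1\<close>, so that shifting the support by one gains the factor \<open>\<pi>\<close> required of a Frobenius lift.\<close>

lemma chain_model:
  assumes x: "x \<in> OK"
  shows "\<exists>B. fun_model v {..k} (\<lambda>i. min k (Suc i)) id B \<and>
    (\<forall>i<k. \<forall>m. delta i (to_ac (unif ^ Suc i) * x ^ m) \<in> ospan B)"
proof -
  obtain n where n: "n > 0" "x ^ n \<in> rspan acO ((\<lambda>i. x ^ i) ` {..<n})" using power_mem_rspan[OF x] by blast
  define S where "S = (\<lambda>i. x ^ i) ` {..<n}"
  have finS: "finite S" by (simp add: S_def)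
  have xS: "x * s \<in> rspan acO S" if s: "s \<in> S" for s
  proof -
    obtain j where j: "s = x ^ j" "j < n" using s by (auto simp: S_def)
    have eq: "x * s = x ^ Suc j" by (simp add: j)
    show ?thesis
    proof (cases "Suc j < n")
      case True
      then show ?thesis unfolding eq S_def by (intro acO.rspan_base imageI) auto
    next
      case False
      then have "Suc j = n" using j(2) by simp
      then show ?thesis unfolding eq using n(2) by (simp add: S_def)
    qed
  qed
  have pow: "x ^ m \<in> rspan acO S" for m
  proof (induction m)
    case 0
    show ?case using n(1) unfolding S_def by (intro acO.rspan_base imageI) auto
  next
    case (Suc m)
    have "x \<in> rspan acO {x}" by (rule acO.rspan_base) auto
    from acO.rspan_mult[OF this Suc, of S] show ?case using xS by simp
  qed
  define e where "e = (\<lambda>t::nat. if t \<in> {..k} then 1 else (0 :: 'l alg_closure))"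
  let ?d = "\<lambda>i y. delta i (to_ac (unif ^ Suc i) * y)"
  define B where "B = insert e ((\<lambda>(i, y). ?d i y) ` ({..<k} \<times> S))"
  let ?R = "ospan B"
  interpret Oc: subring_set "cst ` local_integers v :: (nat \<Rightarrow> 'l alg_closure) set" by (rule subring_Oc)
  have finB: "finite B" using finS by (simp add: B_def)
  have eR: "e \<in> ?R" by (rule Oc.rspan_base[OF finB]) (simp add: B_def)
  \<comment> \<open>Higher powers of the uniformizer than the required one stay in the order.
    Products and q-th powers of generators only raise the exponent, and a shift to the left has one
    factor to spare.\<close>
  have dR: "delta i (to_ac (unif ^ m) * y) \<in> ?R" if i: "i < k" and m: "m \<ge> Suc i" and y: "y \<in> rspan acO S" for i m y
  proof -
    obtain c where c: "y = (\<Sum>s\<in>S. c s * s)" "\<forall>s\<in>S. c s \<in> acO" using y by (auto simp: rspan_def)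
    obtain b where b: "\<And>s. s \<in> S \<Longrightarrow> c s = to_ac (b s) \<and> b s \<in> local_integers v" using c(2) unfolding image_iff by metis
    have y': "y = (\<Sum>s\<in>S. to_ac (b s) * s)" unfolding c(1) using b by (intro sum.cong) auto
    have pw: "unif ^ m = unif ^ (m - Suc i) * unif ^ Suc i" unfolding power_add[symmetric] using m by simp
    have "delta i (to_ac (unif ^ m) * y) = (\<Sum>s\<in>S. cst (unif ^ (m - Suc i) * b s) * ?d i s)"
      by (auto simp: fun_eq_iff delta_def sum_fun_apply fun_apply y' pw sum_distrib_left intro!: sum.cong)
    also have "\<dots> \<in> ?R"
    proof (intro Oc.rspan_sum Oc.rspan_scale)
      fix s assume s: "s \<in> S"
      show "cst (unif ^ (m - Suc i) * b s) \<in> cst ` local_integers v"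
        using b[OF s] unif by (intro imageI) (auto simp: local_integers_def v_mult v_power intro!: mult_le_one power_le_one)
      show "?d i s \<in> ?R" by (rule Oc.rspan_base[OF finB]) (use s i in \<open>auto simp: B_def\<close>)
    qed
    finally show ?thesis .
  qed
  have e_mult: "e * e = e" "i < k \<Longrightarrow> e * delta i z = delta i z" "i < k \<Longrightarrow> delta i z * e = delta i z" for i z
    by (auto simp: e_def fun_eq_iff delta_def fun_apply)
  have d_mult: "delta i y * delta j z = (if i = j then delta i (y * z) else 0)" for i j y z
    by (auto simp: fun_eq_iff delta_def fun_apply)
  have tw_e: "(\<lambda>t. if t \<in> {..k} then id (e (min k (Suc t))) else 0) = e" by (auto simp: e_def fun_eq_iff)
  have tw_d: "(\<lambda>t. if t \<in> {..k} then id (delta i z (min k (Suc t))) else 0) = (if i = 0 then 0 else delta (i - 1) z)"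
    if "i < k" for i z
    using that by (auto simp: fun_eq_iff delta_def min_def fun_apply)
  have e_q: "e ^ q = e" using q_pos by (auto simp: e_def fun_eq_iff power_fun_apply zero_power)
  have d_q: "delta i z ^ q = delta i (z ^ q)" for i z using q_pos by (auto simp: fun_eq_iff delta_def power_fun_apply zero_power)
  have B_cases: "b = e \<or> (\<exists>i j. i < k \<and> b = ?d i (x ^ j))" if "b \<in> B" for b using that unfolding B_def S_def by auto
  have "fun_model v {..k} (\<lambda>i. min k (Suc i)) id B"
  proof unfold_locales
    fix b assume b: "b \<in> B"
    show "b t = 0" if "t \<notin> {..k}" for t using B_cases[OF b] that by (auto simp: delta_def e_def)
    show "(\<lambda>t. if t \<in> {..k} then id (b (min k (Suc t))) else 0) \<in> ?R"
      using B_cases[OF b]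
    proof (elim disjE exE conjE)
      assume be: "b = e" show ?thesis unfolding be tw_e by (rule eR)
    next
      fix i j assume i: "i < k" "b = ?d i (x ^ j)"
      show ?thesis unfolding i(2) tw_d[OF i(1)] using dR[OF _ _ pow, of "i - 1" "Suc i"] i(1) Oc.rspan_zero by auto
    qed
    show "\<exists>g\<in>?R. (\<lambda>t. if t \<in> {..k} then id (b (min k (Suc t))) else 0) - b ^ q = cst unif * g"
      using B_cases[OF b]
    proof (elim disjE exE conjE)
      assume be: "b = e" show ?thesis unfolding be tw_e e_q by (intro bexI[of _ 0] Oc.rspan_zero) simp
    next
      fix i j assume i: "i < k" "b = ?d i (x ^ j)"
      \<comment> \<open>The shifted generator sits at \<open>i - 1\<close> with exponent
        \<open>i + 1\<close>, where \<open>i\<close> suffices; the q-th power has exponent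
        \<open>(i + 1) * q\<close> at \<open>i\<close>. One factor can be taken out of each. For
        \<open>i = 0\<close> the shift leaves the chain and gives zero.\<close>
      define g where "g = (if i = 0 then 0 else delta (i - 1) (to_ac (unif ^ i) * x ^ j)) -
          delta i (to_ac (unif ^ (Suc i * q - 1)) * x ^ (j * q))"
      have q2: "Suc i * q \<ge> Suc i + 1" using q_gt_1 by (cases q) auto
      have "g \<in> ?R"
        unfolding g_def using dR[OF _ _ pow, of "i - 1" i] dR[OF i(1) _ pow, of "Suc i * q - 1"] i(1) q2 Oc.rspan_zero
        by (intro Oc.rspan_diff) auto
      moreover have "(\<lambda>t. if t \<in> {..k} then id (b (min k (Suc t))) else 0) - b ^ q = cst unif * g"
      proof -
        have 1: "(to_ac (unif ^ Suc i) * x ^ j) ^ q = to_ac unif * (to_ac (unif ^ (Suc i * q - 1)) * x ^ (j * q))"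
        proof -
          have "unif ^ (Suc i * q) = unif * unif ^ (Suc i * q - 1)" using q2 by (cases "Suc i * q") auto
          then have "to_ac (unif ^ (Suc i * q)) = to_ac unif * to_ac (unif ^ (Suc i * q - 1))" by (metis to_ac_mult)
          then show ?thesis by (simp only: power_mult_distrib power_mult[symmetric] to_ac_power[symmetric] mult.assoc)
        qed
        show ?thesis
          unfolding i(2) tw_d[OF i(1)] d_q g_def 1 by (auto simp: fun_eq_iff delta_def fun_apply algebra_simps)
      qed
      ultimately show ?thesis by blast
    qed
    fix b' assume b': "b' \<in> B"
    show "b * b' \<in> ?R"
    proof (cases "b = e \<or> b' = e")
      case True
      then show ?thesis using B_cases[OF b] B_cases[OF b'] eR e_mult Oc.rspan_base[OF finB b] Oc.rspan_base[OF finB b']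
        by (elim disjE exE conjE) simp_all
    next
      case False
      then obtain i j i' j' where *: "i < k" "b = ?d i (x ^ j)" "b' = ?d i' (x ^ j')" using B_cases[OF b] B_cases[OF b'] by blast
      have eq: "(to_ac (unif ^ Suc i) * x ^ j) * (to_ac (unif ^ Suc i) * x ^ j') = to_ac (unif ^ (Suc i + Suc i)) * x ^ (j + j')"
        by (simp add: power_add mult_ac)
      show ?thesis
      proof (cases "i = i'")
        case True
        have "b * b' = delta i (to_ac (unif ^ (Suc i + Suc i)) * x ^ (j + j'))"
          unfolding *(2,3) d_mult True[symmetric] eq by simp
        then show ?thesis using dR[OF *(1) _ pow, of "Suc i + Suc i" "j + j'"] by simp
      qed (use *(2,3) d_mult Oc.rspan_zero in simp)
    qed
  next
    show "(\<lambda>t. if t \<in> {..k} then 1 else 0) \<in> ?R" using eR unfolding e_def .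
  qed (use finB gal_id in auto)
  moreover have "\<forall>i<k. \<forall>m. ?d i (x ^ m) \<in> ?R" using dR[OF _ order_refl pow] by blast
  ultimately show ?thesis by blast
qed

lemma chain_iterate: "((\<lambda>i. min k (Suc i)) ^^ n) 0 = min k n"
  by (induction n) auto

text \<open>On the chain ending in \<open>Suc n\<close> the point 0 moves to \<open>n\<close> under
  an element of degree \<open>n\<close>, whereas the zero element behaves like a longer walk and
  ends in the sink. A function supported at \<open>n\<close> tells them apart.\<close>

lemma Phi_Some_neq_None:
  assumes \<rho>: "deg_is \<rho> n" and \<sigma>: "\<sigma> \<in> Gal" "\<sigma>' \<in> Gal"
  shows "Phi (Some \<rho>, \<sigma>) \<noteq> Phi (None, \<sigma>')"
proof
  assume eq: "Phi (Some \<rho>, \<sigma>) = Phi (None, \<sigma>')"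
  obtain B where B: "fun_model v {..Suc n} (\<lambda>i. min (Suc n) (Suc i)) id B"
    "\<forall>i<Suc n. \<forall>m. delta i (to_ac (unif ^ Suc i) * 1 ^ m) \<in> ospan B"
    using chain_model[OF OK.one_mem, of "Suc n"] by blast
  interpret M: fun_model v "{..Suc n}" "\<lambda>i. min (Suc n) (Suc i)" id B by (rule B(1))
  define f where "f = delta n (to_ac (unif ^ Suc n) * 1 ^ 0)"
  have f: "f \<in> M.C" unfolding f_def using B(2) M.R0_C by blast
  have 0: "0 \<in> {..Suc n}" by simp
  obtain m where m: "m \<ge> Suc n" "\<forall>f\<in>M.C. Phi (None, \<sigma>') (M.E, M.psi) (M.ev 0) (M.encode f) =
    inv' \<sigma>' (inv' (frob ^^ m) ((id ^^ m) (f (((\<lambda>i. min (Suc n) (Suc i)) ^^ m) 0))))"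
    using M.Phi_None_ev[OF 0, of "Suc n" \<sigma>'] by (elim exE conjE)
  have fm: "f (min (Suc n) m) = 0" using m(1) by (simp add: f_def delta_def)
  have fn: "f (min (Suc n) n) \<noteq> 0" by (simp add: f_def delta_def)
  have z: "inv' \<tau> y = 0 \<longleftrightarrow> y = 0" if "\<tau> \<in> Gal" for \<tau> y using gal_eq_0_iff[OF gal_inv[OF that]] .
  have "Phi (None, \<sigma>') (M.E, M.psi) (M.ev 0) (M.encode f) = 0"
    unfolding bspec[OF m(2) f] chain_iterate id_funpow fm id_apply
    by (simp only: z[OF \<sigma>(2)] z[OF deg_is_Gal[OF deg_is_frob_power[of m]]])
  moreover have "Phi (Some \<rho>, \<sigma>) (M.E, M.psi) (M.ev 0) (M.encode f) \<noteq> 0"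
    unfolding M.Phi_Some_ev[OF \<rho> 0 f] chain_iterate id_funpow id_apply
    using fn by (simp only: z[OF \<sigma>(1)] z[OF deg_is_Gal[OF \<rho>]] not_False_eq_True)
  ultimately show False unfolding eq by simp
qed

text \<open>Every element of the closure is integral or has an integral inverse.\<close>

lemma gal_eqI_OK:
  assumes "\<sigma> \<in> Gal" "\<tau> \<in> Gal" "\<And>x. x \<in> OK \<Longrightarrow> \<sigma> x = \<tau> x"
  shows "\<sigma> = \<tau>"
proof
  fix x
  have "w x \<le> 1 \<or> w (inverse x) \<le> 1" by (cases "w x \<le> 1") (auto simp: w_inverse inverse_le_1_iff)
  then have "x \<in> OK \<or> inverse x \<in> OK" by (simp add: w_le_1_iff)
  then show "\<sigma> x = \<tau> x"
    using assms(3)[of x] assms(3)[of "inverse x"] gal_inverse[OF assms(1), of x] gal_inverse[OF assms(2), of x] by auto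
qed

text \<open>The place that the point 0 has reached on a chain reveals the degree, and the value
  there of a function proportional to \<open>x\<close> reveals
  \<open>inv' \<sigma> (inv' \<rho> x)\<close>. The integer \<open>x\<close> is arbitrary, so wild
  ramification is seen as well.\<close>

lemma Phi_Some_eq:
  assumes \<rho>: "deg_is \<rho> n" "deg_is \<rho>' n'" and \<sigma>: "\<sigma> \<in> Gal" "\<sigma>' \<in> Gal"
    and eq: "Phi (Some \<rho>, \<sigma>) = Phi (Some \<rho>', \<sigma>')"
  shows "n = n'" "\<rho> \<circ> \<sigma> = \<rho>' \<circ> \<sigma>'"
proof -
  have z: "inv' \<tau> y = 0 \<longleftrightarrow> y = 0" if "\<tau> \<in> Gal" for \<tau> y using gal_eq_0_iff[OF gal_inv[OF that]] .
  note G = deg_is_Gal[OF \<rho>(1)] deg_is_Gal[OF \<rho>(2)]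
  \<comment> \<open>The chain is longer than both degrees, so neither walk is cut off by the
    sink.\<close>
  define k where "k = Suc (max n n')"
  have nk: "n < k" "n' < k" "min k n = n" "min k n' = n'" by (auto simp: k_def)
  have key: "n = n' \<and> inv' \<sigma> (inv' \<rho> x) = inv' \<sigma>' (inv' \<rho>' x)" if x: "x \<in> OK" for x
  proof -
    obtain B where B: "fun_model v {..k} (\<lambda>i. min k (Suc i)) id B"
      "\<forall>i<k. \<forall>m. delta i (to_ac (unif ^ Suc i) * x ^ m) \<in> ospan B"
      using chain_model[OF x, of k] by blast
    interpret M: fun_model v "{..k}" "\<lambda>i. min k (Suc i)" id B by (rule B(1))
    define f where "f = (\<lambda>m. delta n (to_ac (unif ^ Suc n) * x ^ m))"
    have f: "f m \<in> M.C" for m unfolding f_def using B(2) nk(1) M.R0_C by blast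
    have 0: "0 \<in> {..k}" by simp
    have e: "inv' \<sigma> (inv' \<rho> (f m n)) = inv' \<sigma>' (inv' \<rho>' (f m n'))" for m
      using M.Phi_Some_ev[OF \<rho>(1) 0 f[of m], of \<sigma>] M.Phi_Some_ev[OF \<rho>(2) 0 f[of m], of \<sigma>']
      unfolding chain_iterate id_funpow id_apply nk(3,4) eq by simp
    have "f 0 n \<noteq> 0" by (simp add: f_def delta_def)
    then have "inv' \<sigma> (inv' \<rho> (f 0 n)) \<noteq> 0" by (simp only: z[OF \<sigma>(1)] z[OF G(1)] not_False_eq_True)
    then have "f 0 n' \<noteq> 0" unfolding e by (simp only: z[OF \<sigma>(2)] z[OF G(2)] not_False_eq_True)
    then have nn: "n = n'" by (auto simp: f_def delta_def split: if_splits)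
    have *: "f 1 n = to_ac (unif ^ Suc n) * x" by (simp add: f_def delta_def)
    note g = gal_mult gal_to_ac
    have "to_ac (unif ^ Suc n) * inv' \<sigma> (inv' \<rho> x) = to_ac (unif ^ Suc n) * inv' \<sigma>' (inv' \<rho>' x)"
      using e[of 1] unfolding nn[symmetric] *
      by (simp only: g[OF gal_inv[OF \<sigma>(1)]] g[OF gal_inv[OF \<sigma>(2)]] g[OF gal_inv[OF G(1)]] g[OF gal_inv[OF G(2)]])
    then show ?thesis using nn by simp
  qed
  show "n = n'" using key[OF OK.one_mem] by blast
  have "inv' \<sigma> \<circ> inv' \<rho> = inv' \<sigma>' \<circ> inv' \<rho>'"
    using key by (intro gal_eqI_OK gal_comp gal_inv \<sigma> G) simp
  then have "inv' (\<rho> \<circ> \<sigma>) = inv' (\<rho>' \<circ> \<sigma>')" by (simp add: inv_comp \<sigma> G)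
  then show "\<rho> \<circ> \<sigma> = \<rho>' \<circ> \<sigma>'" using inv_inv[OF gal_comp[OF G(1) \<sigma>(1)]] inv_inv[OF gal_comp[OF G(2) \<sigma>(2)]] by metis
qed

text \<open>One point, with values twisted by \<open>frob\<close>. On the ring generated by a root
  of unity of order prime to the residue characteristic, \<open>frob\<close> raises generators
  exactly to the q-th power, so the congruence on them is an equality.\<close>

lemma root_of_unity_model:
  assumes N: "N > 0" "\<not> res_char dvd N" and z: "\<zeta> ^ N = 1"
  shows "fun_model v {()} id frob ((\<lambda>i _. \<zeta> ^ i) ` {..<N})"
proof -
  let ?B = "(\<lambda>i (_::unit). \<zeta> ^ i) ` {..<N}"
  interpret Oc: subring_set "cst ` local_integers v :: (unit \<Rightarrow> 'l alg_closure) set" by (rule subring_Oc)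
  have frobG: "frob \<in> Gal" by (rule deg_is_Gal[OF deg_is_frob])
  have zO: "\<zeta> \<in> OK" by (rule root_of_unity_OK[OF z N(1)])
  have fz: "frob \<zeta> = \<zeta> ^ q"
  proof (rule roots_of_unity_eq_if_MK[OF N])
    show "frob \<zeta> ^ N = 1" using z gal_power[OF frobG, of \<zeta> N] gal_1[OF frobG] by simp
    show "(\<zeta> ^ q) ^ N = 1" using z by (metis power_mult mult.commute power_one)
    show "frob \<zeta> - \<zeta> ^ q \<in> MK" using deg_isD[OF deg_is_frob zO] by simp
  qed
  have zm: "\<zeta> ^ m = \<zeta> ^ (m mod N)" for m
  proof -
    have "\<zeta> ^ m = \<zeta> ^ (N * (m div N) + m mod N)" by simp
    also have "\<dots> = \<zeta> ^ (m mod N)" unfolding power_add power_mult z by simp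
    finally show ?thesis .
  qed
  have pw: "(\<lambda>_. \<zeta> ^ m) \<in> ospan ?B" for m
    by (rule Oc.rspan_base) (use zm[of m] N in auto)
  show ?thesis
  proof unfold_locales
    show "(\<lambda>t. if t \<in> {()} then 1 else 0) \<in> ospan ?B" using pw[of 0] by simp
    fix b assume "b \<in> ?B"
    then obtain i where b: "b = (\<lambda>_. \<zeta> ^ i)" by blast
    have tw: "(\<lambda>t. if t \<in> {()} then frob (b (id t)) else 0) = (\<lambda>_. \<zeta> ^ (q * i))"
      by (simp add: b gal_power[OF frobG] fz power_mult)
    have bq: "b ^ q = (\<lambda>_. \<zeta> ^ (q * i))"
      by (simp add: fun_eq_iff power_fun_apply b mult.commute flip: power_mult)
    show "(\<lambda>t. if t \<in> {()} then frob (b (id t)) else 0) \<in> ospan ?B" unfolding tw by (rule pw)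
    show "\<exists>g\<in>ospan ?B. (\<lambda>t. if t \<in> {()} then frob (b (id t)) else 0) - b ^ q = cst unif * g"
      unfolding tw bq by (intro bexI[of _ 0] Oc.rspan_zero) simp
    fix b' assume "b' \<in> ?B"
    then obtain i' where b': "b' = (\<lambda>_. \<zeta> ^ i')" by blast
    have "b * b' = (\<lambda>_. \<zeta> ^ (i + i'))" by (simp add: b b' fun_eq_iff fun_apply power_add)
    then show "b * b' \<in> ospan ?B" using pw by simp
  qed (use frobG in auto)
qed

text \<open>In these models the powers of \<open>frob\<close> cancel, and zero together with
  \<open>\<sigma>\<close> acts on a root of unity by \<open>inv' \<sigma>\<close>. Hence
  \<open>\<sigma> \<circ> inv' \<sigma>'\<close> fixes all roots of unity of order prime to the
  residue characteristic, and these represent all non-zero residues.\<close>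

lemma Phi_None_eq:
  assumes \<sigma>: "\<sigma> \<in> Gal" "\<sigma>' \<in> Gal" and eq: "Phi (None, \<sigma>) = Phi (None, \<sigma>')"
  shows "\<sigma> \<circ> inv' \<sigma>' \<in> inertia v"
proof -
  define u where "u = \<sigma> \<circ> inv' \<sigma>'"
  have uG: "u \<in> Gal" unfolding u_def by (intro gal_comp gal_inv \<sigma>)
  have uz: "u \<zeta> = \<zeta>" if N: "N > 0" "\<not> res_char dvd N" and z: "\<zeta> ^ N = 1" for \<zeta> N
  proof -
    let ?B = "(\<lambda>i (_::unit). \<zeta> ^ i) ` {..<N}"
    interpret M: fun_model v "{()}" id frob ?B by (rule root_of_unity_model[OF N z])
    interpret O: lambda_object v M.E M.psi by (rule lambda_objectI[OF M.fun_model_object])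
    have 0: "() \<in> {()}" by simp
    obtain f where f: "f \<in> M.C" "f () = \<zeta>"
    proof (cases "N = 1")
      case True
      then have "\<zeta> = 1" using z by simp
      then show thesis using that[OF M.e_D] by (simp add: M.e_def)
    next
      case False
      then have "(\<lambda>_. \<zeta> ^ 1) \<in> ?B" using N by (intro imageI) auto
      then have "(\<lambda>_. \<zeta> ^ 1) \<in> M.C" using M.B_R0 M.R0_C by blast
      then show thesis using that[of "\<lambda>_. \<zeta> ^ 1"] by simp
    qed
    have val: "Phi (None, \<tau>) (M.E, M.psi) (M.ev ()) (M.encode f) = inv' \<tau> \<zeta>" for \<tau>
    proof -
      obtain n where n: "\<forall>f\<in>M.C. Phi (None, \<tau>) (M.E, M.psi) (M.ev ()) (M.encode f) =
        inv' \<tau> (inv' (frob ^^ n) ((frob ^^ n) (f ((id ^^ n) ()))))"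
        using M.Phi_None_ev[OF 0, of 0 \<tau>] by (elim exE conjE)
      show ?thesis
        using bspec[OF n f(1)] f(2) gal_inv_cancel(2)[OF deg_is_Gal[OF deg_is_frob_power[of n]]] by simp
    qed
    have "inv' \<sigma> \<zeta> = inv' \<sigma>' \<zeta>" using val[of \<sigma>] val[of \<sigma>'] unfolding eq by simp
    then show ?thesis using gal_inv_cancel(1)[OF \<sigma>(1), of \<zeta>] by (simp add: u_def)
  qed
  have "u x - x \<in> MK" if x: "x \<in> OK" for x
  proof (cases "x \<in> MK")
    case True
    then have "u x \<in> MK" using gal_mem_MK_iff[OF uG] by simp
    then show ?thesis using True by (rule MK_diff)
  next
    case False
    obtain N where N: "N > 0" "\<not> res_char dvd N" "x ^ N - 1 \<in> MK" using ex_power_eq_one_MK[OF x False] by blast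
    obtain \<zeta> where z: "\<zeta> ^ N = 1" "x - \<zeta> \<in> MK" using root_of_unity_lift[OF x N(3,1)] by blast
    have "u x - u \<zeta> \<in> MK" using gal_mem_MK_iff[OF uG, of "x - \<zeta>"] z(2) by (simp add: gal_diff[OF uG])
    then have "u x - \<zeta> \<in> MK" using uz[OF N(1,2) z(1)] by simp
    from MK_trans[OF this MK_sym[OF z(2)]] show ?thesis .
  qed
  then show ?thesis unfolding inertia_def u_def[symmetric] using uG by blast
qed

text \<open>The inertia element is forced: it is \<open>\<sigma> \<circ> inv' \<sigma>'\<close> over
  zero and \<open>inv' \<rho> \<circ> \<rho>'\<close> otherwise, and the separation lemmas show that
  it has degree 0.\<close>

theorem inertia_rel_eq: "inertia_rel v = {(p, p'). p \<in> carrier SD \<and> p' \<in> carrier SD \<and> Phi p = Phi p'}"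
proof (rule antisym)
  show "inertia_rel v \<subseteq> {(p, p'). p \<in> carrier SD \<and> p' \<in> carrier SD \<and> Phi p = Phi p'}"
    using Phi_inertia_rel by auto
  show "{(p, p'). p \<in> carrier SD \<and> p' \<in> carrier SD \<and> Phi p = Phi p'} \<subseteq> inertia_rel v"
  proof (rule subrelI)
    fix p p' assume "(p, p') \<in> {(p, p'). p \<in> carrier SD \<and> p' \<in> carrier SD \<and> Phi p = Phi p'}"
    then have pp: "p \<in> carrier SD" "p' \<in> carrier SD" "Phi p = Phi p'" by auto
    obtain r \<sigma> where p: "p = (r, \<sigma>)" "r \<in> carrier (Q_monoid v)" "\<sigma> \<in> Gal" using pp(1) by (auto simp: carrier_SD)
    obtain r' \<sigma>' where p': "p' = (r', \<sigma>')" "r' \<in> carrier (Q_monoid v)" "\<sigma>' \<in> Gal" using pp(2) by (auto simp: carrier_SD)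
    have eq: "Phi (r, \<sigma>) = Phi (r', \<sigma>')" using pp(3) p p' by simp
    have "\<exists>u\<in>inertia v. r' = r \<otimes>\<^bsub>Q_monoid v\<^esub> Some u \<and> \<sigma>' = inv' u \<circ> \<sigma>"
    proof (cases r)
      case None
      have r': "r' = None"
      proof (rule ccontr)
        assume "r' \<noteq> None"
        then obtain \<rho>' where r': "r' = Some \<rho>'" by blast
        then have "deg_is \<rho>' (deg \<rho>')" using p'(2) deg_is_deg by (auto simp: carrier_Q)
        from Phi_Some_neq_None[OF this p'(3) p(3)] eq None r' show False by simp
      qed
      have u: "\<sigma> \<circ> inv' \<sigma>' \<in> inertia v" using Phi_None_eq[OF p(3) p'(3)] eq None r' by simp
      have "inv' (\<sigma> \<circ> inv' \<sigma>') \<circ> \<sigma> = \<sigma>'"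
        using gal_comp_inv(2)[OF p(3)] by (simp add: inv_comp p(3) gal_inv[OF p'(3)] inv_inv[OF p'(3)] comp_assoc)
      then show ?thesis using u None r' by (intro bexI[of _ "\<sigma> \<circ> inv' \<sigma>'"]) (simp_all add: mult_Q)
    next
      case (Some \<rho>)
      then have \<rho>: "deg_is \<rho> (deg \<rho>)" using p(2) deg_is_deg by (auto simp: carrier_Q)
      have "r' \<noteq> None"
      proof
        assume "r' = None"
        with Phi_Some_neq_None[OF \<rho> p(3) p'(3)] eq Some show False by simp
      qed
      then obtain \<rho>' where r': "r' = Some \<rho>'" by blast
      then have \<rho>': "deg_is \<rho>' (deg \<rho>')" using p'(2) deg_is_deg by (auto simp: carrier_Q)
      note G = deg_is_Gal[OF \<rho>] deg_is_Gal[OF \<rho>']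
      note E = Phi_Some_eq[OF \<rho> \<rho>' p(3) p'(3) eq[unfolded Some r']]
      define u where "u = inv' \<rho> \<circ> \<rho>'"
      have uG: "u \<in> Gal" unfolding u_def by (intro gal_comp gal_inv G)
      have ru: "\<rho> \<circ> u = \<rho>'" unfolding u_def using gal_comp_inv(1)[OF G(1)] by (simp flip: comp_assoc)
      have "deg_is u 0" using deg_is_cancel_left[of \<rho> u "deg \<rho>" 0] ru \<rho> \<rho>' uG E(1) by simp
      moreover have "inv' u \<circ> \<sigma> = \<sigma>'"
      proof -
        have "inv' u = inv' \<rho>' \<circ> \<rho>" unfolding u_def by (simp add: inv_comp gal_inv[OF G(1)] G inv_inv[OF G(1)])
        then have "inv' u \<circ> \<sigma> = inv' \<rho>' \<circ> (\<rho>' \<circ> \<sigma>')" using E(2) by (simp add: comp_assoc)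
        then show ?thesis using gal_comp_inv(2)[OF G(2)] by (simp flip: comp_assoc)
      qed
      ultimately show ?thesis using ru Some r' by (intro bexI[of _ u]) (simp_all add: mult_Q inertia_iff)
    qed
    then obtain u where u: "u \<in> inertia v" "r' = r \<otimes>\<^bsub>Q_monoid v\<^esub> Some u" "\<sigma>' = inv' u \<circ> \<sigma>" by blast
    have "u \<in> Gal" using u(1) by (simp add: inertia_def)
    then have "\<sigma>' = inv\<^bsub>galois_group\<^esub> u \<otimes>\<^bsub>galois_group\<^esub> \<sigma>" using u(3) galois_inv_eq[OF \<open>u \<in> Gal\<close>] by simp
    then show "(p, p') \<in> inertia_rel v" unfolding inertia_rel_def p(1) p'(1) using u p(2,3) by blast
  qed
qed

theorem fundamental_monoid_iso:
  "topological_monoid_iso (fundamental_monoid v) (fundamental_monoid_topology v) (QG_monoid v) (QG_topology v)"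
  unfolding QG_monoid_def QG_topology_def
proof (rule topological_monoid_iso_quotient[OF continuous_Phi _ _ topspace_SD _ Phi_surj _ Phi_mult inertia_rel_eq])
  show "compact_space SDtop" using compact_Q compact_krull[where 'l = 'l] by (simp add: compact_space_prod_topology)
  show "Hausdorff_space (fundamental_monoid_topology v)"
    unfolding fundamental_monoid_topology_def functor_End_topology_def
    by (intro Hausdorff_space_subtopology) (simp add: Hausdorff_space_product_topology)
  show "topspace (fundamental_monoid_topology v) = carrier (fundamental_monoid v)"
    by (auto simp: fundamental_monoid_topology_def functor_End_topology_def fundamental_monoid_def functor_End_def)
  fix p p' assume p: "p \<in> carrier SD" "p' \<in> carrier SD"
  obtain r \<sigma> r' \<sigma>' where pp: "p = (r, \<sigma>)" "p' = (r', \<sigma>')" by (cases p; cases p')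
  have c: "r \<in> carrier (Q_monoid v)" "\<sigma> \<in> Gal" "r' \<in> carrier (Q_monoid v)" "\<sigma>' \<in> Gal" using p pp by (auto simp: carrier_SD)
  have "r \<otimes>\<^bsub>Q_monoid v\<^esub> conj_action \<sigma> r' \<in> carrier (Q_monoid v)"
  proof (cases "r = None \<or> r' = None")
    case True
    then show ?thesis by (auto simp: mult_Q carrier_Q conj_action_def)
  next
    case False
    then obtain \<rho> \<rho>' where r: "r = Some \<rho>" "r' = Some \<rho>'" by (cases r; cases r') auto
    have d: "deg_is \<rho> (deg \<rho>)" "deg_is \<rho>' (deg \<rho>')" using c r deg_is_deg by (auto simp: carrier_Q)
    have "r \<otimes>\<^bsub>Q_monoid v\<^esub> conj_action \<sigma> r' = Some (\<rho> \<circ> (\<sigma> \<circ> \<rho>' \<circ> inv' \<sigma>))"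
      by (simp add: r conj_action_def mult_Q galois_inv_eq[OF c(2)])
    then show ?thesis using Some_mem_Q[OF deg_is_comp[OF d(1) deg_is_conj[OF c(2) d(2)]]] by simp
  qed
  then show "p \<otimes>\<^bsub>SD\<^esub> p' \<in> carrier SD"
    using gal_comp[OF c(2,4)] by (simp add: pp carrier_SD semidirect_def)
qed

end

section \<open>Completions of number fields\<close>

lemma clear_denominators:
  assumes "finite S" shows "\<exists>N::int. N \<noteq> 0 \<and> (\<forall>s\<in>S. \<exists>m::int. of_int N * (u s :: rat) = of_int m)"
  using assms
proof (induction S rule: finite_induct)
  case (insert x S)
  then obtain N where N: "N \<noteq> 0" "\<forall>s\<in>S. \<exists>m::int. of_int N * u s = of_int m" by blast
  obtain a b where ab: "quotient_of (u x) = (a, b)" by force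
  then have b: "b > 0" "u x = of_int a / of_int b" using quotient_of_denom_pos quotient_of_div by auto
  have "\<exists>m::int. of_int (N * b) * u s = of_int m" if s: "s \<in> insert x S" for s
  proof (cases "s = x")
    case True
    then show ?thesis using b by (intro exI[of _ "N * a"]) simp
  next
    case False
    then obtain m where m: "of_int N * u s = of_int m" using N(2) s by blast
    have "of_int (N * b) * u s = of_int b * (of_int N * u s)" by simp
    also have "\<dots> = of_int (b * m)" unfolding m by simp
    finally show ?thesis by blast
  qed
  then show ?case using N(1) b(1) by (intro exI[of _ "N * b"]) auto
qed (auto intro: exI[of _ 1])

definition int_relation :: "'k::ring_1 set \<Rightarrow> ('k \<Rightarrow> int) \<Rightarrow> bool" where
  "int_relation S m \<longleftrightarrow> (\<exists>s\<in>S. m s \<noteq> 0) \<and> (\<Sum>s\<in>S. of_int (m s) * s) = 0"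

text \<open>The form in which finite degree is used: more elements than a spanning set has are
  linearly dependent over the rationals, and denominators can be cleared.\<close>

lemma number_field_relation:
  assumes "number_field TYPE('k::field_char_0)"
  shows "\<exists>n. \<forall>S :: 'k set. finite S \<longrightarrow> card S > n \<longrightarrow> (\<exists>m. int_relation S m)"
proof -
  interpret Q: vector_space "\<lambda>(q::rat) (x::'k). of_rat q * x"
    by unfold_locales (auto simp: of_rat_add of_rat_mult algebra_simps)
  obtain B :: "'k set" where B: "finite B" "\<And>x. \<exists>c :: 'k \<Rightarrow> rat. x = (\<Sum>b\<in>B. of_rat (c b) * b)"
    using assms unfolding number_field_def by blast
  have span: "x \<in> Q.span B" for x
  proof -
    obtain c :: "'k \<Rightarrow> rat" where c: "x = (\<Sum>b\<in>B. of_rat (c b) * b)" using B(2) by blast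
    show ?thesis unfolding c by (intro Q.span_sum Q.span_scale Q.span_base)
  qed
  have "\<exists>m. int_relation S m" if S: "finite S" "card S > card B" for S :: "'k set"
  proof -
    have "Q.dependent S" using Q.independent_span_bound[OF B(1), of S] span S(2) by fastforce
    then obtain u where u: "\<exists>s\<in>S. u s \<noteq> 0" "(\<Sum>s\<in>S. of_rat (u s) * s) = 0"
      unfolding Q.dependent_finite[OF S(1)] by blast
    obtain N where N: "N \<noteq> 0" "\<forall>s\<in>S. \<exists>m::int. of_int N * u s = of_int m" using clear_denominators[OF S(1)] by blast
    then obtain m :: "'k \<Rightarrow> int" where m: "\<And>s. s \<in> S \<Longrightarrow> of_int N * u s = of_int (m s)" by metis
    have "(\<Sum>s\<in>S. of_int (m s) * s) = (\<Sum>s\<in>S. of_int N * (of_rat (u s) * s))"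
    proof (intro sum.cong refl)
      fix s assume "s \<in> S"
      then have "(of_rat (of_int N * u s) :: 'k) = of_rat (of_int (m s))" using m by simp
      then show "of_int (m s) * s = of_int N * (of_rat (u s) * s)" by (simp add: of_rat_mult)
    qed
    also have "\<dots> = of_int N * (\<Sum>s\<in>S. of_rat (u s) * s)" by (rule sum_distrib_left[symmetric])
    finally have "(\<Sum>s\<in>S. of_int (m s) * s) = 0" using u(2) by simp
    moreover have "\<exists>s\<in>S. m s \<noteq> 0" using u(1) m N(1) by (metis mult_eq_0_iff of_int_0 of_int_eq_0_iff)
    ultimately show ?thesis unfolding int_relation_def by blast
  qed
  then show ?thesis by blast
qed

text \<open>As long as \<open>p\<close> divides all coefficients they can be divided by it; the sum
  of their absolute values decreases.\<close>

lemma primitive_relation: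
  fixes S :: "'k::field_char_0 set"
  assumes "finite S" "int_relation S m" and p: "p > (1::int)"
  shows "\<exists>m. int_relation S m \<and> \<not> (\<forall>s\<in>S. p dvd m s)"
  using assms(2)
proof (induction "\<Sum>s\<in>S. nat \<bar>m s\<bar>" arbitrary: m rule: less_induct)
  case less
  show ?case
  proof (cases "\<forall>s\<in>S. p dvd m s")
    case True
    define m' where "m' s = m s div p" for s
    have m: "m s = p * m' s" if "s \<in> S" for s using True that by (simp add: m'_def)
    have "of_int p * (\<Sum>s\<in>S. of_int (m' s) * s) = (\<Sum>s\<in>S. of_int (m s) * s)"
      unfolding sum_distrib_left using m by (intro sum.cong) auto
    then have "(\<Sum>s\<in>S. of_int (m' s) * s) = 0" using less.prems p by (simp add: int_relation_def)
    moreover obtain s0 where s0: "s0 \<in> S" "m s0 \<noteq> 0" using less.prems by (auto simp: int_relation_def)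
    ultimately have "int_relation S m'" unfolding int_relation_def using m[OF s0(1)] by auto
    moreover have "(\<Sum>s\<in>S. nat \<bar>m' s\<bar>) < (\<Sum>s\<in>S. nat \<bar>m s\<bar>)"
    proof (rule sum_strict_mono_ex1[OF assms(1)])
      have "\<bar>m' s\<bar> \<le> \<bar>m s\<bar>" if "s \<in> S" for s
        unfolding m[OF that] abs_mult using p mult_right_mono[of 1 "\<bar>p\<bar>" "\<bar>m' s\<bar>"] by simp
      then show "\<forall>s\<in>S. nat \<bar>m' s\<bar> \<le> nat \<bar>m s\<bar>" by (simp add: nat_mono)
      have "\<bar>m' s0\<bar> < \<bar>m s0\<bar>" using m[OF s0(1)] s0(2) p mult_strict_right_mono[of 1 "\<bar>p\<bar>" "\<bar>m' s0\<bar>"] by (simp add: abs_mult)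
      then show "\<exists>s\<in>S. nat \<bar>m' s\<bar> < nat \<bar>m s\<bar>" using s0(1) by (intro bexI[of _ s0]) auto
    qed
    ultimately show ?thesis using less.hyps by blast
  qed (use less.prems in blast)
qed

text \<open>A maximal subset of \<open>R\<close> that is linearly independent modulo \<open>p\<close> over \<open>V\<close> is finite and
  generates \<open>R\<close> modulo \<open>V\<close>, so \<open>R / V\<close> is a finite-dimensional \<open>\<F>\<^sub>p\<close>-vector space.\<close>

lemma finite_quotient:
  fixes R V :: "'k::field_char_0 set"
  assumes "number_field TYPE('k)" and p: "prime (p::nat)"
    and R: "0 \<in> R" "\<And>x y. x \<in> R \<Longrightarrow> y \<in> R \<Longrightarrow> x + y \<in> R" "\<And>x. x \<in> R \<Longrightarrow> - x \<in> R"
    and V: "0 \<in> V" "\<And>x y. x \<in> V \<Longrightarrow> y \<in> V \<Longrightarrow> x + y \<in> V" "\<And>x. x \<in> V \<Longrightarrow> - x \<in> V"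
    and pV: "\<And>x. x \<in> R \<Longrightarrow> of_nat p * x \<in> V"
  shows "\<exists>F\<subseteq>R. finite F \<and> (\<forall>x\<in>R. \<exists>y\<in>F. x - y \<in> V)"
proof -
  have natmul: "of_nat k * x \<in> U" if "0 \<in> U" "\<And>x y. x \<in> U \<Longrightarrow> y \<in> U \<Longrightarrow> x + y \<in> U" "x \<in> U" for U k and x :: 'k
    using that by (induction k) (auto simp: distrib_right)
  have intmul: "of_int k * x \<in> U" if "0 \<in> U" "\<And>x y. x \<in> U \<Longrightarrow> y \<in> U \<Longrightarrow> x + y \<in> U" "\<And>x. x \<in> U \<Longrightarrow> - x \<in> U" "x \<in> U"
    for U k and x :: 'k
  proof (cases "k \<ge> 0")
    case True
    then show ?thesis using natmul[OF that(1,2,4), of "nat k"] by (simp add: of_nat_nat)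
  next
    case False
    then show ?thesis using that(3)[OF natmul[OF that(1,2,4), of "nat (- k)"]] by (simp add: of_nat_nat)
  qed
  have sumU: "(\<Sum>i\<in>I. f i) \<in> U" if "0 \<in> U" "\<And>x y. x \<in> U \<Longrightarrow> y \<in> U \<Longrightarrow> x + y \<in> U" "\<And>i. i \<in> I \<Longrightarrow> f i \<in> U"
    for U :: "'k set" and I and f :: "'k \<Rightarrow> 'k"
    using that by (induction I rule: infinite_finite_induct) auto
  have p1: "int p > 1" using prime_gt_1_nat[OF p] by simp
  define indep where "indep S \<longleftrightarrow> finite S \<and> S \<subseteq> R \<and> (\<forall>m. (\<Sum>s\<in>S. of_int (m s) * s) \<in> V \<longrightarrow> (\<forall>s\<in>S. int p dvd m s))" for S
  obtain n where n: "\<And>S :: 'k set. finite S \<Longrightarrow> card S > n \<Longrightarrow> \<exists>m. int_relation S m"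
    using number_field_relation[OF assms(1)] by blast
  \<comment> \<open>More than \<open>n\<close> elements satisfy an integral relation, which may be
    taken primitive at \<open>p\<close>. Its value 0 lies in \<open>V\<close>, so it contradicts
    independence modulo \<open>p\<close>.\<close>
  have bound: "card S < Suc n" if "indep S" for S
  proof (rule ccontr)
    assume "\<not> card S < Suc n"
    then have "card S > n" by simp
    moreover have "finite S" using that by (simp add: indep_def)
    ultimately obtain m where m: "int_relation S m" "\<not> (\<forall>s\<in>S. int p dvd m s)"
      using n primitive_relation[OF _ _ p1] by blast
    then have "(\<Sum>s\<in>S. of_int (m s) * s) \<in> V" using V(1) by (simp add: int_relation_def)
    then show False using that m(2) by (auto simp: indep_def)
  qed
  have "indep {}" using R by (simp add: indep_def)
  from ex_has_greatest_nat[of indep, OF this, of card "Suc n"] bound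
  obtain S where S: "indep S" "\<And>S'. indep S' \<Longrightarrow> card S' \<le> card S" by (metis less_or_eq_imp_le)
  have finS: "finite S" "S \<subseteq> R" using S(1) by (auto simp: indep_def)
  define F where "F = (\<lambda>m. \<Sum>s\<in>S. of_int (m s) * s) ` (S \<rightarrow>\<^sub>E {0..<int p})"
  have "finite F" unfolding F_def using finS by (intro finite_imageI finite_PiE) auto
  moreover have "F \<subseteq> R" unfolding F_def
    using finS(2) by (auto intro!: sumU[OF R(1,2)] intmul[OF R])
  moreover have "\<exists>y\<in>F. x - y \<in> V" if x: "x \<in> R" for x
  proof -
    have "\<exists>c. x - (\<Sum>s\<in>S. of_int (c s) * s) \<in> V"
    proof (cases "x \<in> S")
      case True
      have "(\<Sum>s\<in>S. of_int (if s = x then 1 else 0) * s) = (\<Sum>s\<in>S. if s = x then x else 0)"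
        by (intro sum.cong) auto
      also have "\<dots> = x" using True finS by (simp add: sum.delta)
      finally show ?thesis using V(1) by (intro exI[of _ "\<lambda>s. if s = x then 1 else 0"]) simp
    next
      case False
      have "\<not> indep (insert x S)"
      proof
        assume "indep (insert x S)"
        from S(2)[OF this] show False using False finS by simp
      qed
      then obtain m s0 where m: "(\<Sum>s\<in>insert x S. of_int (m s) * s) \<in> V" "s0 \<in> insert x S" "\<not> int p dvd m s0"
        using finS x unfolding indep_def by blast
      have m1: "of_int (m x) * x + (\<Sum>s\<in>S. of_int (m s) * s) \<in> V" using m(1) False finS by simp
      \<comment> \<open>If \<open>p\<close> divided \<open>m x\<close>, that term would lie in
        \<open>V\<close> and so would the rest of the relation; independence of \<open>S\<close>
        would then make all coefficients divisible by \<open>p\<close>.\<close>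
      have npx: "\<not> int p dvd m x"
      proof
        assume d: "int p dvd m x"
        then obtain k where k: "m x = int p * k" by blast
        have "of_int (m x) * x = of_nat p * (of_int k * x)" by (simp add: k)
        also have "\<dots> \<in> V" by (intro pV intmul[OF R x])
        finally have mV: "of_int (m x) * x \<in> V" .
        have "(\<Sum>s\<in>S. of_int (m s) * s) \<in> V" using V(2)[OF m1 V(3)[OF mV]] by simp
        then have "\<forall>s\<in>S. int p dvd m s" using S(1) by (simp add: indep_def)
        then show False using m(2,3) d by auto
      qed
      then have "coprime (m x) (int p)" using p by (metis coprime_commute prime_imp_coprime prime_int_nat_transfer nat_int of_nat_0_le_iff prime_nat_int_transfer)
      \<comment> \<open>Bezout inverts \<open>m x\<close> modulo \<open>p\<close>; the remaining
        multiple of \<open>p\<close> is absorbed by \<open>V\<close>, so \<open>x\<close> becomes a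
        combination of \<open>S\<close>.\<close>
      then obtain a b where ab: "a * m x + b * int p = 1" by (metis bezout_int coprime_imp_gcd_eq_1)
      define c where "c s = - a * m s" for s
      have "x - (\<Sum>s\<in>S. of_int (c s) * s) = of_int (a * m x + b * int p) * x - (\<Sum>s\<in>S. of_int (c s) * s)" by (simp add: ab)
      also have "\<dots> = of_int a * (of_int (m x) * x + (\<Sum>s\<in>S. of_int (m s) * s)) + of_int b * (of_nat p * x)"
        by (simp add: c_def algebra_simps sum_distrib_left sum_negf)
      also have "\<dots> \<in> V" by (intro V(2) intmul[OF V] m1 pV x)
      finally show ?thesis by blast
    qed
    then obtain c where c: "x - (\<Sum>s\<in>S. of_int (c s) * s) \<in> V" by blast
    define y where "y = (\<Sum>s\<in>S. of_int (c s mod int p) * s)"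
    have "y = (\<Sum>s\<in>S. of_int ((\<lambda>s\<in>S. c s mod int p) s) * s)" unfolding y_def by (intro sum.cong) auto
    then have "y \<in> F" unfolding F_def using p1 by (intro image_eqI[of _ _ "\<lambda>s\<in>S. c s mod int p"]) auto
    moreover have "(\<Sum>s\<in>S. of_int (c s) * s) - y = (\<Sum>s\<in>S. of_nat p * (of_int (c s div int p) * s))"
    proof -
      have "of_int (c s) * s - of_int (c s mod int p) * s = of_nat p * (of_int (c s div int p) * s)" for s :: 'k
      proof -
        have "c s - c s mod int p = int p * (c s div int p)" by (simp add: minus_mod_eq_mult_div)
        then have "(of_int (c s - c s mod int p) :: 'k) = of_int (int p * (c s div int p))" by simp
        then have "(of_int (c s) - of_int (c s mod int p)) * s = of_nat p * of_int (c s div int p) * s" by simp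
        then show ?thesis by (simp add: left_diff_distrib mult.assoc)
      qed
      then show ?thesis unfolding y_def sum_subtractf[symmetric] by simp
    qed
    moreover have "\<dots> \<in> V" using finS(2) by (intro sumU[OF V(1,2)] pV intmul[OF R]) auto
    ultimately have "(x - (\<Sum>s\<in>S. of_int (c s) * s)) + ((\<Sum>s\<in>S. of_int (c s) * s) - y) \<in> V" using c V(2) by simp
    then show ?thesis using \<open>y \<in> F\<close> by auto
  qed
  ultimately show ?thesis by blast
qed

text \<open>Either two powers of \<open>a\<close> coincide, or enough distinct powers satisfy an
  integral relation.\<close>

lemma number_field_algebraic:
  assumes "number_field TYPE('k::field_char_0)" shows "algebraic (a :: 'k)"
proof -
  obtain n where n: "\<And>S :: 'k set. finite S \<Longrightarrow> card S > n \<Longrightarrow> \<exists>m. int_relation S m"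
    using number_field_relation[OF assms] by blast
  show ?thesis
  proof (cases "inj_on (\<lambda>i. a ^ i) {..n}")
    case True
    let ?S = "(\<lambda>i. a ^ i) ` {..n}"
    have "card ?S > n" using True by (simp add: card_image)
    then obtain m where m: "int_relation ?S m" using n by blast
    define f where "f = (\<Sum>i\<le>n. Polynomial.monom (of_int (m (a ^ i)) :: 'k) i)"
    have c: "poly.coeff f i = (if i \<le> n then of_int (m (a ^ i)) else 0)" for i
      by (simp add: f_def coeff_sum)
    have "(\<Sum>i\<le>n. of_int (m (a ^ i)) * a ^ i) = 0"
      using m True unfolding int_relation_def by (simp add: sum.reindex)
    then have "poly f a = 0" by (simp add: f_def poly_sum poly_monom)
    moreover obtain i where "i \<le> n" "m (a ^ i) \<noteq> 0" using m by (auto simp: int_relation_def)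
    then have "f \<noteq> 0" using c[of i] by auto
    moreover have "\<forall>i. poly.coeff f i \<in> \<int>" using c by simp
    ultimately show ?thesis unfolding algebraic_def by blast
  next
    case False
    then obtain i j where ij: "i \<noteq> j" "a ^ i = a ^ j" by (auto simp: inj_on_def)
    let ?f = "Polynomial.monom (1::'k) i - Polynomial.monom 1 j"
    have "poly.coeff ?f i = 1" using ij by simp
    then have "?f \<noteq> 0" by (metis coeff_0 zero_neq_one)
    moreover have "poly ?f a = 0" using ij by (simp add: poly_monom)
    moreover have "\<forall>i. poly.coeff ?f i \<in> \<int>" by (auto simp: coeff_monom)
    ultimately show ?thesis unfolding algebraic_def by blast
  qed
qed

text \<open>With \<open>l\<close> the leading coefficient and \<open>d\<close> the degree,
  multiplying the equation by l^(d - 1) makes it monic in \<open>of_int l * a\<close>.\<close>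

lemma algebraic_scale_integral:
  assumes "algebraic (a :: 'k::field_char_0)" shows "\<exists>l::int. l \<noteq> 0 \<and> algebraic_int (of_int l * a)"
proof -
  obtain f where f: "\<And>i. poly.coeff f i \<in> \<int>" "f \<noteq> 0" "poly f a = 0" using assms unfolding algebraic_def by blast
  define d where "d = degree f"
  obtain l :: int where l: "Polynomial.lead_coeff f = of_int l" using f(1) by (metis Ints_cases)
  have l0: "l \<noteq> 0" using l f(2) by auto
  have d: "d > 0"
  proof (rule ccontr)
    assume "\<not> d > 0"
    then obtain c where "f = [:c:]" unfolding d_def by (metis degree_eq_zeroE gr0I)
    then show False using f(2,3) by simp
  qed
  define g where "g = Polynomial.monom (1::'k) d + (\<Sum>i<d. Polynomial.monom (poly.coeff f i * of_int l ^ (d - 1 - i)) i)"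
  have c: "poly.coeff g i = (if i = d then 1 else if i < d then poly.coeff f i * of_int l ^ (d - 1 - i) else 0)" for i
    by (auto simp: g_def coeff_sum)
  have "poly g (of_int l * a) = of_int l ^ (d - 1) * poly f a"
  proof -
    have ld: "poly.coeff f d = of_int l" using l by (simp add: d_def)
    have 1: "(of_int l * a) ^ d = of_int l ^ (d - 1) * (poly.coeff f d * a ^ d)"
      unfolding ld using d by (cases d) (auto simp: power_mult_distrib)
    have 2: "(poly.coeff f i * of_int l ^ (d - 1 - i)) * (of_int l * a) ^ i = of_int l ^ (d - 1) * (poly.coeff f i * a ^ i)" if "i < d" for i
    proof -
      have "of_int l ^ (d - 1) = (of_int l ^ (d - 1 - i) * of_int l ^ i :: 'k)" using that by (simp flip: power_add)
      then show ?thesis by (simp add: power_mult_distrib mult_ac)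
    qed
    have 3: "poly f a = poly.coeff f d * a ^ d + (\<Sum>i<d. poly.coeff f i * a ^ i)"
      unfolding poly_altdef d_def[symmetric] by (simp add: lessThan_Suc_atMost[symmetric])
    have "poly g (of_int l * a) = (of_int l * a) ^ d + (\<Sum>i<d. poly.coeff f i * of_int l ^ (d - 1 - i) * (of_int l * a) ^ i)"
      by (simp add: g_def poly_sum poly_monom)
    also have "\<dots> = of_int l ^ (d - 1) * (poly.coeff f d * a ^ d) + (\<Sum>i<d. of_int l ^ (d - 1) * (poly.coeff f i * a ^ i))"
      unfolding 1 using 2 by (intro arg_cong2[where f = "(+)"] sum.cong refl) simp
    also have "\<dots> = of_int l ^ (d - 1) * poly f a" unfolding 3 by (simp only: distrib_left sum_distrib_left)
    finally show ?thesis .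
  qed
  then have "poly g (of_int l * a) = 0" using f(3) by simp
  moreover have "degree g = d"
  proof (rule antisym)
    show "degree g \<le> d" by (rule degree_le) (simp add: c)
    show "d \<le> degree g" by (rule le_degree) (simp add: c)
  qed
  then have "Polynomial.lead_coeff g = 1" by (simp add: c)
  moreover have "\<forall>i. poly.coeff g i \<in> \<int>" using f(1) by (auto simp: c)
  ultimately have "algebraic_int (of_int l * a)" by (intro algebraic_int.intros)
  then show ?thesis using l0 by blast
qed

section \<open>The completion of a number field is a local field\<close>

locale completion =
  fixes P :: "'k::field_char_0 set" and \<iota> :: "'k \<Rightarrow> 'l::field" and v :: "'l \<Rightarrow> real"
  assumes nf: "number_field TYPE('k)" and prime_P: "primeideal P (ring_of_integers :: 'k ring)"
    and P_nonzero: "P \<noteq> {0}" and compl: "completion_at P \<iota> v"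
begin

abbreviation "R \<equiv> ring_of_integers :: 'k ring"

sublocale P: primeideal P R by (rule prime_P)

lemma R_sel [simp]: "carrier R = {x. algebraic_int x}" "x \<otimes>\<^bsub>R\<^esub> y = x * y" "x \<oplus>\<^bsub>R\<^esub> y = x + y"
  "\<one>\<^bsub>R\<^esub> = 1" "\<zero>\<^bsub>R\<^esub> = 0"
  by (simp_all add: ring_of_integers_def ring_of_type_algebra_def)

lemma int_add: "algebraic_int x \<Longrightarrow> algebraic_int y \<Longrightarrow> algebraic_int (x + y :: 'k)"
  and int_mult: "algebraic_int x \<Longrightarrow> algebraic_int y \<Longrightarrow> algebraic_int (x * y :: 'k)"
  using P.a_closed P.m_closed by (metis R_sel mem_Collect_eq)+

lemma P_int: "x \<in> P \<Longrightarrow> algebraic_int x"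
  using P.a_subset by auto

lemma P_add: "x \<in> P \<Longrightarrow> y \<in> P \<Longrightarrow> x + y \<in> P"
  using P.a_closed[of x y] by (metis P.additive_subgroup_axioms additive_subgroup.a_closed R_sel(3))

lemma P_mult: "algebraic_int r \<Longrightarrow> x \<in> P \<Longrightarrow> r * x \<in> P"
  using P.I_l_closed[of x r] by simp

lemma P_minus: "x \<in> P \<Longrightarrow> - x \<in> P"
  using P_mult[of "-1" x] by auto

lemma zero_P: "0 \<in> P"
  using P.additive_subgroup_axioms additive_subgroup.zero_closed by fastforce

lemma one_P: "1 \<notin> P"
  using P.one_imp_carrier P.I_notcarr by auto

lemma P_prime: "algebraic_int a \<Longrightarrow> algebraic_int b \<Longrightarrow> a * b \<in> P \<Longrightarrow> a \<in> P \<or> b \<in> P"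
  using P.I_prime[of a b] by simp

lemma poly_int: "algebraic_int x \<Longrightarrow> (\<And>i. poly.coeff f i \<in> \<int>) \<Longrightarrow> algebraic_int (poly f x :: 'k)"
proof (induction f)
  case (pCons a f)
  have "a \<in> \<int>" using pCons.prems(2)[of 0] by simp
  moreover have "poly.coeff f i \<in> \<int>" for i using pCons.prems(2)[of "Suc i"] by simp
  ultimately show ?case using pCons int_add[OF int_imp_algebraic_int int_mult] by auto
qed simp

text \<open>The constant term of an integral equation for \<open>x\<close> is a multiple of
  \<open>x\<close>; if it vanishes, the equation is first divided by the variable.\<close>

lemma int_multiple:
  assumes x: "algebraic_int x" "x \<noteq> (0 :: 'k)"
  shows "\<exists>m y. (m::int) \<noteq> 0 \<and> algebraic_int y \<and> of_int m = x * y"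
proof -
  obtain f where f: "Polynomial.lead_coeff f = 1" "\<forall>i. poly.coeff f i \<in> \<int>" "poly f x = 0"
    using x(1) by (elim algebraic_int.cases) (metis (full_types))
  then show ?thesis
  proof (induction "degree f" arbitrary: f rule: less_induct)
    case less
    obtain a g where fg: "f = pCons a g" by (cases f)
    have g0: "g \<noteq> 0" using less.prems fg by auto
    have gc: "poly.coeff g i \<in> \<int>" for i using less.prems(2)[rule_format, of "Suc i"] fg by simp
    obtain m :: int where a: "a = of_int m" using less.prems(2)[rule_format, of 0] fg by (auto elim: Ints_cases)
    have eq: "a + x * poly g x = 0" using less.prems(3) fg by simp
    show ?case
    proof (cases "m = 0")
      case True
      then have "poly g x = 0" using eq a x(2) by simp
      moreover have "Polynomial.lead_coeff g = 1" "degree g < degree f" using less.prems(1) fg g0 by auto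
      ultimately show ?thesis using less.hyps[of g] gc by blast
    next
      case False
      have "of_int m = x * (- poly g x)" using eq a by (simp add: eq_neg_iff_add_eq_0)
      moreover have "algebraic_int (- poly g x)" using poly_int[OF x(1) gc] by simp
      ultimately show ?thesis using False by blast
    qed
  qed
qed

text \<open>A non-zero element of \<open>P\<close> has a non-zero rational integer among its
  multiples, and the least positive integer in \<open>P\<close> is prime.\<close>

lemma ex_prime_in_P: "\<exists>p. prime p \<and> of_nat p \<in> P"
proof -
  obtain x where x: "x \<in> P" "x \<noteq> 0" using P_nonzero zero_P by auto
  obtain m y where m: "(m::int) \<noteq> 0" "algebraic_int y" "of_int m = x * y" using int_multiple[OF P_int[OF x(1)] x(2)] by blast
  have "of_int m \<in> P" using P_mult[OF m(2) x(1)] m(3) by (simp add: mult.commute)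
  then have "of_nat (nat \<bar>m\<bar>) \<in> P" using P_minus[of "of_int m"] by (simp add: abs_if)
  moreover have "nat \<bar>m\<bar> > 0" using m(1) by simp
  ultimately show ?thesis
    using prime_Least[of "nat \<bar>m\<bar>" "\<lambda>n. of_nat n \<in> P"] one_P P_prime by auto
qed

lemma iota: "\<iota> (x + y) = \<iota> x + \<iota> y" "\<iota> (x * y) = \<iota> x * \<iota> y" "\<iota> 1 = 1"
  and v_complete: "Metric_space.mcomplete UNIV (\<lambda>x y. v (x - y))"
  and v_dense: "e > 0 \<Longrightarrow> \<exists>a. v (z - \<iota> a) < e"
  using compl by (auto simp: completion_at_def ring_hom_def ring_of_type_algebra_def)

sublocale valued_field v
  by unfold_locales (use compl in \<open>simp_all add: completion_at_def\<close>)

lemma ex_c: "\<exists>c. 0 < c \<and> c < 1 \<and> (\<forall>x. algebraic_int x \<longrightarrow> x \<noteq> 0 \<longrightarrow> v (\<iota> x) = c ^ prime_order P x)"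
  using compl by (auto simp: completion_at_def)

lemma iota_0: "\<iota> 0 = 0" using iota(1)[of 0 0] by (metis add.right_neutral add_left_cancel)

lemma iota_minus: "\<iota> (- x) = - \<iota> x"
  using iota(1)[of x "- x"] iota_0 by (simp add: eq_neg_iff_add_eq_0 add.commute)

lemma iota_diff: "\<iota> (x - y) = \<iota> x - \<iota> y"
  using iota(1)[of x "- y"] iota_minus by simp

lemma iota_of_nat: "\<iota> (of_nat n) = of_nat n"
  by (induction n) (auto simp: iota iota_0)

lemma iota_eq_0: "\<iota> x = 0 \<longleftrightarrow> x = 0"
proof
  assume "\<iota> x = 0"
  show "x = 0"
  proof (rule ccontr)
    assume "x \<noteq> 0"
    then have "\<iota> (x * inverse x) = 1" using iota(3) by simp
    then show False using \<open>\<iota> x = 0\<close> by (simp add: iota(2))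
  qed
qed (simp add: iota_0)

lemma v_eq_if_close: assumes "v (x - y) < v x" shows "v y = v x"
proof (rule antisym)
  show "v y \<le> v x" using v_diff_le_max[of x "x - y"] assms by simp
  show "v x \<le> v y" using v_add_le_max[of y "x - y"] assms by simp
qed

lemma v_int_le_1: "algebraic_int x \<Longrightarrow> v (\<iota> x) \<le> 1"
  using ex_c v_eq_0[of 0] by (cases "x = 0") (auto simp: iota_0 power_le_one)

text \<open>With a rational prime \<open>p\<close> in \<open>P\<close>, finitely many elements
  represent \<open>P\<close> modulo the multiples of \<open>p\<close>; together with
  \<open>p\<close> they generate.\<close>

lemma finite_generation: "\<exists>S\<subseteq>P. finite S \<and> (\<exists>s\<in>S. s \<noteq> 0) \<and> P \<subseteq> rspan {x. algebraic_int x} S"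
proof -
  obtain p where p: "prime p" "of_nat p \<in> P" using ex_prime_in_P by blast
  define V where "V = (\<lambda>x. of_nat p * x) ` {x::'k. algebraic_int x}"
  have "\<exists>F\<subseteq>P. finite F \<and> (\<forall>x\<in>P. \<exists>y\<in>F. x - y \<in> V)"
  proof (rule finite_quotient[OF nf p(1) zero_P P_add P_minus])
    show "0 \<in> V" unfolding V_def by (intro image_eqI[of _ _ 0]) auto
    show "x + y \<in> V" if "x \<in> V" "y \<in> V" for x y
      using that unfolding V_def by (auto simp: int_add simp flip: distrib_left)
    show "- x \<in> V" if "x \<in> V" for x
      using that unfolding V_def by (auto intro!: image_eqI[of _ _ "- _"])
    show "of_nat p * x \<in> V" if "x \<in> P" for x using P_int that by (auto simp: V_def)
  qed
  then obtain F where F: "F \<subseteq> P" "finite F" "\<And>x. x \<in> P \<Longrightarrow> \<exists>y\<in>F. x - y \<in> V" by blast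
  interpret O: subring_set "{x::'k. algebraic_int x}"
    by unfold_locales (auto intro: int_add int_mult)
  let ?S = "insert (of_nat p) F"
  have "P \<subseteq> rspan {x. algebraic_int x} ?S"
  proof
    fix x assume "x \<in> P"
    then obtain y where y: "y \<in> F" "x - y \<in> V" using F(3) by blast
    then obtain r where r: "algebraic_int r" "x = y + of_nat p * r" by (auto simp: V_def algebra_simps)
    have "y + r * of_nat p \<in> rspan {x. algebraic_int x} ?S"
      using r(1) y(1) F(2) by (intro O.rspan_add O.rspan_scale O.rspan_base) auto
    then show "x \<in> rspan {x. algebraic_int x} ?S" using r(2) by (simp add: mult.commute)
  qed
  moreover have "(of_nat p :: 'k) \<noteq> 0" using p(1) by (simp add: prime_nat_iff)
  ultimately show ?thesis using F(1,2) p(2) by (intro exI[of _ ?S]) auto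
qed

text \<open>By Nakayama's lemma in the localisation at \<open>P\<close>.\<close>

lemma P_not_idempotent: "\<exists>x\<in>P. x \<notin> ideal_prod R P P"
proof (rule ccontr)
  assume "\<not> ?thesis"
  then have idem: "P \<subseteq> ideal_prod R P P" by blast
  obtain S where S: "S \<subseteq> P" "finite S" "\<exists>s\<in>S. s \<noteq> 0" "P \<subseteq> rspan {x. algebraic_int x} S" using finite_generation by blast
  define L where "L = {a / b | a b :: 'k. algebraic_int a \<and> algebraic_int b \<and> b \<notin> P}"
  define J where "J = {a / b | a b :: 'k. a \<in> P \<and> algebraic_int b \<and> b \<notin> P}"
  have nz: "b \<noteq> 0" if "b \<notin> P" for b using that zero_P by blast
  have LI: "a / b \<in> L" if "algebraic_int a" "algebraic_int b" "b \<notin> P" for a b using that unfolding L_def by blast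
  have JI: "a / b \<in> J" if "a \<in> P" "algebraic_int b" "b \<notin> P" for a b using that unfolding J_def by blast
  have bd: "algebraic_int (b * d)" "b * d \<notin> P" if "algebraic_int b" "b \<notin> P" "algebraic_int d" "d \<notin> P" for b d
    using that int_mult P_prime by blast+
  have PJ: "P \<subseteq> J" using JI[of _ 1] one_P by auto
  have Jadd: "x + y \<in> J" if "x \<in> J" "y \<in> J" for x y
  proof -
    obtain a b c d where *: "x = a / b" "a \<in> P" "algebraic_int b" "b \<notin> P" "y = c / d" "c \<in> P" "algebraic_int d" "d \<notin> P"
      using \<open>x \<in> J\<close> \<open>y \<in> J\<close> unfolding J_def by blast
    have "x + y = (d * a + b * c) / (b * d)" using * nz by (simp add: add_frac_eq mult.commute)
    then show ?thesis using JI[OF P_add[OF P_mult[OF *(7,2)] P_mult[OF *(3,6)]] bd[OF *(3,4,7,8)]] by simp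
  qed
  have Jmult: "r * x \<in> J" if "r \<in> L" "x \<in> J" for r x
  proof -
    obtain a b c d where *: "r = a / b" "algebraic_int a" "algebraic_int b" "b \<notin> P" "x = c / d" "c \<in> P" "algebraic_int d" "d \<notin> P"
      using \<open>r \<in> L\<close> \<open>x \<in> J\<close> unfolding J_def L_def by blast
    have "r * x = (a * c) / (b * d)" using * by simp
    then show ?thesis using JI[OF P_mult[OF *(2,6)] bd[OF *(3,4,7,8)]] by simp
  qed
  have sub: "subring_set L"
  proof
    show "0 \<in> L" "1 \<in> L" using LI[of 0 1] LI[of 1 1] one_P by auto
    fix x y assume "x \<in> L" "y \<in> L"
    then obtain a b c d where *: "x = a / b" "algebraic_int a" "algebraic_int b" "b \<notin> P" "y = c / d" "algebraic_int c" "algebraic_int d" "d \<notin> P"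
      unfolding L_def by blast
    have "x + y = (d * a + b * c) / (b * d)" using * nz by (simp add: add_frac_eq mult.commute)
    then show "x + y \<in> L" using LI[OF int_add[OF int_mult[OF *(7,2)] int_mult[OF *(3,6)]] bd[OF *(3,4,7,8)]] by simp
    have "x * y = (a * c) / (b * d)" using * by simp
    then show "x * y \<in> L" using LI[OF int_mult[OF *(2,6)] bd[OF *(3,4,7,8)]] by simp
  next
    fix x assume "x \<in> L"
    then obtain a b where *: "x = a / b" "algebraic_int a" "algebraic_int b" "b \<notin> P" unfolding L_def by blast
    then show "- x \<in> L" using LI[of "- a" b] by simp
  qed
  interpret L: subring_set L by (rule sub)
  have OL: "{x. algebraic_int x} \<subseteq> L" using LI[of _ 1] one_P by auto
  \<comment> \<open>An element of the product ideal is a combination of the generators of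
    \<open>P\<close> with coefficients again in \<open>P\<close>, which lie in \<open>J\<close>;
    idempotence puts the generators themselves there.\<close>
  have prodJ: "x \<in> rspan J S" if "x \<in> ideal_prod R P P" for x
    using that
  proof (induction rule: ideal_prod.induct)
    case (prod i j)
    have "j \<in> rspan {x. algebraic_int x} S" using S(4) prod by blast
    moreover have "i * y \<in> J" if "algebraic_int y" for y
      using P_mult[OF that prod(1)] PJ by (auto simp: mult.commute)
    ultimately have "i * j \<in> rspan J S" by (intro rspan_scale_gen[where R = "{x. algebraic_int x}"]) auto
    then show ?case by simp
  next
    case (sum s1 s2)
    then show ?case using rspan_add_gen[of J s1 S s2] Jadd by simp
  qed
  have "S \<subseteq> {0}"
  proof (rule nakayama[OF sub _ Jadd Jmult _ S(2)])
    show "J \<subseteq> L" unfolding J_def L_def using P_int by blast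
    show "S \<subseteq> rspan J S" using S(1) idem prodJ by blast
    fix j assume "j \<in> J"
    then obtain a b where *: "j = a / b" "a \<in> P" "algebraic_int b" "b \<notin> P" unfolding J_def by blast
    have ba: "b - a \<notin> P" using P_add[of "b - a" a] * by auto
    have ba': "algebraic_int (b - a)" using int_add[of b "- a"] P_int[OF *(2)] *(3) by simp
    have b0: "b \<noteq> 0" "b - a \<noteq> 0" using nz[OF *(4)] nz[OF ba] by auto
    have "inverse (1 - j) = b / (b - a)" using b0 by (simp add: *(1) field_simps)
    then show "j \<noteq> 1 \<and> inverse (1 - j) \<in> L" using LI[OF *(3) ba' ba] b0 *(1) by auto
  qed
  then show False using S(3) by auto
qed

lemma ex_small: "\<exists>x. algebraic_int x \<and> x \<noteq> 0 \<and> v (\<iota> x) < 1"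
proof -
  let ?I = "ideals_set R"
  obtain x where x: "x \<in> P" "x \<notin> ideal_prod R P P" using P_not_idempotent by blast
  have ideal: "ideal (P [^]\<^bsub>?I\<^esub> n) R" for n :: nat
  proof (induction n)
    case 0
    show ?case using P.oneideal by (simp add: ideals_set_def nat_pow_def)
  next
    case (Suc n)
    then show ?case using P.ideal_prod_is_ideal[OF _ P.is_ideal] by (simp add: ideals_set_def nat_pow_def)
  qed
  have pow_Suc: "P [^]\<^bsub>?I\<^esub> Suc n = ideal_prod R (P [^]\<^bsub>?I\<^esub> n) P" for n
    by (simp add: ideals_set_def nat_pow_def)
  have p1: "P [^]\<^bsub>?I\<^esub> (1::nat) = P"
  proof -
    interpret M: semiring ?I by (rule P.ideals_set_is_semiring)
    have "P \<in> carrier ?I" using P.is_ideal by (simp add: ideals_set_def)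
    then show ?thesis by (rule M.nat_pow_eone)
  qed
  have mono: "P [^]\<^bsub>?I\<^esub> (n + k) \<subseteq> P [^]\<^bsub>?I\<^esub> n" for n k :: nat
  proof (induction k)
    case (Suc k)
    have "P [^]\<^bsub>?I\<^esub> Suc (n + k) \<subseteq> P [^]\<^bsub>?I\<^esub> (n + k)"
      unfolding pow_Suc using P.ideal_prod_inter[OF ideal P.is_ideal] by blast
    then show ?case using Suc by simp
  qed simp
  have "n \<le> 1" if n: "x \<in> P [^]\<^bsub>?I\<^esub> n" for n :: nat
  proof (rule ccontr)
    assume "\<not> n \<le> 1"
    then have "n = Suc 1 + (n - 2)" by simp
    then have "x \<in> P [^]\<^bsub>?I\<^esub> Suc 1" using n mono[of "Suc 1" "n - 2"] by auto
    then show False using x(2) unfolding pow_Suc p1 by simp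
  qed
  then have "prime_order P x \<ge> 1"
    unfolding prime_order_def using x(1) p1 by (intro Greatest_le_nat[of _ _ 1]) simp_all
  moreover have "x \<noteq> 0"
  proof
    assume "x = 0"
    moreover have "0 \<in> ideal_prod R P P" using ideal_prod.prod[OF zero_P zero_P, of R] by simp
    ultimately show False using x(2) by simp
  qed
  moreover obtain c where c: "0 < c" "c < 1" "\<And>x. algebraic_int x \<Longrightarrow> x \<noteq> 0 \<Longrightarrow> v (\<iota> x) = c ^ prime_order P x"
    using ex_c by blast
  ultimately have "v (\<iota> x) = c ^ prime_order P x" "prime_order P x \<noteq> 0" using P_int[OF x(1)] by auto
  then have "v (\<iota> x) < 1" using c by (simp add: power_less_one_iff)
  then show ?thesis using \<open>x \<noteq> 0\<close> P_int[OF x(1)] by blast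
qed

lemma ex_prime_small: "\<exists>p. prime p \<and> v (of_nat p) < 1"
proof -
  obtain x where x: "algebraic_int x" "x \<noteq> 0" "v (\<iota> x) < 1" using ex_small by blast
  obtain m y where m: "(m::int) \<noteq> 0" "algebraic_int y" "of_int m = x * y" using int_multiple[OF x(1,2)] by blast
  have "v (\<iota> (of_int m)) = v (\<iota> x) * v (\<iota> y)" by (simp add: m(3) iota v_mult)
  also have "\<dots> < 1" using x(3) v_int_le_1[OF m(2)] v_nonneg[of "\<iota> x"] v_nonneg[of "\<iota> y"]
    by (metis mult_left_le mult.right_neutral order_le_less_trans)
  finally have "v (\<iota> (of_int m)) < 1" .
  moreover have "\<iota> (of_int m) = of_nat (nat \<bar>m\<bar>) \<or> \<iota> (of_int m) = - of_nat (nat \<bar>m\<bar>)"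
  proof (cases "m \<ge> 0")
    case True
    then have "(of_int m :: 'k) = of_nat (nat \<bar>m\<bar>)" by simp
    then show ?thesis using iota_of_nat by metis
  next
    case False
    then have "(of_int m :: 'k) = - of_nat (nat \<bar>m\<bar>)" by simp
    then show ?thesis using iota_of_nat iota_minus by metis
  qed
  ultimately have "v (of_nat (nat \<bar>m\<bar>)) < 1" using v_minus by metis
  then show ?thesis
    using prime_Least[of "nat \<bar>m\<bar>" "\<lambda>n. v (of_nat n) < 1"] m(1) v_of_nat_prime by auto
qed

theorem local_field_v: "local_field v"
proof
  show "n = 0" if "of_nat n = (0::'l)" for n
    using that iota_eq_0[of "of_nat n"] by (simp add: iota_of_nat)
  obtain c where c: "0 < c" "c < 1" "\<And>x. algebraic_int x \<Longrightarrow> x \<noteq> 0 \<Longrightarrow> v (\<iota> x) = c ^ prime_order P x"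
    using ex_c by blast
  \<comment> \<open>By density the value is attained at some \<open>a\<close> in the number field.
    Both \<open>of_int l * a\<close> and \<open>of_int l\<close> are integral with values powers of
    \<open>c\<close>, so the value of \<open>a\<close> is a quotient of two such powers.\<close>
  have vals: "\<exists>k>0. v x = c ^ k" if x: "x \<noteq> 0" "v x < 1" for x
  proof -
    have "v x > 0" using x(1) v_eq_0[of x] v_nonneg[of x] by (simp add: less_le)
    then obtain a where a: "v (x - \<iota> a) < v x" using v_dense by blast
    have va: "v (\<iota> a) = v x" by (rule v_eq_if_close[OF a])
    have a0: "a \<noteq> 0" using va x(1) v_eq_0 iota_0 by metis
    obtain l where l: "l \<noteq> 0" "algebraic_int (of_int l * a)"
      using algebraic_scale_integral[OF number_field_algebraic[OF nf, of a]] by blast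
    obtain i where i: "v (\<iota> (of_int l * a)) = c ^ i" using c(3)[OF l(2)] l(1) a0 by auto
    obtain j where j: "v (\<iota> (of_int l)) = c ^ j" using c(3)[of "of_int l"] l(1) by auto
    have eq: "c ^ i = c ^ j * v x" using i j va by (simp add: iota v_mult)
    have "j < i"
    proof (rule ccontr)
      assume "\<not> j < i"
      then have "c ^ j \<le> c ^ i" using c by (intro power_decreasing) auto
      moreover have "c ^ j * v x < c ^ j" using x(2) c(1) by simp
      ultimately show False using eq by simp
    qed
    then have "c ^ i = c ^ j * c ^ (i - j)" by (simp flip: power_add)
    then have "v x = c ^ (i - j)" using eq c(1) by simp
    then show ?thesis using \<open>j < i\<close> by (intro exI[of _ "i - j"]) auto
  qed
  obtain x0 where x0: "x0 \<noteq> 0" "v x0 < 1" using ex_small iota_eq_0 by blast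
  \<comment> \<open>The least positive exponent that occurs belongs to the largest value below 1,
    that of a uniformizer.\<close>
  define k0 where "k0 = (LEAST k. k > 0 \<and> (\<exists>x. v x = c ^ k))"
  have "\<exists>k>0. \<exists>x. v x = c ^ k" using vals[OF x0] by blast
  then have k0: "k0 > 0" "\<exists>x. v x = c ^ k0" unfolding k0_def using LeastI_ex[of "\<lambda>k. k > 0 \<and> (\<exists>x. v x = c ^ k)"] by auto
  then obtain p where p: "v p = c ^ k0" by blast
  show "\<exists>p. 0 < v p \<and> v p < 1 \<and> (\<forall>x. v x < 1 \<longrightarrow> v x \<le> v p)"
  proof (intro exI[of _ p] conjI allI impI)
    show "0 < v p" using p c by simp
    show "v p < 1" using p c k0(1) by (simp add: power_less_one_iff)
    fix x assume x: "v x < 1"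
    show "v x \<le> v p"
    proof (cases "x = 0")
      case True
      then show ?thesis using v_eq_0[of 0] v_nonneg[of p] by simp
    next
      case False
      obtain k where k: "k > 0" "v x = c ^ k" using vals[OF False x] by blast
      then have "k0 \<le> k" unfolding k0_def by (intro Least_le) blast
      then show ?thesis unfolding k p using c by (intro power_decreasing) auto
    qed
  qed
  show "finite (carrier (ring_on (local_integers v) Quot local_prime v))"
  proof -
    obtain r where r: "prime r" "v (of_nat r) < 1" using ex_prime_small by blast
    \<comment> \<open>The quotient is formed inside the number field, where linear algebra is
      available; a rational prime of small value kills it.\<close>
    have "\<exists>F\<subseteq>{x. v (\<iota> x) \<le> 1}. finite F \<and> (\<forall>x\<in>{x. v (\<iota> x) \<le> 1}. \<exists>y\<in>F. x - y \<in> {x. v (\<iota> x) < 1})"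
    proof (rule finite_quotient[OF nf r(1)])
      show "of_nat r * x \<in> {x. v (\<iota> x) < 1}" if "x \<in> {x. v (\<iota> x) \<le> 1}" for x
      proof -
        have "v (of_nat r) * v (\<iota> x) \<le> v (of_nat r) * 1" using that v_nonneg by (intro mult_left_mono) auto
        then show ?thesis using r(2) by (simp add: iota iota_of_nat v_mult)
      qed
      show "x + y \<in> {x. v (\<iota> x) \<le> 1}" if "x \<in> {x. v (\<iota> x) \<le> 1}" "y \<in> {x. v (\<iota> x) \<le> 1}" for x y
        using that v_add_le_max[of "\<iota> x" "\<iota> y"] by (simp add: iota)
      show "x + y \<in> {x. v (\<iota> x) < 1}" if "x \<in> {x. v (\<iota> x) < 1}" "y \<in> {x. v (\<iota> x) < 1}" for x y
        using that v_add_le_max[of "\<iota> x" "\<iota> y"] by (simp add: iota)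
    qed (auto simp: iota_0 iota_minus v_minus v_eq_0[THEN iffD2])
    then obtain F where F: "finite F" "\<And>x. v (\<iota> x) \<le> 1 \<Longrightarrow> \<exists>y\<in>F. v (\<iota> (x - y)) < 1" by auto
    \<comment> \<open>The residue class as a ball. By density every class contains an element of the
      number field, hence one of the finitely many representatives.\<close>
    define g where "g x = {h + x | h. v h < 1}" for x
    have g_eq: "g x = g y" if xy: "v (x - y) < 1" for x y
    proof -
      have sub: "g x \<subseteq> g y" if xy: "v (x - y) < 1" for x y
      proof
        fix z assume "z \<in> g x"
        then obtain h where h: "z = h + x" "v h < 1" by (auto simp: g_def)
        have "v (h + (x - y)) < 1" using v_add_le_max[of h "x - y"] h(2) xy by simp
        moreover have "z = (h + (x - y)) + y" by (simp add: h(1))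
        ultimately show "z \<in> g y" unfolding g_def by blast
      qed
      have "v (y - x) < 1" using xy v_minus[of "x - y"] by simp
      then show ?thesis using sub[OF xy] sub[of y x] by blast
    qed
    have "carrier (ring_on (local_integers v) Quot local_prime v) = g ` local_integers v"
      by (auto simp: FactRing_def A_RCOSETS_def' a_r_coset_def' g_def local_prime_def ring_of_type_algebra_def)
    also have "\<dots> \<subseteq> (\<lambda>y. g (\<iota> y)) ` F"
    proof
      fix z assume "z \<in> g ` local_integers v"
      then obtain x where x: "z = g x" "v x \<le> 1" by (auto simp: local_integers_def)
      obtain a where a: "v (x - \<iota> a) < 1" using v_dense[of 1 x] by auto
      have "v (\<iota> a) \<le> 1" using v_diff_le_max[of x "x - \<iota> a"] a x(2) by simp
      then obtain y where y: "y \<in> F" "v (\<iota> (a - y)) < 1" using F(2) by blast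
      have "g x = g (\<iota> y)" using g_eq[OF a] g_eq[of "\<iota> a" "\<iota> y"] y(2) by (simp add: iota_diff)
      then show "z \<in> (\<lambda>y. g (\<iota> y)) ` F" using y(1) x(1) by blast
    qed
    finally show ?thesis using F(1) by (rule finite_subset[OF _ finite_imageI])
  qed
qed (rule v_complete)

end

theorem theorem4p7:
  fixes P :: "'k::field_char_0 set" and \<iota> :: "'k \<Rightarrow> 'l::field" and v :: "'l \<Rightarrow> real"
  assumes "number_field TYPE('k)"
    and "primeideal P (ring_of_integers :: 'k ring)" and "P \<noteq> {0}"
    and "completion_at P \<iota> v"
  shows "topological_monoid_iso
    (fundamental_monoid v) (fundamental_monoid_topology v) (QG_monoid v) (QG_topology v)"
proof -
  interpret completion P \<iota> v by (intro completion.intro assms)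
  interpret local_field v by (rule local_field_v)
  show ?thesis by (rule fundamental_monoid_iso)
qed

end
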